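(* The staged unique assembly verification problem is $\mathrm{coNP}^{\mathrm{NP}}$-hard, even when restricted to staged systems with 7 stages and temperature $\tau=2$.
   Context: Tile assembly model. A tile is a non-rotatable unit square each of whose four edges is labeled with a glue from a finite set $\Sigma$; each glue $g$ has a nonnegative integer strength $\mathrm{str}(g,g)$, distinct glues have strength $0$ with each other, and there is a null glue of strength $0$. A configuration is a partial function $A:\mathbb{Z}^2\to T$ for a tile set $T$; an assembly is a configuration up to translation; its size $|A|$ is its number of tiles, and its shape is its domain up to translation. The bond graph of a configuration has one vertex per occupied position and an edge between each pair of adjacent occupied positions, weighted by the strength of the pair of abutting glues. An assembly is $\tau$-stable if every edge cut of its bond graph has total weight at least $\tau$. Assemblies $A,B$ are $\tau$-combinable into $C$ if some translates of $A$ and $B$ have disjoint domains, their union is a translate of $C$, and $C$ is $\tau$-stable. For a bin $(S,\tau)$ with set $S$ of initial assemblies, the set of produced assemblies is the smallest set containing $S$ and closed under: if produced $A,B$ are $\tau$-combinable into $C$ then $C$ is produced. A produced assembly is terminal if it is not $\tau$-combinable with any produced assembly. Staged systems. An $r$-stage $b$-bin mix graph is a directed graph on vertices $m_{i,j}$ ($1\le i\le r$, $1\le j\le b$) whose edges all have the form $(m_{i,j},m_{i+1,j'})$. A staged system $\langle M, \{T_1,\dots,T_b\},\tau\rangle$ consists of such a mix graph $M$, tile sets $T_1,\dots,T_b$, and a temperature $\tau$. Bin $(i,j)$ has initial assemblies $R_{1,j}=$ the single tiles of $T_j$, and for $i\ge 2$, $R_{i,j}$ is the union of the sets of terminal assemblies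 of the bins $(i-1,k)$ with $(m_{i-1,k},m_{i,j})\in M$; each bin operates at temperature $\tau$. The output of the system is the union of the sets of terminal assemblies of the bins in the final stage $r$. Staged unique assembly verification (staged UAV) problem: given a staged system $\Gamma$ and an assembly $A$, does $\Gamma$ uniquely assemble $A$, i.e. is $A$ the unique terminal assembly (output) of $\Gamma$? Hardness is with respect to polynomial-time many-one reductions; $\mathrm{coNP}^{\mathrm{NP}}=\Pi_2^{\mathrm{P}}$. *)

theory Defs
  imports Main
begin

text \<open>Glues are natural numbers; glue 0 is the null glue.  A tile is a
  quadruple (north, east, south, west) of glues.  The strength function
  gs assigns to each glue g the strength str(g,g); distinct glues have
  strength 0 with each other.\<close>

type_synonym glue = nat
type_synonym tile = "glue \<times> glue \<times> glue \<times> glue"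
type_synonym pos = "int \<times> int"
type_synonym config = "pos \<rightharpoonup> tile"

definition tN :: "tile \<Rightarrow> glue" where "tN t = fst t"
definition tE :: "tile \<Rightarrow> glue" where "tE t = fst (snd t)"
definition tS :: "tile \<Rightarrow> glue" where "tS t = fst (snd (snd t))"
definition tW :: "tile \<Rightarrow> glue" where "tW t = snd (snd (snd t))"

definition glue_str :: "(glue \<Rightarrow> nat) \<Rightarrow> glue \<Rightarrow> glue \<Rightarrow> nat" where
  "glue_str gs g h = (if g = h then gs g else 0)"

definition bond :: "(glue \<Rightarrow> nat) \<Rightarrow> config \<Rightarrow> pos \<Rightarrow> pos \<Rightarrow> nat" where
  "bond gs A p q =
     (case (A p, A q) of
        (Some a, Some c) \<Rightarrow>
          (if q = (fst p + 1, snd p) then glue_str gs (tE a) (tW c)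
           else if q = (fst p - 1, snd p) then glue_str gs (tW a) (tE c)
           else if q = (fst p, snd p + 1) then glue_str gs (tN a) (tS c)
           else if q = (fst p, snd p - 1) then glue_str gs (tS a) (tN c)
           else 0)
      | _ \<Rightarrow> 0)"

definition adjacent :: "pos \<Rightarrow> pos \<Rightarrow> bool" where
  "adjacent p q = (\<bar>fst p - fst q\<bar> + \<bar>snd p - snd q\<bar> = 1)"

definition cut_weight :: "(glue \<Rightarrow> nat) \<Rightarrow> config \<Rightarrow> pos set \<Rightarrow> nat" where
  "cut_weight gs A X =
     (\<Sum>(p, q) \<in> {(p, q). p \<in> X \<and> q \<in> dom A - X \<and> adjacent p q}. bond gs A p q)"

definition stable :: "nat \<Rightarrow> (glue \<Rightarrow> nat) \<Rightarrow> config \<Rightarrow> bool" where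
  "stable tau gs A =
     (\<forall>X. X \<subseteq> dom A \<and> X \<noteq> {} \<and> X \<noteq> dom A \<longrightarrow> cut_weight gs A X \<ge> tau)"

definition shift :: "pos \<Rightarrow> config \<Rightarrow> config" where
  "shift v A = (\<lambda>p. A (fst p - fst v, snd p - snd v))"

text \<open>Assemblies are configurations up to translation; we represent them by
  configurations and keep all sets of assemblies closed under translation.\<close>
definition combinable :: "nat \<Rightarrow> (glue \<Rightarrow> nat) \<Rightarrow> config \<Rightarrow> config \<Rightarrow> config \<Rightarrow> bool" where
  "combinable tau gs A B C =
     (\<exists>u v w. dom (shift u A) \<inter> dom (shift v B) = {} \<and>
              shift u A ++ shift v B = shift w C \<and> stable tau gs C)"

inductive_set produced :: "nat \<Rightarrow> (glue \<Rightarrow> nat) \<Rightarrow> config set \<Rightarrow> config set"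
  for tau gs S where
  init: "A \<in> S \<Longrightarrow> A \<in> produced tau gs S"
| transl: "A \<in> produced tau gs S \<Longrightarrow> shift v A \<in> produced tau gs S"
| comb: "A \<in> produced tau gs S \<Longrightarrow> B \<in> produced tau gs S \<Longrightarrow>
         combinable tau gs A B C \<Longrightarrow> C \<in> produced tau gs S"

definition terminal :: "nat \<Rightarrow> (glue \<Rightarrow> nat) \<Rightarrow> config set \<Rightarrow> config set" where
  "terminal tau gs S =
     {A \<in> produced tau gs S. \<not> (\<exists>B \<in> produced tau gs S. \<exists>C. combinable tau gs A B C)}"

text \<open>An instance of staged UAV: a staged system (number of stages r, number
  of bins b, temperature, mix graph edges (i,j,i',j') meaning
  (m_{i,j}, m_{i',j'}), glue strengths strs (glue g has strength strs!g),
  tile sets T_1..T_b as lists) together with an assembly given as a list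
  of placed tiles.\<close>
record uav_instance =
  stages :: nat
  bins :: nat
  temp :: nat
  mix :: "(nat \<times> nat \<times> nat \<times> nat) list"
  strs :: "nat list"
  tilesets :: "tile list list"
  asm :: "(pos \<times> tile) list"

definition tile_glues :: "tile \<Rightarrow> glue set" where
  "tile_glues t = {tN t, tE t, tS t, tW t}"

definition wf_instance :: "uav_instance \<Rightarrow> bool" where
  "wf_instance I =
     (stages I \<ge> 1 \<and> bins I \<ge> 1 \<and> length (tilesets I) = bins I \<and>
      strs I \<noteq> [] \<and> strs I ! 0 = 0 \<and>
      (\<forall>(i, j, i', j') \<in> set (mix I). 1 \<le> i \<and> i' = i + 1 \<and> i' \<le> stages I \<and>
                                      1 \<le> j \<and> j \<le> bins I \<and> 1 \<le> j' \<and> j' \<le> bins I) \<and>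
      (\<forall>ts \<in> set (tilesets I). \<forall>t \<in> set ts. \<forall>g \<in> tile_glues t. g < length (strs I)) \<and>
      (\<forall>(p, t) \<in> set (asm I). \<forall>g \<in> tile_glues t. g < length (strs I)) \<and>
      distinct (map fst (asm I)))"

definition inst_gs :: "uav_instance \<Rightarrow> glue \<Rightarrow> nat" where
  "inst_gs I g = (if g < length (strs I) then strs I ! g else 0)"

definition bin_tiles :: "uav_instance \<Rightarrow> nat \<Rightarrow> tile set" where
  "bin_tiles I j = set (tilesets I ! (j - 1))"

definition single_tiles :: "tile set \<Rightarrow> config set" where
  "single_tiles T = {[(0, 0) \<mapsto> t] | t. t \<in> T}"

fun bin_terminal :: "uav_instance \<Rightarrow> nat \<Rightarrow> nat \<Rightarrow> config set" where
  "bin_terminal I 0 j = {}"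
| "bin_terminal I (Suc 0) j =
     terminal (temp I) (inst_gs I) (single_tiles (bin_tiles I j))"
| "bin_terminal I (Suc (Suc i)) j =
     terminal (temp I) (inst_gs I)
       (\<Union>{bin_terminal I (Suc i) k | k. 1 \<le> k \<and> k \<le> bins I \<and>
                                        (Suc i, k, Suc (Suc i), j) \<in> set (mix I)})"

definition system_output :: "uav_instance \<Rightarrow> config set" where
  "system_output I = \<Union>{bin_terminal I (stages I) j | j. 1 \<le> j \<and> j \<le> bins I}"

definition target :: "uav_instance \<Rightarrow> config" where
  "target I = map_of (asm I)"

definition uniquely_assembles :: "uav_instance \<Rightarrow> bool" where
  "uniquely_assembles I = (system_output I = {C. \<exists>v. C = shift v (target I)})"

fun nat_bits :: "nat \<Rightarrow> bool list" where
  "nat_bits n = (if n = 0 then [] else odd n # nat_bits (n div 2))"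

definition dbl :: "bool list \<Rightarrow> bool list" where
  "dbl xs = concat (map (\<lambda>b. [True, b]) xs)"

definition enc_nat :: "nat \<Rightarrow> bool list" where
  "enc_nat n = dbl (nat_bits n) @ [False, False]"

definition enc_nats :: "nat list \<Rightarrow> bool list" where
  "enc_nats xs = concat (map enc_nat xs)"

definition int_code :: "int \<Rightarrow> nat" where
  "int_code z = (if z \<ge> 0 then 2 * nat z else 2 * nat (- z) - 1)"

definition tile_nats :: "tile \<Rightarrow> nat list" where
  "tile_nats t = [tN t, tE t, tS t, tW t]"

definition inst_nats :: "uav_instance \<Rightarrow> nat list" where
  "inst_nats I =
     [stages I, bins I, temp I, length (mix I)] @
     concat (map (\<lambda>(a, b, c, d). [a, b, c, d]) (mix I)) @
     [length (strs I)] @ strs I @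
     [length (tilesets I)] @
     concat (map (\<lambda>ts. length ts # concat (map tile_nats ts)) (tilesets I)) @
     [length (asm I)] @
     concat (map (\<lambda>((x, y), t). int_code x # int_code y # tile_nats t) (asm I))"

definition encode :: "uav_instance \<Rightarrow> bool list" where
  "encode I = enc_nats (inst_nats I)"

definition staged_UAV_7_2 :: "bool list set" where
  "staged_UAV_7_2 = {encode I | I. wf_instance I \<and> stages I = 7 \<and> temp I = 2 \<and>
                                   uniquely_assembles I}"

text \<open>Deterministic single-tape Turing machine with states 0..nq-1
  (0 start, 1 halt) and tape symbols 0..ns-1 (0 blank, 1 bit False,
  2 bit True); delta q s = (q', s', move) with move in {-1,0,1}.\<close>
record tm =
  nq :: nat
  ns :: nat
  delta :: "nat \<Rightarrow> nat \<Rightarrow> nat \<times> nat \<times> int"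

definition valid_tm :: "tm \<Rightarrow> bool" where
  "valid_tm M = (nq M \<ge> 2 \<and> ns M \<ge> 3 \<and>
     (\<forall>q < nq M. \<forall>s < ns M. case delta M q s of (q', s', d) \<Rightarrow>
        q' < nq M \<and> s' < ns M \<and> d \<in> {-1, 0, 1}))"

type_synonym tm_conf = "nat \<times> (int \<Rightarrow> nat) \<times> int"

definition tm_step :: "tm \<Rightarrow> tm_conf \<Rightarrow> tm_conf" where
  "tm_step M c = (case c of (q, tp, h) \<Rightarrow>
     if q = 1 then c else
     (case delta M q (tp h) of (q', s', d) \<Rightarrow> (q', tp(h := s'), h + d)))"

definition tm_init :: "bool list \<Rightarrow> tm_conf" where
  "tm_init w = (0, \<lambda>i. if 0 \<le> i \<and> i < int (length w)
                        then (if w ! nat i then 2 else 1) else 0, 0)"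

definition tm_output :: "tm_conf \<Rightarrow> bool list" where
  "tm_output c = (case c of (q, tp, h) \<Rightarrow>
     map (\<lambda>i. tp (h + int i) = 2) [0 ..< (LEAST n. tp (h + int n) \<notin> {1, 2})])"

definition poly_time_computable :: "(bool list \<Rightarrow> bool list) \<Rightarrow> bool" where
  "poly_time_computable f =
     (\<exists>M c k. valid_tm M \<and>
        (\<forall>w. \<exists>t. t \<le> c * (length w + 1) ^ k \<and>
               fst ((tm_step M ^^ t) (tm_init w)) = 1 \<and>
               tm_output ((tm_step M ^^ t) (tm_init w)) = f w))"

definition tuple3 :: "bool list \<Rightarrow> bool list \<Rightarrow> bool list \<Rightarrow> bool list" where
  "tuple3 x y z = dbl x @ [False, False] @ dbl y @ [False, False] @ dbl z"

text \<open>Pi_2^P = coNP^NP: languages of the form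
  {w. for all y with |y| \<le> p(|w|) exists z with |z| \<le> p(|w|). V(w,y,z)}
  with V polynomial-time decidable.\<close>
definition Pi2P :: "bool list set \<Rightarrow> bool" where
  "Pi2P L = (\<exists>V c k. poly_time_computable (\<lambda>x. [V x]) \<and>
     (\<forall>w. w \<in> L \<longleftrightarrow>
        (\<forall>y. length y \<le> c * (length w + 1) ^ k \<longrightarrow>
          (\<exists>z. length z \<le> c * (length w + 1) ^ k \<and> V (tuple3 w y z)))))"

definition poly_reducible :: "bool list set \<Rightarrow> bool list set \<Rightarrow> bool" where
  "poly_reducible L1 L2 = (\<exists>f. poly_time_computable f \<and> (\<forall>w. w \<in> L1 \<longleftrightarrow> f w \<in> L2))"

definition Pi2P_hard :: "bool list set \<Rightarrow> bool" where
  "Pi2P_hard L = (\<forall>L'. Pi2P L' \<longrightarrow> poly_reducible L' L)"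

end

theory Submission
  imports Defs
begin

text \<open>The instances place no bound on the size of the produced assemblies, so a staged system can run an
  arbitrary nondeterministic computation and no tableau of bounded size is needed.  Given
  \<open>L = {w. \<forall>y. \<exists>z. V w y z}\<close> (with polynomially bounded \<open>y\<close> and \<open>z\<close>), a nondeterministic program over finitely many
  stacks computes the length bound in unary, guesses \<open>y\<close>, enumerates all \<open>z\<close> and simulates the machine of
  \<open>V\<close>; it has an accepting run on \<open>w\<close> iff \<open>w \<notin> L\<close>.

  In stage 1, strength 2 glues form bent lines: a column of arbitrary height above a corner, followed by a
  row that carries the initial stacks of \<open>w\<close> and arbitrarily many blanks.  In stage 2, tiles with strength 1 glues
  fill the rectangle spanned by such a line cooperatively, row by row; each row performs one step of the
  program, and the last row tests acceptance in the north-east corner.  A rejecting corner exposes a strength 2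
  glue, to which in stage 3 two tiles attach alternately forever, so that only the accepting rectangles are
  terminal.  The lines also include junk with an arbitrary symbol and an arbitrary state, which ensures that no
  interior tile is terminal in stage 2.  The remaining stages do nothing.  A separate bin carries an inert
  tile, which is always in the output and is the target assembly; it is the only output iff \<open>w \<in> L\<close>.

  Only the tiles and glues of the initial row depend on \<open>w\<close>.  The glue joining the \<open>i\<close>-th to the next input tile is a
  multiple of a power of two \<open>2 ^ l\<close> that exceeds all other glues, so its binary code consists of constant bits followed
  by the code of a counter.\<close>

section \<open>Stability and production\<close>

text \<open>The output of a bin contains all of its terminal assemblies, so each wrong guess and
  each halted growth must be made non-terminal. This forces three features of the tiles: every glue
  inside a line has partners for both sides, so an unfinished line can grow; the step relation is
  total, so an unfinished rectangle can grow; and failure is not a dead end but endless growth.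
  Conversely, finished assemblies must not bond to each other in unforeseen ways. One invariant
  controls this, \<open>grounded\<close>: a non-null south or west glue already has a neighbour, so
  a bond between two such assemblies has no free side to use. With it, stage 3 needs no description
  of the towers that arise.

  The reduction has to be carried out by an explicit single-tape machine. The lists of the instance
  are therefore padded until their lengths exceed a multiple of \<open>2 ^ l\<close> by exactly 1.
  Then one binary counter, running from 1 to \<open>length w + 1\<close>, provides every number that
  depends on the length of the input or on a position in it.\<close>

declare split_paired_All [simp del] split_paired_Ex [simp del]

definition nb_E :: "pos \<Rightarrow> pos" where "nb_E p = (fst p + 1, snd p)"
definition nb_W :: "pos \<Rightarrow> pos" where "nb_W p = (fst p - 1, snd p)"
definition nb_N :: "pos \<Rightarrow> pos" where "nb_N p = (fst p, snd p + 1)"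
definition nb_S :: "pos \<Rightarrow> pos" where "nb_S p = (fst p, snd p - 1)"

lemmas nb_defs = nb_E_def nb_W_def nb_N_def nb_S_def

lemma nb_inverse [simp]:
  "nb_E (nb_W p) = p" "nb_W (nb_E p) = p" "nb_N (nb_S p) = p" "nb_S (nb_N p) = p"
  by (simp_all add: nb_defs)

lemma nb_neq [simp]:
  "nb_E p \<noteq> p" "nb_W p \<noteq> p" "nb_N p \<noteq> p" "nb_S p \<noteq> p"
  "p \<noteq> nb_E p" "p \<noteq> nb_W p" "p \<noteq> nb_N p" "p \<noteq> nb_S p"
  by (cases p; simp add: nb_defs)+

lemma adjacent_iff:
  "adjacent p q \<longleftrightarrow> q = nb_E p \<or> q = nb_W p \<or> q = nb_N p \<or> q = nb_S p"
  by (cases p; cases q) (auto simp: adjacent_def nb_defs)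

lemma bond_nb:
  assumes "A p = Some a" "A q = Some b"
  shows "q = nb_E p \<Longrightarrow> bond gs A p q = glue_str gs (tE a) (tW b)"
    "q = nb_W p \<Longrightarrow> bond gs A p q = glue_str gs (tW a) (tE b)"
    "q = nb_N p \<Longrightarrow> bond gs A p q = glue_str gs (tN a) (tS b)"
    "q = nb_S p \<Longrightarrow> bond gs A p q = glue_str gs (tS a) (tN b)"
  using assms by (auto simp: bond_def nb_defs)

lemma bond_None [simp]: "A p = None \<Longrightarrow> bond gs A p q = 0" "A q = None \<Longrightarrow> bond gs A p q = 0"
  by (auto simp: bond_def split: option.splits)

lemma glue_str_commute: "glue_str gs g h = glue_str gs h g"
  by (auto simp: glue_str_def)

lemma bond_commute: "bond gs A p q = bond gs A q p"
  by (cases p; cases q; cases "A p"; cases "A q")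
    (auto simp: bond_def glue_str_commute)

lemma bond_cong: "A p = B p \<Longrightarrow> A q = B q \<Longrightarrow> bond gs A p q = bond gs B p q"
  by (simp add: bond_def)

section \<open>Weights of cuts and the attachment of a single tile\<close>

definition cut_edges :: "config \<Rightarrow> pos set \<Rightarrow> (pos \<times> pos) set" where
  "cut_edges A X = {(p, q). p \<in> X \<and> q \<in> dom A - X \<and> adjacent p q}"

lemma cut_weight_edges: "cut_weight gs A X = (\<Sum>(p, q) \<in> cut_edges A X. bond gs A p q)"
  by (simp add: cut_weight_def cut_edges_def)

text \<open>Sums over infinite sets are 0, so lower bounds on \<open>cut_weight\<close> need a
  finite set of cut edges. Finiteness of \<open>X\<close> alone suffices, since a position has only
  four neighbours.\<close>

lemma finite_cut_edges: "finite X \<Longrightarrow> finite (cut_edges A X)"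
proof -
  assume "finite X"
  then have "finite (\<Union>p\<in>X. {(p, nb_E p), (p, nb_W p), (p, nb_N p), (p, nb_S p)})" by auto
  moreover have "cut_edges A X \<subseteq> (\<Union>p\<in>X. {(p, nb_E p), (p, nb_W p), (p, nb_N p), (p, nb_S p)})"
    by (auto simp: cut_edges_def adjacent_iff)
  ultimately show ?thesis by (rule finite_subset[rotated])
qed

lemma cut_weight_pos:
  assumes "cut_weight gs A X > 0"
  obtains p q where "p \<in> X" "q \<in> dom A - X" "adjacent p q" "bond gs A p q > 0"
proof -
  have "\<exists>e \<in> cut_edges A X. (case e of (p, q) \<Rightarrow> bond gs A p q) \<noteq> 0"
  proof (rule ccontr)
    assume "\<not> ?thesis"
    then have "cut_weight gs A X = 0" unfolding cut_weight_edges by (intro sum.neutral) simp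
    then show False using assms by simp
  qed
  then obtain p q where "(p, q) \<in> cut_edges A X" "bond gs A p q \<noteq> 0" by auto
  then show ?thesis by (intro that[of p q]) (simp_all add: cut_edges_def)
qed

lemma cut_weight_ge_bond:
  assumes "finite X" "p \<in> X" "q \<in> dom A - X" "adjacent p q"
  shows "bond gs A p q \<le> cut_weight gs A X"
proof -
  have "(p, q) \<in> cut_edges A X" using assms by (simp add: cut_edges_def)
  from member_le_sum[OF this, of "\<lambda>(p, q). bond gs A p q"] finite_cut_edges[OF assms(1)]
  show ?thesis by (simp add: cut_weight_edges)
qed

lemma cut_weight_single:
  assumes "A p = Some t"
  shows "cut_weight gs A {p} =
    bond gs A p (nb_E p) + bond gs A p (nb_W p) + bond gs A p (nb_N p) + bond gs A p (nb_S p)"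
proof -
  let ?N = "{nb_E p, nb_W p, nb_N p, nb_S p}"
  have "cut_weight gs A {p} = (\<Sum>q \<in> ?N \<inter> dom A. bond gs A p q)"
    unfolding cut_weight_edges
    by (rule sum.reindex_bij_witness[of _ "Pair p" snd]) (auto simp: cut_edges_def adjacent_iff)
  also have "\<dots> = (\<Sum>q \<in> ?N. bond gs A p q)"
  proof (rule sum.mono_neutral_left)
    show "\<forall>q\<in>?N - ?N \<inter> dom A. bond gs A p q = 0"
      by (metis DiffE IntI bond_None(2) domIff)
  qed simp_all
  also have "\<dots> = bond gs A p (nb_E p) + bond gs A p (nb_W p) + bond gs A p (nb_N p) + bond gs A p (nb_S p)"
    by (cases p) (simp add: nb_defs)
  finally show ?thesis .
qed

lemma cut_weight_compl_single:
  assumes "A p = Some t" "X = dom A - {p}"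
  shows "cut_weight gs A X = cut_weight gs A {p}"
  unfolding cut_weight_edges
  by (rule sum.reindex_bij_witness[of _ prod.swap prod.swap])
    (use assms in \<open>auto simp: cut_edges_def adjacent_iff intro: bond_commute\<close>)

text \<open>A cut of the enlarged assembly either isolates \<open>p\<close>, on one side or the
  other, or restricts to a proper cut of \<open>A\<close>. The first kind is bounded by
  \<open>w\<close>; the second can only gain edges through \<open>p\<close>.\<close>

lemma stable_attach:
  assumes st: "stable tau gs A" and fin: "finite (dom A)" and p: "A p = None"
    and w: "cut_weight gs (A(p \<mapsto> t)) {p} \<ge> tau"
  shows "stable tau gs (A(p \<mapsto> t))"
  unfolding stable_def
proof (intro allI impI, elim conjE)
  fix X
  let ?C = "A(p \<mapsto> t)"
  assume X: "X \<subseteq> dom ?C" "X \<noteq> {}" "X \<noteq> dom ?C"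
  have pd: "p \<notin> dom A" using p by auto
  let ?Y = "X - {p}"
  consider "?Y = {}" | "?Y = dom A" | "?Y \<noteq> {}" "?Y \<noteq> dom A" by blast
  then show "tau \<le> cut_weight gs ?C X"
  proof cases
    case 1
    then have "X = {p}" using X by auto
    then show ?thesis using w by simp
  next
    case 2
    then have "X = dom ?C - {p}" using X pd by auto
    then show ?thesis using cut_weight_compl_single[of ?C p t X gs] w by simp
  next
    case 3
    have sub: "?Y \<subseteq> dom A" using X by auto
    have finX: "finite X" using X fin by (auto intro: finite_subset)
    have "tau \<le> cut_weight gs A ?Y" using st sub 3 unfolding stable_def by blast
    also have "\<dots> = (\<Sum>(a, b)\<in>cut_edges A ?Y. bond gs ?C a b)"
      unfolding cut_weight_edges
      by (rule sum.cong) (use pd sub in \<open>auto simp: cut_edges_def intro!: bond_cong\<close>)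
    also have "\<dots> \<le> cut_weight gs ?C X"
      unfolding cut_weight_edges
    proof (rule sum_mono2)
      show "finite (cut_edges ?C X)" by (rule finite_cut_edges[OF finX])
      show "cut_edges A ?Y \<subseteq> cut_edges ?C X"
        using pd by (auto simp: cut_edges_def)
    qed simp
    finally show ?thesis .
  qed
qed

lemma stable_single: "stable tau gs [p \<mapsto> t]"
  by (auto simp: stable_def)

section \<open>Invariance under translation\<close>

definition shiftp :: "pos \<Rightarrow> pos \<Rightarrow> pos" where
  "shiftp v p = (fst p + fst v, snd p + snd v)"

lemma shift_app: "shift v A (shiftp v p) = A p"
  by (simp add: shift_def shiftp_def)

lemma shift_shift: "shift u (shift v A) = shift (shiftp v u) A"
  by (auto simp: shift_def shiftp_def algebra_simps)

lemma shift_zero [simp]: "shift (0, 0) A = A"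
  by (auto simp: shift_def)

definition neg :: "pos \<Rightarrow> pos" where "neg v = (- fst v, - snd v)"

lemma shift_neg [simp]: "shift (neg v) (shift v A) = A" "shift v (shift (neg v) A) = A"
  by (auto simp: shift_shift shiftp_def neg_def)

lemma dom_shift: "dom (shift v A) = shiftp v ` dom A"
proof -
  have "p \<in> shiftp v ` dom A" if "p \<in> dom (shift v A)" for p
    using that by (intro image_eqI[of _ _ "(fst p - fst v, snd p - snd v)"]) (auto simp: shift_def shiftp_def)
  then show ?thesis by (auto simp: shift_def shiftp_def)
qed

lemma inj_shiftp: "inj (shiftp v)"
  by (auto simp: inj_def shiftp_def)

lemma disjoint_shift: "dom (shift v A) \<inter> dom (shift v B) = {} \<longleftrightarrow> dom A \<inter> dom B = {}"
  by (metis dom_shift image_Int image_is_empty inj_shiftp)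

lemma shiftp_nb [simp]:
  "nb_E (shiftp v p) = shiftp v (nb_E p)" "nb_W (shiftp v p) = shiftp v (nb_W p)"
  "nb_N (shiftp v p) = shiftp v (nb_N p)" "nb_S (shiftp v p) = shiftp v (nb_S p)"
  by (auto simp: shiftp_def nb_defs)

lemma shift_map_add: "shift v (A ++ B) = shift v A ++ shift v B"
  by (auto simp: shift_def map_add_def)

lemma bond_shift: "bond gs (shift v A) (shiftp v p) (shiftp v q) = bond gs A p q"
proof -
  have "(shiftp v q = (fst (shiftp v p) + 1, snd (shiftp v p))) = (q = (fst p + 1, snd p))"
    "(shiftp v q = (fst (shiftp v p) - 1, snd (shiftp v p))) = (q = (fst p - 1, snd p))"
    "(shiftp v q = (fst (shiftp v p), snd (shiftp v p) + 1)) = (q = (fst p, snd p + 1))"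
    "(shiftp v q = (fst (shiftp v p), snd (shiftp v p) - 1)) = (q = (fst p, snd p - 1))"
    by (cases p; cases q; simp add: shiftp_def; arith)+
  then show ?thesis unfolding bond_def shift_app by (simp only:)
qed

lemma adjacent_shift: "adjacent (shiftp v p) (shiftp v q) = adjacent p q"
  by (simp add: adjacent_def shiftp_def)

lemma stable_shiftI:
  assumes "stable tau gs A"
  shows "stable tau gs (shift v A)"
  unfolding stable_def
proof (intro allI impI, elim conjE)
  fix X assume X: "X \<subseteq> dom (shift v A)" "X \<noteq> {}" "X \<noteq> dom (shift v A)"
  then obtain Y where Y: "X = shiftp v ` Y" "Y \<subseteq> dom A" by (metis dom_shift subset_imageE)
  have "cut_edges (shift v A) X = map_prod (shiftp v) (shiftp v) ` cut_edges A Y"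
  proof (intro set_eqI iffI)
    fix e assume "e \<in> cut_edges (shift v A) X"
    moreover obtain p' q' where "e = (p', q')" by (cases e)
    ultimately have e': "e = (p', q')" "p' \<in> shiftp v ` Y" "q' \<in> shiftp v ` dom A"
      "q' \<notin> shiftp v ` Y" "adjacent p' q'"
      by (simp_all add: cut_edges_def dom_shift Y)
    then obtain p q where "p \<in> Y" "q \<in> dom A" "p' = shiftp v p" "q' = shiftp v q" by blast
    with e' have e: "e = (shiftp v p, shiftp v q)" "p \<in> Y" "q \<in> dom A" "shiftp v q \<notin> shiftp v ` Y" "adjacent p q"
      by (simp_all add: adjacent_shift)
    then have "(p, q) \<in> cut_edges A Y" by (auto simp: cut_edges_def)
    then show "e \<in> map_prod (shiftp v) (shiftp v) ` cut_edges A Y" unfolding e by force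
  next
    fix e assume "e \<in> map_prod (shiftp v) (shiftp v) ` cut_edges A Y"
    then obtain p q where "e = (shiftp v p, shiftp v q)" "p \<in> Y" "q \<in> dom A" "q \<notin> Y" "adjacent p q"
      unfolding cut_edges_def by fastforce
    then show "e \<in> cut_edges (shift v A) X"
      using inj_image_mem_iff[OF inj_shiftp, of v q Y] by (simp add: cut_edges_def dom_shift Y adjacent_shift)
  qed
  moreover have "inj_on (map_prod (shiftp v) (shiftp v)) (cut_edges A Y)"
    by (intro inj_on_subset[OF prod.inj_map]) (auto intro: inj_shiftp)
  ultimately have "cut_weight gs (shift v A) X = cut_weight gs A Y"
    unfolding cut_weight_edges
    by (simp add: sum.reindex case_prod_beta bond_shift)
  moreover have "tau \<le> cut_weight gs A Y"
    using assms X Y unfolding stable_def dom_shift by blast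
  ultimately show "tau \<le> cut_weight gs (shift v A) X" by simp
qed

lemma stable_shift [simp]: "stable tau gs (shift v A) = stable tau gs A"
  using stable_shiftI[of tau gs A v] stable_shiftI[of tau gs "shift v A" "neg v"] by auto

section \<open>Produced and terminal assemblies in terms of disjoint unions\<close>

lemma combinableI:
  assumes "dom A \<inter> dom B = {}" "stable tau gs (A ++ B)"
  shows "combinable tau gs A B (A ++ B)"
  unfolding combinable_def using assms
  by (intro exI[of _ "(0::int, 0::int)"]) simp

text \<open>Absorbs the three independent translations of \<open>combinable\<close> into the shift
  case, so that the combination case speaks only of two disjoint configurations in place.\<close>

lemma produced_induct_union [consumes 1, case_names init shift union]:
  assumes C: "C \<in> produced tau gs S"
    and init: "\<And>A. A \<in> S \<Longrightarrow> P A"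
    and sh: "\<And>A v. A \<in> produced tau gs S \<Longrightarrow> P A \<Longrightarrow> P (shift v A)"
    and un: "\<And>A B. A \<in> produced tau gs S \<Longrightarrow> B \<in> produced tau gs S \<Longrightarrow> P A \<Longrightarrow> P B \<Longrightarrow>
       dom A \<inter> dom B = {} \<Longrightarrow> stable tau gs (A ++ B) \<Longrightarrow> P (A ++ B)"
  shows "P C"
  using C
proof induction
  case (comb A B C)
  from \<open>combinable tau gs A B C\<close> obtain u v w where
    c: "dom (shift u A) \<inter> dom (shift v B) = {}" "shift u A ++ shift v B = shift w C" "stable tau gs C"
    by (auto simp: combinable_def)
  have "P (shift u A ++ shift v B)"
    by (rule un) (use comb c sh in \<open>auto intro: produced.transl\<close>)
  moreover have "shift w C \<in> produced tau gs S"
    by (rule produced.transl, rule produced.comb) (use comb in auto)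
  ultimately have "P (shift (neg w) (shift w C))" unfolding c(2) by (rule sh[rotated])
  then show ?case by simp
qed (auto intro: init sh)

lemma produced_union:
  assumes "A \<in> produced tau gs S" "B \<in> produced tau gs S" "dom A \<inter> dom B = {}" "stable tau gs (A ++ B)"
  shows "A ++ B \<in> produced tau gs S"
  using assms combinableI produced.comb by metis

text \<open>Moving the partner by the inverse of the translation applied to \<open>A\<close> brings
  every combination into the form of a disjoint union with \<open>A\<close> itself.\<close>

lemma terminal_iff:
  "A \<in> terminal tau gs S \<longleftrightarrow> A \<in> produced tau gs S \<and>
     (\<forall>B \<in> produced tau gs S. dom A \<inter> dom B = {} \<longrightarrow> \<not> stable tau gs (A ++ B))"
proof -
  have "\<exists>B \<in> produced tau gs S. dom A \<inter> dom B = {} \<and> stable tau gs (A ++ B)"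
    if B: "B \<in> produced tau gs S" and c: "combinable tau gs A B C" for B C
  proof -
    from c obtain u v w where
      c: "dom (shift u A) \<inter> dom (shift v B) = {}" "shift u A ++ shift v B = shift w C" "stable tau gs C"
      by (auto simp: combinable_def)
    let ?B = "shift (neg u) (shift v B)"
    have "shift (neg u) (shift u A ++ shift v B) = A ++ ?B"
      by (simp add: shift_map_add)
    then have "stable tau gs (A ++ ?B)" using c by (metis stable_shift)
    moreover have "dom A \<inter> dom ?B = {}"
      using c(1) disjoint_shift[of u A ?B] by simp
    moreover have "?B \<in> produced tau gs S" using B by (intro produced.transl)
    ultimately show ?thesis by blast
  qed
  then show ?thesis unfolding terminal_def using combinableI by blast
qed

lemma terminal_not_stable:
  "A \<in> terminal tau gs S \<Longrightarrow> B \<in> produced tau gs S \<Longrightarrow> dom A \<inter> dom B = {} \<Longrightarrow>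
    \<not> stable tau gs (A ++ B)"
  by (simp add: terminal_iff)

lemma terminal_subset_produced: "terminal tau gs S \<subseteq> produced tau gs S"
  by (auto simp: terminal_def)

lemma terminal_shift:
  assumes "A \<in> terminal tau gs S" shows "shift v A \<in> terminal tau gs S"
  unfolding terminal_iff
proof (intro conjI ballI impI notI)
  show "shift v A \<in> produced tau gs S" using assms by (auto simp: terminal_def intro: produced.transl)
  fix B assume B: "B \<in> produced tau gs S" "dom (shift v A) \<inter> dom B = {}" "stable tau gs (shift v A ++ B)"
  have "shift v A ++ B = shift v (A ++ shift (neg v) B)" by (simp add: shift_map_add)
  then have "stable tau gs (A ++ shift (neg v) B)" using B by (metis stable_shift)
  moreover have "dom A \<inter> dom (shift (neg v) B) = {}"
    using B(2) disjoint_shift[of v A "shift (neg v) B"] by simp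
  moreover have "shift (neg v) B \<in> produced tau gs S" using B by (intro produced.transl)
  ultimately show False using assms unfolding terminal_iff by blast
qed

lemma produced_stable_finite:
  assumes "\<And>A. A \<in> S \<Longrightarrow> stable tau gs A \<and> finite (dom A) \<and> dom A \<noteq> {}"
    and "C \<in> produced tau gs S"
  shows "stable tau gs C \<and> finite (dom C) \<and> dom C \<noteq> {}"
  using assms(2)
proof (induction rule: produced_induct_union)
  case (init A)
  then show ?case by (rule assms(1))
next
  case (shift A v)
  then show ?case by (simp add: dom_shift)
next
  case (union A B)
  then show ?case by (metis Un_empty dom_map_add finite_Un)
qed

text \<open>Terminal assemblies are in particular produced, so by terminality no two of them
  combine. Hence a bin that receives the output of a single bin passes it on unchanged; this is what
  makes the idle stages idle.\<close>

lemma terminal_terminal: "terminal tau gs (terminal tau gs S) = terminal tau gs S"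
proof -
  let ?T = "terminal tau gs S"
  have p: "C \<in> ?T" if "C \<in> produced tau gs ?T" for C
    using that
  proof (induction rule: produced_induct_union)
    case (union A B)
    have "B \<in> produced tau gs S" using union.IH(2) terminal_subset_produced by (rule subsetD[rotated])
    then show ?case using terminal_not_stable[OF union.IH(1) _ union.hyps(3)] union.hyps(4) by simp
  qed (simp_all add: terminal_shift)
  then have "produced tau gs ?T = ?T" by (intro subset_antisym subsetI) (simp_all add: produced.init)
  moreover have "\<not> stable tau gs (A ++ B)" if "A \<in> ?T" "B \<in> ?T" "dom A \<inter> dom B = {}" for A B
    using terminal_not_stable[OF that(1) _ that(3)] subsetD[OF terminal_subset_produced that(2)] by simp
  ultimately show ?thesis by (intro set_eqI) (simp only: terminal_iff[of _ _ _ ?T], blast)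
qed

lemma union_cut:
  assumes "stable tau gs (A ++ B)" "dom A \<inter> dom B = {}" "dom A \<noteq> {}" "dom B \<noteq> {}"
  shows "cut_weight gs (A ++ B) (dom A) \<ge> tau"
proof -
  have "dom A \<subseteq> dom (A ++ B)" "dom A \<noteq> dom (A ++ B)"
    using assms(2,4) by (simp_all add: dom_map_add) blast
  then show ?thesis using assms(1)[unfolded stable_def, THEN spec, of "dom A"] assms(3) by simp
qed

text \<open>The entry point of the impossibility arguments below: a stable union has a positive bond
  across the seam between its operands.\<close>

lemma union_bond:
  assumes "stable tau gs (A ++ B)" "dom A \<inter> dom B = {}" "dom A \<noteq> {}" "dom B \<noteq> {}" "tau > 0"
  obtains p q a b where "A p = Some a" "B q = Some b" "adjacent p q" "bond gs (A ++ B) p q > 0"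
proof -
  have "cut_weight gs (A ++ B) (dom A) > 0" using union_cut[OF assms(1-4)] assms(5) by simp
  then obtain p q where "p \<in> dom A" "q \<in> dom (A ++ B) - dom A" "adjacent p q" "bond gs (A ++ B) p q > 0"
    by (rule cut_weight_pos)
  then have "p \<in> dom A" "q \<in> dom B" by auto
  then obtain a b where "A p = Some a" "B q = Some b" by blast
  then show ?thesis by (rule that) fact+
qed

lemma bond_union:
  assumes "dom A \<inter> dom B = {}" "A p = Some a" "B q = Some b"
  shows "q = nb_E p \<Longrightarrow> bond gs (A ++ B) p q = glue_str gs (tE a) (tW b)"
    "q = nb_W p \<Longrightarrow> bond gs (A ++ B) p q = glue_str gs (tW a) (tE b)"
    "q = nb_N p \<Longrightarrow> bond gs (A ++ B) p q = glue_str gs (tN a) (tS b)"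
    "q = nb_S p \<Longrightarrow> bond gs (A ++ B) p q = glue_str gs (tS a) (tN b)"
proof -
  have "B p = None" using assms(1,2) by (metis IntI domI domIff empty_iff)
  then have "(A ++ B) p = Some a" "(A ++ B) q = Some b"
    using assms(2,3) by (simp_all add: map_add_def)
  note f = bond_nb[OF this, of gs]
  show "q = nb_E p \<Longrightarrow> bond gs (A ++ B) p q = glue_str gs (tE a) (tW b)"
    "q = nb_W p \<Longrightarrow> bond gs (A ++ B) p q = glue_str gs (tW a) (tE b)"
    "q = nb_N p \<Longrightarrow> bond gs (A ++ B) p q = glue_str gs (tN a) (tS b)"
    "q = nb_S p \<Longrightarrow> bond gs (A ++ B) p q = glue_str gs (tS a) (tN b)"
    by (fact f)+
qed

definition singles :: "tile set \<Rightarrow> config set" where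
  "singles T = {[p \<mapsto> t] | p t. t \<in> T}"

lemma shift_single: "shift v [p \<mapsto> t] = [shiftp v p \<mapsto> t]"
  by (rule ext) (auto simp: shift_def shiftp_def)

lemma single_tiles_produced:
  assumes "single_tiles T \<subseteq> S" "t \<in> T"
  shows "[p \<mapsto> t] \<in> produced tau gs S"
proof -
  have "[(0, 0) \<mapsto> t] \<in> produced tau gs S"
    using assms by (intro produced.init) (auto simp: single_tiles_def)
  then have "shift p [(0, 0) \<mapsto> t] \<in> produced tau gs S" by (rule produced.transl)
  then show ?thesis by (simp add: shift_single shiftp_def)
qed

text \<open>All three conclusions come from one stable union; the last shows that a free tile is not
  terminal as soon as some produced assembly has a site for it.\<close>

lemma attach_produced:
  assumes A: "A \<in> produced tau gs S" and t: "[p \<mapsto> t] \<in> produced tau gs S"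
    and st: "stable tau gs A" "finite (dom A)" and p: "A p = None"
    and w: "cut_weight gs (A(p \<mapsto> t)) {p} \<ge> tau"
  shows "A(p \<mapsto> t) \<in> produced tau gs S" "A \<notin> terminal tau gs S" "[p \<mapsto> t] \<notin> terminal tau gs S"
proof -
  have s: "stable tau gs (A(p \<mapsto> t))" by (rule stable_attach[OF st p w])
  have d: "dom A \<inter> dom [p \<mapsto> t] = {}" using p by auto
  show "A(p \<mapsto> t) \<in> produced tau gs S"
    using produced_union[OF A t d] s by simp
  show "A \<notin> terminal tau gs S"
    using terminal_not_stable[OF _ t d] s by auto
  have "[p \<mapsto> t] ++ A = A(p \<mapsto> t)"
    using map_add_comm[OF d] by simp
  then show "[p \<mapsto> t] \<notin> terminal tau gs S"
    using terminal_not_stable[OF _ A, of "[p \<mapsto> t]"] s d by auto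
qed

section \<open>Bent lines\<close>

text \<open>Position number \<open>k\<close> on the bent line that comes down the y-axis and leaves along the x-axis.\<close>
definition lpos :: "int \<Rightarrow> pos" where
  "lpos k = (if k \<ge> 0 then (k, 0) else (0, - k))"

text \<open>The range from \<open>a\<close> to \<open>b\<close> need not contain 0, so a piece of
  pure row or pure column is also a line. Joining two pieces then concatenates their index
  ranges.\<close>

definition line :: "int \<Rightarrow> int \<Rightarrow> (int \<Rightarrow> tile) \<Rightarrow> config" where
  "line a b \<tau> p =
     (if snd p = 0 \<and> 0 \<le> fst p \<and> a \<le> fst p \<and> fst p \<le> b then Some (\<tau> (fst p))
      else if fst p = 0 \<and> 0 < snd p \<and> a \<le> - snd p \<and> - snd p \<le> b then Some (\<tau> (- snd p))
      else None)"

lemma line_lpos: "line a b \<tau> (lpos k) = (if a \<le> k \<and> k \<le> b then Some (\<tau> k) else None)"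
  by (auto simp: line_def lpos_def)

lemma line_SomeE:
  assumes "line a b \<tau> p = Some t"
  obtains k where "p = lpos k" "a \<le> k" "k \<le> b" "t = \<tau> k"
proof -
  have "p = lpos (if snd p = 0 then fst p else - snd p)" using assms
    by (cases p) (auto simp: line_def lpos_def split: if_splits)
  with assms show ?thesis using that by (metis line_lpos option.discI option.inject)
qed

lemma shift_line_SomeE:
  assumes "shift v (line a b \<tau>) p = Some t"
  obtains k where "p = shiftp v (lpos k)" "a \<le> k" "k \<le> b" "t = \<tau> k"
proof -
  have "shift v (line a b \<tau>) p = line a b \<tau> (fst p - fst v, snd p - snd v)" by (simp add: shift_def)
  with assms obtain k where k: "(fst p - fst v, snd p - snd v) = lpos k" "a \<le> k" "k \<le> b" "t = \<tau> k"
    by (auto elim: line_SomeE)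
  have "p = shiftp v (lpos k)" unfolding k(1)[symmetric] by (simp add: shiftp_def)
  then show ?thesis using k that by blast
qed

lemma lpos_nb: "k \<ge> 0 \<Longrightarrow> nb_E (lpos k) = lpos (k + 1)" "k < 0 \<Longrightarrow> nb_S (lpos k) = lpos (k + 1)"
  "k > 0 \<Longrightarrow> nb_W (lpos k) = lpos (k - 1)" "k \<le> 0 \<Longrightarrow> nb_N (lpos k) = lpos (k - 1)"
  by (auto simp: lpos_def nb_defs)

lemma line_extend_right: "a \<le> b \<Longrightarrow> (line a b \<tau>)(lpos (b + 1) \<mapsto> \<tau> (b + 1)) = line a (b + 1) \<tau>"
  by (rule ext) (auto simp: line_def lpos_def intro: arg_cong[where f = \<tau>])

lemma line_extend_left: "a \<le> b \<Longrightarrow> (line a b \<tau>)(lpos (a - 1) \<mapsto> \<tau> (a - 1)) = line (a - 1) b \<tau>"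
  by (rule ext) (auto simp: line_def lpos_def intro: arg_cong[where f = \<tau>])

text \<open>Only the piece that may contain the corner can keep its indices: here the left one, in
  \<open>col_join\<close> the lower one. The other piece is renumbered.\<close>

lemma row_join:
  assumes "a \<le> b" "0 \<le> b" "1 \<le> a'" "a' \<le> b'"
    and v: "shiftp v' (lpos a') = shiftp v (lpos (b + 1))"
  shows "shift v (line a b \<tau>) ++ shift v' (line a' b' \<tau>') =
    shift v (line a (b + 1 + (b' - a')) (\<lambda>k. if k \<le> b then \<tau> k else \<tau>' (k - b - 1 + a')))"
proof -
  have v': "fst v' = fst v + b + 1 - a'" "snd v' = snd v"
    using assms by (auto simp: shiftp_def lpos_def)
  show ?thesis
  proof (rule ext)
    fix p :: pos
    define x y where xy: "x = fst p - fst v" "y = snd p - snd v"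
    have *: "snd p - snd v' = y" "fst p - fst v' = x - b - 1 + a'"
      using v' xy by simp_all
    consider "x \<le> b" "y = 0" | "x > b" "y = 0" | "y \<noteq> 0" by linarith
    then show "(shift v (line a b \<tau>) ++ shift v' (line a' b' \<tau>')) p =
      shift v (line a (b + 1 + (b' - a')) (\<lambda>k. if k \<le> b then \<tau> k else \<tau>' (k - b - 1 + a'))) p"
      unfolding shift_def map_add_def line_def fst_conv snd_conv xy[symmetric] * using assms(1-4)
      by cases simp_all
  qed
qed

lemma col_join:
  assumes "a \<le> b" "b \<le> -1" "a' \<le> 0" "a' \<le> b'"
    and v: "shiftp v (lpos b) = shiftp v' (lpos (a' - 1))"
  shows "shift v' (line a' b' \<tau>') ++ shift v (line a b \<tau>) =
    shift v' (line (a' - 1 - (b - a)) b' (\<lambda>k. if k \<ge> a' then \<tau>' k else \<tau> (k - a' + 1 + b)))"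
proof -
  have v': "snd v = snd v' - a' + 1 + b" "fst v = fst v'"
    using assms by (auto simp: shiftp_def lpos_def)
  show ?thesis
  proof (rule ext)
    fix p :: pos
    define x y where xy: "x = fst p - fst v'" "y = snd p - snd v'"
    have *: "fst p - fst v = x" "snd p - snd v = y + a' - 1 - b" "- (y + a' - 1 - b) = - y - a' + 1 + b"
      using v' xy by simp_all
    consider "y \<le> 0" | "0 < y" "y \<le> - a'" | "- a' < y" "0 < y" by linarith
    then show "(shift v' (line a' b' \<tau>') ++ shift v (line a b \<tau>)) p =
      shift v' (line (a' - 1 - (b - a)) b' (\<lambda>k. if k \<ge> a' then \<tau>' k else \<tau> (k - a' + 1 + b))) p"
      unfolding shift_def map_add_def line_def fst_conv snd_conv xy[symmetric] * using assms(1-4)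
      by cases simp_all
  qed
qed

text \<open>\<open>HR\<close> and \<open>HC\<close> are the glues inside the row and the column of a line.  A line tile is a row tile, a
  column tile or a corner.\<close>
locale line_tiles =
  fixes gs :: "glue \<Rightarrow> nat" and LT :: "tile set" and HR HC :: "glue set"
  assumes gs0: "gs 0 = 0" and gs2: "\<And>g. g \<in> HR \<union> HC \<Longrightarrow> gs g = 2"
    and nz: "0 \<notin> HR" "0 \<notin> HC"
    and kinds: "\<And>t. t \<in> LT \<Longrightarrow>
      (tW t \<in> HR \<and> tS t = 0 \<and> tE t \<in> insert 0 HR \<and> tN t \<notin> HC) \<or>
      (tS t \<in> HC \<and> tW t = 0 \<and> tE t \<notin> HR) \<or>
      (tS t = 0 \<and> tW t = 0 \<and> tN t \<in> HC \<and> tE t \<in> HR)"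
    and partner_row: "\<And>g. g \<in> HR \<Longrightarrow> (\<exists>t \<in> LT. tW t = g) \<and> (\<exists>t \<in> LT. tE t = g)"
    and partner_col: "\<And>g. g \<in> HC \<Longrightarrow> (\<exists>t \<in> LT. tN t = g) \<and> (\<exists>t \<in> LT. tS t = g)"
begin

definition valid_line :: "int \<Rightarrow> int \<Rightarrow> (int \<Rightarrow> tile) \<Rightarrow> bool" where
  "valid_line a b \<tau> \<longleftrightarrow> a \<le> b \<and>
    (\<forall>k. a \<le> k \<and> k \<le> b \<longrightarrow> \<tau> k \<in> LT \<and> (k > 0 \<longrightarrow> tW (\<tau> k) \<in> HR) \<and> (k < 0 \<longrightarrow> tS (\<tau> k) \<in> HC) \<and>
       (k = 0 \<longrightarrow> tN (\<tau> k) \<in> HC \<and> tE (\<tau> k) \<in> HR)) \<and>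
    (\<forall>k. a \<le> k \<and> k < b \<longrightarrow> (k \<ge> 0 \<longrightarrow> tE (\<tau> k) = tW (\<tau> (k + 1))) \<and>
                           (k < 0 \<longrightarrow> tS (\<tau> k) = tN (\<tau> (k + 1))))"

lemma valid_lineI:
  assumes "a \<le> b"
    and "\<And>k. a \<le> k \<Longrightarrow> k \<le> b \<Longrightarrow> \<tau> k \<in> LT"
    and "\<And>k. a \<le> k \<Longrightarrow> k \<le> b \<Longrightarrow> 0 < k \<Longrightarrow> tW (\<tau> k) \<in> HR"
    and "\<And>k. a \<le> k \<Longrightarrow> k \<le> b \<Longrightarrow> k < 0 \<Longrightarrow> tS (\<tau> k) \<in> HC"
    and "\<And>k. a \<le> k \<Longrightarrow> k \<le> b \<Longrightarrow> k = 0 \<Longrightarrow> tN (\<tau> k) \<in> HC"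
    and "\<And>k. a \<le> k \<Longrightarrow> k \<le> b \<Longrightarrow> k = 0 \<Longrightarrow> tE (\<tau> k) \<in> HR"
    and "\<And>k. a \<le> k \<Longrightarrow> k < b \<Longrightarrow> 0 \<le> k \<Longrightarrow> tE (\<tau> k) = tW (\<tau> (k + 1))"
    and "\<And>k. a \<le> k \<Longrightarrow> k < b \<Longrightarrow> k < 0 \<Longrightarrow> tS (\<tau> k) = tN (\<tau> (k + 1))"
  shows "valid_line a b \<tau>"
  unfolding valid_line_def using assms by simp

abbreviation lines :: "config set" where
  "lines \<equiv> {shift v (line a b \<tau>) | v a b \<tau>. valid_line a b \<tau>}"

lemma valid_tile: "valid_line a b \<tau> \<Longrightarrow> a \<le> k \<Longrightarrow> k \<le> b \<Longrightarrow> \<tau> k \<in> LT"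
  by (simp add: valid_line_def)

text \<open>By \<open>kinds\<close> and the absence of 0 from \<open>HR\<close> and
  \<open>HC\<close>, the west and south glues of a tile reveal on which arm it sits. Hence a bond
  through such a glue fixes the relative position of two lines.\<close>

lemma valid_row:
  assumes "valid_line a b \<tau>" "a \<le> k" "k \<le> b"
  shows "tW (\<tau> k) \<in> HR \<longleftrightarrow> k > 0" "tE (\<tau> k) \<in> HR \<Longrightarrow> k \<ge> 0"
    "tS (\<tau> k) \<in> HC \<longleftrightarrow> k < 0" "tN (\<tau> k) \<in> HC \<Longrightarrow> k \<le> 0"
proof -
  have v: "\<tau> k \<in> LT" "k > 0 \<longrightarrow> tW (\<tau> k) \<in> HR" "k < 0 \<longrightarrow> tS (\<tau> k) \<in> HC"
    "k = 0 \<longrightarrow> tN (\<tau> k) \<in> HC \<and> tE (\<tau> k) \<in> HR"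
    using assms by (auto simp: valid_line_def)
  consider "k < 0" | "k = 0" | "k > 0" by linarith
  then show "tW (\<tau> k) \<in> HR \<longleftrightarrow> k > 0" "tE (\<tau> k) \<in> HR \<Longrightarrow> k \<ge> 0"
    "tS (\<tau> k) \<in> HC \<longleftrightarrow> k < 0" "tN (\<tau> k) \<in> HC \<Longrightarrow> k \<le> 0"
    using kinds[OF v(1)] v nz by (cases; metis less_irrefl order.asym less_imp_le order_refl)+
qed

lemma valid_link:
  assumes "valid_line a b \<tau>" "a \<le> k" "k < b"
  shows "0 \<le> k \<Longrightarrow> tE (\<tau> k) = tW (\<tau> (k + 1))" "k < 0 \<Longrightarrow> tS (\<tau> k) = tN (\<tau> (k + 1))"
  using assms by (simp_all add: valid_line_def)

lemma tile_WS: "t \<in> LT \<Longrightarrow> tW t \<in> insert 0 HR" "t \<in> LT \<Longrightarrow> tS t \<in> insert 0 HC"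
  using kinds[of t] by auto

lemma glue_pos: "glue_str gs g h > 0 \<Longrightarrow> g = h \<and> g \<noteq> 0"
  using gs0 by (cases "g = h"; cases "g = 0") (auto simp: glue_str_def)

text \<open>A glue that bonds here lies in \<open>HR\<close>, so \<open>s\<close> is the corner or a
  row tile, and \<open>t\<close> is a row tile. Disjointness makes \<open>s\<close> the last tile of
  its line and \<open>t\<close> the first of the other one, since otherwise the site across the bond
  would already be occupied. The extra conclusions about the ends exclude such a join for a complete
  line.\<close>

lemma join_right:
  assumes A: "valid_line a b \<tau>" and B: "valid_line a' b' \<tau>'"
    and p: "shift v (line a b \<tau>) p = Some s" and q: "shift v' (line a' b' \<tau>') (nb_E p) = Some t"
    and d: "dom (shift v (line a b \<tau>)) \<inter> dom (shift v' (line a' b' \<tau>')) = {}"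
    and g: "glue_str gs (tE s) (tW t) > 0"
  shows "tE (\<tau> b) \<in> HR \<and> 0 \<le> b \<and> 1 \<le> a' \<and> shift v (line a b \<tau>) ++ shift v' (line a' b' \<tau>') \<in> lines"
proof -
  obtain i where i: "p = shiftp v (lpos i)" "a \<le> i" "i \<le> b" "s = \<tau> i"
    using p by (rule shift_line_SomeE)
  obtain j where j: "nb_E p = shiftp v' (lpos j)" "a' \<le> j" "j \<le> b'" "t = \<tau>' j"
    using q by (rule shift_line_SomeE)
  have e: "tE s = tW t" "tE s \<in> HR" using glue_pos[OF g] tile_WS(1)[of t] valid_tile[OF B j(2,3)] j(4) by auto
  have ij: "i \<ge> 0" "j > 0" using valid_row[OF A i(2,3)] valid_row[OF B j(2,3)] e i j by auto
  have ib: "i = b"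
  proof (rule ccontr)
    assume "i \<noteq> b"
    then have "nb_E p \<in> dom (shift v (line a b \<tau>))"
      using i ij by (auto simp: lpos_nb shift_app line_lpos)
    then show False using q d by auto
  qed
  have ja: "j = a'"
  proof (rule ccontr)
    assume "j \<noteq> a'"
    moreover have "p = shiftp v' (lpos (j - 1))" using j(1) lpos_nb(3)[OF ij(2)] by (metis nb_inverse(2) shiftp_nb(2))
    ultimately have "p \<in> dom (shift v' (line a' b' \<tau>'))"
      using j ij by (auto simp: shift_app line_lpos)
    then show False using p d by auto
  qed
  let ?\<tau> = "\<lambda>k. if k \<le> b then \<tau> k else \<tau>' (k - b - 1 + a')"
  have "shift v (line a b \<tau>) ++ shift v' (line a' b' \<tau>') = shift v (line a (b + 1 + (b' - a')) ?\<tau>)"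
    by (rule row_join) (use i j ij ib ja lpos_nb(1)[OF ij(1)] in auto)
  moreover have "valid_line a (b + 1 + (b' - a')) ?\<tau>"
  proof (rule valid_lineI)
    show "a \<le> b + 1 + (b' - a')" using i j by simp
  next
    fix k assume k: "a \<le> k" "k \<le> b + 1 + (b' - a')"
    show "?\<tau> k \<in> LT" using k A B by (auto simp: valid_line_def)
    show "tW (?\<tau> k) \<in> HR" if "0 < k" using that k A B ij ja by (auto simp: valid_line_def)
    show "tS (?\<tau> k) \<in> HC" if "k < 0" using that k A ij ib by (auto simp: valid_line_def)
    show "tN (?\<tau> k) \<in> HC" "tE (?\<tau> k) \<in> HR" if "k = 0" using that k A ij ib by (auto simp: valid_line_def)
  next
    fix k assume k: "a \<le> k" "k < b + 1 + (b' - a')"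
    show "tE (?\<tau> k) = tW (?\<tau> (k + 1))" if "0 \<le> k"
    proof -
      consider "k < b" | "k = b" | "k > b" by linarith
      then show ?thesis
      proof cases
        case 1 then show ?thesis using that k A by (auto simp: valid_line_def)
      next
        case 2 then show ?thesis using e i j ib ja by auto
      next
        case 3
        have "tE (\<tau>' (k - b - 1 + a')) = tW (\<tau>' (k - b - 1 + a' + 1))"
          using 3 k B ij ja by (auto simp: valid_line_def)
        then show ?thesis using 3 by (simp add: algebra_simps)
      qed
    qed
    show "tS (?\<tau> k) = tN (?\<tau> (k + 1))" if "k < 0" using that k A ij ib by (auto simp: valid_line_def)
  qed
  ultimately show ?thesis using e i ij ib ja by auto
qed

lemma join_down:
  assumes A: "valid_line a b \<tau>" and B: "valid_line a' b' \<tau>'"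
    and p: "shift v (line a b \<tau>) p = Some s" and q: "shift v' (line a' b' \<tau>') (nb_S p) = Some t"
    and d: "dom (shift v (line a b \<tau>)) \<inter> dom (shift v' (line a' b' \<tau>')) = {}"
    and g: "glue_str gs (tS s) (tN t) > 0"
  shows "tN (\<tau>' a') \<in> HC \<and> b \<le> -1 \<and> a' \<le> 0 \<and> shift v (line a b \<tau>) ++ shift v' (line a' b' \<tau>') \<in> lines"
proof -
  obtain i where i: "p = shiftp v (lpos i)" "a \<le> i" "i \<le> b" "s = \<tau> i"
    using p by (rule shift_line_SomeE)
  obtain j where j: "nb_S p = shiftp v' (lpos j)" "a' \<le> j" "j \<le> b'" "t = \<tau>' j"
    using q by (rule shift_line_SomeE)
  have e: "tS s = tN t" "tS s \<in> HC" using glue_pos[OF g] tile_WS(2)[of s] valid_tile[OF A i(2,3)] i(4) by auto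
  have ij: "i < 0" "j \<le> 0" using valid_row[OF A i(2,3)] valid_row[OF B j(2,3)] e i j by auto
  have ib: "i = b"
  proof (rule ccontr)
    assume "i \<noteq> b"
    then have "nb_S p \<in> dom (shift v (line a b \<tau>))"
      using i ij by (auto simp: lpos_nb shift_app line_lpos)
    then show False using q d by auto
  qed
  have p': "p = shiftp v' (lpos (j - 1))" using j(1) lpos_nb(4)[OF ij(2)] by (metis nb_inverse(3) shiftp_nb(3))
  have ja: "j = a'"
  proof (rule ccontr)
    assume "j \<noteq> a'"
    with p' have "p \<in> dom (shift v' (line a' b' \<tau>'))"
      using j ij by (auto simp: shift_app line_lpos)
    then show False using p d by auto
  qed
  let ?\<tau> = "\<lambda>k. if k \<ge> a' then \<tau>' k else \<tau> (k - a' + 1 + b)"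
  have "shift v' (line a' b' \<tau>') ++ shift v (line a b \<tau>) = shift v' (line (a' - 1 - (b - a)) b' ?\<tau>)"
    by (rule col_join) (use i j ij ib ja p' in auto)
  then have "shift v (line a b \<tau>) ++ shift v' (line a' b' \<tau>') = shift v' (line (a' - 1 - (b - a)) b' ?\<tau>)"
    using map_add_comm[OF d] by simp
  moreover have "valid_line (a' - 1 - (b - a)) b' ?\<tau>"
  proof (rule valid_lineI)
    show "a' - 1 - (b - a) \<le> b'" using i j by simp
  next
    fix k assume k: "a' - 1 - (b - a) \<le> k" "k \<le> b'"
    show "?\<tau> k \<in> LT" using k A B by (auto simp: valid_line_def)
    show "tW (?\<tau> k) \<in> HR" if "0 < k" using that k B ij ja by (auto simp: valid_line_def)
    show "tS (?\<tau> k) \<in> HC" if "k < 0" using that k A B ij ib by (auto simp: valid_line_def)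
    show "tN (?\<tau> k) \<in> HC" "tE (?\<tau> k) \<in> HR" if "k = 0" using that k B ij ja by (auto simp: valid_line_def)
  next
    fix k assume k: "a' - 1 - (b - a) \<le> k" "k < b'"
    show "tE (?\<tau> k) = tW (?\<tau> (k + 1))" if "0 \<le> k" using that k B ij ja by (auto simp: valid_line_def)
    show "tS (?\<tau> k) = tN (?\<tau> (k + 1))" if "k < 0"
    proof -
      consider "k \<ge> a'" | "k = a' - 1" | "k < a' - 1" by linarith
      then show ?thesis
      proof cases
        case 1 then show ?thesis using that k B by (auto simp: valid_line_def)
      next
        case 2 then show ?thesis using e i j ib ja by auto
      next
        case 3
        have "tS (\<tau> (k - a' + 1 + b)) = tN (\<tau> (k - a' + 1 + b + 1))"
          using 3 k A ij ib by (auto simp: valid_line_def)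
        then show ?thesis using 3 by (simp add: algebra_simps)
      qed
    qed
  qed
  ultimately show ?thesis using e i j ij ib ja by auto
qed

lemma line_stable_finite: "A \<in> produced 2 gs (single_tiles LT) \<Longrightarrow> stable 2 gs A \<and> finite (dom A) \<and> dom A \<noteq> {}"
  by (rule produced_stable_finite) (auto simp: single_tiles_def stable_single)

lemma produced_lines:
  assumes "C \<in> produced 2 gs (single_tiles LT)"
  shows "C \<in> lines"
  using assms
proof (induction rule: produced_induct_union)
  case (init A)
  then obtain t where t: "A = [(0, 0) \<mapsto> t]" "t \<in> LT" by (auto simp: single_tiles_def)
  \<comment> \<open>A single tile is a line of one tile: a row tile has index 1, a column tile index
    -1, a corner index 0.\<close>
  let ?k = "if tW t \<in> HR then 1 else if tS t \<in> HC then -1 else (0::int)"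
  have "valid_line ?k ?k (\<lambda>_. t)" using kinds[OF t(2)] t(2) nz by (auto simp: valid_line_def)
  moreover have "line ?k ?k (\<lambda>_. t) = [lpos ?k \<mapsto> t]"
    by (rule ext) (auto simp: line_def lpos_def)
  then have "A = shift (neg (lpos ?k)) (line ?k ?k (\<lambda>_. t))"
    by (simp add: shift_single t shiftp_def neg_def)
  ultimately show ?case by blast
next
  case (shift A v)
  then show ?case by (auto simp: shift_shift) blast
next
  case (union A B)
  from union.IH obtain v a b \<tau> v' a' b' \<tau>' where
    A: "A = shift v (line a b \<tau>)" "valid_line a b \<tau>" and B: "B = shift v' (line a' b' \<tau>')" "valid_line a' b' \<tau>'"
    by blast
  have ne: "dom A \<noteq> {}" "dom B \<noteq> {}"
    using line_stable_finite[OF union.hyps(1)] line_stable_finite[OF union.hyps(2)] by simp_all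
  obtain p q s t where pq: "A p = Some s" "B q = Some t" "adjacent p q" "bond gs (A ++ B) p q > 0"
    by (rule union_bond[OF union.hyps(4,3) ne]) auto
  note bu = bond_union[OF union.hyps(3) pq(1,2), of gs]
  have d': "dom B \<inter> dom A = {}" using union.hyps(3) by blast
  have comm: "B ++ A = A ++ B" using map_add_comm[OF d'] .
  from pq(3) consider "q = nb_E p" | "q = nb_W p" | "q = nb_N p" | "q = nb_S p"
    by (auto simp: adjacent_iff)
  then show ?case
  proof cases
    case 1
    then show ?thesis using join_right[OF A(2) B(2), of v p s v' t] pq union.hyps(3) bu(1) unfolding A(1) B(1) by simp
  next
    case 2
    then have "p = nb_E q" by simp
    then show ?thesis using join_right[OF B(2) A(2), of v' q t v s] pq d' bu(2) 2 comm
      unfolding A(1) B(1) by (simp add: glue_str_commute)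
  next
    case 3
    then have "p = nb_S q" by simp
    then show ?thesis using join_down[OF B(2) A(2), of v' q t v s] pq d' bu(3) 3 comm
      unfolding A(1) B(1) by (simp add: glue_str_commute)
  next
    case 4
    then show ?thesis using join_down[OF A(2) B(2), of v p s v' t] pq union.hyps(3) bu(4) unfolding A(1) B(1) by simp
  qed
qed

text \<open>The shape of a terminal line: both arms are present and both ends are closed. The east
  end is closed by the null glue, while the top end may show any glue outside \<open>HC\<close>,
  because junk columns will expose a strength 2 marker there.\<close>

definition complete :: "int \<Rightarrow> int \<Rightarrow> (int \<Rightarrow> tile) \<Rightarrow> bool" where
  "complete m n \<tau> \<longleftrightarrow> valid_line (- n) m \<tau> \<and> m > 0 \<and> n > 0 \<and> tE (\<tau> m) = 0 \<and> tN (\<tau> (- n)) \<notin> HC"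

lemma attach_line:
  assumes A: "A \<in> produced 2 gs (single_tiles LT)" and t: "t \<in> LT" and p: "A p = None"
    and q: "A q = Some s"
    and m: "q = nb_E p \<and> tE t = tW s \<and> tE t \<in> HR \<or> q = nb_W p \<and> tW t = tE s \<and> tW t \<in> HR \<or>
            q = nb_N p \<and> tN t = tS s \<and> tN t \<in> HC \<or> q = nb_S p \<and> tS t = tN s \<and> tS t \<in> HC"
  shows "A(p \<mapsto> t) \<in> produced 2 gs (single_tiles LT)" "A \<notin> terminal 2 gs (single_tiles LT)"
proof -
  have pq: "q \<noteq> p" "adjacent p q" using m by (auto simp: adjacent_iff)
  have 1: "(A(p \<mapsto> t)) p = Some t" "(A(p \<mapsto> t)) q = Some s" using p q pq by auto
  have "bond gs (A(p \<mapsto> t)) p q = 2"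
    using m bond_nb[OF 1, of gs] gs2 by (auto simp: glue_str_def simp del: fun_upd_apply)
  moreover have "bond gs (A(p \<mapsto> t)) p q \<le> cut_weight gs (A(p \<mapsto> t)) {p}"
    by (rule cut_weight_ge_bond) (use pq 1 in auto)
  ultimately have "cut_weight gs (A(p \<mapsto> t)) {p} \<ge> 2" by simp
  from attach_produced[OF A single_tiles_produced[OF order_refl t] _ _ p this] line_stable_finite[OF A]
  show "A(p \<mapsto> t) \<in> produced 2 gs (single_tiles LT)" "A \<notin> terminal 2 gs (single_tiles LT)" by auto
qed

text \<open>An open end shows a glue of \<open>HR\<close> or \<open>HC\<close>, for which
  \<open>partner_row\<close> or \<open>partner_col\<close> supplies a tile that attaches with
  strength 2. Neither arm can be empty, since the corner itself exposes a glue of either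
  kind.\<close>

lemma terminal_complete:
  assumes "C \<in> terminal 2 gs (single_tiles LT)"
  obtains v m n \<tau> where "C = shift v (line (- n) m \<tau>)" "complete m n \<tau>"
proof -
  have "C \<in> lines" by (rule produced_lines) (rule subsetD[OF terminal_subset_produced assms])
  then obtain v a b \<tau> where C: "C = shift v (line a b \<tau>)" and V: "valid_line a b \<tau>" by blast
  let ?A = "line a b \<tau>"
  have T: "?A \<in> terminal 2 gs (single_tiles LT)"
    using terminal_shift[OF assms, of "neg v"] by (simp add: C)
  then have A: "?A \<in> produced 2 gs (single_tiles LT)" using terminal_subset_produced by blast
  have ab: "a \<le> b" using V by (simp add: valid_line_def)
  have b: "b \<ge> 0"
  proof (rule ccontr)
    assume "\<not> b \<ge> 0"
    then have "tS (\<tau> b) \<in> HC" "b < 0" using V ab by (auto simp: valid_line_def)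
    moreover obtain t where "t \<in> LT" "tN t = tS (\<tau> b)" using partner_col calculation(1) by blast
    ultimately show False
      using attach_line(2)[OF A, of t "lpos (b + 1)" "lpos b" "\<tau> b"] T ab
      by (auto simp: line_lpos) (metis lpos_nb(2) nb_inverse(3))
  qed
  have a: "a \<le> 0"
  proof (rule ccontr)
    assume "\<not> a \<le> 0"
    then have "tW (\<tau> a) \<in> HR" "a > 0" using V ab by (auto simp: valid_line_def)
    moreover obtain t where "t \<in> LT" "tE t = tW (\<tau> a)" using partner_row calculation(1) by blast
    ultimately show False
      using attach_line(2)[OF A, of t "lpos (a - 1)" "lpos a" "\<tau> a"] T ab
      by (auto simp: line_lpos) (metis lpos_nb(3) nb_inverse(1))
  qed
  have E: "tE (\<tau> b) \<notin> HR"
  proof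
    assume g: "tE (\<tau> b) \<in> HR"
    moreover obtain t where "t \<in> LT" "tW t = tE (\<tau> b)" using partner_row g by blast
    ultimately show False
      using attach_line(2)[OF A, of t "lpos (b + 1)" "lpos b" "\<tau> b"] T ab b
      by (auto simp: line_lpos) (metis lpos_nb(1) nb_inverse(2))
  qed
  have N: "tN (\<tau> a) \<notin> HC"
  proof
    assume g: "tN (\<tau> a) \<in> HC"
    moreover obtain t where "t \<in> LT" "tS t = tN (\<tau> a)" using partner_col g by blast
    ultimately show False
      using attach_line(2)[OF A, of t "lpos (a - 1)" "lpos a" "\<tau> a"] T ab a
      by (auto simp: line_lpos) (metis lpos_nb(4) nb_inverse(4))
  qed
  have b0: "b > 0" using b E V a by (cases "b = 0") (auto simp: valid_line_def)
  have a0: "a < 0" using a N V b by (cases "a = 0") (auto simp: valid_line_def)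
  have "tW (\<tau> b) \<in> HR" "\<tau> b \<in> LT" using V b0 ab by (auto simp: valid_line_def)
  then have "tE (\<tau> b) = 0" using kinds[of "\<tau> b"] E nz by auto
  then have "complete b (- a) \<tau>" using V a0 b0 N by (simp add: complete_def)
  then show ?thesis using that[of v "- a" b \<tau>] C by simp
qed

text \<open>The line grows from the corner, eastwards and then upwards. By \<open>join_right\<close>
  and \<open>join_down\<close>, a partner would need an open end of this line, or this line would
  have to lie on one arm only.\<close>

lemma complete_terminal:
  assumes c: "complete m n \<tau>"
  shows "line (- n) m \<tau> \<in> terminal 2 gs (single_tiles LT)"
proof -
  have V: "valid_line (- n) m \<tau>" and mn: "m > 0" "n > 0" using c by (auto simp: complete_def)
  have "line 0 (int k) \<tau> \<in> produced 2 gs (single_tiles LT)" if "int k \<le> m" for k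
    using that
  proof (induction k)
    case 0
    have "line 0 (int 0) \<tau> = [(0, 0) \<mapsto> \<tau> 0]" by (rule ext) (auto simp: line_def)
    then show ?case using single_tiles_produced[OF order_refl, of "\<tau> 0" LT "(0, 0)" 2 gs] valid_tile[OF V, of 0] mn
      by (simp del: fun_upd_apply)
  next
    case (Suc k)
    have "tE (\<tau> (int k)) = tW (\<tau> (int k + 1))" "\<tau> (int k + 1) \<in> LT" "tW (\<tau> (int k + 1)) \<in> HR"
      using V Suc.prems mn by (auto simp: valid_line_def)
    then have "(line 0 (int k) \<tau>)(lpos (int k + 1) \<mapsto> \<tau> (int k + 1)) \<in> produced 2 gs (single_tiles LT)"
      using Suc by (intro attach_line(1)[where q = "lpos (int k)" and s = "\<tau> (int k)"])
        (auto simp: line_lpos lpos_nb)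
    then show ?case using line_extend_right[of 0 "int k" \<tau>] by (simp add: algebra_simps)
  qed
  from this[of "nat m"] have R: "line 0 m \<tau> \<in> produced 2 gs (single_tiles LT)" using mn by simp
  have "line (- int k) m \<tau> \<in> produced 2 gs (single_tiles LT)" if "int k \<le> n" for k
    using that
  proof (induction k)
    case 0
    then show ?case using R by simp
  next
    case (Suc k)
    have "tS (\<tau> (- int k - 1)) = tN (\<tau> (- int k - 1 + 1))" "\<tau> (- int k - 1) \<in> LT" "tS (\<tau> (- int k - 1)) \<in> HC"
      using valid_link(2)[OF V, of "- int k - 1"] valid_tile[OF V, of "- int k - 1"]
        valid_row(3)[OF V, of "- int k - 1"] Suc.prems mn by simp_all
    then have "(line (- int k) m \<tau>)(lpos (- int k - 1) \<mapsto> \<tau> (- int k - 1)) \<in> produced 2 gs (single_tiles LT)"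
      using Suc mn by (intro attach_line(1)[where q = "lpos (- int k)" and s = "\<tau> (- int k)"])
        (auto simp: line_lpos lpos_nb)
    moreover have "- int (Suc k) = - int k - 1" by simp
    ultimately show ?case using mn line_extend_left[of "- int k" m \<tau>] by (simp only:)
  qed
  from this[of "nat n"] have P: "line (- n) m \<tau> \<in> produced 2 gs (single_tiles LT)" using mn by simp
  show ?thesis unfolding terminal_iff
  proof (intro conjI ballI impI notI P)
    let ?A = "line (- n) m \<tau>"
    fix B assume B: "B \<in> produced 2 gs (single_tiles LT)" "dom ?A \<inter> dom B = {}" "stable 2 gs (?A ++ B)"
    obtain v' a' b' \<tau>' where B': "B = shift v' (line a' b' \<tau>')" "valid_line a' b' \<tau>'"
      using produced_lines[OF B(1)] by blast
    obtain p q s t where pq: "?A p = Some s" "B q = Some t" "adjacent p q" "bond gs (?A ++ B) p q > 0"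
      by (rule union_bond[OF B(3,2)]) (use line_stable_finite[OF P] line_stable_finite[OF B(1)] in auto)
    note bu = bond_union[OF B(2) pq(1,2), of gs]
    have A0: "?A = shift (0, 0) ?A" by simp
    have d': "dom B \<inter> dom ?A = {}" using B(2) by blast
    have an: "tE (\<tau> m) \<notin> HR" using c nz by (simp add: complete_def)
    from pq(3) consider "q = nb_E p" | "q = nb_W p" | "q = nb_N p" | "q = nb_S p"
      by (auto simp: adjacent_iff)
    then show False
    proof cases
      case 1
      then show ?thesis using join_right[OF V B'(2), of "(0, 0)" p s v' t] pq B(2) bu(1) an unfolding B'(1) by simp
    next
      case 2
      then have "p = nb_E q" by simp
      then show ?thesis using join_right[OF B'(2) V, of v' q t "(0, 0)" s] pq d' bu(2) 2 mn
        unfolding B'(1) by (simp add: glue_str_commute)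
    next
      case 3
      then have "p = nb_S q" by simp
      then show ?thesis using join_down[OF B'(2) V, of v' q t "(0, 0)" s] pq d' bu(3) 3 c
        unfolding B'(1) by (simp add: glue_str_commute complete_def)
    next
      case 4
      then show ?thesis using join_down[OF V B'(2), of "(0, 0)" p s v' t] pq B(2) bu(4) mn unfolding B'(1) by simp
    qed
  qed
qed

end

section \<open>Rectangles\<close>

lemma shift_upd: "shift v (A(p \<mapsto> t)) = (shift v A)(shiftp v p \<mapsto> t)"
  by (rule ext) (auto simp: shift_def shiftp_def)

lemma singles_shift: "C \<in> singles T \<Longrightarrow> shift v C \<in> singles T"
proof -
  assume "C \<in> singles T"
  then obtain p t where "C = [p \<mapsto> t]" "t \<in> T" by (auto simp: singles_def)
  then have "shift v C = [shiftp v p \<mapsto> t]" "t \<in> T" by (simp_all add: shift_single)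
  then show ?thesis unfolding singles_def by blast
qed

lemma single_tiles_subset: "single_tiles T \<subseteq> singles T"
  by (auto simp: single_tiles_def singles_def)

text \<open>Two single tiles share at most one edge, so the cut between them carries a single
  bond.\<close>

lemma two_singles_unstable:
  assumes T: "\<And>s t. s \<in> T \<Longrightarrow> t \<in> T \<Longrightarrow> glue_str gs (tE s) (tW t) < tau \<and> glue_str gs (tN s) (tS t) < tau"
    and A: "A \<in> singles T" "B \<in> singles T" "dom A \<inter> dom B = {}"
  shows "\<not> stable tau gs (A ++ B)"
proof
  assume st: "stable tau gs (A ++ B)"
  obtain p s q t where pq: "A = [p \<mapsto> s]" "B = [q \<mapsto> t]" "s \<in> T" "t \<in> T" using A by (auto simp: singles_def)
  have ne: "p \<noteq> q" using A(3) pq by auto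
  have "cut_weight gs (A ++ B) (dom A) \<ge> tau" by (rule union_cut[OF st A(3)]) (use pq in auto)
  moreover have "cut_edges (A ++ B) (dom A) \<subseteq> {(p, q)}" using pq ne by (auto simp: cut_edges_def)
  then have "cut_weight gs (A ++ B) (dom A) \<le> (\<Sum>(p, q)\<in>{(p, q)}. bond gs (A ++ B) p q)"
    unfolding cut_weight_edges by (intro sum_mono2) auto
  ultimately have b: "bond gs (A ++ B) p q \<ge> tau" by simp
  have 1: "A p = Some s" "B q = Some t" using pq by auto
  have "tau > 0" using T[OF pq(3,4)] by simp
  then have "adjacent p q"
    using b by (auto simp: adjacent_iff nb_defs bond_def split: option.splits if_splits)
  then show False using b bond_union[OF A(3) 1, of gs] T[OF pq(3,4)] T[OF pq(4,3)]
    by (auto simp: adjacent_iff glue_str_commute)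
qed

text \<open>A bin whose tiles bond too weakly in pairs merely stores them; the interior tiles, the
  tower tiles and the target enter the system in this way.\<close>

lemma terminal_singles:
  assumes T: "\<And>s t. s \<in> T \<Longrightarrow> t \<in> T \<Longrightarrow> glue_str gs (tE s) (tW t) < tau \<and> glue_str gs (tN s) (tS t) < tau"
  shows "terminal tau gs (single_tiles T) = singles T"
proof -
  have "C \<in> singles T" if "C \<in> produced tau gs (single_tiles T)" for C
    using that
  proof (induction rule: produced_induct_union)
    case (init A)
    then show ?case using single_tiles_subset by blast
  next
    case (shift A v)
    then show ?case by (simp add: singles_shift)
  next
    case (union A B)
    then show ?case using two_singles_unstable[OF T] by blast
  qed
  moreover have "C \<in> produced tau gs (single_tiles T)" if "C \<in> singles T" for C
    using that single_tiles_produced[OF order_refl] by (auto simp: singles_def)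
  ultimately have "produced tau gs (single_tiles T) = singles T" by blast
  then show ?thesis using two_singles_unstable[OF T] by (auto simp: terminal_iff)
qed

text \<open>Growth can then proceed only through north and east glues. The set \<open>G\<close>
  exempts south glues: it is empty for rectangles and holds the two marker glues for the towers of
  stage 3, whose lowest tile may hang free.\<close>

definition grounded :: "glue set \<Rightarrow> config \<Rightarrow> bool" where
  "grounded G C \<longleftrightarrow> (\<forall>p t. C p = Some t \<longrightarrow>
     (tS t \<notin> insert 0 G \<longrightarrow> nb_S p \<in> dom C) \<and> (tW t \<noteq> 0 \<longrightarrow> nb_W p \<in> dom C))"

lemma groundedD:
  assumes "grounded G C" "C p = Some t"
  shows "tS t \<notin> insert 0 G \<Longrightarrow> nb_S p \<in> dom C" "tW t \<noteq> 0 \<Longrightarrow> nb_W p \<in> dom C"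
  using assms by (auto simp: grounded_def)

lemma grounded_mono: "grounded G C \<Longrightarrow> G \<subseteq> H \<Longrightarrow> grounded H C"
  unfolding grounded_def by blast

lemma grounded_shift:
  assumes "grounded G C" shows "grounded G (shift v C)"
  unfolding grounded_def
proof (intro allI impI)
  fix p t assume p: "shift v C p = Some t"
  then obtain q where q: "p = shiftp v q" "C q = Some t"
    by (metis domI dom_shift imageE shift_app)
  then show "(tS t \<notin> insert 0 G \<longrightarrow> nb_S p \<in> dom (shift v C)) \<and> (tW t \<noteq> 0 \<longrightarrow> nb_W p \<in> dom (shift v C))"
    using groundedD[OF assms q(2)] by (simp add: dom_shift)
qed

lemma grounded_union:
  assumes "grounded G A" "grounded G B"
  shows "grounded G (A ++ B)"
  unfolding grounded_def
proof (intro allI impI)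
  fix p t assume "(A ++ B) p = Some t"
  then consider "A p = Some t" | "B p = Some t" by (auto simp: map_add_Some_iff)
  then show "(tS t \<notin> insert 0 G \<longrightarrow> nb_S p \<in> dom (A ++ B)) \<and> (tW t \<noteq> 0 \<longrightarrow> nb_W p \<in> dom (A ++ B))"
    using groundedD[OF assms(1)] groundedD[OF assms(2)] by cases (simp_all add: dom_map_add)
qed

text \<open>A bond needs an exposed south or west glue, which grounded assemblies do not have.\<close>
lemma grounded_no_bond:
  assumes gs0: "gs 0 = 0" and A: "grounded {} A" and B: "grounded G B" and d: "dom A \<inter> dom B = {}"
    and N: "\<And>p t. A p = Some t \<Longrightarrow> tN t \<notin> G" and ne: "dom A \<noteq> {}" "dom B \<noteq> {}" and tau: "tau > 0"
  shows "\<not> stable tau gs (A ++ B)"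
proof
  assume st: "stable tau gs (A ++ B)"
  obtain p q s t where pq: "A p = Some s" "B q = Some t" "adjacent p q" "bond gs (A ++ B) p q > 0"
    by (rule union_bond[OF st d ne tau])
  note bu = bond_union[OF d pq(1,2), of gs]
  have gp: "glue_str gs g h > 0 \<Longrightarrow> g = h \<and> g \<noteq> 0" for g h
    using gs0 by (cases "g = h"; cases "g = 0") (auto simp: glue_str_def)
  have nd: "q \<notin> dom A" "p \<notin> dom B" using d pq by auto
  from pq(3) consider "q = nb_E p" | "q = nb_W p" | "q = nb_N p" | "q = nb_S p"
    by (auto simp: adjacent_iff)
  then show False
  proof cases
    case 1
    then have "tW t \<noteq> 0" using pq(4) bu(1) gp[of "tE s" "tW t"] by auto
    then show False using groundedD(2)[OF B pq(2)] nd 1 by simp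
  next
    case 2
    then have "tW s \<noteq> 0" using pq(4) bu(2) gp[of "tW s" "tE t"] by auto
    then show False using groundedD(2)[OF A pq(1)] nd 2 by simp
  next
    case 3
    then have "tS t \<noteq> 0" "tN s = tS t" using pq(4) bu(3) gp[of "tN s" "tS t"] by auto
    then show False using groundedD(1)[OF B pq(2)] nd 3 N[OF pq(1)] by simp
  next
    case 4
    then have "tS s \<noteq> 0" using pq(4) bu(4) gp[of "tS s" "tN t"] by auto
    then show False using groundedD(1)[OF A pq(1)] nd 4 by simp
  qed
qed

lemma grounded_no_bond_grounded:
  assumes "gs 0 = 0" "grounded {} A" "grounded {} B" "dom A \<inter> dom B = {}"
    "dom A \<noteq> {}" "dom B \<noteq> {}" "tau > 0"
  shows "\<not> stable tau gs (A ++ B)"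
  by (rule grounded_no_bond[where G = "{}"]) (use assms in simp_all)

text \<open>\<open>Sy\<close> and \<open>St\<close> are the symbols (vertical glues) and states (horizontal glues) of the interior tiles \<open>TI\<close>;
  the states in \<open>Stop\<close> occur only in the topmost row.  The glue \<open>gb\<close> marks rejecting rectangles.\<close>
locale rect_tiles = line_tiles +
  fixes TI :: "tile set" and Sy St Stop :: "glue set" and gb gb' :: glue
  assumes gs1: "\<And>g. g \<in> Sy \<union> St \<Longrightarrow> gs g = 1"
    and gbs: "gs gb = 2" "gs gb' = 2" "gb \<noteq> gb'" "gb \<notin> HC" "gb' \<notin> HC"
    and row_N: "\<And>t. t \<in> LT \<Longrightarrow> tW t \<in> HR \<Longrightarrow> tN t \<in> Sy"
    and col_EN: "\<And>t. t \<in> LT \<Longrightarrow> tS t \<in> HC \<Longrightarrow> tE t \<in> St \<and> (tN t \<in> HC \<or> tN t = 0 \<or> tN t = gb)"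
    and col_gb: "\<And>m n \<tau> k. complete m n \<tau> \<Longrightarrow> 1 \<le> k \<Longrightarrow> k < n \<Longrightarrow> tE (\<tau> (- k)) \<notin> Stop"
    and TI: "\<And>t. t \<in> TI \<Longrightarrow> tS t \<in> Sy \<and> tW t \<in> St \<and> tE t \<in> St \<and> (tN t \<in> Sy \<or> tN t = gb \<and> tW t \<in> Stop) \<and>
               (tE t \<in> Stop \<longleftrightarrow> tW t \<in> Stop)"
    and total: "\<And>a q. a \<in> Sy \<Longrightarrow> q \<in> St \<Longrightarrow> \<exists>t \<in> TI. tS t = a \<and> tW t = q"
    and junk: "\<And>a q. a \<in> Sy \<Longrightarrow> q \<in> St \<Longrightarrow> \<exists>\<tau>. complete 1 1 \<tau> \<and> tN (\<tau> 1) = a \<and> tE (\<tau> (-1)) = q"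
begin

section \<open>Stage 2: filling the rectangle spanned by a line\<close>

lemma glue_sets:
  "g \<in> Sy \<Longrightarrow> g \<noteq> 0 \<and> g \<notin> HR \<and> g \<notin> HC \<and> g \<noteq> gb \<and> g \<noteq> gb'"
  "g \<in> St \<Longrightarrow> g \<noteq> 0 \<and> g \<notin> HR \<and> g \<notin> HC \<and> g \<noteq> gb \<and> g \<noteq> gb'"
  "gb \<noteq> 0" "gb' \<noteq> 0"
  using gs1[of g] gs0 gs2[of g] gbs by (auto intro!: gr0I)

lemma valid_corner: "valid_line a b \<tau> \<Longrightarrow> a \<le> 0 \<Longrightarrow> 0 \<le> b \<Longrightarrow> tN (\<tau> 0) \<in> HC \<and> tE (\<tau> 0) \<in> HR"
  by (simp add: valid_line_def)

text \<open>Interior glues have strength 1, so at temperature 2 a tile needs its south and its west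
  neighbour at once. The set collects all partial fillings, in whatever order the tiles
  arrive.\<close>

inductive_set fill :: "int \<Rightarrow> int \<Rightarrow> (int \<Rightarrow> tile) \<Rightarrow> config set" for m n \<tau> where
  base: "line (- n) m \<tau> \<in> fill m n \<tau>"
| step: "C \<in> fill m n \<tau> \<Longrightarrow> C p = None \<Longrightarrow> t \<in> TI \<Longrightarrow> C (nb_S p) = Some s \<Longrightarrow> tN s = tS t \<Longrightarrow>
    C (nb_W p) = Some r \<Longrightarrow> tE r = tW t \<Longrightarrow> C(p \<mapsto> t) \<in> fill m n \<tau>"

text \<open>Symbols are offered northwards by the row only, and states eastwards by the column only.
  This confines the interior tiles to the quadrant inside the bend.\<close>

lemma complete_line_tile:
  assumes c: "complete m n \<tau>" and k: "- n \<le> k" "k \<le> m"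
  shows "tN (\<tau> k) \<in> Sy \<longleftrightarrow> k > 0" "tE (\<tau> k) \<in> St \<longleftrightarrow> k < 0" "\<tau> k \<in> LT"
proof -
  have V: "valid_line (- n) m \<tau>" using c by (simp add: complete_def)
  show L: "\<tau> k \<in> LT" using valid_tile[OF V k] .
  note vr = valid_row[OF V k]
  show "tN (\<tau> k) \<in> Sy \<longleftrightarrow> k > 0"
  proof
    assume N: "tN (\<tau> k) \<in> Sy"
    show "k > 0"
    proof (rule ccontr)
      assume "\<not> k > 0"
      then consider "k = 0" | "k < 0" by linarith
      then show False
      proof cases
        case 1 then show ?thesis using valid_corner[OF V] k N glue_sets(1)[of "tN (\<tau> k)"] by simp
      next
        case 2
        then have "tS (\<tau> k) \<in> HC" using vr by blast
        then show ?thesis using col_EN[OF L] N glue_sets(1)[of "tN (\<tau> k)"] by auto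
      qed
    qed
  qed (use vr row_N[OF L] in auto)
  show "tE (\<tau> k) \<in> St \<longleftrightarrow> k < 0"
  proof
    assume E: "tE (\<tau> k) \<in> St"
    show "k < 0"
    proof (rule ccontr)
      assume "\<not> k < 0"
      then have "tS (\<tau> k) \<notin> HC" using vr by blast
      then show False using kinds[OF L] E glue_sets(2)[of "tE (\<tau> k)"] by auto
    qed
  qed (use vr col_EN[OF L] in auto)
qed

definition rect :: "int \<Rightarrow> int \<Rightarrow> pos set" where "rect m n = {1..m} \<times> {1..n}"

lemma rect_not_line: "p \<in> rect m n \<Longrightarrow> line (- n) m \<tau> p = None"
  by (auto simp: rect_def line_def)

text \<open>The south neighbour of a new tile keeps it within the columns \<open>1..m\<close>, the
  west neighbour within the rows \<open>1..n\<close>. States of \<open>Stop\<close> travel along a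
  row from the column, and by \<open>col_gb\<close> only the topmost column tile can emit
  one.\<close>

lemma fill_cases:
  assumes c: "complete m n \<tau>" and C: "C \<in> fill m n \<tau>" and p: "C p = Some t"
  shows "line (- n) m \<tau> p = Some t \<or> p \<in> rect m n \<and> t \<in> TI \<and> (tE t \<in> Stop \<longrightarrow> snd p = n)"
  using C p
proof (induction arbitrary: p t)
  case base
  then show ?case by simp
next
  case (step C p t s r p' t')
  show ?case
  proof (cases "p' = p")
    case False
    then show ?thesis using step.IH[of p' t'] step.prems by simp
  next
    case True
    then have t': "t' = t" using step.prems by simp
    have ts: "tN s \<in> Sy" "tE r \<in> St" using TI[OF \<open>t \<in> TI\<close>] step.hyps by auto
    have S: "fst p \<in> {1..m} \<and> snd p \<ge> 1"
    proof -
      consider "line (- n) m \<tau> (nb_S p) = Some s" | "nb_S p \<in> rect m n" using step.IH[OF step.hyps(4)] by blast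
      then show ?thesis
      proof cases
        case 1
        then obtain k where k: "nb_S p = lpos k" "- n \<le> k" "k \<le> m" "s = \<tau> k" by (rule line_SomeE)
        then have "k > 0" using complete_line_tile(1)[OF c k(2,3)] ts by simp
        then show ?thesis using k by (auto simp: nb_defs lpos_def)
      next
        case 2 then show ?thesis by (auto simp: rect_def nb_defs)
      qed
    qed
    have W: "snd p \<in> {1..n} \<and> (tE t \<in> Stop \<longrightarrow> snd p = n)"
    proof -
      have top: "tE t \<in> Stop \<Longrightarrow> tE r \<in> Stop" using TI[OF \<open>t \<in> TI\<close>] step.hyps by auto
      consider "line (- n) m \<tau> (nb_W p) = Some r" | "nb_W p \<in> rect m n \<and> (tE r \<in> Stop \<longrightarrow> snd (nb_W p) = n)"
        using step.IH[OF step.hyps(6)] by blast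
      then show ?thesis
      proof cases
        case 1
        then obtain k where k: "nb_W p = lpos k" "- n \<le> k" "k \<le> m" "r = \<tau> k" by (rule line_SomeE)
        then have k0: "k < 0" using complete_line_tile(2)[OF c k(2,3)] ts by simp
        have "snd p = - k" using k0 k(1) by (simp add: nb_defs lpos_def)
        moreover have "tE r \<in> Stop \<Longrightarrow> - k = n" using col_gb[OF c, of "- k"] k k0 by (cases "- k < n") auto
        ultimately show ?thesis using k k0 top by auto
      next
        case 2 then show ?thesis using top by (auto simp: rect_def nb_defs)
      qed
    qed
    have "p \<in> rect m n" using S W by (cases p) (simp add: rect_def)
    then show ?thesis using True t' \<open>t \<in> TI\<close> W by simp
  qed
qed

lemma fill_line:
  assumes c: "complete m n \<tau>" and C: "C \<in> fill m n \<tau>" and p: "line (- n) m \<tau> p = Some t"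
  shows "C p = Some t"
  using C p by induction auto

lemma fill_grounded:
  assumes c: "complete m n \<tau>" and C: "C \<in> fill m n \<tau>"
  shows "grounded {} C"
  using C
proof induction
  case base
  have V: "valid_line (- n) m \<tau>" "0 < m" "0 < n" using c by (auto simp: complete_def)
  show ?case unfolding grounded_def
  proof (intro allI impI)
    fix p t assume "line (- n) m \<tau> p = Some t"
    then obtain k where k: "p = lpos k" "- n \<le> k" "k \<le> m" "t = \<tau> k" by (rule line_SomeE)
    note vr = valid_row[OF V(1) k(2,3)] and ws = tile_WS[OF valid_tile[OF V(1) k(2,3)]]
    have "nb_S p \<in> dom (line (- n) m \<tau>)" if "tS t \<noteq> 0"
    proof -
      have "k < 0" using vr ws that k by auto
      then show ?thesis using k V by (simp add: lpos_nb line_lpos domIff)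
    qed
    moreover have "nb_W p \<in> dom (line (- n) m \<tau>)" if "tW t \<noteq> 0"
    proof -
      have "k > 0" using vr ws that k by auto
      then show ?thesis using k V by (simp add: lpos_nb line_lpos domIff)
    qed
    ultimately show "(tS t \<notin> insert 0 {} \<longrightarrow> nb_S p \<in> dom (line (- n) m \<tau>)) \<and> (tW t \<noteq> 0 \<longrightarrow> nb_W p \<in> dom (line (- n) m \<tau>))"
      by blast
  qed
next
  case (step C p t s r)
  show ?case unfolding grounded_def
  proof (intro allI impI)
    fix p' t' assume a: "(C(p \<mapsto> t)) p' = Some t'"
    show "(tS t' \<notin> insert 0 {} \<longrightarrow> nb_S p' \<in> dom (C(p \<mapsto> t))) \<and> (tW t' \<noteq> 0 \<longrightarrow> nb_W p' \<in> dom (C(p \<mapsto> t)))"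
    proof (cases "p' = p")
      case True
      then show ?thesis using step.hyps by (simp add: domIff)
    next
      case False
      then show ?thesis using groundedD[OF step.IH, of p' t'] a by simp
    qed
  qed
qed

abbreviation S2 :: "config set" where "S2 \<equiv> terminal 2 gs (single_tiles LT) \<union> singles TI"

abbreviation fills :: "config set" where
  "fills \<equiv> {shift v C | v m n \<tau> C. complete m n \<tau> \<and> C \<in> fill m n \<tau>}"

lemma fills_grounded: "C \<in> fills \<Longrightarrow> grounded {} C"
  using fill_grounded grounded_shift by blast

lemma fills_shift: "C \<in> fills \<Longrightarrow> shift v C \<in> fills"
  by (auto simp: shift_shift) blast

lemma S2_stable:
  assumes "C \<in> produced 2 gs S2"
  shows "stable 2 gs C \<and> finite (dom C) \<and> dom C \<noteq> {}"
proof (rule produced_stable_finite[OF _ assms])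
  fix A assume "A \<in> S2"
  then show "stable 2 gs A \<and> finite (dom A) \<and> dom A \<noteq> {}"
    using line_stable_finite subsetD[OF terminal_subset_produced, of A 2 gs "single_tiles LT"]
    by (auto simp: singles_def stable_single)
qed

text \<open>In a grounded \<open>B\<close>, a tile above or to the right of the free position
  \<open>p\<close> has a null glue towards \<open>p\<close>. So only the south and west bonds can
  count, each with weight at most 1.\<close>

lemma cut_single_fill:
  assumes g: "grounded {} B" and p: "B p = None" and t: "t \<in> TI"
  shows "cut_weight gs (B(p \<mapsto> t)) {p} \<ge> 2 \<longleftrightarrow>
    (\<exists>s r. B (nb_S p) = Some s \<and> tN s = tS t \<and> B (nb_W p) = Some r \<and> tE r = tW t)"
proof -
  let ?C = "B(p \<mapsto> t)"
  have tt: "gs (tS t) = 1" "gs (tW t) = 1" "gs (tE t) = 1" "tE t \<noteq> 0" "tN t \<noteq> 0"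
    using TI[OF t] gs1 glue_sets by auto
  have Cp: "?C p = Some t" by simp
  have E: "bond gs ?C p (nb_E p) = 0"
  proof (cases "B (nb_E p)")
    case (Some s)
    have "tW s = 0"
    proof (rule ccontr)
      assume "tW s \<noteq> 0"
      then have "nb_W (nb_E p) \<in> dom B" using groundedD(2)[OF g Some] by blast
      then show False using p by auto
    qed
    then show ?thesis using bond_nb(1)[of ?C p t "nb_E p" s gs] Some tt by (simp add: glue_str_def)
  qed simp
  have N: "bond gs ?C p (nb_N p) = 0"
  proof (cases "B (nb_N p)")
    case (Some s)
    have "tS s = 0"
    proof (rule ccontr)
      assume "tS s \<noteq> 0"
      then have "nb_S (nb_N p) \<in> dom B" using groundedD(1)[OF g Some] by simp
      then show False using p by auto
    qed
    then show ?thesis using bond_nb(3)[of ?C p t "nb_N p" s gs] Some tt by (simp add: glue_str_def)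
  qed simp
  have S: "bond gs ?C p (nb_S p) = (if \<exists>s. B (nb_S p) = Some s \<and> tN s = tS t then 1 else 0)"
  proof (cases "B (nb_S p)")
    case (Some s)
    then show ?thesis using bond_nb(4)[of ?C p t "nb_S p" s gs] tt by (auto simp: glue_str_def)
  qed simp
  have W: "bond gs ?C p (nb_W p) = (if \<exists>s. B (nb_W p) = Some s \<and> tE s = tW t then 1 else 0)"
  proof (cases "B (nb_W p)")
    case (Some s)
    then show ?thesis using bond_nb(2)[of ?C p t "nb_W p" s gs] tt by (auto simp: glue_str_def)
  qed simp
  show ?thesis unfolding cut_weight_single[of ?C p t gs, OF Cp] E N S W by auto
qed

lemma attach_fill:
  assumes C: "C \<in> fill m n \<tau>" and c: "complete m n \<tau>" and p: "shift v C p = None" and t: "t \<in> TI"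
    and w: "cut_weight gs ((shift v C)(p \<mapsto> t)) {p} \<ge> 2"
  obtains q where "p = shiftp v q" "C(q \<mapsto> t) \<in> fill m n \<tau>" "C q = None" "(shift v C)(p \<mapsto> t) = shift v (C(q \<mapsto> t))"
proof -
  have g: "grounded {} (shift v C)" by (rule grounded_shift, rule fill_grounded[OF c C])
  obtain s r where sr: "shift v C (nb_S p) = Some s" "tN s = tS t" "shift v C (nb_W p) = Some r" "tE r = tW t"
    using cut_single_fill[OF g p t] w by blast
  define q where "q = shiftp (neg v) p"
  have pq: "p = shiftp v q" by (simp add: q_def shiftp_def neg_def)
  have "C (nb_S q) = Some s" "C (nb_W q) = Some r" "C q = None"
    using sr p by (simp_all add: pq shift_app)
  then have "C(q \<mapsto> t) \<in> fill m n \<tau>" using C t sr by (intro fill.step) auto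
  then show ?thesis using that pq \<open>C q = None\<close> by (simp add: shift_upd)
qed

lemma fill_produced:
  assumes c: "complete m n \<tau>" and C: "C \<in> fill m n \<tau>"
  shows "C \<in> produced 2 gs S2"
  using C
proof induction
  case base
  then show ?case using complete_terminal[OF c] by (intro produced.init) simp
next
  case (step C p t s r)
  have "cut_weight gs (C(p \<mapsto> t)) {p} \<ge> 2"
    using cut_single_fill[OF fill_grounded[OF c step.hyps(1)], of p t] step.hyps by blast
  moreover have "[p \<mapsto> t] \<in> produced 2 gs S2" using step.hyps by (intro produced.init) (auto simp: singles_def)
  ultimately show ?case using attach_produced(1)[OF step.IH] S2_stable[OF step.IH] step.hyps by blast
qed

lemma single_union_fill:
  assumes A: "A = [p \<mapsto> t]" "t \<in> TI" and C: "complete m n \<tau>" "C \<in> fill m n \<tau>" "B = shift v C"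
    and d: "dom A \<inter> dom B = {}" and st: "stable 2 gs (A ++ B)"
  obtains q where "C(q \<mapsto> t) \<in> fill m n \<tau>" "C q = None" "A ++ B = shift v (C(q \<mapsto> t))"
proof -
  have Bp: "shift v C p = None" using d A C by auto
  have eq: "A ++ B = (shift v C)(p \<mapsto> t)" using map_add_comm[OF d] by (simp add: A C)
  have "C (lpos 0) = Some (\<tau> 0)"
    by (rule fill_line[OF C(1,2)]) (use C(1) in \<open>simp add: complete_def line_lpos\<close>)
  then have neB: "dom B \<noteq> {}" unfolding C(3) dom_shift by blast
  have "cut_weight gs (A ++ B) (dom A) \<ge> 2"
    by (rule union_cut[OF st d _ neB]) (simp add: A)
  then have "cut_weight gs ((shift v C)(p \<mapsto> t)) {p} \<ge> 2" unfolding eq by (simp add: A)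
  from attach_fill[OF C(2,1) Bp A(2) this] eq that show ?thesis by metis
qed

text \<open>Two fillings are grounded and do not bond, and the only bond between two single tiles is
  below the temperature. So every combination attaches exactly one interior tile to a
  filling.\<close>

lemma produced_fills:
  assumes "C \<in> produced 2 gs S2"
  shows "C \<in> singles TI \<or> C \<in> fills"
  using assms
proof (induction rule: produced_induct_union)
  case (init A)
  then show ?case
  proof
    assume "A \<in> terminal 2 gs (single_tiles LT)"
    then obtain v m n \<tau> where "A = shift v (line (- n) m \<tau>)" "complete m n \<tau>" by (rule terminal_complete)
    then show ?thesis using fill.base by blast
  qed simp
next
  case (shift A v)
  then show ?case using singles_shift fills_shift by blast
next
  case (union A B)
  have ne: "dom A \<noteq> {}" "dom B \<noteq> {}" using S2_stable union.hyps by auto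
  have d': "dom B \<inter> dom A = {}" using union.hyps(3) by blast
  have comm: "B ++ A = A ++ B" using map_add_comm[OF d'] .
  consider "A \<in> singles TI" "B \<in> singles TI" | "A \<in> singles TI" "B \<in> fills" | "A \<in> fills" "B \<in> singles TI" |
    "A \<in> fills" "B \<in> fills" using union.IH by blast
  then show ?case
  proof cases
    case 1
    have "glue_str gs (tE s) (tW t) < 2 \<and> glue_str gs (tN s) (tS t) < 2" if "s \<in> TI" "t \<in> TI" for s t
      using TI[OF that(1)] TI[OF that(2)] gs1 by (auto simp: glue_str_def)
    from two_singles_unstable[OF this 1 union.hyps(3)] show ?thesis using union.hyps(4) by simp
  next
    case 2
    then obtain p t where A: "A = [p \<mapsto> t]" "t \<in> TI" by (auto simp: singles_def)
    from 2 obtain v m n \<tau> C where C: "complete m n \<tau>" "C \<in> fill m n \<tau>" "B = shift v C" by blast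
    show ?thesis by (rule single_union_fill[OF A C union.hyps(3,4)]) (use C in blast)
  next
    case 3
    then obtain p t where A: "B = [p \<mapsto> t]" "t \<in> TI" by (auto simp: singles_def)
    from 3 obtain v m n \<tau> C where C: "complete m n \<tau>" "C \<in> fill m n \<tau>" "A = shift v C" by blast
    show ?thesis unfolding comm[symmetric]
      by (rule single_union_fill[OF A C d' union.hyps(4)[folded comm]]) (use C in blast)
  next
    case 4
    then show ?thesis
      using grounded_no_bond_grounded[of gs, OF gs0 fills_grounded fills_grounded union.hyps(3) ne, of 2] union.hyps(4)
      by simp
  qed
qed

definition full :: "int \<Rightarrow> int \<Rightarrow> config \<Rightarrow> bool" where
  "full m n C \<longleftrightarrow> rect m n \<subseteq> dom C"

definition rects :: "config set" where
  "rects = {shift v C | v m n \<tau> C. complete m n \<tau> \<and> C \<in> fill m n \<tau> \<and> full m n C}"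

text \<open>Among the empty positions of the rectangle, one with the least sum of coordinates has
  its south and west neighbours occupied.\<close>

lemma fillable_position:
  assumes c: "complete m n \<tau>" and C: "C \<in> fill m n \<tau>" and nf: "\<not> full m n C"
  obtains p s r where "p \<in> rect m n" "C p = None" "C (nb_S p) = Some s" "tN s \<in> Sy" "C (nb_W p) = Some r" "tE r \<in> St"
proof -
  have mn: "0 < m" "0 < n" using c by (auto simp: complete_def)
  let ?M = "{p \<in> rect m n. C p = None}"
  have "\<exists>p. p \<in> ?M" using nf by (auto simp: full_def)
  then obtain p where p: "p \<in> ?M" and min: "\<And>q. q \<in> ?M \<Longrightarrow> nat (fst p + snd p) \<le> nat (fst q + snd q)"
    using ex_has_least_nat[of "\<lambda>p. p \<in> ?M" _ "\<lambda>p. nat (fst p + snd p)"] by blast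
  have r: "1 \<le> fst p" "fst p \<le> m" "1 \<le> snd p" "snd p \<le> n" using p by (auto simp: rect_def)
  have S: "\<exists>s. C (nb_S p) = Some s \<and> tN s \<in> Sy"
  proof (cases "snd p = 1")
    case True
    then have e: "nb_S p = lpos (fst p)" using r by (simp add: nb_defs lpos_def)
    have "C (nb_S p) = Some (\<tau> (fst p))"
      by (rule fill_line[OF c C]) (use e r mn in \<open>simp add: line_lpos\<close>)
    then show ?thesis using complete_line_tile(1)[OF c, of "fst p"] r mn by auto
  next
    case False
    then have q: "nb_S p \<in> rect m n" using r by (simp add: nb_defs rect_def)
    have "C (nb_S p) \<noteq> None"
    proof
      assume "C (nb_S p) = None"
      then have "nat (fst p + snd p) \<le> nat (fst (nb_S p) + snd (nb_S p))" using min[of "nb_S p"] q by simp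
      then show False using r by (simp add: nb_defs)
    qed
    then obtain s where s: "C (nb_S p) = Some s" by blast
    from fill_cases[OF c C s] rect_not_line[OF q] have "s \<in> TI" "tE s \<in> Stop \<longrightarrow> snd (nb_S p) = n" by auto
    \<comment> \<open>The neighbour lies below the top row, so it cannot show the marker
      \<open>gb\<close> in place of a symbol.\<close>
    then have "tN s \<in> Sy" using TI[of s] r by (auto simp: nb_defs)
    then show ?thesis using s by blast
  qed
  have W: "\<exists>r. C (nb_W p) = Some r \<and> tE r \<in> St"
  proof (cases "fst p = 1")
    case True
    then have e: "nb_W p = lpos (- snd p)" using r by (simp add: nb_defs lpos_def)
    have "C (nb_W p) = Some (\<tau> (- snd p))"
      by (rule fill_line[OF c C]) (use e r mn in \<open>simp add: line_lpos\<close>)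
    then show ?thesis using complete_line_tile(2)[OF c, of "- snd p"] r mn by auto
  next
    case False
    then have q: "nb_W p \<in> rect m n" using r by (simp add: nb_defs rect_def)
    have "C (nb_W p) \<noteq> None"
    proof
      assume "C (nb_W p) = None"
      then have "nat (fst p + snd p) \<le> nat (fst (nb_W p) + snd (nb_W p))" using min[of "nb_W p"] q by simp
      then show False using r by (simp add: nb_defs)
    qed
    then obtain s where s: "C (nb_W p) = Some s" by blast
    from fill_cases[OF c C s] rect_not_line[OF q] have "s \<in> TI" by auto
    then show ?thesis using TI[of s] s by auto
  qed
  from S W obtain s r where "C (nb_S p) = Some s" "tN s \<in> Sy" "C (nb_W p) = Some r" "tE r \<in> St" by blast
  then show ?thesis using p by (intro that[of p s r]) simp_all
qed

lemma terminal_S2: "terminal 2 gs S2 = rects"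
proof (intro set_eqI iffI)
  fix C assume T: "C \<in> terminal 2 gs S2"
  then have P: "C \<in> produced 2 gs S2" using terminal_subset_produced by blast
  have "C \<notin> singles TI"
  proof
    assume "C \<in> singles TI"
    then obtain p t where pt: "C = [p \<mapsto> t]" "t \<in> TI" by (auto simp: singles_def)
    \<comment> \<open>A junk line with arms of length 1 offers exactly the symbol and the state that
      the tile asks for, so the tile has a site.\<close>
    then obtain \<tau> where \<tau>: "complete 1 1 \<tau>" "tN (\<tau> 1) = tS t" "tE (\<tau> (-1)) = tW t"
      using junk[of "tS t" "tW t"] TI[OF pt(2)] by blast
    let ?L = "line (- 1) 1 \<tau>"
    have L: "?L (1, 1) = None" "?L (nb_S (1, 1)) = Some (\<tau> 1)" "?L (nb_W (1, 1)) = Some (\<tau> (-1))"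
      by (simp_all add: line_def nb_defs)
    have w: "cut_weight gs (?L((1, 1) \<mapsto> t)) {(1, 1)} \<ge> 2"
      using cut_single_fill[OF fill_grounded[OF \<tau>(1) fill.base] L(1) pt(2)] L \<tau> by blast
    have PL: "?L \<in> produced 2 gs S2" using complete_terminal[OF \<tau>(1)] by (intro produced.init) simp
    have "[(1, 1) \<mapsto> t] \<in> produced 2 gs S2" using pt by (intro produced.init) (auto simp: singles_def)
    from attach_produced(3)[OF PL this _ _ L(1) w] S2_stable[OF PL]
    have "[(1, 1) \<mapsto> t] \<notin> terminal 2 gs S2" by blast
    moreover have "shift (1 - fst p, 1 - snd p) C = [(1, 1) \<mapsto> t]"
      unfolding pt shift_single by (simp add: shiftp_def)
    ultimately show False using terminal_shift[OF T, of "(1 - fst p, 1 - snd p)"] by (simp only:)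
  qed
  then obtain v m n \<tau> D where D: "C = shift v D" "complete m n \<tau>" "D \<in> fill m n \<tau>"
    using produced_fills[OF P] by blast
  have TD: "D \<in> terminal 2 gs S2" using terminal_shift[OF T, of "neg v"] D by simp
  have "full m n D"
  proof (rule ccontr)
    assume "\<not> full m n D"
    from fillable_position[OF D(2,3) this] obtain p s r where
      p: "D p = None" "D (nb_S p) = Some s" "tN s \<in> Sy" "D (nb_W p) = Some r" "tE r \<in> St" by blast
    obtain t where t: "t \<in> TI" "tS t = tN s" "tW t = tE r" using total[OF p(3,5)] by blast
    have "cut_weight gs (D(p \<mapsto> t)) {p} \<ge> 2"
      using cut_single_fill[OF fill_grounded[OF D(2,3)] p(1) t(1)] p t by auto
    moreover have PD: "D \<in> produced 2 gs S2" using fill_produced[OF D(2,3)] .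
    moreover have "[p \<mapsto> t] \<in> produced 2 gs S2" using t by (intro produced.init) (auto simp: singles_def)
    ultimately show False using attach_produced(2)[of D 2 gs S2 p t] S2_stable[OF PD] p(1) TD by blast
  qed
  then show "C \<in> rects" using D unfolding rects_def by blast
next
  fix C assume "C \<in> rects"
  then obtain v m n \<tau> D where D: "C = shift v D" "complete m n \<tau>" "D \<in> fill m n \<tau>" "full m n D"
    by (auto simp: rects_def)
  have PD: "D \<in> produced 2 gs S2" using fill_produced[OF D(2,3)] .
  have "D \<in> terminal 2 gs S2"
    unfolding terminal_iff
  proof (intro conjI ballI impI notI PD)
    fix B assume B: "B \<in> produced 2 gs S2" "dom D \<inter> dom B = {}" "stable 2 gs (D ++ B)"
    have ne: "dom D \<noteq> {}" "dom B \<noteq> {}" using S2_stable PD B by auto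
    from produced_fills[OF B(1)] show False
    proof
      assume "B \<in> singles TI"
      then obtain p t where pt: "B = [p \<mapsto> t]" "t \<in> TI" by (auto simp: singles_def)
      have d': "dom B \<inter> dom D = {}" using B(2) by blast
      have comm: "B ++ D = D ++ B" using map_add_comm[OF d'] .
      obtain q where q: "D(q \<mapsto> t) \<in> fill m n \<tau>" "D q = None"
        by (rule single_union_fill[OF pt D(2,3) _ d', of "(0, 0)"]) (use B(3) comm in auto)
      have "q \<in> rect m n"
      proof -
        have "line (- n) m \<tau> q = None" using fill_line[OF D(2,3), of q] q(2) by (cases "line (- n) m \<tau> q") auto
        then show ?thesis using fill_cases[OF D(2) q(1), of q t] by simp
      qed
      then show False using D(4) q(2) by (auto simp: full_def)
    next
      assume "B \<in> fills"
      then have gB: "grounded {} B" by (rule fills_grounded)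
      show False using grounded_no_bond_grounded[of gs, OF gs0 fill_grounded[OF D(2,3)] gB B(2) ne, of 2] B(3) by simp
    qed
  qed
  then show "C \<in> terminal 2 gs S2" using D terminal_shift by blast
qed

lemma fill_match:
  assumes c: "complete m n \<tau>" and C: "C \<in> fill m n \<tau>" and p: "p \<in> rect m n" "C p = Some t"
  shows "\<exists>s r. C (nb_S p) = Some s \<and> tN s = tS t \<and> C (nb_W p) = Some r \<and> tE r = tW t"
  using C p(2)
proof induction
  case base
  then show ?case using rect_not_line[OF p(1)] by simp
next
  case (step C p' t' s r)
  show ?case
  proof (cases "p' = p")
    case True
    then show ?thesis using step.hyps step.prems by auto
  next
    case False
    then obtain s' r' where "C (nb_S p) = Some s' \<and> tN s' = tS t \<and> C (nb_W p) = Some r' \<and> tE r' = tW t"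
      using step.IH step.prems by auto
    then show ?thesis using step.hyps(2) by (intro exI[of _ s'] exI[of _ r']) auto
  qed
qed

lemma finite_rect: "finite (rect m n)"
  by (simp add: rect_def)

text \<open>Several tiles may fit at a site, so a full rectangle need not agree with
  \<open>F\<close>. A partial filling that agrees with \<open>F\<close> and misses as few positions
  as possible is full: otherwise \<open>F\<close> itself prescribes a fitting tile at a fillable
  site.\<close>

lemma fill_exists:
  assumes c: "complete m n \<tau>" and F: "\<And>p. p \<in> rect m n \<Longrightarrow> F p \<in> TI"
    and S: "\<And>p. p \<in> rect m n \<Longrightarrow> tS (F p) = (if nb_S p \<in> rect m n then tN (F (nb_S p)) else tN (\<tau> (fst p)))"
    and W: "\<And>p. p \<in> rect m n \<Longrightarrow> tW (F p) = (if nb_W p \<in> rect m n then tE (F (nb_W p)) else tE (\<tau> (- snd p)))"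
  obtains C where "C \<in> fill m n \<tau>" "full m n C" "\<And>p. p \<in> rect m n \<Longrightarrow> C p = Some (F p)"
proof -
  let ?G = "{C \<in> fill m n \<tau>. \<forall>p \<in> rect m n. C p = None \<or> C p = Some (F p)}"
  have "line (- n) m \<tau> \<in> ?G" using fill.base rect_not_line by blast
  then obtain C where C: "C \<in> ?G" and min: "\<And>D. D \<in> ?G \<Longrightarrow> card (rect m n - dom C) \<le> card (rect m n - dom D)"
    using ex_has_least_nat[of "\<lambda>C. C \<in> ?G" _ "\<lambda>C. card (rect m n - dom C)"] by blast
  have full: "full m n C"
  proof (rule ccontr)
    assume nf: "\<not> full m n C"
    from C have Cf: "C \<in> fill m n \<tau>" by simp
    obtain p s r where p: "p \<in> rect m n" "C p = None" "C (nb_S p) = Some s" "C (nb_W p) = Some r"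
      by (rule fillable_position[OF c Cf nf])
    have pr: "1 \<le> fst p" "fst p \<le> m" "1 \<le> snd p" "snd p \<le> n" using p(1) by (auto simp: rect_def)
    have mn: "0 < m" "0 < n" using c by (auto simp: complete_def)
    have "tN s = tS (F p)"
    proof (cases "nb_S p \<in> rect m n")
      case True
      then show ?thesis using C p(3) S[OF p(1)] by force
    next
      case False
      then have "snd p = 1" using pr by (auto simp: rect_def nb_defs)
      then have "nb_S p = lpos (fst p)" using pr by (simp add: nb_defs lpos_def)
      then have "line (- n) m \<tau> (nb_S p) = Some (\<tau> (fst p))" using pr mn by (simp add: line_lpos)
      then show ?thesis using fill_line[OF c Cf] p(3) S[OF p(1)] False by fastforce
    qed
    moreover have "tE r = tW (F p)"
    proof (cases "nb_W p \<in> rect m n")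
      case True
      then show ?thesis using C p(4) W[OF p(1)] by force
    next
      case False
      then have "fst p = 1" using pr by (auto simp: rect_def nb_defs)
      then have "nb_W p = lpos (- snd p)" using pr by (simp add: nb_defs lpos_def)
      then have "line (- n) m \<tau> (nb_W p) = Some (\<tau> (- snd p))" using pr mn by (simp add: line_lpos)
      then show ?thesis using fill_line[OF c Cf] p(4) W[OF p(1)] False by fastforce
    qed
    ultimately have "C(p \<mapsto> F p) \<in> fill m n \<tau>" using fill.step[OF Cf p(2) F[OF p(1)] p(3) _ p(4)] by simp
    then have "C(p \<mapsto> F p) \<in> ?G" using C by auto
    from min[OF this] have "card (rect m n - dom C) \<le> card (rect m n - dom (C(p \<mapsto> F p)))" .
    moreover have "rect m n - dom (C(p \<mapsto> F p)) = (rect m n - dom C) - {p}" by auto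
    moreover have "card ((rect m n - dom C) - {p}) < card (rect m n - dom C)"
      using p(1,2) by (intro card_Diff1_less) (auto simp: finite_rect)
    ultimately show False by simp
  qed
  show ?thesis
  proof (rule that[OF _ full])
    show "C p = Some (F p)" if "p \<in> rect m n" for p
      using C full that by (auto simp: full_def)
  qed (use C in simp)
qed

section \<open>Stage 3: rejecting rectangles grow forever\<close>

definition accepting :: "config set" where
  "accepting = {C \<in> rects. \<forall>p t. C p = Some t \<longrightarrow> tN t \<noteq> gb}"

text \<open>The marker must be exposed in the highest row, so that the position above it is free and
  \<open>X\<close> or \<open>Y\<close> attaches there. Each of the two tiles exposes to the north
  the marker that the other one binds to, so the growth never ends.\<close>

definition growing :: "config \<Rightarrow> bool" where
  "growing C \<longleftrightarrow> (\<exists>p t. C p = Some t \<and> tN t \<in> {gb, gb'} \<and> (\<forall>q \<in> dom C. snd q \<le> snd p))"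

abbreviation X :: tile where "X \<equiv> (gb', 0, gb, 0)"
abbreviation Y :: tile where "Y \<equiv> (gb, 0, gb', 0)"

abbreviation S3 :: "config set" where "S3 \<equiv> rects \<union> singles {X, Y}"

lemma growing_shift:
  assumes "growing C" shows "growing (shift v C)"
proof -
  obtain p t where p: "C p = Some t" "tN t \<in> {gb, gb'}" "\<forall>q \<in> dom C. snd q \<le> snd p"
    using assms by (auto simp: growing_def)
  have "shift v C (shiftp v p) = Some t" using p by (simp add: shift_app)
  moreover have "\<forall>q \<in> dom (shift v C). snd q \<le> snd (shiftp v p)"
    using p(3) unfolding dom_shift by (auto simp: shiftp_def)
  ultimately show ?thesis using p(2) unfolding growing_def by blast
qed

text \<open>Of the two exposed markers, one of maximal height is still in the highest row of the
  union.\<close>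

lemma growing_union:
  assumes "growing A" "growing B" "dom A \<inter> dom B = {}"
  shows "growing (A ++ B)"
proof -
  obtain p s q t where p: "A p = Some s" "tN s \<in> {gb, gb'}" "\<forall>q \<in> dom A. snd q \<le> snd p"
    and q: "B q = Some t" "tN t \<in> {gb, gb'}" "\<forall>p \<in> dom B. snd p \<le> snd q"
    using assms by (auto simp: growing_def)
  have "B p = None" using p assms(3) by (metis IntI domI domIff empty_iff)
  then have 1: "(A ++ B) p = Some s" "(A ++ B) q = Some t" using p q by (simp_all add: map_add_def)
  show ?thesis
  proof (cases "snd p \<le> snd q")
    case True
    then have "snd x \<le> snd q" if "x \<in> dom (A ++ B)" for x
      using p(3) q(3) that order_trans unfolding dom_map_add by blast
    then show ?thesis using 1 q(2) unfolding growing_def by (intro exI[of _ q] exI[of _ t]) simp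
  next
    case False
    then have "snd q \<le> snd p" by simp
    then have "snd x \<le> snd p" if "x \<in> dom (A ++ B)" for x
      using p(3) q(3) that order_trans unfolding dom_map_add by blast
    then show ?thesis using 1 p(2) unfolding growing_def by (intro exI[of _ p] exI[of _ s]) simp
  qed
qed

lemma rects_shift: "C \<in> rects \<Longrightarrow> shift v C \<in> rects"
  unfolding rects_def using shift_shift by blast

lemma accepting_shift: "C \<in> accepting \<Longrightarrow> shift v C \<in> accepting"
proof -
  assume C: "C \<in> accepting"
  have "tN t \<noteq> gb" if p: "shift v C p = Some t" for p t
  proof -
    have "C (fst p - fst v, snd p - snd v) = Some t" using p by (simp add: shift_def)
    then show ?thesis using C by (auto simp: accepting_def)
  qed
  then show ?thesis using C rects_shift by (auto simp: accepting_def)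
qed

text \<open>The marker \<open>gb\<close> occurs on an interior tile only together with a state of
  \<open>Stop\<close>, hence in row \<open>n\<close>. In the column, \<open>gb\<close> is not in
  \<open>HC\<close>, so no column tile can follow above it.\<close>

lemma rect_tile:
  assumes c: "complete m n \<tau>" "C \<in> fill m n \<tau>" and p: "C p = Some t"
  shows "tN t \<noteq> gb'" "tN t = gb \<Longrightarrow> snd p = n"
proof -
  consider "line (- n) m \<tau> p = Some t" | "t \<in> TI" "tE t \<in> Stop \<longrightarrow> snd p = n"
    using fill_cases[OF c p] by blast
  then have "tN t \<noteq> gb' \<and> (tN t = gb \<longrightarrow> snd p = n)"
  proof cases
    case 1
    then obtain k where k: "p = lpos k" "- n \<le> k" "k \<le> m" "t = \<tau> k" by (rule line_SomeE)
    have V: "valid_line (- n) m \<tau>" "0 < n" "0 < m" using c by (auto simp: complete_def)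
    note L = complete_line_tile[OF c(1) k(2,3)]
    consider "k > 0" | "k = 0" | "k < 0" by linarith
    then show ?thesis
    proof cases
      case 1 then show ?thesis using L k glue_sets(1) by auto
    next
      case 2 then show ?thesis using valid_corner[OF V(1)] V k gbs by auto
    next
      case 3
      have "tS (\<tau> k) \<in> HC" using valid_row(3)[OF V(1) k(2,3)] 3 by simp
      then have N: "tN t \<in> HC \<or> tN t = 0 \<or> tN t = gb" using col_EN[OF L(3)] k by auto
      have "snd p = n" if "tN t = gb"
      proof (rule ccontr)
        assume "snd p \<noteq> n"
        then have "- n < k" using k 3 by (auto simp: lpos_def)
        then have j: "- n \<le> k - 1" "k - 1 < m" "k - 1 < 0" using k 3 by auto
        then have "tS (\<tau> (k - 1)) = tN (\<tau> k)" using valid_link(2)[OF V(1) j] by simp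
        moreover have "tS (\<tau> (k - 1)) \<in> HC" using valid_row(3)[OF V(1) j(1)] j by simp
        ultimately show False using that k gbs by simp
      qed
      then show ?thesis using N gbs glue_sets by auto
    qed
  next
    case 2
    then show ?thesis using TI[OF 2(1)] gbs glue_sets(1)[of "tN t"] by auto
  qed
  then show "tN t \<noteq> gb'" "tN t = gb \<Longrightarrow> snd p = n" by blast+
qed

lemma fill_height:
  assumes c: "complete m n \<tau>" "C \<in> fill m n \<tau>" and p: "p \<in> dom C"
  shows "snd p \<le> n"
proof -
  obtain t where t: "C p = Some t" using p by blast
  have "line (- n) m \<tau> p = Some t \<Longrightarrow> snd p \<le> n"
    using c(1) by (auto simp: line_def complete_def split: if_splits)
  then show ?thesis using fill_cases[OF c t] by (auto simp: rect_def)
qed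

lemma rects_accepting_or_growing:
  assumes "C \<in> rects" shows "C \<in> accepting \<or> growing C"
proof (rule disjCI)
  assume "\<not> growing C"
  obtain v m n \<tau> D where D: "C = shift v D" "complete m n \<tau>" "D \<in> fill m n \<tau>" "full m n D"
    using assms by (auto simp: rects_def)
  have "\<not> growing D" using growing_shift[of D v] D \<open>\<not> growing C\<close> by blast
  have "tN t \<noteq> gb" if "D p = Some t" for p t
  proof
    assume "tN t = gb"
    then have "snd p = n" using rect_tile(2)[OF D(2,3) that] by blast
    then have "growing D" using that \<open>tN t = gb\<close> fill_height[OF D(2,3)] unfolding growing_def by blast
    then show False using \<open>\<not> growing D\<close> by blast
  qed
  moreover have "D \<in> rects" unfolding rects_def using D shift_zero by (metis (mono_tags, lifting) mem_Collect_eq)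
  ultimately have "D \<in> accepting" by (simp add: accepting_def)
  then show "C \<in> accepting" using D accepting_shift by blast
qed

lemma rects_grounded: "C \<in> rects \<Longrightarrow> grounded {} C"
  unfolding rects_def using fill_grounded grounded_shift by blast

lemma rects_no_gb': "C \<in> rects \<Longrightarrow> C p = Some t \<Longrightarrow> tN t \<noteq> gb'"
proof -
  assume C: "C \<in> rects" "C p = Some t"
  then obtain v m n \<tau> D where D: "C = shift v D" "complete m n \<tau>" "D \<in> fill m n \<tau>"
    by (auto simp: rects_def)
  have "D (fst p - fst v, snd p - snd v) = Some t" using C D by (simp add: shift_def)
  then show ?thesis using rect_tile(1)[OF D(2,3)] by blast
qed

lemma S3_stable:
  assumes "C \<in> produced 2 gs S3"
  shows "stable 2 gs C \<and> finite (dom C) \<and> dom C \<noteq> {}"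
proof (rule produced_stable_finite[OF _ assms])
  fix A assume "A \<in> S3"
  then show "stable 2 gs A \<and> finite (dom A) \<and> dom A \<noteq> {}"
    using S2_stable[of A] terminal_subset_produced[of 2 gs S2] terminal_S2
    by (auto simp: singles_def stable_single)
qed

text \<open>The only glues that \<open>B\<close> may leave open to the south are the markers, and an
  accepting rectangle shows neither of them to the north.\<close>

lemma accepting_isolated:
  assumes A: "A \<in> accepting" and B: "grounded {gb, gb'} B" and d: "dom A \<inter> dom B = {}"
    and ne: "dom A \<noteq> {}" "dom B \<noteq> {}"
  shows "\<not> stable 2 gs (A ++ B)"
proof (rule grounded_no_bond[where G = "{gb, gb'}"])
  show "grounded {} A" using A by (simp add: accepting_def rects_grounded)
  show "tN t \<notin> {gb, gb'}" if "A p = Some t" for p t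
    using A that rects_no_gb'[of A p t] by (auto simp: accepting_def)
qed (use gs0 B d ne in simp_all)

text \<open>Rejecting rectangles and towers may bond in many ways, none of which has to be
  described: being grounded up to the markers and being \<open>growing\<close> are both preserved by
  unions, and accepting rectangles never take part in one.\<close>

lemma produced_S3:
  assumes "C \<in> produced 2 gs S3"
  shows "grounded {gb, gb'} C \<and> (C \<in> accepting \<or> growing C)"
  using assms
proof (induction rule: produced_induct_union)
  case (init A)
  then show ?case
  proof
    assume A: "A \<in> rects"
    then show ?thesis using rects_accepting_or_growing grounded_mono[OF rects_grounded] by blast
  next
    assume "A \<in> singles {X, Y}"
    then show ?thesis by (auto simp: singles_def grounded_def growing_def tN_def tS_def tW_def split: if_splits)
  qed
next
  case (shift A v)
  then show ?case using grounded_shift accepting_shift growing_shift by blast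
next
  case (union A B)
  have ne: "dom A \<noteq> {}" "dom B \<noteq> {}" using S3_stable union.hyps by auto
  have d': "dom B \<inter> dom A = {}" using union.hyps(3) by blast
  have comm: "B ++ A = A ++ B" using map_add_comm[OF d'] .
  have "A \<notin> accepting" using accepting_isolated[OF _ _ union.hyps(3) ne] union by blast
  moreover have "B \<notin> accepting" using accepting_isolated[OF _ _ d' ne(2,1)] union comm by auto
  ultimately show ?case using union grounded_union growing_union by blast
qed

theorem terminal_S3: "terminal 2 gs S3 = accepting"
proof (intro set_eqI iffI)
  fix C assume T: "C \<in> terminal 2 gs S3"
  then have P: "C \<in> produced 2 gs S3" using terminal_subset_produced by blast
  have "\<not> growing C"
  proof
    assume "growing C"
    then obtain p t where p: "C p = Some t" "tN t \<in> {gb, gb'}" "\<forall>q \<in> dom C. snd q \<le> snd p"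
      by (auto simp: growing_def)
    define x where "x = (if tN t = gb then X else Y)"
    have x: "tS x = tN t" "gs (tN t) = 2" using p(2) gbs by (auto simp: x_def tS_def)
    have np: "C (nb_N p) = None"
    proof (rule ccontr)
      assume "C (nb_N p) \<noteq> None"
      then have "snd (nb_N p) \<le> snd p" using p(3) by (metis domIff)
      then show False by (simp add: nb_defs)
    qed
    have 1: "(C(nb_N p \<mapsto> x)) (nb_N p) = Some x" "(C(nb_N p \<mapsto> x)) p = Some t" using p by auto
    have "bond gs (C(nb_N p \<mapsto> x)) (nb_N p) p = 2"
      using bond_nb(4)[OF 1, of gs] x by (simp add: glue_str_def del: fun_upd_apply)
    moreover have "bond gs (C(nb_N p \<mapsto> x)) (nb_N p) p \<le> cut_weight gs (C(nb_N p \<mapsto> x)) {nb_N p}"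
      by (rule cut_weight_ge_bond) (use 1 p(1) in \<open>auto simp: adjacent_iff simp del: fun_upd_apply\<close>)
    moreover have "[nb_N p \<mapsto> x] \<in> produced 2 gs S3"
      by (intro produced.init) (auto simp: singles_def x_def)
    ultimately show False using attach_produced(2)[OF P _ _ _ np, of x] S3_stable[OF P] T by simp
  qed
  then show "C \<in> accepting" using produced_S3[OF P] by blast
next
  fix C assume C: "C \<in> accepting"
  then have P: "C \<in> produced 2 gs S3" by (intro produced.init) (simp add: accepting_def)
  show "C \<in> terminal 2 gs S3" unfolding terminal_iff
  proof (intro conjI ballI impI P)
    fix B assume B: "B \<in> produced 2 gs S3" "dom C \<inter> dom B = {}"
    show "\<not> stable 2 gs (C ++ B)"
      using accepting_isolated[OF C _ B(2)] produced_S3[OF B(1)] S3_stable[OF P] S3_stable[OF B(1)] by simp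
  qed
qed

end

section \<open>Turing machines on zippers\<close>

definition nthd :: "nat list \<Rightarrow> nat \<Rightarrow> nat" where
  "nthd xs i = (if i < length xs then xs ! i else 0)"

definition hd0 :: "nat list \<Rightarrow> nat" where "hd0 xs = nthd xs 0"

lemma nthd_simps [simp]: "nthd [] i = 0" "nthd (x # xs) 0 = x" "nthd (x # xs) (Suc i) = nthd xs i"
  by (simp_all add: nthd_def)

lemma hd0_simps [simp]: "hd0 [] = 0" "hd0 (x # xs) = x"
  by (simp_all add: hd0_def)

lemma nthd_tl: "nthd (tl xs) i = nthd xs (Suc i)"
  by (cases xs) auto

type_synonym zconf = "nat \<times> nat list \<times> nat list"

fun zmove :: "int \<Rightarrow> nat \<Rightarrow> nat \<Rightarrow> nat list \<Rightarrow> nat list \<Rightarrow> zconf" where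
  "zmove d q s l r = (if d = 1 then (q, s # l, r) else if d = 0 then (q, l, s # r) else (q, tl l, hd0 l # s # r))"

fun zstep :: "tm \<Rightarrow> zconf \<Rightarrow> zconf" where
  "zstep M (q, l, r) = (if q = 1 then (q, l, r) else
     (case delta M q (hd0 r) of (q', s', d) \<Rightarrow> zmove d q' s' l (tl r)))"

declare zstep.simps [simp del]

text \<open>The left list starts next to the head and the right list at the head. Missing entries
  read as blanks through \<open>nthd\<close>, so a tape has many representations, which differ in
  trailing blanks.\<close>

fun zrep :: "tm_conf \<Rightarrow> zconf \<Rightarrow> bool" where
  "zrep (q, tp, h) (q', l, r) \<longleftrightarrow> q = q' \<and> (\<forall>i. tp (h + int i) = nthd r i \<and> tp (h - 1 - int i) = nthd l i)"

fun zok :: "tm \<Rightarrow> zconf \<Rightarrow> bool" where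
  "zok M (q, l, r) \<longleftrightarrow> q < nq M \<and> set l \<subseteq> {..<ns M} \<and> set r \<subseteq> {..<ns M}"

lemma hd0_less: "set xs \<subseteq> {..<n} \<Longrightarrow> 0 < n \<Longrightarrow> hd0 xs < n"
  by (cases xs) auto

lemma set_tl_subset: "set xs \<subseteq> A \<Longrightarrow> set (tl xs) \<subseteq> A"
  by (cases xs) auto

lemma valid_delta:
  assumes "valid_tm M" "q < nq M" "s < ns M" "delta M q s = (q', s', d)"
  shows "q' < nq M" "s' < ns M" "d \<in> {-1, 0, 1}"
proof -
  have "case delta M q s of (q', s', d) \<Rightarrow> q' < nq M \<and> s' < ns M \<and> d \<in> {-1, 0, 1}"
    using assms(1-3) by (simp add: valid_tm_def)
  then show "q' < nq M" "s' < ns M" "d \<in> {-1, 0, 1}" by (simp_all add: assms(4))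
qed

lemma zstep_ok:
  assumes M: "valid_tm M" and c: "zok M c"
  shows "zok M (zstep M c)"
proof -
  obtain q l r where cc: "c = (q, l, r)" by (cases c)
  have ns: "0 < ns M" using M by (simp add: valid_tm_def)
  have h: "hd0 r < ns M" "hd0 l < ns M" using c ns by (auto simp: cc intro: hd0_less)
  obtain q' s' d where d: "delta M q (hd0 r) = (q', s', d)" by (cases "delta M q (hd0 r)")
  have "q' < nq M \<and> s' < ns M" using valid_delta[OF M _ h(1) d] c by (simp add: cc)
  then show ?thesis using c h set_tl_subset[of r "{..<ns M}"] set_tl_subset[of l "{..<ns M}"]
    by (auto simp: cc zstep.simps d)
qed

lemma zstep_rep:
  assumes M: "valid_tm M" and c: "zok M z" and r: "zrep c z"
  shows "zrep (tm_step M c) (zstep M z)"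
proof -
  obtain q l r where zz: "z = (q, l, r)" by (cases z)
  obtain tp h where cc: "c = (q, tp, h)" using r by (cases c) (auto simp: zz)
  have rp: "\<And>i. tp (h + int i) = nthd r i" "\<And>i. tp (h - 1 - int i) = nthd l i" using r by (auto simp: cc zz)
  have th: "tp h = hd0 r" using rp(1)[of 0] by (simp add: hd0_def)
  have ns: "0 < ns M" using M by (simp add: valid_tm_def)
  have hl: "hd0 r < ns M" using c ns by (auto simp: zz intro: hd0_less)
  show ?thesis
  proof (cases "q = 1")
    case True
    then show ?thesis using r by (simp add: cc zz tm_step_def zstep.simps)
  next
    case False
    obtain q' s' d where d: "delta M q (hd0 r) = (q', s', d)" by (cases "delta M q (hd0 r)")
    have dd: "d \<in> {-1, 0, 1}" using valid_delta(3)[OF M _ hl d] c by (simp add: zz)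
    let ?tp = "tp(h := s')"
    have tmc: "tm_step M c = (q', ?tp, h + d)" using False by (simp add: cc tm_step_def th d)
    have R: "?tp (h + int (Suc i)) = nthd (tl r) i" for i using rp(1)[of "Suc i"] by (simp add: nthd_tl)
    have L: "?tp (h - 1 - int i) = nthd l i" for i using rp(2)[of i] by simp
    from dd consider "d = -1" | "d = 0" | "d = 1" by blast
    then show ?thesis
    proof cases
      case 1
      have "?tp (h - 1 + int i) = nthd (hd0 l # s' # tl r) i" for i
      proof (cases i)
        case 0 then show ?thesis using L[of 0] by (simp add: hd0_def)
      next
        case (Suc j)
        then show ?thesis using R by (cases j) (simp_all add: algebra_simps)
      qed
      moreover have "?tp (h - 1 - 1 - int i) = nthd (tl l) i" for i
        using L[of "Suc i"] by (simp add: nthd_tl algebra_simps)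
      ultimately show ?thesis using 1 False by (simp add: tmc zz zstep.simps d del: fun_upd_apply)
    next
      case 2
      have "?tp (h + int i) = nthd (s' # tl r) i" for i using R by (cases i) simp_all
      then show ?thesis using 2 False L by (simp add: tmc zz zstep.simps d del: fun_upd_apply)
    next
      case 3
      have "?tp (h + 1 + int i) = nthd (tl r) i" for i using R[of i] by (simp add: algebra_simps)
      moreover have "?tp (h + 1 - 1 - int i) = nthd (s' # l) i" for i
        using L by (cases i) (simp_all add: algebra_simps)
      ultimately show ?thesis using 3 False by (simp add: tmc zz zstep.simps d del: fun_upd_apply)
    qed
  qed
qed

definition bcode :: "bool \<Rightarrow> nat" where "bcode b = (if b then 2 else 1)"

definition zinit :: "bool list \<Rightarrow> zconf" where "zinit w = (0, [], map bcode w)"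

lemma zinit_rep: "zrep (tm_init w) (zinit w)"
  by (auto simp: tm_init_def zinit_def nthd_def bcode_def)

lemma zinit_ok: "valid_tm M \<Longrightarrow> zok M (zinit w)"
  by (auto simp: zinit_def valid_tm_def bcode_def)

lemma zsteps:
  assumes "valid_tm M"
  shows "zok M ((zstep M ^^ t) (zinit w)) \<and> zrep ((tm_step M ^^ t) (tm_init w)) ((zstep M ^^ t) (zinit w))"
  by (induction t) (use assms in \<open>auto simp: zinit_rep zinit_ok zstep_ok zstep_rep\<close>)

lemma zstep_halted: "fst c = 1 \<Longrightarrow> zstep M c = c"
  by (cases c) (simp add: zstep.simps)

lemma zsteps_halted: "fst c = 1 \<Longrightarrow> (zstep M ^^ t) c = c"
  by (induction t) (auto simp: zstep_halted)

lemma zsteps_mono: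
  assumes "fst ((zstep M ^^ t) c) = 1" "t \<le> t'"
  shows "(zstep M ^^ t') c = (zstep M ^^ t) c"
proof -
  have "(zstep M ^^ t') c = (zstep M ^^ (t' - t)) ((zstep M ^^ t) c)"
    using assms(2) by (metis comp_apply funpow_add le_add_diff_inverse2)
  then show ?thesis using zsteps_halted[OF assms(1)] by simp
qed

lemma zsteps_unique:
  assumes "fst ((zstep M ^^ t) c) = 1" "fst ((zstep M ^^ t') c) = 1"
  shows "(zstep M ^^ t) c = (zstep M ^^ t') c"
proof (cases "t \<le> t'")
  case True
  then show ?thesis by (rule zsteps_mono[OF assms(1), symmetric])
next
  case False
  then have "t' \<le> t" by simp
  then show ?thesis by (rule zsteps_mono[OF assms(2)])
qed

lemma zrep_fst: "zrep c z \<Longrightarrow> fst c = fst z"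
  by (cases c; cases z) auto

lemma zrep_output1:
  assumes "zrep c (q, l, r)" "tm_output c = [b]"
  shows "b \<longleftrightarrow> hd0 r = 2"
proof -
  obtain tp h where c: "c = (q, tp, h)" using assms(1) by (cases c) auto
  define m where "m = (LEAST n. tp (h + int n) \<notin> {1, 2})"
  have o: "map (\<lambda>i. tp (h + int i) = 2) [0..<m] = [b]" using assms(2) by (simp add: tm_output_def c m_def)
  then have "length [0..<m] = 1" by (metis length_Cons length_map list.size(3) One_nat_def)
  then have "m = 1" by simp
  then have "b \<longleftrightarrow> tp h = 2" using o by simp
  then show ?thesis using assms(1)[unfolded c] by (simp add: hd0_def) (metis add_0_right of_nat_0)
qed

lemma zrep_output:
  assumes "zrep c (q, l, map bcode bs @ x # r)" "x \<notin> {1, 2}"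
  shows "tm_output c = bs"
proof -
  obtain tp h where c: "c = (q, tp, h)" using assms(1) by (cases c) auto
  have tp: "tp (h + int i) = nthd (map bcode bs @ x # r) i" for i using assms(1) by (simp add: c)
  have in_bs: "nthd (map bcode bs @ x # r) i = bcode (bs ! i)" if "i < length bs" for i
    using that by (simp add: nthd_def nth_append)
  have "(LEAST n. tp (h + int n) \<notin> {1, 2}) = length bs"
  proof (rule Least_equality)
    show "tp (h + int (length bs)) \<notin> {1, 2}" using assms(2) by (simp add: tp nthd_def nth_append)
    fix y assume y: "tp (h + int y) \<notin> {1, 2}"
    show "length bs \<le> y"
    proof (rule ccontr)
      assume "\<not> length bs \<le> y"
      then show False using y in_bs[of y] by (simp add: tp bcode_def split: if_splits)
    qed
  qed
  then have "tm_output c = map (\<lambda>i. tp (h + int i) = 2) [0..<length bs]"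
    by (simp add: tm_output_def c)
  also have "\<dots> = map (\<lambda>i. bs ! i) [0..<length bs]"
    by (rule map_cong) (auto simp: tp in_bs bcode_def)
  also have "\<dots> = bs" by (rule map_nth)
  finally show ?thesis .
qed

lemma bcode_simps [simp]: "bcode True = 2" "bcode False = 1"
  by (simp_all add: bcode_def)

text \<open>The counterpart of \<open>dbl\<close> on tape symbols: the marker bit
  \<open>True\<close> is the symbol 2.\<close>

definition pairs :: "nat list \<Rightarrow> nat list" where "pairs xs = concat (map (\<lambda>s. [2, s]) xs)"

lemma pairs_simps [simp]: "pairs [] = []" "pairs (x # xs) = 2 # x # pairs xs" "pairs (xs @ ys) = pairs xs @ pairs ys"
  by (simp_all add: pairs_def)

lemma pairs_dbl: "map bcode (dbl xs) = pairs (map bcode xs)"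
  by (induction xs) (auto simp: dbl_def bcode_def)

section \<open>Nondeterministic stack programs\<close>

text \<open>Regular programs over a store of stacks. A failing test or a wrong guess has no run at
  all, so programs may guess freely and verify afterwards.\<close>

datatype prog = Push nat nat | Pop nat nat | Emp nat | Skip | Fail | Seq prog prog | Alt prog prog | Star prog

type_synonym regs = "nat \<Rightarrow> nat list"

fun sem :: "prog \<Rightarrow> (regs \<times> regs) set" where
  "sem (Push r s) = {(\<sigma>, \<sigma>'). \<sigma>' = \<sigma>(r := s # \<sigma> r)}"
| "sem (Pop r s) = {(\<sigma>, \<sigma>'). \<exists>l. \<sigma> r = s # l \<and> \<sigma>' = \<sigma>(r := l)}"
| "sem (Emp r) = {(\<sigma>, \<sigma>'). \<sigma>' = \<sigma> \<and> \<sigma> r = []}"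
| "sem Skip = Id"
| "sem Fail = {}"
| "sem (Seq p q) = sem p O sem q"
| "sem (Alt p q) = sem p \<union> sem q"
| "sem (Star p) = (sem p)\<^sup>*"

datatype act = Nop | Prim prog

text \<open>A control location is the list of programs still to be executed.\<close>
fun edges :: "prog list \<Rightarrow> (act \<times> prog list) set" where
  "edges [] = {}"
| "edges (Push r s # K) = {(Prim (Push r s), K)}"
| "edges (Pop r s # K) = {(Prim (Pop r s), K)}"
| "edges (Emp r # K) = {(Prim (Emp r), K)}"
| "edges (Skip # K) = {(Nop, K)}"
| "edges (Fail # K) = {}"
| "edges (Seq p q # K) = {(Nop, p # q # K)}"
| "edges (Alt p q # K) = {(Nop, p # K), (Nop, q # K)}"
| "edges (Star p # K) = {(Nop, K), (Nop, p # Star p # K)}"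

fun act_sem :: "act \<Rightarrow> (regs \<times> regs) set" where
  "act_sem Nop = Id"
| "act_sem (Prim p) = sem p"

definition pstep :: "((prog list \<times> regs) \<times> (prog list \<times> regs)) set" where
  "pstep = {((X, \<sigma>), (Y, \<sigma>')). \<exists>a. (a, Y) \<in> edges X \<and> (\<sigma>, \<sigma>') \<in> act_sem a}"

fun sems :: "prog list \<Rightarrow> (regs \<times> regs) set" where
  "sems [] = Id"
| "sems (p # K) = sem p O sems K"

lemma pstepI: "(a, Y) \<in> edges X \<Longrightarrow> (\<sigma>, \<sigma>') \<in> act_sem a \<Longrightarrow> ((X, \<sigma>), (Y, \<sigma>')) \<in> pstep"
  by (auto simp: pstep_def)

lemma sem_psteps: "(\<sigma>, \<sigma>') \<in> sem p \<Longrightarrow> ((p # K, \<sigma>), (K, \<sigma>')) \<in> pstep\<^sup>*"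
proof (induction p arbitrary: \<sigma> \<sigma>' K)
  case (Seq p q)
  then obtain \<tau> where t: "(\<sigma>, \<tau>) \<in> sem p" "(\<tau>, \<sigma>') \<in> sem q" by auto
  have "((Seq p q # K, \<sigma>), (p # q # K, \<sigma>)) \<in> pstep" by (rule pstepI[of Nop]) auto
  also have "((p # q # K, \<sigma>), (q # K, \<tau>)) \<in> pstep\<^sup>*" using Seq t by blast
  also have "((q # K, \<tau>), (K, \<sigma>')) \<in> pstep\<^sup>*" using Seq t by blast
  finally show ?case .
next
  case (Alt p q)
  have a: "((Alt p q # K, \<sigma>), (p # K, \<sigma>)) \<in> pstep" "((Alt p q # K, \<sigma>), (q # K, \<sigma>)) \<in> pstep"
    by (rule pstepI[of Nop]; auto)+
  then show ?case using Alt by (auto intro: converse_rtrancl_into_rtrancl)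
next
  case (Star p)
  have a: "((Star p # K, \<sigma>), (p # Star p # K, \<sigma>)) \<in> pstep" "((Star p # K, \<sigma>), (K, \<sigma>)) \<in> pstep" for \<sigma>
    by (rule pstepI[of Nop]; auto)+
  from Star.prems have "(\<sigma>, \<sigma>') \<in> (sem p)\<^sup>*" by simp
  then show ?case
  proof (induction rule: converse_rtrancl_induct)
    case base
    then show ?case using a by blast
  next
    case (step \<sigma> \<tau>)
    have "((Star p # K, \<sigma>), (p # Star p # K, \<sigma>)) \<in> pstep" by (rule a)
    also have "((p # Star p # K, \<sigma>), (Star p # K, \<tau>)) \<in> pstep\<^sup>*" using Star.IH step by blast
    also note step(3)
    finally show ?case .
  qed
qed (auto intro!: r_into_rtrancl pstepI)

lemma psteps_sems: "((X, \<sigma>), ([], \<sigma>')) \<in> pstep\<^sup>* \<Longrightarrow> (\<sigma>, \<sigma>') \<in> sems X"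
proof (induction "(X, \<sigma>)" arbitrary: X \<sigma> rule: converse_rtrancl_induct)
  case base
  then show ?case by simp
next
  case (step c)
  obtain Y \<tau> where c: "c = (Y, \<tau>)" by (cases c)
  have IH: "(\<tau>, \<sigma>') \<in> sems Y" using step c by blast
  from step(1) obtain a where a: "(a, Y) \<in> edges X" "(\<sigma>, \<tau>) \<in> act_sem a" by (auto simp: pstep_def c)
  show ?case
  proof (cases X)
    case Nil
    then show ?thesis using a by simp
  next
    case (Cons p K)
    show ?thesis
    proof (cases p)
      case (Star b)
      then have "(a = Nop \<and> Y = K) \<or> (a = Nop \<and> Y = b # Star b # K)" using a Cons by auto
      then show ?thesis
      proof
        assume "a = Nop \<and> Y = K"
        then show ?thesis using IH a Cons Star by auto
      next
        assume Y: "a = Nop \<and> Y = b # Star b # K"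
        then have "(\<tau>, \<sigma>') \<in> sem b O (sem b)\<^sup>* O sems K" using IH by simp
        then have "(\<tau>, \<sigma>') \<in> (sem b)\<^sup>* O sems K" by (meson converse_rtrancl_into_rtrancl relcomp.simps)
        then show ?thesis using Y a Cons Star by simp
      qed
    qed (use a IH Cons in auto)
  qed
qed

lemma psteps_iff: "((([p], \<sigma>), ([], \<sigma>')) \<in> pstep\<^sup>*) \<longleftrightarrow> (\<sigma>, \<sigma>') \<in> sem p"
  using sem_psteps[of \<sigma> \<sigma>' p "[]"] psteps_sems[of "[p]" \<sigma> \<sigma>'] by auto

text \<open>Control locations are lists of programs, but only finitely many occur in the runs of a
  program: the remaining list is fixed by the place in the program and the given continuation. This
  makes locations usable as symbols of a finite tile set.\<close>

fun locs :: "prog \<Rightarrow> prog list \<Rightarrow> prog list set" where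
  "locs (Seq p q) K = {Seq p q # K} \<union> locs p (q # K) \<union> locs q K"
| "locs (Alt p q) K = {Alt p q # K} \<union> locs p K \<union> locs q K"
| "locs (Star p) K = {Star p # K, K} \<union> locs p (Star p # K)"
| "locs p K = {p # K, K}"

lemma finite_locs: "finite (locs p K)"
  by (induction p arbitrary: K) auto

lemma locs_ends: "p # K \<in> locs p K \<and> K \<in> locs p K"
  by (induction p arbitrary: K) auto

fun prog_ok :: "nat \<Rightarrow> nat \<Rightarrow> prog \<Rightarrow> bool" where
  "prog_ok R S (Push r s) \<longleftrightarrow> r < R \<and> s < S"
| "prog_ok R S (Pop r s) \<longleftrightarrow> r < R \<and> s < S"
| "prog_ok R S (Emp r) \<longleftrightarrow> r < R"
| "prog_ok R S (Seq p q) \<longleftrightarrow> prog_ok R S p \<and> prog_ok R S q"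
| "prog_ok R S (Alt p q) \<longleftrightarrow> prog_ok R S p \<and> prog_ok R S q"
| "prog_ok R S (Star p) \<longleftrightarrow> prog_ok R S p"
| "prog_ok R S _ \<longleftrightarrow> True"

fun act_ok :: "nat \<Rightarrow> nat \<Rightarrow> act \<Rightarrow> bool" where
  "act_ok R S Nop \<longleftrightarrow> True"
| "act_ok R S (Prim (Push r s)) \<longleftrightarrow> r < R \<and> s < S"
| "act_ok R S (Prim (Pop r s)) \<longleftrightarrow> r < R \<and> s < S"
| "act_ok R S (Prim (Emp r)) \<longleftrightarrow> r < R"
| "act_ok R S (Prim p) \<longleftrightarrow> False"

lemma locs_step:
  assumes "X \<in> locs p K" "prog_ok R S p" "(a, Y) \<in> edges X"
  shows "X = K \<or> Y \<in> locs p K \<and> act_ok R S a"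
  using assms
proof (induction p arbitrary: K)
  case (Seq p q)
  from Seq.prems consider "X = Seq p q # K" | "X \<in> locs p (q # K)" | "X \<in> locs q K" by auto
  then show ?case
  proof cases
    case 1 then show ?thesis using Seq.prems locs_ends by auto
  next
    case 2
    then have "X = q # K \<or> Y \<in> locs p (q # K) \<and> act_ok R S a" using Seq by auto
    then show ?thesis using Seq.IH(2)[of K] Seq.prems locs_ends[of q K] by auto
  next
    case 3 then show ?thesis using Seq by auto
  qed
next
  case (Alt p q)
  from Alt.prems consider "X = Alt p q # K" | "X \<in> locs p K" | "X \<in> locs q K" by auto
  then show ?case
  proof cases
    case 1 then show ?thesis using Alt.prems locs_ends[of p K] locs_ends[of q K] by auto
  qed (use Alt in auto)
next
  case (Star p)
  from Star.prems consider "X = Star p # K" | "X = K" | "X \<in> locs p (Star p # K)" by auto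
  then show ?case
  proof cases
    case 1 then show ?thesis using Star.prems locs_ends[of p "Star p # K"] by auto
  next
    case 3
    then have "X = Star p # K \<or> Y \<in> locs p (Star p # K) \<and> act_ok R S a" using Star by auto
    then show ?thesis using Star.prems locs_ends[of p "Star p # K"] by auto
  qed auto
qed auto

section \<open>The program that decides the complement\<close>

fun alts :: "(nat \<Rightarrow> prog) \<Rightarrow> nat \<Rightarrow> prog" where
  "alts f 0 = Fail"
| "alts f (Suc n) = Alt (f n) (alts f n)"

lemma sem_alts: "sem (alts f n) = (\<Union>i<n. sem (f i))"
  by (induction n) (auto simp: lessThan_Suc)

lemma prog_ok_alts: "prog_ok R S (alts f n) \<longleftrightarrow> (\<forall>i<n. prog_ok R S (f i))"
  by (induction n) (auto simp: less_Suc_eq)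

text \<open>A loop over all entries of stack \<open>a\<close>. The final test for emptiness discards
  the runs in which \<open>Star\<close> stops early.\<close>

definition each :: "nat \<Rightarrow> nat \<Rightarrow> (nat \<Rightarrow> prog) \<Rightarrow> prog" where
  "each S a f = Seq (Star (alts (\<lambda>s. Seq (Pop a s) (f s)) S)) (Emp a)"

lemma prog_ok_each: "prog_ok R S (each S a f) \<longleftrightarrow> a < R \<and> (\<forall>s<S. prog_ok R S (f s))"
  by (auto simp: each_def prog_ok_alts)

lemma star_unfold: "(\<sigma>, \<sigma>') \<in> A\<^sup>* O B \<longleftrightarrow> (\<sigma>, \<sigma>') \<in> B \<or> (\<exists>\<tau>. (\<sigma>, \<tau>) \<in> A \<and> (\<tau>, \<sigma>') \<in> A\<^sup>* O B)"
proof
  assume "(\<sigma>, \<sigma>') \<in> A\<^sup>* O B"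
  then obtain \<rho> where r: "(\<sigma>, \<rho>) \<in> A\<^sup>*" "(\<rho>, \<sigma>') \<in> B" by blast
  from r(1) show "(\<sigma>, \<sigma>') \<in> B \<or> (\<exists>\<tau>. (\<sigma>, \<tau>) \<in> A \<and> (\<tau>, \<sigma>') \<in> A\<^sup>* O B)"
    by (cases rule: converse_rtranclE) (use r(2) in blast)+
qed (blast intro: converse_rtrancl_into_rtrancl)

lemma each_Nil: "\<sigma> a = [] \<Longrightarrow> (\<sigma>, \<sigma>') \<in> sem (each S a f) \<longleftrightarrow> \<sigma>' = \<sigma>"
  unfolding each_def sem.simps
  by (subst star_unfold) (auto simp: sem_alts)

lemma each_Cons:
  assumes "\<sigma> a = s # l" "s < S"
  shows "(\<sigma>, \<sigma>') \<in> sem (each S a f) \<longleftrightarrow> (\<exists>\<tau>. (\<sigma>(a := l), \<tau>) \<in> sem (f s) \<and> (\<tau>, \<sigma>') \<in> sem (each S a f))"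
proof -
  have "(\<sigma>, \<tau>) \<in> sem (alts (\<lambda>s. Seq (Pop a s) (f s)) S) \<longleftrightarrow> (\<sigma>(a := l), \<tau>) \<in> sem (f s)" for \<tau>
    using assms by (auto simp: sem_alts)
  then show ?thesis
    unfolding each_def sem.simps
    by (subst star_unfold) (use assms in auto)
qed

text \<open>The stacks hold the input, the length bound in unary, two auxiliary lists, the words \<open>y\<close> and \<open>z\<close>, and the
  right half tape, left half tape and state of the simulated machine.\<close>
definition st :: "nat list \<Rightarrow> nat list \<Rightarrow> nat list \<Rightarrow> nat list \<Rightarrow> nat list \<Rightarrow> nat list \<Rightarrow> nat list \<Rightarrow> nat list \<Rightarrow> nat list \<Rightarrow> regs" where
  "st w p q t y z r l u = (\<lambda>_. [])(0 := w, 1 := p, 2 := q, 3 := t, 4 := y, 5 := z, 6 := r, 7 := l, 8 := u)"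

lemma st_app [simp]:
  "st w p q t y z r l u 0 = w" "st w p q t y z r l u (Suc 0) = p" "st w p q t y z r l u 1 = p" "st w p q t y z r l u 2 = q"
  "st w p q t y z r l u 3 = t" "st w p q t y z r l u 4 = y" "st w p q t y z r l u 5 = z"
  "st w p q t y z r l u 6 = r" "st w p q t y z r l u 7 = l" "st w p q t y z r l u 8 = u"
  by (simp_all add: st_def)



lemma st_upd [simp]:
  "(st w p q t y z r l u)(0 := x) = st x p q t y z r l u"
  "(st w p q t y z r l u)(Suc 0 := x) = st w x q t y z r l u"
  "(st w p q t y z r l u)(1 := x) = st w x q t y z r l u"
  "(st w p q t y z r l u)(2 := x) = st w p x t y z r l u"
  "(st w p q t y z r l u)(3 := x) = st w p q x y z r l u"
  "(st w p q t y z r l u)(4 := x) = st w p q t x z r l u"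
  "(st w p q t y z r l u)(5 := x) = st w p q t y x r l u"
  "(st w p q t y z r l u)(6 := x) = st w p q t y z x l u"
  "(st w p q t y z r l u)(7 := x) = st w p q t y z r x u"
  "(st w p q t y z r l u)(8 := x) = st w p q t y z r l x"
  by (auto simp: st_def fun_eq_iff)

lemma st_inj [simp]: "st w p q t y z r l u = st w' p' q' t' y' z' r' l' u' \<longleftrightarrow>
  w = w' \<and> p = p' \<and> q = q' \<and> t = t' \<and> y = y' \<and> z = z' \<and> r = r' \<and> l = l' \<and> u = u'"
proof
  assume e: "st w p q t y z r l u = st w' p' q' t' y' z' r' l' u'"
  show "w = w' \<and> p = p' \<and> q = q' \<and> t = t' \<and> y = y' \<and> z = z' \<and> r = r' \<and> l = l' \<and> u = u'"
    using fun_cong[OF e, of 0] fun_cong[OF e, of 1] fun_cong[OF e, of 2] fun_cong[OF e, of 3]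
      fun_cong[OF e, of 4] fun_cong[OF e, of 5] fun_cong[OF e, of 6] fun_cong[OF e, of 7] fun_cong[OF e, of 8]
    by simp
qed simp

lemma sem_Push [simp]: "(\<sigma>, \<sigma>') \<in> sem (Push r s) \<longleftrightarrow> \<sigma>' = \<sigma>(r := s # \<sigma> r)" by simp
lemma sem_Seq: "(\<sigma>, \<sigma>') \<in> sem (Seq p q) \<longleftrightarrow> (\<exists>\<tau>. (\<sigma>, \<tau>) \<in> sem p \<and> (\<tau>, \<sigma>') \<in> sem q)" by auto
lemma sem_Alt: "(\<sigma>, \<sigma>') \<in> sem (Alt p q) \<longleftrightarrow> (\<sigma>, \<sigma>') \<in> sem p \<or> (\<sigma>, \<sigma>') \<in> sem q" by auto
lemma sem_Pop: "(\<sigma>, \<sigma>') \<in> sem (Pop r s) \<longleftrightarrow> (\<exists>l. \<sigma> r = s # l \<and> \<sigma>' = \<sigma>(r := l))" by auto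
lemma sem_Emp: "(\<sigma>, \<sigma>') \<in> sem (Emp r) \<longleftrightarrow> \<sigma>' = \<sigma> \<and> \<sigma> r = []" by auto
lemma sem_Skip: "(\<sigma>, \<sigma>') \<in> sem Skip \<longleftrightarrow> \<sigma>' = \<sigma>" by auto

lemmas sem_iffs = sem_Seq sem_Alt sem_Pop sem_Emp sem_Skip

declare One_nat_def [simp del]

section \<open>Counting, guessing, simulation and search on nine stacks\<close>

context
  fixes M :: tm and S :: nat
  assumes M: "valid_tm M" and S: "ns M \<le> S" "nq M \<le> S"
begin

lemma S3: "3 \<le> S" "2 < S" "1 < S" "0 < S" using M S by (auto simp: valid_tm_def)

text \<open>Multiplies the unary counter in stack 1 by \<open>length w + 1\<close>. For each of its
  units the input is run through once, which adds \<open>length w\<close> units to stack 2, and one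
  more unit is added; stack 3 keeps the input for the next pass.\<close>

definition mul_prog :: prog where
  "mul_prog = Seq (each S 1 (\<lambda>_. Seq (each S 0 (\<lambda>s. Seq (Push 3 s) (Push 2 1))) (Seq (Push 2 1) (each S 3 (Push 0)))))
                  (each S 2 (Push 1))"

lemma each_W_T_Q:
  "set w \<subseteq> {..<S} \<Longrightarrow> (st w p q t y z r l u, \<sigma>') \<in> sem (each S 0 (\<lambda>s. Seq (Push 3 s) (Push 2 1))) \<longleftrightarrow>
    \<sigma>' = st [] p (replicate (length w) 1 @ q) (rev w @ t) y z r l u"
  by (induction w arbitrary: q t)
    (simp_all add: each_Nil each_Cons sem_iffs replicate_app_Cons_same del: sem.simps)

lemma each_T_W:
  "set t \<subseteq> {..<S} \<Longrightarrow> (st w p q t y z r l u, \<sigma>') \<in> sem (each S 3 (Push 0)) \<longleftrightarrow>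
    \<sigma>' = st (rev t @ w) p q [] y z r l u"
  by (induction t arbitrary: w) (simp_all add: each_Nil each_Cons del: sem.simps)

lemma each_Q_P:
  "set q \<subseteq> {..<S} \<Longrightarrow> (st w p q t y z r l u, \<sigma>') \<in> sem (each S 2 (Push 1)) \<longleftrightarrow>
    \<sigma>' = st w (rev q @ p) [] t y z r l u"
  by (induction q arbitrary: p) (simp_all add: each_Nil each_Cons del: sem.simps)

lemma mul_inner:
  assumes "set w \<subseteq> {..<S}"
  shows "set p \<subseteq> {..<S} \<Longrightarrow>
    (st w p q [] y z r l u, \<sigma>') \<in> sem (each S 1 (\<lambda>_. Seq (each S 0 (\<lambda>s. Seq (Push 3 s) (Push 2 1))) (Seq (Push 2 1) (each S 3 (Push 0))))) \<longleftrightarrow>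
    \<sigma>' = st w [] (replicate (length p * Suc (length w)) 1 @ q) [] y z r l u"
proof (induction p arbitrary: q)
  case Nil
  then show ?case by (simp add: each_Nil del: sem.simps)
next
  case (Cons a p)
  have e: "replicate (length p * Suc (length w)) 1 @ 1 # replicate (length w) (1::nat) @ q =
    replicate (Suc (length w) + length p * Suc (length w)) 1 @ q"
  proof -
    have "replicate (length p * Suc (length w)) 1 @ replicate (Suc (length w)) (1::nat) =
      replicate (Suc (length w) + length p * Suc (length w)) 1"
      by (simp only: replicate_add[symmetric] add.commute)
    then show ?thesis by (metis append.assoc append_Cons replicate_Suc)
  qed
  have l: "length (a # p) * Suc (length w) = Suc (length w) + length p * Suc (length w)" by simp
  have "set (rev w) \<subseteq> {..<S}" "a < S" "set p \<subseteq> {..<S}" using assms Cons.prems by auto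
  then show ?case unfolding l
    by (simp add: each_Cons sem_Seq each_W_T_Q[OF assms] each_T_W Cons.IH e del: sem.simps mult_Suc_right replicate.simps)
qed

lemma mul_sem:
  assumes "set w \<subseteq> {..<S}" "p = replicate k 1"
  shows "(st w p [] [] y z r l u, \<sigma>') \<in> sem mul_prog \<longleftrightarrow> \<sigma>' = st w (replicate (k * Suc (length w)) 1) [] [] y z r l u"
proof -
  have "set p \<subseteq> {..<S}" "set (replicate (k * Suc (length w)) 1) \<subseteq> {..<S}" using assms S3 by auto
  then show ?thesis unfolding mul_prog_def using assms
    by (simp add: sem_Seq mul_inner each_Q_P del: sem.simps replicate.simps mult_Suc_right)
qed

text \<open>The coefficient and the exponent of the length bound are constants of the language, so
  the corresponding repetitions are unrolled in the program.\<close>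

fun rep_prog :: "nat \<Rightarrow> prog \<Rightarrow> prog" where
  "rep_prog 0 p = Skip"
| "rep_prog (Suc n) p = Seq (rep_prog n p) p"

lemma rep_push: "(st w p q t y z r l u, \<sigma>') \<in> sem (rep_prog c (Push 1 1)) \<longleftrightarrow> \<sigma>' = st w (replicate c 1 @ p) q t y z r l u"
  by (induction c arbitrary: \<sigma>') (simp_all add: sem_iffs del: sem.simps)

lemma rep_mul:
  assumes "set w \<subseteq> {..<S}"
  shows "(st w (replicate c 1) [] [] y z r l u, \<sigma>') \<in> sem (rep_prog k mul_prog) \<longleftrightarrow>
    \<sigma>' = st w (replicate (c * Suc (length w) ^ k) 1) [] [] y z r l u"
proof (induction k arbitrary: \<sigma>')
  case (Suc k)
  have e: "c * Suc (length w) ^ k * Suc (length w) = c * Suc (length w) ^ Suc k"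
    by (simp only: power_Suc2 mult.assoc)
  show ?case using Suc mul_sem[OF assms refl] by (simp add: sem_Seq e del: sem.simps mult_Suc_right power_Suc)
qed (simp add: sem_Skip del: sem.simps)

text \<open>Each unit of the length bound allows one letter or none, so precisely the words up to
  the bound can be guessed. Stack 2 preserves the bound for the later search.\<close>

definition guess_prog :: prog where
  "guess_prog = Seq (each S 1 (\<lambda>s. Seq (Push 2 s) (Alt Skip (Alt (Push 4 1) (Push 4 2))))) (each S 2 (Push 1))"

lemma guess_inner:
  "set p \<subseteq> {..<S} \<Longrightarrow> (st w p q t y z r l u, \<sigma>') \<in> sem (each S 1 (\<lambda>s. Seq (Push 2 s) (Alt Skip (Alt (Push 4 1) (Push 4 2))))) \<longleftrightarrow>
    (\<exists>y'. set y' \<subseteq> {1, 2} \<and> length y' \<le> length p \<and> \<sigma>' = st w [] (rev p @ q) t (y' @ y) z r l u)"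
proof (induction p arbitrary: q y)
  case Nil
  show ?case by (auto simp: each_Nil simp del: sem.simps)
next
  case (Cons a p)
  have "(st w (a # p) q t y z r l u, \<sigma>') \<in> sem (each S 1 (\<lambda>s. Seq (Push 2 s) (Alt Skip (Alt (Push 4 1) (Push 4 2))))) \<longleftrightarrow>
    (\<exists>y0 \<in> {y, 1 # y, 2 # y}. \<exists>y'. set y' \<subseteq> {1, 2} \<and> length y' \<le> length p \<and> \<sigma>' = st w [] (rev p @ a # q) t (y' @ y0) z r l u)"
    using Cons by (auto simp: each_Cons sem_iffs simp del: sem.simps)
  also have "\<dots> \<longleftrightarrow> (\<exists>y'. set y' \<subseteq> {1, 2} \<and> length y' \<le> length (a # p) \<and> \<sigma>' = st w [] (rev (a # p) @ q) t (y' @ y) z r l u)"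
    (is "?L \<longleftrightarrow> ?R")
  proof
    assume ?L
    then obtain y0 y' where *: "y0 \<in> {y, 1 # y, 2 # y}" "set y' \<subseteq> {1, 2}" "length y' \<le> length p" "\<sigma>' = st w [] (rev p @ a # q) t (y' @ y0) z r l u"
      by blast
    from *(1) consider "y0 = y" | "y0 = 1 # y" | "y0 = 2 # y" by blast
    then show ?R
    proof cases
      case 1 then show ?thesis using * by (intro exI[of _ y']) auto
    next
      case 2 then show ?thesis using * by (intro exI[of _ "y' @ [1]"]) auto
    next
      case 3 then show ?thesis using * by (intro exI[of _ "y' @ [2]"]) auto
    qed
  next
    assume ?R
    then obtain y' where *: "set y' \<subseteq> {1, 2}" "length y' \<le> Suc (length p)" "\<sigma>' = st w [] (rev p @ a # q) t (y' @ y) z r l u"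
      by auto
    show ?L
    proof (cases "length y' \<le> length p")
      case True
      then show ?thesis using * by (intro bexI[of _ y] exI[of _ y']) auto
    next
      case False
      then have "y' \<noteq> []" by auto
      then obtain y1 b where b: "y' = y1 @ [b]" by (metis rev_exhaust)
      show ?thesis using * b by (intro bexI[of _ "b # y"] exI[of _ y1]) auto
    qed
  qed
  finally show ?case .
qed

lemma guess_sem:
  assumes "p = replicate k 1"
  shows "(st w p [] [] [] z r l u, \<sigma>') \<in> sem guess_prog \<longleftrightarrow>
    (\<exists>y. set y \<subseteq> {1, 2} \<and> length y \<le> k \<and> \<sigma>' = st w p [] [] y z r l u)"
proof -
  have "set p \<subseteq> {..<S}" "rev p = p" using assms S3 by auto
  moreover have "(st w p [] [] [] z r l u, \<sigma>') \<in> sem guess_prog \<longleftrightarrow>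
    (\<exists>y. set y \<subseteq> {1, 2} \<and> length y \<le> length p \<and> (st w [] (rev p) [] y z r l u, \<sigma>') \<in> sem (each S 2 (Push 1)))"
    unfolding guess_prog_def sem_Seq[of _ _ "each _ _ _"] guess_inner[OF calculation(1)] by auto
  ultimately show ?thesis using assms by (simp add: each_Q_P del: sem.simps)
qed

text \<open>Stack 3 holds the reversed word. Reading it back restores stack \<open>a\<close> and
  puts each letter in front of the tape; the marker 2 is pushed after the letter because it has to
  stand before it.\<close>

definition load_prog :: "nat \<Rightarrow> prog" where
  "load_prog a = Seq (each S a (Push 3)) (each S 3 (\<lambda>s. Seq (Push a s) (Seq (Push 6 s) (Push 6 2))))"

lemma load_T:
  "set w \<subseteq> {..<S} \<Longrightarrow> (st w p q t y z r l u, \<sigma>') \<in> sem (each S 0 (Push 3)) \<longleftrightarrow> \<sigma>' = st [] p q (rev w @ t) y z r l u"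
  "set y \<subseteq> {..<S} \<Longrightarrow> (st w p q t y z r l u, \<sigma>') \<in> sem (each S 4 (Push 3)) \<longleftrightarrow> \<sigma>' = st w p q (rev y @ t) [] z r l u"
  "set z \<subseteq> {..<S} \<Longrightarrow> (st w p q t y z r l u, \<sigma>') \<in> sem (each S 5 (Push 3)) \<longleftrightarrow> \<sigma>' = st w p q (rev z @ t) y [] r l u"
  subgoal by (induction w arbitrary: t) (simp_all add: each_Nil each_Cons del: sem.simps)
  subgoal by (induction y arbitrary: t) (simp_all add: each_Nil each_Cons del: sem.simps)
  subgoal by (induction z arbitrary: t) (simp_all add: each_Nil each_Cons del: sem.simps)
  done

lemma load_back:
  "set t \<subseteq> {..<S} \<Longrightarrow> (st w p q t y z r l u, \<sigma>') \<in> sem (each S 3 (\<lambda>s. Seq (Push 0 s) (Seq (Push 6 s) (Push 6 2)))) \<longleftrightarrow>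
    \<sigma>' = st (rev t @ w) p q [] y z (pairs (rev t) @ r) l u"
  "set t \<subseteq> {..<S} \<Longrightarrow> (st w p q t y z r l u, \<sigma>') \<in> sem (each S 3 (\<lambda>s. Seq (Push 4 s) (Seq (Push 6 s) (Push 6 2)))) \<longleftrightarrow>
    \<sigma>' = st w p q [] (rev t @ y) z (pairs (rev t) @ r) l u"
  "set t \<subseteq> {..<S} \<Longrightarrow> (st w p q t y z r l u, \<sigma>') \<in> sem (each S 3 (\<lambda>s. Seq (Push 5 s) (Seq (Push 6 s) (Push 6 2)))) \<longleftrightarrow>
    \<sigma>' = st w p q [] y (rev t @ z) (pairs (rev t) @ r) l u"
  subgoal by (induction t arbitrary: w r) (simp_all add: each_Nil each_Cons sem_Seq del: sem.simps)
  subgoal by (induction t arbitrary: y r) (simp_all add: each_Nil each_Cons sem_Seq del: sem.simps)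
  subgoal by (induction t arbitrary: z r) (simp_all add: each_Nil each_Cons sem_Seq del: sem.simps)
  done

lemma load_sem:
  "set w \<subseteq> {..<S} \<Longrightarrow> (st w p q [] y z r l u, \<sigma>') \<in> sem (load_prog 0) \<longleftrightarrow> \<sigma>' = st w p q [] y z (pairs w @ r) l u"
  "set y \<subseteq> {..<S} \<Longrightarrow> (st w p q [] y z r l u, \<sigma>') \<in> sem (load_prog 4) \<longleftrightarrow> \<sigma>' = st w p q [] y z (pairs y @ r) l u"
  "set z \<subseteq> {..<S} \<Longrightarrow> (st w p q [] y z r l u, \<sigma>') \<in> sem (load_prog 5) \<longleftrightarrow> \<sigma>' = st w p q [] y z (pairs z @ r) l u"
  unfolding load_prog_def by (simp_all add: sem_Seq load_T load_back del: sem.simps)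

text \<open>An exhausted half tape stands for blanks, so the symbol 0 may also be read from an empty
  stack.\<close>

definition rd :: "nat \<Rightarrow> nat \<Rightarrow> prog" where
  "rd a s = (if s = 0 then Alt (Pop a 0) (Emp a) else Pop a s)"

lemma rd_sem: "(\<sigma>, \<sigma>') \<in> sem (rd a s) \<longleftrightarrow> s = hd0 (\<sigma> a) \<and> \<sigma>' = \<sigma>(a := tl (\<sigma> a))"
  by (cases "\<sigma> a") (auto simp: rd_def)

definition wr :: "nat \<times> nat \<times> int \<Rightarrow> prog" where
  "wr x = (case x of (q, s, d) \<Rightarrow>
     Seq (if d = 1 then Push 7 s else if d = 0 then Push 6 s
          else Seq (Push 6 s) (alts (\<lambda>u. Seq (rd 7 u) (Push 6 u)) S)) (Push 8 q))"

text \<open>The current state and the scanned symbol are guessed, and only the right guess survives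
  the pops. There is no step from the halting state 1.\<close>

definition tm_prog :: prog where
  "tm_prog = alts (\<lambda>q. if q = 1 then Fail else alts (\<lambda>s. Seq (Pop 8 q) (Seq (rd 6 s) (wr (delta M q s)))) (ns M)) (nq M)"

lemma tm_sem:
  assumes "zok M (q, l, r)"
  shows "(st w p qq t y z r l [q], \<sigma>') \<in> sem tm_prog \<longleftrightarrow>
    q \<noteq> 1 \<and> (\<exists>q' l' r'. zstep M (q, l, r) = (q', l', r') \<and> \<sigma>' = st w p qq t y z r' l' [q'])"
proof (cases "q = 1")
  case True
  then show ?thesis by (auto simp: tm_prog_def sem_alts sem_iffs simp del: sem.simps(2,6))
next
  case False
  have h: "hd0 r < ns M" "hd0 l < S" using assms M S by (auto simp: valid_tm_def intro!: hd0_less)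
  obtain q' s' d where d: "delta M q (hd0 r) = (q', s', d)" by (cases "delta M q (hd0 r)")
  have "(st w p qq t y z r l [q], \<sigma>') \<in> sem tm_prog \<longleftrightarrow> (st w p qq t y z (tl r) l [], \<sigma>') \<in> sem (wr (delta M q (hd0 r)))"
  proof
    assume "(st w p qq t y z r l [q], \<sigma>') \<in> sem tm_prog"
    then obtain i s where "i < nq M" "(st w p qq t y z r l [q], \<sigma>') \<in> sem (Seq (Pop 8 i) (Seq (rd 6 s) (wr (delta M i s))))"
      by (auto simp: tm_prog_def sem_alts simp del: sem.simps(2,6) split: if_splits)
    then show "(st w p qq t y z (tl r) l [], \<sigma>') \<in> sem (wr (delta M q (hd0 r)))"
      by (auto simp: sem_Seq sem_Pop rd_sem simp del: sem.simps)
  next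
    assume a: "(st w p qq t y z (tl r) l [], \<sigma>') \<in> sem (wr (delta M q (hd0 r)))"
    have "(st w p qq t y z r l [q], \<sigma>') \<in> sem (Seq (Pop 8 q) (Seq (rd 6 (hd0 r)) (wr (delta M q (hd0 r)))))"
      using a by (simp add: sem_Seq sem_Pop rd_sem del: sem.simps)
    then have 1: "(st w p qq t y z r l [q], \<sigma>') \<in> sem (if q = 1 then Fail else alts (\<lambda>s. Seq (Pop 8 q) (Seq (rd 6 s) (wr (delta M q s)))) (ns M))"
      using False h(1) unfolding if_not_P[OF False] sem_alts by blast
    have "q < nq M" using assms by simp
    then show "(st w p qq t y z r l [q], \<sigma>') \<in> sem tm_prog"
      unfolding tm_prog_def sem_alts[of _ "nq M"] using 1 by blast
  qed
  also have "\<dots> \<longleftrightarrow> (\<exists>q'' l' r'. zmove d q' s' l (tl r) = (q'', l', r') \<and> \<sigma>' = st w p qq t y z r' l' [q''])"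
    using h(2) by (auto simp: d wr_def sem_Seq sem_alts rd_sem simp del: sem.simps)
  finally show ?thesis using False by (simp add: zstep.simps d del: zmove.simps)
qed

text \<open>Popping the state 1 after the loop discards all runs that leave the loop before the
  machine has halted.\<close>

lemma tm_star:
  assumes "zok M c" "c = (q, l, r)"
  shows "(st w p qq t y z r l [q], \<sigma>') \<in> sem (Seq (Star tm_prog) (Pop 8 1)) \<longleftrightarrow>
    (\<exists>n l' r'. (zstep M ^^ n) c = (1, l', r') \<and> \<sigma>' = st w p qq t y z r' l' [])"
proof
  assume "(st w p qq t y z r l [q], \<sigma>') \<in> sem (Seq (Star tm_prog) (Pop 8 1))"
  then obtain \<tau> where \<tau>: "(st w p qq t y z r l [q], \<tau>) \<in> (sem tm_prog)\<^sup>*" "(\<tau>, \<sigma>') \<in> sem (Pop 8 1)"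
    unfolding sem_Seq sem.simps(8) by blast
  have "\<exists>n q' l' r'. (zstep M ^^ n) c = (q', l', r') \<and> zok M (q', l', r') \<and> \<tau> = st w p qq t y z r' l' [q']"
    using \<tau>(1)
  proof (induction rule: rtrancl_induct)
    case base
    show ?case by (rule exI[of _ 0]) (use assms in auto)
  next
    case (step \<tau> \<tau>')
    then obtain n q' l' r' where n: "(zstep M ^^ n) c = (q', l', r')" "zok M (q', l', r')" "\<tau> = st w p qq t y z r' l' [q']" by blast
    with step(2) tm_sem[OF n(2)] obtain q2 l2 r2 where
      "zstep M (q', l', r') = (q2, l2, r2)" "\<tau>' = st w p qq t y z r2 l2 [q2]" by blast
    then show ?case using n zstep_ok[OF M n(2)]
      by (intro exI[of _ "Suc n"] exI[of _ q2] exI[of _ l2] exI[of _ r2] conjI) simp_all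
  qed
  then show "\<exists>n l' r'. (zstep M ^^ n) c = (1, l', r') \<and> \<sigma>' = st w p qq t y z r' l' []"
    using \<tau>(2) by (auto simp: sem_Pop simp del: sem.simps)
next
  assume "\<exists>n l' r'. (zstep M ^^ n) c = (1, l', r') \<and> \<sigma>' = st w p qq t y z r' l' []"
  then obtain n l' r' where n: "(zstep M ^^ n) c = (1, l', r')" "\<sigma>' = st w p qq t y z r' l' []" by blast
  have "(st w p qq t y z r l [q], st w p qq t y z r' l' [1]) \<in> (sem tm_prog)\<^sup>*"
    using n(1) assms
  proof (induction n arbitrary: c q l r)
    case 0
    then show ?case by simp
  next
    case (Suc n)
    show ?case
    proof (cases "q = 1")
      case True
      then have "(zstep M ^^ Suc n) c = c" using Suc.prems by (intro zsteps_halted) simp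
      then show ?thesis using Suc.prems True by simp
    next
      case False
      obtain q2 l2 r2 where z: "zstep M c = (q2, l2, r2)" by (cases "zstep M c")
      have "(zstep M ^^ n) (q2, l2, r2) = (1, l', r')" using Suc.prems(1) z by (simp add: funpow_swap1)
      then have "(st w p qq t y z r2 l2 [q2], st w p qq t y z r' l' [1]) \<in> (sem tm_prog)\<^sup>*"
        using Suc.IH zstep_ok[OF M Suc.prems(2)] z by metis
      moreover have "(st w p qq t y z r l [q], st w p qq t y z r2 l2 [q2]) \<in> sem tm_prog"
        using tm_sem[of q l r] Suc.prems z False by auto
      ultimately show ?thesis by (rule converse_rtrancl_into_rtrancl[rotated])
    qed
  qed
  then show "(st w p qq t y z r l [q], \<sigma>') \<in> sem (Seq (Star tm_prog) (Pop 8 1))"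
    unfolding sem_Seq sem.simps(8) using n(2) by (auto simp: sem_Pop simp del: sem.simps)
qed

definition run_prog :: prog where "run_prog = Seq (Star tm_prog) (Pop 8 1)"

text \<open>The tape is a stack, so the components of \<open>tuple3\<close> are loaded from last to
  first; two symbols 1 code a separator. The run survives only if the machine halts on a symbol
  other than 2, that is, if \<open>V\<close> rejects. Clearing both half tapes restores the stacks
  for the next round.\<close>

definition check_prog :: prog where
  "check_prog = Seq (load_prog 5) (Seq (Push 6 1) (Seq (Push 6 1) (Seq (load_prog 4) (Seq (Push 6 1) (Seq (Push 6 1)
     (Seq (load_prog 0) (Seq (Push 8 0) (Seq run_prog
     (Seq (alts (\<lambda>s. if s = 2 then Fail else rd 6 s) S) (Seq (each S 6 (\<lambda>_. Skip)) (each S 7 (\<lambda>_. Skip))))))))))))"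

lemma clear_sem:
  "set r \<subseteq> {..<S} \<Longrightarrow> (st w p q t y z r l u, \<sigma>') \<in> sem (each S 6 (\<lambda>_. Skip)) \<longleftrightarrow> \<sigma>' = st w p q t y z [] l u"
  "set l \<subseteq> {..<S} \<Longrightarrow> (st w p q t y z r l u, \<sigma>') \<in> sem (each S 7 (\<lambda>_. Skip)) \<longleftrightarrow> \<sigma>' = st w p q t y z r [] u"
  subgoal by (induction r) (simp_all add: each_Nil each_Cons sem_Skip del: sem.simps)
  subgoal by (induction l) (simp_all add: each_Nil each_Cons sem_Skip del: sem.simps)
  done

lemma tuple3_code: "map bcode (tuple3 w y z) =
  pairs (map bcode w) @ 1 # 1 # pairs (map bcode y) @ 1 # 1 # pairs (map bcode z)"
  by (simp add: tuple3_def pairs_dbl)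

lemma bcode_less: "set (map bcode w) \<subseteq> {..<S}" using S3 by (auto simp: bcode_def)

lemma check_sem:
  assumes V: "\<And>x. \<exists>t. fst ((tm_step M ^^ t) (tm_init x)) = 1 \<and> tm_output ((tm_step M ^^ t) (tm_init x)) = [V x]"
  shows "(st (map bcode w) p q [] (map bcode y) (map bcode z) [] [] [], \<sigma>') \<in> sem check_prog \<longleftrightarrow>
    \<not> V (tuple3 w y z) \<and> \<sigma>' = st (map bcode w) p q [] (map bcode y) (map bcode z) [] [] []"
proof -
  let ?x = "tuple3 w y z"
  let ?st = "\<lambda>r l u. st (map bcode w) p q [] (map bcode y) (map bcode z) r l u"
  have zi: "zinit ?x = (0, [], map bcode ?x)" by (simp add: zinit_def)
  obtain t where t: "fst ((tm_step M ^^ t) (tm_init ?x)) = 1" "tm_output ((tm_step M ^^ t) (tm_init ?x)) = [V ?x]"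
    using V by blast
  obtain q0 l0 r0 where z0: "(zstep M ^^ t) (zinit ?x) = (q0, l0, r0)" by (cases "(zstep M ^^ t) (zinit ?x)")
  note zs = zsteps[OF M, of t ?x, unfolded z0]
  have q0: "q0 = 1" using zrep_fst[OF conjunct2[OF zs]] t(1) by simp
  have VV: "V ?x \<longleftrightarrow> hd0 r0 = 2" using zrep_output1[OF conjunct2[OF zs] t(2)] .
  have less: "set l0 \<subseteq> {..<S}" "set (tl r0) \<subseteq> {..<S}" "hd0 r0 < S"
    using conjunct1[OF zs] S S3 by (auto intro!: set_tl_subset hd0_less)
  have run: "(?st (map bcode ?x) [] [0], \<tau>) \<in> sem run_prog \<longleftrightarrow> \<tau> = ?st r0 l0 []" for \<tau>
    unfolding run_prog_def tm_star[OF zinit_ok[OF M, of ?x] zi]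
  proof
    assume "\<exists>n l' r'. (zstep M ^^ n) (zinit ?x) = (1, l', r') \<and> \<tau> = ?st r' l' []"
    then obtain n l' r' where n: "(zstep M ^^ n) (zinit ?x) = (1, l', r')" "\<tau> = ?st r' l' []" by blast
    have "(zstep M ^^ n) (zinit ?x) = (zstep M ^^ t) (zinit ?x)"
      by (rule zsteps_unique) (simp_all add: n z0 q0)
    then show "\<tau> = ?st r0 l0 []" using n z0 by simp
  qed (use z0 q0 in blast)
  have test: "(?st r0 l0 [], \<tau>) \<in> sem (alts (\<lambda>s. if s = 2 then Fail else rd 6 s) S) \<longleftrightarrow>
      hd0 r0 \<noteq> 2 \<and> \<tau> = ?st (tl r0) l0 []" for \<tau>
    using less(3) by (auto simp: sem_alts rd_sem simp del: sem.simps(1,2,3,4,6,7,8) split: if_splits)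
  show ?thesis unfolding check_prog_def
    using bcode_less
    by (simp add: sem_Seq load_sem tuple3_code[symmetric] run test clear_sem less VV del: sem.simps)
qed

text \<open>Addition of 1 in bijective base 2, least significant digit first: leading digits 2
  become 1 with a carry, then the next digit 1 becomes 2, or a new digit 1 is appended.\<close>

definition inc_prog :: prog where
  "inc_prog = Seq (Seq (Star (Seq (Pop 5 2) (Push 3 1)))
     (Alt (Seq (Emp 5) (Push 5 1)) (Seq (Pop 5 1) (Push 5 2)))) (each S 3 (Push 5))"

fun nxt :: "bool list \<Rightarrow> bool list" where
  "nxt [] = [False]"
| "nxt (False # zs) = True # zs"
| "nxt (True # zs) = False # nxt zs"

lemma each_T_Z:
  "set t \<subseteq> {..<S} \<Longrightarrow> (st w p q t y z r l u, \<sigma>') \<in> sem (each S 3 (Push 5)) \<longleftrightarrow>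
    \<sigma>' = st w p q [] y (rev t @ z) r l u"
  by (induction t arbitrary: z) (simp_all add: each_Nil each_Cons del: sem.simps)

text \<open>\<open>Star\<close> may stop at any time, but one of the two alternatives applies only
  after all leading digits 2 are gone. The equation for \<open>j\<close> pins down this point, so
  that the split between stacks 3 and 5 is unique.\<close>

lemma inc_inner:
  "(st w p q (replicate k 1) y (map bcode z) r l u, \<sigma>') \<in> sem (Seq (Star (Seq (Pop 5 2) (Push 3 1)))
     (Alt (Seq (Emp 5) (Push 5 1)) (Seq (Pop 5 1) (Push 5 2)))) \<longleftrightarrow>
   (\<exists>j z'. \<sigma>' = st w p q (replicate j 1) y z' r l u \<and> replicate j 1 @ z' = replicate k 1 @ map bcode (nxt z) \<and> z' \<noteq> [] \<and> j = k + length (takeWhile id z))"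
proof (induction z arbitrary: k rule: nxt.induct)
  case 1
  show ?case unfolding sem.simps(6) sem.simps(8)
    by (subst star_unfold) (auto simp: bcode_def)
next
  case (2 zs)
  show ?case unfolding sem.simps(6) sem.simps(8)
    by (subst star_unfold) (auto simp: bcode_def)
next
  case (3 zs)
  have "(st w p q (replicate k 1) y (map bcode (True # zs)) r l u, \<sigma>') \<in> sem (Seq (Star (Seq (Pop 5 2) (Push 3 1)))
     (Alt (Seq (Emp 5) (Push 5 1)) (Seq (Pop 5 1) (Push 5 2)))) \<longleftrightarrow>
    (st w p q (replicate (Suc k) 1) y (map bcode zs) r l u, \<sigma>') \<in> sem (Seq (Star (Seq (Pop 5 2) (Push 3 1)))
     (Alt (Seq (Emp 5) (Push 5 1)) (Seq (Pop 5 1) (Push 5 2))))"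
    unfolding sem.simps(6)[of "Star _"] sem.simps(8)
    by (subst star_unfold) (auto simp: bcode_def sem_iffs simp del: sem.simps)
  then show ?case using 3[of "Suc k"]
    by (simp add: replicate_app_Cons_same del: sem.simps)
qed

lemma inc_sem:
  "(st w p q [] y (map bcode z) r l u, \<sigma>') \<in> sem inc_prog \<longleftrightarrow> \<sigma>' = st w p q [] y (map bcode (nxt z)) r l u"
proof -
  have one: "set (replicate j 1) \<subseteq> {..<S}" for j using S3 by auto
  have a1: "replicate j (1::nat) @ z' = map bcode (nxt z) \<Longrightarrow> j = length (takeWhile id z) \<Longrightarrow> z' = drop j (map bcode (nxt z))" for j z'
    by (metis append_eq_conv_conj length_replicate)
  have a2: "replicate (length (takeWhile id z)) 1 @ drop (length (takeWhile id z)) (map bcode (nxt z)) = map bcode (nxt z)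
    \<and> drop (length (takeWhile id z)) (map bcode (nxt z)) \<noteq> []"
    by (induction z rule: nxt.induct) (auto simp: bcode_def)
  define j D where jdef: "j = length (takeWhile id z)" "D = drop (length (takeWhile id z)) (map bcode (nxt z))"
  have jD: "replicate j 1 @ D = map bcode (nxt z)" "D \<noteq> []"
    using a2 unfolding jdef by blast+
  have jD': "z' = D" if "replicate j (1::nat) @ z' = map bcode (nxt z)" for z'
    using a1[OF that jdef(1)] unfolding jdef .
  have inner: "(st w p q [] y (map bcode z) r l u, \<tau>) \<in> sem (Seq (Star (Seq (Pop 5 2) (Push 3 1)))
     (Alt (Seq (Emp 5) (Push 5 1)) (Seq (Pop 5 1) (Push 5 2)))) \<longleftrightarrow>
     \<tau> = st w p q (replicate j 1) y D r l u" for \<tau>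
  proof -
    have "(\<exists>j' z'. \<tau> = st w p q (replicate j' 1) y z' r l u \<and> replicate j' 1 @ z' = map bcode (nxt z) \<and> z' \<noteq> [] \<and> j' = j) \<longleftrightarrow>
      \<tau> = st w p q (replicate j 1) y D r l u" using jD jD' by blast
    then show ?thesis using inc_inner[of w p q 0 y z r l u \<tau>] unfolding jdef(1)
      by (simp del: sem.simps)
  qed
  show ?thesis unfolding inc_prog_def sem_Seq[of _ _ "Seq _ _"] inner
    using each_T_Z[OF one[of j], of w p q y D r l u \<sigma>'] jD(1) by auto
qed

text \<open>Bijective base 2 numeration: \<open>nxt\<close> enumerates all words in the order of their length.\<close>
fun bval :: "bool list \<Rightarrow> nat" where
  "bval [] = 0"
| "bval (b # bs) = (if b then 2 else 1) + 2 * bval bs"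

lemma bval_nxt: "bval (nxt z) = Suc (bval z)"
  by (induction z rule: nxt.induct) auto

lemma bval_inj: "bval x = bval y \<Longrightarrow> x = y"
proof (induction x arbitrary: y)
  case Nil
  then show ?case by (cases y) (auto split: if_splits)
next
  case (Cons b x)
  then obtain b' y' where y: "y = b' # y'" by (cases y) (auto split: if_splits)
  have "b = b'" using Cons.prems unfolding y by (cases b; cases b') (simp_all, presburger+)
  then show ?case using Cons unfolding y by (auto split: if_splits)
qed

lemma bval_bounds: "2 ^ length z \<le> Suc (bval z) \<and> bval z + 2 \<le> 2 ^ Suc (length z)"
  by (induction z) auto

lemma nxt_iter: "bval ((nxt ^^ i) []) = i"
  by (induction i) (auto simp: bval_nxt)

lemma nxt_iter_bval: "(nxt ^^ bval z) [] = z"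
  by (rule bval_inj) (simp add: nxt_iter)

lemma bval_length_less: "length x < length y \<Longrightarrow> bval x < bval y"
proof -
  assume "length x < length y"
  then have "(2::nat) ^ Suc (length x) \<le> 2 ^ length y" by (intro power_increasing) auto
  then show ?thesis using bval_bounds[of x] bval_bounds[of y] by simp
qed

text \<open>One letter of \<open>z\<close> is removed for each unit of the bound and then one more,
  which succeeds only for words longer than the bound.\<close>

definition long_prog :: prog where
  "long_prog = Seq (each S 1 (\<lambda>_. Alt (Pop 5 1) (Pop 5 2))) (Alt (Pop 5 1) (Pop 5 2))"

lemma bcode_pop: "(st w p q t y (map bcode z) r l u, \<sigma>') \<in> sem (Alt (Pop 5 1) (Pop 5 2)) \<longleftrightarrow>
  z \<noteq> [] \<and> \<sigma>' = st w p q t y (map bcode (tl z)) r l u"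
  by (cases z) (auto simp: sem_iffs bcode_def simp del: sem.simps)

lemma long_sem:
  "set p \<subseteq> {..<S} \<Longrightarrow> (\<exists>\<sigma>'. (st w p q t y (map bcode z) r l u, \<sigma>') \<in> sem long_prog) \<longleftrightarrow> length z > length p"
  unfolding long_prog_def
proof (induction p arbitrary: z)
  case Nil
  then show ?case by (simp add: sem_Seq each_Nil bcode_pop del: sem.simps)
next
  case (Cons a p)
  let ?P = "Alt (Pop 5 1) (Pop 5 2)"
  have "(\<exists>\<sigma>'. (st w (a # p) q t y (map bcode z) r l u, \<sigma>') \<in> sem (Seq (each S 1 (\<lambda>_. ?P)) ?P)) \<longleftrightarrow>
    z \<noteq> [] \<and> (\<exists>\<sigma>'. (st w p q t y (map bcode (tl z)) r l u, \<sigma>') \<in> sem (Seq (each S 1 (\<lambda>_. ?P)) ?P))"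
    using Cons.prems by (auto simp: sem_Seq[of _ _ "each _ _ _"] each_Cons bcode_pop simp del: sem.simps)
  also have "\<dots> \<longleftrightarrow> length z > length (a # p)"
    using Cons.IH[of "tl z"] Cons.prems by (cases z) (simp_all del: sem.simps)
  finally show ?case .
qed

lemma prog_ok_run: "prog_ok R S' run_prog \<longleftrightarrow> prog_ok R S' tm_prog \<and> 8 < R \<and> 1 < S'"
  by (auto simp: run_prog_def)

definition main_prog :: "nat \<Rightarrow> nat \<Rightarrow> prog" where
  "main_prog c k = Seq (rep_prog c (Push 1 1)) (Seq (rep_prog k mul_prog) (Seq guess_prog
     (Seq (Star (Seq check_prog inc_prog)) long_prog)))"

text \<open>Words are checked in the order of their length, and a run can end only at a word longer
  than the bound; by then every word within the bound has been rejected. The checks need no time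
  limit, because the machine halts on every input.\<close>

theorem main_sem:
  assumes V: "\<And>x. \<exists>t. fst ((tm_step M ^^ t) (tm_init x)) = 1 \<and> tm_output ((tm_step M ^^ t) (tm_init x)) = [V x]"
  shows "(\<exists>\<sigma>'. (st (map bcode w) [] [] [] [] [] [] [] [], \<sigma>') \<in> sem (main_prog c k)) \<longleftrightarrow>
    (\<exists>y. length y \<le> c * (length w + 1) ^ k \<and> (\<forall>z. length z \<le> c * (length w + 1) ^ k \<longrightarrow> \<not> V (tuple3 w y z)))"
proof -
  define N where "N = c * Suc (length w) ^ k"
  let ?p = "replicate N (1::nat)"
  let ?st = "\<lambda>y z. st (map bcode w) ?p [] [] (map bcode y) (map bcode z) [] [] []"
  have body: "(?st y z, \<tau>) \<in> sem (Seq check_prog inc_prog) \<longleftrightarrow> \<not> V (tuple3 w y z) \<and> \<tau> = ?st y (nxt z)" for y z \<tau>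
    by (simp add: sem_Seq check_sem[OF V] inc_sem del: sem.simps)
  have iter: "(?st y [], \<tau>) \<in> (sem (Seq check_prog inc_prog))\<^sup>* \<longleftrightarrow>
     (\<exists>i. (\<forall>j<i. \<not> V (tuple3 w y ((nxt ^^ j) []))) \<and> \<tau> = ?st y ((nxt ^^ i) []))" for y \<tau>
  proof
    assume "(?st y [], \<tau>) \<in> (sem (Seq check_prog inc_prog))\<^sup>*"
    then show "\<exists>i. (\<forall>j<i. \<not> V (tuple3 w y ((nxt ^^ j) []))) \<and> \<tau> = ?st y ((nxt ^^ i) [])"
    proof (induction rule: rtrancl_induct)
      case base
      show ?case by (intro exI[of _ 0]) simp
    next
      case (step \<tau> \<tau>')
      then obtain i where i: "\<forall>j<i. \<not> V (tuple3 w y ((nxt ^^ j) []))" "\<tau> = ?st y ((nxt ^^ i) [])" by blast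
      then have "\<not> V (tuple3 w y ((nxt ^^ i) [])) \<and> \<tau>' = ?st y (nxt ((nxt ^^ i) []))" using step(2) body by simp
      then show ?case using i by (intro exI[of _ "Suc i"]) (auto simp: less_Suc_eq)
    qed
  next
    assume "\<exists>i. (\<forall>j<i. \<not> V (tuple3 w y ((nxt ^^ j) []))) \<and> \<tau> = ?st y ((nxt ^^ i) [])"
    then obtain i where i: "\<forall>j<i. \<not> V (tuple3 w y ((nxt ^^ j) []))" "\<tau> = ?st y ((nxt ^^ i) [])" by blast
    have "(?st y [], ?st y ((nxt ^^ i) [])) \<in> (sem (Seq check_prog inc_prog))\<^sup>*" using i(1)
    proof (induction i)
      case (Suc i)
      then have "(?st y ((nxt ^^ i) []), ?st y ((nxt ^^ Suc i) [])) \<in> sem (Seq check_prog inc_prog)" using body by simp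
      then show ?case using Suc by (simp only: less_Suc_eq) (meson rtrancl.rtrancl_into_rtrancl)
    qed simp
    then show "(?st y [], \<tau>) \<in> (sem (Seq check_prog inc_prog))\<^sup>*" using i by simp
  qed
  have loop: "(\<exists>\<sigma>'. (?st y [], \<sigma>') \<in> sem (Seq (Star (Seq check_prog inc_prog)) long_prog)) \<longleftrightarrow>
    (\<forall>z. length z \<le> N \<longrightarrow> \<not> V (tuple3 w y z))" for y
  proof -
    have "(\<exists>\<sigma>'. (?st y [], \<sigma>') \<in> sem (Seq (Star (Seq check_prog inc_prog)) long_prog)) \<longleftrightarrow>
      (\<exists>i. (\<forall>j<i. \<not> V (tuple3 w y ((nxt ^^ j) []))) \<and> (\<exists>\<sigma>'. (?st y ((nxt ^^ i) []), \<sigma>') \<in> sem long_prog))"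
      unfolding sem_Seq[of _ _ "Star _"] sem.simps(8) iter by blast
    also have "\<dots> \<longleftrightarrow> (\<exists>i. (\<forall>j<i. \<not> V (tuple3 w y ((nxt ^^ j) []))) \<and> length ((nxt ^^ i) []) > N)"
      by (subst long_sem) (use S3 in auto)
    also have "\<dots> \<longleftrightarrow> (\<forall>z. length z \<le> N \<longrightarrow> \<not> V (tuple3 w y z))"
    proof
      assume "\<exists>i. (\<forall>j<i. \<not> V (tuple3 w y ((nxt ^^ j) []))) \<and> length ((nxt ^^ i) []) > N"
      then obtain i where i: "\<forall>j<i. \<not> V (tuple3 w y ((nxt ^^ j) []))" "length ((nxt ^^ i) []) > N" by blast
      show "\<forall>z. length z \<le> N \<longrightarrow> \<not> V (tuple3 w y z)"
      proof (intro allI impI)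
        fix z :: "bool list" assume "length z \<le> N"
        then have "length z < length ((nxt ^^ i) [])" using i(2) by simp
        then have "bval z < i" using bval_length_less nxt_iter by metis
        then show "\<not> V (tuple3 w y z)" using i(1) nxt_iter_bval by metis
      qed
    next
      assume a: "\<forall>z. length z \<le> N \<longrightarrow> \<not> V (tuple3 w y z)"
      \<comment> \<open>The word of \<open>N + 1\<close> letters \<open>False\<close> is the first
        one longer than \<open>N\<close>; its number is \<open>2 ^ Suc N - 1\<close>.\<close>
      define i where "i = bval (replicate (Suc N) False)"
      have "\<not> V (tuple3 w y ((nxt ^^ j) []))" if "j < i" for j
      proof -
        have "length ((nxt ^^ j) []) \<le> N"
        proof (rule ccontr)
          assume "\<not> length ((nxt ^^ j) []) \<le> N"
          then have "(2::nat) ^ Suc N \<le> 2 ^ length ((nxt ^^ j) [])" by (intro power_increasing) auto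
          then have "2 ^ Suc N \<le> Suc j" using bval_bounds[of "(nxt ^^ j) []"] nxt_iter[of j] by simp
          moreover have "Suc (bval (replicate m False)) = 2 ^ m" for m by (induction m) auto
          then have "Suc i = 2 ^ Suc N" unfolding i_def by blast
          ultimately show False using that by simp
        qed
        then show ?thesis using a by blast
      qed
      then show "\<exists>i. (\<forall>j<i. \<not> V (tuple3 w y ((nxt ^^ j) []))) \<and> length ((nxt ^^ i) []) > N"
        by (intro exI[of _ i]) (simp add: i_def nxt_iter_bval del: replicate.simps)
    qed
    finally show ?thesis .
  qed
  have onetwo: "set y \<subseteq> {1, 2} \<Longrightarrow> \<exists>y'. y = map bcode y'" for y
  proof (intro exI[of _ "map (\<lambda>s. s = 2) y"])
    assume "set y \<subseteq> {1, 2}"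
    then show "y = map bcode (map (\<lambda>s. s = 2) y)" by (induction y) (auto simp: bcode_def)
  qed
  have bset: "set (map bcode y) \<subseteq> {1, 2}" for y by (auto simp: bcode_def)
  have "(\<exists>\<sigma>'. (st (map bcode w) [] [] [] [] [] [] [] [], \<sigma>') \<in> sem (main_prog c k)) \<longleftrightarrow>
    (\<exists>y \<sigma>'. set y \<subseteq> {1, 2} \<and> length y \<le> N \<and> (st (map bcode w) ?p [] [] y [] [] [] [], \<sigma>') \<in> sem (Seq (Star (Seq check_prog inc_prog)) long_prog))"
    unfolding main_prog_def sem_Seq[of _ _ "rep_prog _ _"] sem_Seq[of _ _ guess_prog]
    by (simp add: rep_push rep_mul[OF bcode_less] guess_sem[OF refl] N_def del: sem.simps) blast
  also have "\<dots> \<longleftrightarrow> (\<exists>y. length y \<le> N \<and> (\<exists>\<sigma>'. (?st y [], \<sigma>') \<in> sem (Seq (Star (Seq check_prog inc_prog)) long_prog)))"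
    (is "?L \<longleftrightarrow> ?R")
  proof
    assume ?L
    then obtain y \<sigma>' where y: "set y \<subseteq> {1, 2}" "length y \<le> N"
      "(st (map bcode w) ?p [] [] y [] [] [] [], \<sigma>') \<in> sem (Seq (Star (Seq check_prog inc_prog)) long_prog)" by blast
    obtain y' where "y = map bcode y'" using onetwo[OF y(1)] by blast
    then show ?R using y by (intro exI[of _ y']) auto
  next
    assume ?R
    then obtain y \<sigma>' where y: "length y \<le> N" "(?st y [], \<sigma>') \<in> sem (Seq (Star (Seq check_prog inc_prog)) long_prog)" by blast
    then show ?L using bset[of y] by (intro exI[of _ "map bcode y"] exI[of _ \<sigma>']) simp
  qed
  also have "\<dots> \<longleftrightarrow> (\<exists>y. length y \<le> N \<and> (\<forall>z. length z \<le> N \<longrightarrow> \<not> V (tuple3 w y z)))"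
    unfolding loop ..
  finally show ?thesis by (simp only: N_def Suc_eq_plus1)
qed

lemma prog_ok_rep: "prog_ok R S' (rep_prog n p) \<longleftrightarrow> n = 0 \<or> prog_ok R S' p"
  by (induction n) auto

lemma main_ok: "prog_ok 9 S (main_prog c k)"
proof -
  have rd: "prog_ok 9 S (rd a s)" if "a < 9" "s < S" for a s using that S3 by (auto simp: rd_def)
  have "prog_ok 9 S (wr (delta M q s))" if "q < nq M" "s < ns M" for q s
  proof -
    obtain q' s' d where d: "delta M q s = (q', s', d)" by (cases "delta M q s")
    have "q' < S" "s' < S" using valid_delta[OF M that d] S by auto
    then show ?thesis by (auto simp: d wr_def prog_ok_alts rd)
  qed
  then have "prog_ok 9 S tm_prog" using S by (auto simp: tm_prog_def prog_ok_alts rd)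
  then show ?thesis using S3
    by (auto simp: main_prog_def prog_ok_rep mul_prog_def guess_prog_def check_prog_def inc_prog_def
        long_prog_def load_prog_def prog_ok_run prog_ok_each prog_ok_alts rd)
qed

end

declare One_nat_def [simp]

section \<open>Runs as rectangular pictures\<close>

text \<open>A row has the control location in column 1, the stacks in columns 2 to
  \<open>W + 1\<close>, with the entries of equal depth of all stacks in one cell, and an end marker
  with a flag in column \<open>W + 2\<close>. States travel from west to east: \<open>Go\<close>
  starts an ordinary row, \<open>Top\<close> the last one.\<close>

datatype asym = SLoc "prog list" | SCell "nat \<Rightarrow> nat" | SEnd bool
datatype ast = Go | Top bool | Err | Idt | Psh nat nat | Pp nat nat | Em nat

fun is_top :: "ast \<Rightarrow> bool" where
  "is_top (Top b) \<longleftrightarrow> True"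
| "is_top _ \<longleftrightarrow> False"

fun is_end :: "asym \<Rightarrow> bool" where
  "is_end (SEnd b) \<longleftrightarrow> True"
| "is_end _ \<longleftrightarrow> False"

text \<open>A row is correct only if nothing is left over at the end marker: a pushed stack must
  have found room, and the last guess of a pop must be that no entry follows. The value 0 means no
  entry.\<close>

fun final :: "ast \<Rightarrow> bool" where
  "final Idt \<longleftrightarrow> True"
| "final (Psh r u) \<longleftrightarrow> u = 0"
| "final (Pp r u) \<longleftrightarrow> u = 0"
| "final _ \<longleftrightarrow> False"

fun start :: "act \<Rightarrow> ast" where
  "start (Prim (Push r s)) = Psh r (Suc s)"
| "start (Prim (Pop r s)) = Pp r (Suc s)"
| "start (Prim (Emp r)) = Em r"
| "start _ = Idt"

text \<open>One cell of a row: the symbol below and the state from the left determine the admissible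
  symbols above and states to the right.  The result \<open>None\<close> marks a rejecting corner.  The states \<open>Psh r u\<close> and
  \<open>Pp r u\<close> carry an entry of stack \<open>r\<close> to the right; a pop guesses the next entry.  The relation is made total by
  the rules for \<open>Err\<close>, which set the flag of the end marker to \<open>False\<close>.\<close>
inductive tr :: "nat \<Rightarrow> asym \<Rightarrow> ast \<Rightarrow> asym option \<Rightarrow> ast \<Rightarrow> bool" for S where
  top_loc: "tr S (SLoc X) (Top b) (Some (SLoc X)) (Top (X = []))"
| top_cell: "tr S (SCell v) (Top b) (Some (SCell v)) (Top b)"
| top_end: "tr S (SEnd f) (Top b) (if f \<and> b then Some (SEnd f) else None) (Top b)"
| err: "\<not> is_top q \<Longrightarrow> \<not> is_end s \<Longrightarrow> tr S s q (Some s) Err"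
| err_end: "\<not> is_top q \<Longrightarrow> tr S (SEnd f) q (Some (SEnd (f \<and> final q))) Err"
| loc: "(a, Y) \<in> edges X \<Longrightarrow> tr S (SLoc X) Go (Some (SLoc Y)) (start a)"
| idt: "tr S (SCell v) Idt (Some (SCell v)) Idt"
| psh: "tr S (SCell v) (Psh r u) (Some (SCell (v(r := u)))) (Psh r (v r))"
| pp: "v r = u \<Longrightarrow> u' \<le> S \<Longrightarrow> tr S (SCell v) (Pp r u) (Some (SCell (v(r := u')))) (Pp r u')"
| em: "v r = 0 \<Longrightarrow> tr S (SCell v) (Em r) (Some (SCell v)) Idt"

lemma start_not_top [simp]: "\<not> is_top (start a)"
  by (cases a rule: start.cases) auto

lemma tr_top: "tr S s q n e \<Longrightarrow> is_top e \<longleftrightarrow> is_top q"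
  by (induction rule: tr.induct) auto

lemma tr_is_end: "tr S s q n e \<Longrightarrow> n = Some s' \<Longrightarrow> is_end s' \<longleftrightarrow> is_end s"
  by (induction arbitrary: s' rule: tr.induct) (auto split: if_splits)

inductive_cases tr_LocGo: "tr S (SLoc X) Go n e"
inductive_cases tr_LocTop: "tr S (SLoc X) (Top b) n e"
inductive_cases tr_CellTop: "tr S (SCell v) (Top b) n e"
inductive_cases tr_EndTop: "tr S (SEnd f) (Top b) n e"
inductive_cases tr_CellErr: "tr S (SCell v) Err n e"
inductive_cases tr_CellIdt: "tr S (SCell v) Idt n e"
inductive_cases tr_CellPsh: "tr S (SCell v) (Psh r u) n e"
inductive_cases tr_CellPp: "tr S (SCell v) (Pp r u) n e"
inductive_cases tr_CellEm: "tr S (SCell v) (Em r) n e"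
inductive_cases tr_End: "tr S (SEnd f) q n e"

lemma tr_cell:
  assumes "e \<noteq> Err"
  shows "tr S (SCell v) Idt (Some b) e \<Longrightarrow> b = SCell v \<and> e = Idt"
    "tr S (SCell v) (Psh r u) (Some b) e \<Longrightarrow> b = SCell (v(r := u)) \<and> e = Psh r (v r)"
    "tr S (SCell v) (Pp r u) (Some b) e \<Longrightarrow> v r = u \<and> (\<exists>u'. b = SCell (v(r := u')) \<and> e = Pp r u')"
    "tr S (SCell v) (Em r) (Some b) e \<Longrightarrow> v r = 0 \<and> b = SCell v \<and> e = Idt"
  using assms by (auto elim: tr_CellIdt tr_CellPsh tr_CellPp tr_CellEm simp del: fun_upd_apply)

text \<open>The \<open>i\<close>-th entries of all stacks; 0 stands for the absence of an entry.\<close>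
definition cell :: "regs \<Rightarrow> nat \<Rightarrow> nat \<Rightarrow> nat" where
  "cell \<sigma> i = (\<lambda>r. if i < length (\<sigma> r) then Suc (\<sigma> r ! i) else 0)"

definition fits :: "nat \<Rightarrow> regs \<Rightarrow> bool" where
  "fits W \<sigma> \<longleftrightarrow> (\<forall>r. length (\<sigma> r) \<le> W)"

lemma cell_Push: "cell (\<sigma>(r := s # \<sigma> r)) i = (cell \<sigma> i)(r := if i = 0 then Suc s else cell \<sigma> (i - 1) r)"
  by (cases i) (auto simp: cell_def)

lemma cell_Pop: "\<sigma> r = s # l \<Longrightarrow> cell (\<sigma>(r := l)) i = (cell \<sigma> i)(r := cell \<sigma> (Suc i) r)"
  by (auto simp: cell_def)

lemma cell_zero: "cell \<sigma> i r = 0 \<longleftrightarrow> length (\<sigma> r) \<le> i"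
  by (auto simp: cell_def)

lemma cell_fits: "fits W \<sigma> \<Longrightarrow> W \<le> i \<Longrightarrow> cell \<sigma> i r = 0"
  by (auto simp: cell_zero fits_def intro: le_trans)

definition row :: "nat \<Rightarrow> prog list \<Rightarrow> regs \<Rightarrow> bool \<Rightarrow> nat \<Rightarrow> asym" where
  "row W X \<sigma> f x = (if x = 1 then SLoc X else if x = W + 2 then SEnd f else SCell (cell \<sigma> (x - 2)))"

lemma row_simps: "row W X \<sigma> f (Suc 0) = SLoc X" "row W X \<sigma> f (Suc (Suc W)) = SEnd f"
  "i < W \<Longrightarrow> row W X \<sigma> f (Suc (Suc i)) = SCell (cell \<sigma> i)"
  by (auto simp: row_def)

text \<open>A flag that is still \<open>True\<close> above shows that the state at the end marker is
  \<open>final\<close>. As \<open>Err\<close> persists up to the end, it cannot have occurred, and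
  without it the rules carry out the operation chosen at the location.\<close>

lemma row_pass:
  assumes tr: "\<And>x. 1 \<le> x \<Longrightarrow> x \<le> W + 2 \<Longrightarrow> tr S (row W X \<sigma> f x) (e (x - 1)) (Some (b x)) (e x)"
    and e0: "e 0 = Go" and W: "W \<ge> 1" and fit: "fits W \<sigma>" and last: "b (W + 2) = SEnd True"
  shows "f \<and> (\<exists>Y \<sigma>'. ((X, \<sigma>), (Y, \<sigma>')) \<in> pstep \<and> fits W \<sigma>' \<and> (\<forall>x. 1 \<le> x \<and> x \<le> W + 2 \<longrightarrow> b x = row W Y \<sigma>' True x))"
proof -
  define q where "q i = e (Suc i)" for i
  have t0: "tr S (SLoc X) Go (Some (b 1)) (q 0)" using tr[of 1] e0 by (simp add: row_simps q_def)
  have tc: "tr S (SCell (cell \<sigma> i)) (q i) (Some (b (i + 2))) (q (Suc i))" if "i < W" for i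
    using tr[of "i + 2"] that by (simp add: row_simps q_def)
  have te: "tr S (SEnd f) (q W) (Some (SEnd True)) (e (W + 2))"
    using tr[of "W + 2"] last by (simp add: row_simps q_def)
  have notop: "\<not> is_top (q 0)"
    using tr_top[OF t0] by simp
  have nt: "\<not> is_top (q i)" if "i \<le> W" for i
    using that
  proof (induction i)
    case (Suc i)
    then show ?case using tr_top[OF tc[of i]] by simp
  qed (rule notop)
  have fin: "f" "final (q W)"
    using te nt[of W] by (auto elim: tr_End)
  have abs: "q i = Err \<Longrightarrow> i + j \<le> W \<Longrightarrow> q (i + j) = Err" for i j
  proof (induction j)
    case (Suc j)
    then show ?case using tc[of "i + j"] by (auto elim: tr_CellErr)
  qed simp
  have noerr: "q i \<noteq> Err" if "i \<le> W" for i
    using abs[of i "W - i"] fin(2) that by auto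
  from t0 obtain a Y where a: "(a, Y) \<in> edges X" "b 1 = SLoc Y" "q 0 = start a"
    using noerr[of 0] by (cases rule: tr_LocGo) auto
  have res: "?thesis" if s: "(\<sigma>, \<sigma>') \<in> act_sem a" "fits W \<sigma>'" and c: "\<And>i. i < W \<Longrightarrow> b (i + 2) = SCell (cell \<sigma>' i)" for \<sigma>'
  proof -
    have "b x = row W Y \<sigma>' True x" if x: "1 \<le> x" "x \<le> W + 2" for x
    proof -
      consider "x = 1" | "x = W + 2" | "x - 2 < W" "x = x - 2 + 2" "x \<noteq> 1" "x \<noteq> W + 2" using x by linarith
      then show ?thesis
      proof cases
        case 3
        then show ?thesis using c[of "x - 2"] by (simp add: row_def)
      qed (use a(2) last in \<open>simp_all add: row_def\<close>)
    qed
    then have "\<forall>x. 1 \<le> x \<and> x \<le> W + 2 \<longrightarrow> b x = row W Y \<sigma>' True x" by blast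
    then show ?thesis using fin(1) s(2) pstepI[OF a(1) s(1)]
      by (intro conjI exI[of _ Y] exI[of _ \<sigma>']) assumption+
  qed
  have idt: "q j = Idt \<and> b (j + 2) = SCell (cell \<sigma> j)" if "q i = Idt" "i \<le> j" "j < W" for i j
  proof -
    have "q (i + k) = Idt" if "i + k < W" for k
      using that
    proof (induction k)
      case 0
      then show ?case using \<open>q i = Idt\<close> by simp
    next
      case (Suc k)
      then show ?case using tr_cell(1)[OF noerr[of "Suc (i + k)"]] tc[of "i + k"] by simp
    qed
    from this[of "j - i"] that have qj: "q j = Idt" by simp
    then show ?thesis using tr_cell(1)[OF noerr[of "Suc j"]] tc[of j] that(3) by simp
  qed
  have actions: "a = Nop \<or> (\<exists>r s. a = Prim (Push r s)) \<or> (\<exists>r s. a = Prim (Pop r s)) \<or> (\<exists>r. a = Prim (Emp r))"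
    using a(1) by (cases X rule: edges.cases) auto
  then consider "a = Nop" | r s where "a = Prim (Push r s)" | r s where "a = Prim (Pop r s)" | r where "a = Prim (Emp r)"
    by blast
  then show ?thesis
  proof cases
    case 1
    then have "q 0 = Idt" using a by simp
    then show ?thesis using res[of \<sigma>] 1 fit idt[of 0] by simp
  next
    case (2 r s)
    define u where "u i = (if i = 0 then Suc s else cell \<sigma> (i - 1) r)" for i
    have "q i = Psh r (u i) \<and> b (i + 2) = SCell ((cell \<sigma> i)(r := u i))" if "i < W" for i
      using that
    proof (induction i)
      case 0
      then have "q 0 = Psh r (u 0)" using a 2 by (simp add: u_def)
      then show ?case using tr_cell(2)[OF noerr[of "Suc 0"]] tc[of 0] W by (simp del: fun_upd_apply)
    next
      case (Suc i)
      have "i < W" using Suc.prems by simp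
      then have t: "tr S (SCell (cell \<sigma> i)) (Psh r (u i)) (Some (b (i + 2))) (q (Suc i))"
        using tc[of i] Suc.IH by simp
      have q: "q (Suc i) = Psh r (u (Suc i))"
        using conjunct2[OF tr_cell(2)[OF noerr t]] Suc.prems by (simp add: u_def)
      have t': "tr S (SCell (cell \<sigma> (Suc i))) (Psh r (u (Suc i))) (Some (b (Suc i + 2))) (q (Suc (Suc i)))"
        using tc[OF Suc.prems] unfolding q .
      show ?case using q conjunct1[OF tr_cell(2)[OF noerr t']] Suc.prems by (simp del: fun_upd_apply)
    qed
    note Q = this
    have "q W = Psh r (u W)"
    proof -
      obtain j where j: "W = Suc j" using W by (cases W) auto
      have "tr S (SCell (cell \<sigma> j)) (Psh r (u j)) (Some (b (j + 2))) (q (Suc j))"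
        using tc[of j] Q[of j] j by simp
      from conjunct2[OF tr_cell(2)[OF noerr this]] show ?thesis using j by (simp add: u_def)
    qed
    \<comment> \<open>The entry that leaves the last cell is absent, so the stack had fewer than
      \<open>W\<close> entries and the pushed one fits.\<close>
    then have "u W = 0" using fin(2) by simp
    then have len: "length (\<sigma> r) < W" using W by (simp add: u_def cell_zero)
    let ?\<sigma> = "\<sigma>(r := s # \<sigma> r)"
    show ?thesis
    proof (rule res[of ?\<sigma>])
      show "(\<sigma>, ?\<sigma>) \<in> act_sem a" using 2 by simp
      show "fits W ?\<sigma>" using fit len by (auto simp: fits_def)
      show "b (i + 2) = SCell (cell ?\<sigma> i)" if "i < W" for i
        using Q[OF that] unfolding cell_Push u_def by simp
    qed
  next
    case (3 r s)
    have "q i = Pp r (cell \<sigma> i r) \<and> (i = 0 \<longrightarrow> cell \<sigma> 0 r = Suc s) \<and>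
        (\<exists>u'. q (Suc i) = Pp r u' \<and> b (i + 2) = SCell ((cell \<sigma> i)(r := u')))" if "i < W" for i
      using that
    proof (induction i)
      case 0
      have "q 0 = Pp r (Suc s)" using a 3 by simp
      then have t: "tr S (SCell (cell \<sigma> 0)) (Pp r (Suc s)) (Some (b (0 + 2))) (q (Suc 0))" using tc[of 0] W by simp
      from tr_cell(3)[OF noerr t] W \<open>q 0 = Pp r (Suc s)\<close> show ?case by (auto simp del: fun_upd_apply)
    next
      case (Suc i)
      then obtain u' where u': "q (Suc i) = Pp r u'" by auto
      then have t: "tr S (SCell (cell \<sigma> (Suc i))) (Pp r u') (Some (b (Suc i + 2))) (q (Suc (Suc i)))"
        using tc[OF Suc.prems] by simp
      from tr_cell(3)[OF noerr t] Suc.prems u' show ?case by (auto simp del: fun_upd_apply)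
    qed
    note Q = this
    have hd: "cell \<sigma> 0 r = Suc s" using Q[of 0] W by simp
    \<comment> \<open>The guess made in a cell is verified by the next cell, and in the last cell by
      \<open>final\<close> at the end marker.\<close>
    have q: "q (Suc i) = Pp r (cell \<sigma> (Suc i) r)" if "i < W" for i
    proof (cases "Suc i < W")
      case True
      then show ?thesis using Q by blast
    next
      case False
      then have i: "Suc i = W" using that by simp
      obtain u' where "q (Suc i) = Pp r u'" using Q[of i] \<open>i < W\<close> by blast
      then show ?thesis using fin(2) i cell_fits[OF fit, of "Suc i" r] by simp
    qed
    obtain l where l: "\<sigma> r = s # l" using hd by (cases "\<sigma> r") (auto simp: cell_def)
    let ?\<sigma> = "\<sigma>(r := l)"
    show ?thesis
    proof (rule res[of ?\<sigma>])
      show "(\<sigma>, ?\<sigma>) \<in> act_sem a" using 3 l by simp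
      have "length l \<le> W" using fit l by (metis Suc_leD fits_def length_Cons)
      then show "fits W ?\<sigma>" using fit by (auto simp: fits_def)
      show "b (i + 2) = SCell (cell ?\<sigma> i)" if "i < W" for i
        using Q[OF that] q[OF that] unfolding cell_Pop[of \<sigma> r s l, OF l] by auto
    qed
  next
    case (4 r)
    have q0: "q 0 = Em r" using a 4 by simp
    then have c0: "cell \<sigma> 0 r = 0" "q 1 = Idt" "b 2 = SCell (cell \<sigma> 0)"
      using tr_cell(4)[OF noerr[of "Suc 0"]] tc[of 0] W by (simp_all add: numeral_2_eq_2)
    show ?thesis
    proof (rule res[of \<sigma>])
      show "(\<sigma>, \<sigma>) \<in> act_sem a" using 4 c0 by (simp add: cell_zero)
      show "b (i + 2) = SCell (cell \<sigma> i)" if "i < W" for i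
        using idt[OF c0(2), of i] that c0 by (cases i) (auto simp: numeral_2_eq_2)
    qed (rule fit)
  qed
qed

text \<open>The states of a correct row. Behind the end marker the state is always
  \<open>Err\<close>, since \<open>err_end\<close> is the only rule for that marker outside the top
  row.\<close>

fun row_state :: "nat \<Rightarrow> act \<Rightarrow> regs \<Rightarrow> nat \<Rightarrow> ast" where
  "row_state W a \<sigma> x = (if x = 0 then Go else if x = W + 2 then Err else
     (case a of Prim (Push r s) \<Rightarrow> Psh r (if x = 1 then Suc s else cell \<sigma> (x - 2) r)
      | Prim (Pop r s) \<Rightarrow> Pp r (cell \<sigma> (x - 1) r)
      | Prim (Emp r) \<Rightarrow> (if x = 1 then Em r else Idt)
      | _ \<Rightarrow> Idt))"

lemma row_build:
  assumes a: "(a, Y) \<in> edges X" "(\<sigma>, \<sigma>') \<in> act_sem a" and W: "W \<ge> 1" and fit: "fits W \<sigma>" "fits W \<sigma>'"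
    and S: "\<And>i r. cell \<sigma> i r \<le> S" and x: "1 \<le> x" "x \<le> W + 2"
  shows "tr S (row W X \<sigma> True x) (row_state W a \<sigma> (x - 1)) (Some (row W Y \<sigma>' True x)) (row_state W a \<sigma> x)"
proof -
  have actions: "a = Nop \<or> (\<exists>r s. a = Prim (Push r s)) \<or> (\<exists>r s. a = Prim (Pop r s)) \<or> (\<exists>r. a = Prim (Emp r))"
    using a(1) by (cases X rule: edges.cases) auto
  have "x = 1 \<or> x = W + 2 \<or> (x - 2 < W \<and> x = x - 2 + 2 \<and> x \<noteq> 1 \<and> x \<noteq> W + 2)" using x by linarith
  then consider "x = 1" | "x = W + 2" | i where "i < W" "x = i + 2" "x \<noteq> 1" "x \<noteq> W + 2" by metis
  then show ?thesis
  proof cases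
    case 1
    have "row_state W a \<sigma> 1 = start a"
      using actions a W by (auto simp: cell_def)
    then show ?thesis using tr.loc[OF a(1), of S] 1 by (simp add: row_def)
  next
    case 2
    have "final (row_state W a \<sigma> (W + 1))"
    proof -
      from actions consider "a = Nop" | r s where "a = Prim (Push r s)" | r s where "a = Prim (Pop r s)" | r where "a = Prim (Emp r)"
        by blast
      then show ?thesis
      proof cases
        case (2 r s)
        then have "\<sigma>' r = s # \<sigma> r" using a by simp
        moreover have "length (\<sigma>' r) \<le> W" using fit(2) by (simp add: fits_def)
        ultimately have "cell \<sigma> (W - 1) r = 0" by (simp add: cell_zero)
        then show ?thesis using 2 W by simp
      next
        case (3 r s)
        then show ?thesis using cell_fits[OF fit(1), of W r] by simp
      qed (use W in simp_all)
    qed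
    then show ?thesis using tr.err_end[of "row_state W a \<sigma> (W + 1)" S True] 2 W actions
      by (auto simp: row_def split: act.splits prog.splits)
  next
    case (3 i)
    have e: "row W X \<sigma> True x = SCell (cell \<sigma> i)" "row W Y \<sigma>' True x = SCell (cell \<sigma>' i)" using 3 by (auto simp: row_def)
    have xx: "x - 1 = Suc i" "x = Suc (Suc i)" using 3 by auto
    from actions consider "a = Nop" | r s where "a = Prim (Push r s)" | r s where "a = Prim (Pop r s)" | r where "a = Prim (Emp r)"
      by blast
    then show ?thesis
    proof cases
      case 1
      then show ?thesis unfolding e using a 3 tr.idt[of S "cell \<sigma> i"] by (simp add: xx)
    next
      case (2 r s)
      then have "\<sigma>' = \<sigma>(r := s # \<sigma> r)" using a by simp
      then show ?thesis unfolding e using 2 3 tr.psh[of S "cell \<sigma> i" r "if i = 0 then Suc s else cell \<sigma> (i - 1) r"]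
        by (cases i) (simp_all add: xx cell_Push)
    next
      case (3 r s)
      then obtain l where "\<sigma> r = s # l" "\<sigma>' = \<sigma>(r := l)" using a by auto
      then show ?thesis unfolding e using 3 \<open>i < W\<close> tr.pp[of "cell \<sigma> i" r "cell \<sigma> i r" "cell \<sigma> (Suc i) r" S] S
        by (simp add: xx cell_Pop)
    next
      case (4 r)
      then have "\<sigma>' = \<sigma>" "cell \<sigma> i r = 0" using a by (auto simp: cell_zero)
      then show ?thesis unfolding e using 4 \<open>i < W\<close> tr.em[of "cell \<sigma> i" r S] tr.idt[of S "cell \<sigma> i"]
        by (cases i) (simp_all add: xx)
    qed
  qed
qed

definition picture :: "nat \<Rightarrow> prog \<Rightarrow> regs \<Rightarrow> nat \<Rightarrow> nat \<Rightarrow> (nat \<Rightarrow> nat \<Rightarrow> asym) \<Rightarrow> (nat \<Rightarrow> nat \<Rightarrow> ast) \<Rightarrow> bool" where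
  "picture S p \<sigma> W T a e \<longleftrightarrow>
     (\<forall>x. 1 \<le> x \<and> x \<le> W + 2 \<longrightarrow> a x 0 = row W [p] \<sigma> True x) \<and>
     (\<forall>y. 1 \<le> y \<and> y < T \<longrightarrow> e 0 y = Go) \<and> e 0 T = Top True \<and>
     (\<forall>x y. 1 \<le> x \<and> x \<le> W + 2 \<and> 1 \<le> y \<and> y \<le> T \<longrightarrow>
        tr S (a x (y - 1)) (e (x - 1) y) (Some (a x y)) (e x y))"

text \<open>In the top row the corner passes only if the flag is \<open>True\<close> and the
  location below is \<open>[]\<close>. A flag never returns from \<open>False\<close> to
  \<open>True\<close>, so it is \<open>True\<close> in all rows below the top, and
  \<open>row_pass\<close> turns each of them into a step of the program.\<close>

lemma picture_run:
  assumes P: "picture S p \<sigma> W T a e" and W: "W \<ge> 1" and T: "T \<ge> 1" and fit: "fits W \<sigma>"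
  shows "\<exists>\<sigma>'. (\<sigma>, \<sigma>') \<in> sem p"
proof -
  have tr: "tr S (a x (y - 1)) (e (x - 1) y) (Some (a x y)) (e x y)" if "1 \<le> x" "x \<le> W + 2" "1 \<le> y" "y \<le> T" for x y
    using P that by (auto simp: picture_def)
  have ends': "is_end (a (W + 2) y)" if "y \<le> T" for y
    using that
  proof (induction y)
    case 0
    then show ?case using P by (auto simp: picture_def row_def)
  next
    case (Suc y)
    then show ?case using tr_is_end[OF tr[of "W + 2" "Suc y"] refl] by simp
  qed
  have ends: "\<exists>f. a (W + 2) y = SEnd f" if "y \<le> T" for y
    using ends'[OF that] by (cases "a (W + 2) y") auto
  have top_state: "is_top (e x T)" if "x \<le> W + 2" for x
    using that
  proof (induction x)
    case 0
    then show ?case using P by (simp add: picture_def)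
  next
    case (Suc x)
    then show ?case using tr_top[OF tr[of "Suc x" T]] T by simp
  qed
  have aT: "a (W + 2) (T - 1) = SEnd True \<and> e (W + 1) T = Top True"
  proof -
    obtain f where f: "a (W + 2) (T - 1) = SEnd f" using ends[of "T - 1"] by auto
    obtain b where b: "e (W + 1) T = Top b" using top_state[of "W + 1"] by (cases "e (W + 1) T") auto
    show ?thesis using tr[of "W + 2" T] T f b by (auto elim!: tr_EndTop split: if_splits)
  qed
  have flag: "a (W + 2) y = SEnd True" if "y \<le> T - 1" for y
    using that
  proof (induction rule: inc_induct)
    case base
    then show ?case using aT by simp
  next
    case (step y)
    have "y \<le> T" using step.hyps by linarith
    then obtain f where f: "a (W + 2) y = SEnd f" using ends[of y] by blast
    have "Suc y \<le> T" using step.hyps by linarith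
    then have "tr S (SEnd f) (e (W + 1) (Suc y)) (Some (SEnd True)) (e (W + 2) (Suc y))"
      using tr[of "W + 2" "Suc y"] step.IH f by simp
    then show ?case using f by (auto elim!: tr_End split: if_splits)
  qed
  have rows: "\<exists>X \<tau>. (([p], \<sigma>), (X, \<tau>)) \<in> pstep\<^sup>* \<and> fits W \<tau> \<and> (\<forall>x. 1 \<le> x \<and> x \<le> W + 2 \<longrightarrow> a x y = row W X \<tau> True x)"
    if "y \<le> T - 1" for y
    using that
  proof (induction y)
    case 0
    show ?case by (rule exI[of _ "[p]"], rule exI[of _ \<sigma>]) (use P fit in \<open>simp add: picture_def\<close>)
  next
    case (Suc y)
    then obtain X \<tau> where X: "(([p], \<sigma>), (X, \<tau>)) \<in> pstep\<^sup>*" "fits W \<tau>"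
      "\<And>x. 1 \<le> x \<Longrightarrow> x \<le> W + 2 \<Longrightarrow> a x y = row W X \<tau> True x" by auto
    have "tr S (row W X \<tau> True x) (e (x - 1) (Suc y)) (Some (a x (Suc y))) (e x (Suc y))" if "1 \<le> x" "x \<le> W + 2" for x
      using tr[of x "Suc y"] X(3)[OF that] that Suc.prems by simp
    moreover have "e 0 (Suc y) = Go" using P Suc.prems by (simp add: picture_def)
    ultimately obtain Y \<tau>' where Y: "((X, \<tau>), (Y, \<tau>')) \<in> pstep" "fits W \<tau>'"
      "\<forall>x. 1 \<le> x \<and> x \<le> W + 2 \<longrightarrow> a x (Suc y) = row W Y \<tau>' True x"
      using row_pass[of W S X \<tau> True "\<lambda>x. e x (Suc y)" "\<lambda>x. a x (Suc y)"] W X(2) flag[OF Suc.prems] by auto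
    then show ?case using X(1) by (meson rtrancl.rtrancl_into_rtrancl)
  qed
  obtain X \<tau> where X: "(([p], \<sigma>), (X, \<tau>)) \<in> pstep\<^sup>*" "\<And>x. 1 \<le> x \<Longrightarrow> x \<le> W + 2 \<Longrightarrow> a x (T - 1) = row W X \<tau> True x"
    using rows[of "T - 1"] by auto
  have "e x T = Top (X = [])" if "1 \<le> x" "x \<le> W + 1" for x
    using that
  proof (induction x rule: dec_induct)
    case base
    have "a 1 (T - 1) = SLoc X" "e 0 T = Top True" using X(2)[of 1] P by (auto simp: row_def picture_def)
    then show ?case using tr[of 1 T] T by (auto elim: tr_LocTop)
  next
    case (step x)
    then have x: "x = Suc (x - 1)" "x - 1 < W" by auto
    have "a (Suc x) (T - 1) = SCell (cell \<tau> (x - 1))"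
      using X(2)[of "Suc x"] step x by (simp add: row_def)
    then show ?case using tr[of "Suc x" T] T step by (auto elim: tr_CellTop)
  qed
  from this[of "W + 1"] aT have "X = []" by simp
  then show ?thesis using X(1) psteps_iff by blast
qed

text \<open>The last clause bounds the symbols of the picture, so that it can be realised with a
  finite tile set. It rests on the invariant that locations, stack letters and stack numbers stay in
  range along the run.\<close>

lemma run_picture:
  assumes run: "(\<sigma>, \<sigma>') \<in> sem p" and R: "\<And>r. r \<ge> R \<Longrightarrow> \<sigma> r = []" and S: "\<And>r. set (\<sigma> r) \<subseteq> {..<S}"
    and ok: "prog_ok R S p"
  shows "\<exists>W T a e. n \<le> W \<and> 1 \<le> W \<and> 1 \<le> T \<and> fits W \<sigma> \<and> picture S p \<sigma> W T a e \<and>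
    (\<forall>x y. 1 \<le> x \<and> x \<le> W + 2 \<and> y \<le> T \<longrightarrow> (\<exists>X \<tau>. a x y = row W X \<tau> True x \<and> X \<in> locs p [] \<and>
        (\<forall>r. set (\<tau> r) \<subseteq> {..<S}) \<and> (\<forall>r \<ge> R. \<tau> r = [])))"
proof -
  have "(([p], \<sigma>), ([], \<sigma>')) \<in> pstep\<^sup>*" using run psteps_iff by blast
  then obtain k where "(([p], \<sigma>), ([], \<sigma>')) \<in> pstep ^^ k" by (auto simp: rtrancl_power)
  then obtain c where c: "c 0 = ([p], \<sigma>)" "c k = ([], \<sigma>')" "\<And>i. i < k \<Longrightarrow> (c i, c (Suc i)) \<in> pstep"
    by (auto simp: relpow_fun_conv)
  define X where "X i = fst (c i)" for i
  define \<rho> where "\<rho> i = snd (c i)" for i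
  have cc: "c i = (X i, \<rho> i)" for i by (simp add: X_def \<rho>_def)
  have "\<exists>a. (a, X (Suc i)) \<in> edges (X i) \<and> (\<rho> i, \<rho> (Suc i)) \<in> act_sem a" if "i < k" for i
    using c(3)[OF that] by (auto simp: cc pstep_def)
  then obtain A where A: "\<And>i. i < k \<Longrightarrow> (A i, X (Suc i)) \<in> edges (X i) \<and> (\<rho> i, \<rho> (Suc i)) \<in> act_sem (A i)" by metis
  have inv: "X i \<in> locs p [] \<and> (\<forall>r. set (\<rho> i r) \<subseteq> {..<S}) \<and> (\<forall>r \<ge> R. \<rho> i r = [])" if "i \<le> k" for i
    using that
  proof (induction i)
    case 0
    then show ?case using c(1) locs_ends[of p "[]"] R S by (simp add: X_def \<rho>_def)
  next
    case (Suc i)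
    then have IH: "X i \<in> locs p []" "\<And>r. set (\<rho> i r) \<subseteq> {..<S}" "\<And>r. r \<ge> R \<Longrightarrow> \<rho> i r = []" by auto
    have Ai: "(A i, X (Suc i)) \<in> edges (X i)" "(\<rho> i, \<rho> (Suc i)) \<in> act_sem (A i)" using A[of i] Suc by auto
    have "X i \<noteq> []" using Ai(1) by auto
    then have l: "X (Suc i) \<in> locs p []" "act_ok R S (A i)" using locs_step[OF IH(1) ok Ai(1)] by auto
    have "(\<forall>r. set (\<rho> (Suc i) r) \<subseteq> {..<S}) \<and> (\<forall>r \<ge> R. \<rho> (Suc i) r = [])"
      using l(2) Ai(2)
    proof (cases rule: act_ok.cases[of "(R, S, A i)"])
      case (3 R' S' r s)
      then obtain l where l': "\<rho> i r = s # l" "\<rho> (Suc i) = (\<rho> i)(r := l)" using Ai(2) by auto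
      then have "set l \<subseteq> {..<S}" using IH(2)[of r] by auto
      moreover have "r < R" using 3 l(2) by simp
      ultimately show ?thesis using IH l' by auto
    qed (use IH in auto)
    then show ?case using l by blast
  qed
  \<comment> \<open>The run is finite, so some width holds all stacks throughout; the summand
    \<open>n\<close> meets the minimum width demanded by the caller.\<close>
  define W where "W = n + 1 + (\<Sum>i\<le>k. \<Sum>r<R. length (\<rho> i r))"
  have fitW: "fits W (\<rho> i)" if "i \<le> k" for i
    unfolding fits_def
  proof
    fix r
    show "length (\<rho> i r) \<le> W"
    proof (cases "r < R")
      case True
      have "length (\<rho> i r) \<le> (\<Sum>r<R. length (\<rho> i r))" using True by (intro member_le_sum) auto
      also have "\<dots> \<le> (\<Sum>i\<le>k. \<Sum>r<R. length (\<rho> i r))" using that by (intro member_le_sum[where f = "\<lambda>i. \<Sum>r<R. length (\<rho> i r)"]) auto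
      finally show ?thesis by (simp add: W_def)
    next
      case False
      then show ?thesis using inv[OF that] by simp
    qed
  qed
  have cS: "cell (\<rho> i) j r \<le> S" if "i \<le> k" for i j r
    using inv[OF that] by (auto simp: cell_def) (meson lessThan_iff nth_mem subsetD Suc_leI)
  \<comment> \<open>One row for each of the \<open>k\<close> steps and a last one for the acceptance
    test.\<close>
  define T where "T = Suc k"
  define a where "a x y = row W (X (min y k)) (\<rho> (min y k)) True x" for x y
  define e where "e x y = (if y = T then Top True else row_state W (A (y - 1)) (\<rho> (y - 1)) x)" for x y
  have XK: "X k = []" "X 0 = [p]" "\<rho> 0 = \<sigma>" using c by (auto simp: X_def \<rho>_def)
  have W1: "W \<ge> 1" "n \<le> W" by (auto simp: W_def)
  have "picture S p \<sigma> W T a e"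
    unfolding picture_def
  proof (intro conjI allI impI)
    fix x show "a x 0 = row W [p] \<sigma> True x" by (simp add: a_def XK)
  next
    fix y assume "1 \<le> y \<and> y < T"
    then show "e 0 y = Go" by (simp add: e_def)
  next
    show "e 0 T = Top True" by (simp add: e_def)
  next
    fix x y assume xy: "1 \<le> x \<and> x \<le> W + 2 \<and> 1 \<le> y \<and> y \<le> T"
    show "tr S (a x (y - 1)) (e (x - 1) y) (Some (a x y)) (e x y)"
    proof (cases "y = T")
      case True
      consider "x = 1" | "x = W + 2" | "x \<noteq> 1" "x \<noteq> W + 2" by blast
      then show ?thesis
      proof cases
        case 1
        then show ?thesis using tr.top_loc[of S "[]" True] True by (simp add: a_def e_def T_def XK row_def)
      next
        case 2
        then show ?thesis using tr.top_end[of S True True] True by (simp add: a_def e_def T_def XK row_def)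
      next
        case 3
        then show ?thesis using tr.top_cell[of S _ True] True by (simp add: a_def e_def T_def XK row_def)
      qed
    next
      case False
      then have y: "y - 1 < k" "Suc (y - 1) = y" "y \<le> k" using xy by (auto simp: T_def)
      have Ay: "(A (y - 1), X y) \<in> edges (X (y - 1))" "(\<rho> (y - 1), \<rho> y) \<in> act_sem (A (y - 1))"
        using A[OF y(1)] y(2) by auto
      have "tr S (row W (X (y - 1)) (\<rho> (y - 1)) True x) (row_state W (A (y - 1)) (\<rho> (y - 1)) (x - 1))
          (Some (row W (X y) (\<rho> y) True x)) (row_state W (A (y - 1)) (\<rho> (y - 1)) x)"
        by (rule row_build[OF Ay W1(1) fitW fitW cS]) (use y xy in auto)
      then show ?thesis using y False by (simp add: a_def e_def min_absorb1 del: row_state.simps)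
    qed
  qed
  moreover have "\<exists>X \<tau>. a x y = row W X \<tau> True x \<and> X \<in> locs p [] \<and>
        (\<forall>r. set (\<tau> r) \<subseteq> {..<S}) \<and> (\<forall>r \<ge> R. \<tau> r = [])" for x y
    by (rule exI[of _ "X (min y k)"], rule exI[of _ "\<rho> (min y k)"]) (use inv[of "min y k"] in \<open>simp add: a_def\<close>)
  ultimately show ?thesis
    by (intro exI[of _ W] exI[of _ T] exI[of _ a] exI[of _ e]) (use W1 fitW[of 0] XK in \<open>simp add: T_def\<close>)
qed

section \<open>The tile system of a stack program\<close>

text \<open>\<open>HK\<close>, \<open>HB\<close> and \<open>HJ\<close> bind within rows: between
  corner and control tile, along the blanks up to the end marker, and in junk lines.
  \<open>VC\<close> and \<open>VJ\<close> bind within proper and junk columns. \<open>Gb\<close>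
  marks rejection, and \<open>Gb2\<close> alternates with it in the towers.\<close>

datatype aglue = GSym asym | GSt ast | HK | HB | HJ | VC | VJ | Gb | Gb2

lemma tile_sel [simp]: "tN (a, b, c, d) = a" "tE (a, b, c, d) = b" "tS (a, b, c, d) = c" "tW (a, b, c, d) = d"
  by (simp_all add: tN_def tE_def tS_def tW_def)

definition cells :: "nat \<Rightarrow> (nat \<Rightarrow> nat) set" where
  "cells S = {v. (\<forall>r<9. v r \<le> S) \<and> (\<forall>r\<ge>9. v r = 0)}"

definition syms :: "nat \<Rightarrow> prog \<Rightarrow> asym set" where
  "syms S p = SLoc ` locs p [] \<union> SCell ` cells S \<union> {SEnd True, SEnd False}"

definition states :: "nat \<Rightarrow> ast set" where
  "states S = {Go, Err, Idt, Top True, Top False} \<union> (\<lambda>(r, u). Psh r u) ` ({..<9} \<times> {..S}) \<union>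
     (\<lambda>(r, u). Pp r u) ` ({..<9} \<times> {..S}) \<union> Em ` {..<9}"

definition aglues :: "nat \<Rightarrow> prog \<Rightarrow> aglue set" where
  "aglues S p = GSym ` syms S p \<union> GSt ` states S \<union> {HK, HB, HJ, VC, VJ, Gb, Gb2}"

lemma finite_cells: "finite (cells S)"
proof -
  have "cells S \<subseteq> {f. \<forall>x. (x \<in> {..<9} \<longrightarrow> f x \<in> {..S}) \<and> (x \<notin> {..<9} \<longrightarrow> f x = 0)}"
    unfolding cells_def by (intro subsetI CollectI allI) simp
  moreover have "finite {f. \<forall>x. (x \<in> {..<9::nat} \<longrightarrow> f x \<in> {..S}) \<and> (x \<notin> {..<9} \<longrightarrow> f x = 0)}"
    by (rule finite_set_of_finite_funs) simp_all
  ultimately show ?thesis by (rule finite_subset)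
qed

lemma finite_syms: "finite (syms S p)"
  by (simp add: syms_def finite_locs finite_cells)

lemma finite_states: "finite (states S)"
  by (simp add: states_def)

lemma finite_aglues: "finite (aglues S p)"
  by (simp add: aglues_def finite_syms finite_states)

lemma states_simps [simp]: "Go \<in> states S" "Err \<in> states S" "Idt \<in> states S" "Top b \<in> states S"
  "Psh r u \<in> states S \<longleftrightarrow> r < 9 \<and> u \<le> S" "Pp r u \<in> states S \<longleftrightarrow> r < 9 \<and> u \<le> S" "Em r \<in> states S \<longleftrightarrow> r < 9"
  by (cases b; auto simp: states_def)+

lemma syms_simps [simp]: "SLoc X \<in> syms S p \<longleftrightarrow> X \<in> locs p []" "SCell v \<in> syms S p \<longleftrightarrow> v \<in> cells S" "SEnd b \<in> syms S p"
  by (cases b; auto simp: syms_def)+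

lemma aglues_simps [simp]: "GSym s \<in> aglues S p \<longleftrightarrow> s \<in> syms S p" "GSt q \<in> aglues S p \<longleftrightarrow> q \<in> states S"
  "HK \<in> aglues S p" "HB \<in> aglues S p" "HJ \<in> aglues S p" "VC \<in> aglues S p" "VJ \<in> aglues S p" "Gb \<in> aglues S p" "Gb2 \<in> aglues S p"
  by (auto simp: aglues_def)

lemma start_states: "act_ok 9 S a \<Longrightarrow> start a \<in> states S"
  by (cases a rule: start.cases) auto

lemma tr_closed:
  assumes "tr S s q n e" "prog_ok 9 S p" "s \<in> syms S p" "q \<in> states S"
  shows "e \<in> states S \<and> (\<forall>s'. n = Some s' \<longrightarrow> s' \<in> syms S p) \<and> (n = None \<longrightarrow> is_top q)"
  using assms
proof cases
  case (loc a Y X)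
  then have "X \<noteq> []" by auto
  then show ?thesis using locs_step[of X p "[]" 9 S a Y] loc assms start_states by auto
qed (use assms in \<open>auto simp: cells_def split: if_splits\<close>)

lemma tr_total: "\<exists>n e. tr S s q n e"
proof (cases "is_top q")
  case True
  then obtain b where "q = Top b" by (cases q) auto
  then show ?thesis using tr.top_loc tr.top_cell tr.top_end by (cases s) blast+
next
  case False
  show ?thesis
  proof (cases "is_end s")
    case True
    then obtain f where "s = SEnd f" by (cases s) auto
    then show ?thesis using tr.err_end[OF False] by blast
  next
    case False
    then show ?thesis using tr.err[OF \<open>\<not> is_top q\<close> False] by blast
  qed
qed

definition bit_cell :: "bool \<Rightarrow> nat \<Rightarrow> nat" where
  "bit_cell b = (\<lambda>r. if r = 0 then Suc (bcode b) else 0)"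

definition init_regs :: "bool list \<Rightarrow> regs" where
  "init_regs w = st (map bcode w) [] [] [] [] [] [] [] []"

lemma init_regs_app: "init_regs w r = (if r = 0 then map bcode w else [])"
  by (simp add: init_regs_def st_def)

lemma cell_init: "cell (init_regs w) i = (if i < length w then bit_cell (w ! i) else (\<lambda>_. 0))"
  by (auto simp: cell_def init_regs_app bit_cell_def)

locale tile_sys =
  fixes S :: nat and p :: prog and enc :: "aglue \<Rightarrow> nat" and B :: nat and w :: "bool list"
  assumes ok: "prog_ok 9 S p" and S3: "3 \<le> S"
    and inj: "inj_on enc (aglues S p)" and range: "enc ` aglues S p \<subseteq> {1..<B}"
begin

abbreviation sg :: "asym \<Rightarrow> nat" where "sg s \<equiv> enc (GSym s)"
abbreviation qg :: "ast \<Rightarrow> nat" where "qg q \<equiv> enc (GSt q)"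

lemma enc_eq [simp]: "x \<in> aglues S p \<Longrightarrow> y \<in> aglues S p \<Longrightarrow> enc x = enc y \<longleftrightarrow> x = y"
  using inj by (auto simp: inj_on_def)

lemma enc_less: "x \<in> aglues S p \<Longrightarrow> enc x < B" and enc_pos: "x \<in> aglues S p \<Longrightarrow> 0 < enc x"
  using range by auto

lemma B_pos: "0 < B" using enc_less[of HK] by simp

definition weak :: "glue set" where "weak = enc ` (GSym ` syms S p \<union> GSt ` states S)"

definition strength :: "glue \<Rightarrow> nat" where
  "strength g = (if g = 0 then 0 else if g \<in> weak then 1 else 2)"

text \<open>From index \<open>B\<close> on the strength is uniformly 2, so this tail consists of
  \<open>length w\<close> equal blocks and one last entry, for the glue
  \<open>(length w + 1) * B\<close>.\<close>

definition strs_list :: "nat list" where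
  "strs_list = map strength [0..<B] @ replicate (length w * B + 1) 2"

definition gs :: "glue \<Rightarrow> nat" where
  "gs g = (if g < length strs_list then strs_list ! g else 0)"

text \<open>\<open>jcorner\<close>, \<open>jrow\<close> and \<open>jcol\<close> form the junk lines, which are never accepting because of \<open>Gb\<close>.\<close>
definition corner :: tile where "corner = (enc VC, enc HK, 0, 0)"
definition control :: tile where "control = (sg (SLoc [p]), B, 0, enc HK)"
text \<open>Each glue \<open>v * B\<close> joins exactly one pair of tiles, so the input bits are
  forced to appear once and in order between \<open>control\<close> and \<open>link\<close>.\<close>

definition chain :: "nat \<Rightarrow> tile" where
  "chain i = (sg (SCell (bit_cell (w ! i))), (i + 2) * B, 0, (i + 1) * B)"
definition link :: tile where "link = (sg (SCell (\<lambda>_. 0)), enc HB, 0, (length w + 1) * B)"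
definition blank :: tile where "blank = (sg (SCell (\<lambda>_. 0)), enc HB, 0, enc HB)"
definition endt :: tile where "endt = (sg (SEnd True), 0, 0, enc HB)"
definition col :: tile where "col = (enc VC, qg Go, enc VC, 0)"
definition topt :: tile where "topt = (0, qg (Top True), enc VC, 0)"
definition jcorner :: tile where "jcorner = (enc VJ, enc HJ, 0, 0)"
definition jrow :: "asym \<Rightarrow> tile" where "jrow s = (sg s, 0, 0, enc HJ)"
definition jcol :: "ast \<Rightarrow> tile" where "jcol q = (enc Gb, qg q, enc VJ, 0)"

lemmas tile_defs = corner_def control_def chain_def link_def blank_def endt_def col_def topt_def jcorner_def jrow_def jcol_def

definition const_line :: "tile set" where
  "const_line = {corner, control, blank, endt, col, topt, jcorner} \<union> jrow ` syms S p \<union> jcol ` states S"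

definition LT :: "tile set" where
  "LT = const_line \<union> chain ` {..<length w} \<union> {link}"

definition HR :: "glue set" where
  "HR = {enc HK, enc HB, enc HJ} \<union> (\<lambda>v. v * B) ` {1..length w + 1}"

definition HC :: "glue set" where "HC = {enc VC, enc VJ}"

definition interior :: "asym \<Rightarrow> ast \<Rightarrow> asym option \<Rightarrow> ast \<Rightarrow> tile" where
  "interior s q n e = (case n of Some s' \<Rightarrow> sg s' | None \<Rightarrow> enc Gb, qg e, sg s, qg q)"

definition TI :: "tile set" where
  "TI = {interior s q n e | s q n e. tr S s q n e \<and> s \<in> syms S p \<and> q \<in> states S}"

lemma LT_cases:
  assumes "t \<in> LT"
  obtains "t = corner" | "t = control" | "t = blank" | "t = endt" | "t = col" | "t = topt" | "t = jcorner"
    | s where "s \<in> syms S p" "t = jrow s" | q where "q \<in> states S" "t = jcol q"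
    | i where "i < length w" "t = chain i" | "t = link"
  using assms unfolding LT_def const_line_def by blast

lemma cell_mem [simp]: "(\<lambda>_. 0) \<in> cells S" "bit_cell b \<in> cells S"
  using S3 by (auto simp: cells_def bit_cell_def bcode_def)

lemma loc_mem [simp]: "[p] \<in> locs p []" "[] \<in> locs p []" using locs_ends[of p "[]"] by auto

lemma mult_B [simp]: "x \<in> aglues S p \<Longrightarrow> enc x \<noteq> Suc v * B" "x \<in> aglues S p \<Longrightarrow> Suc v * B \<noteq> enc x"
  using enc_less[of x] by auto

lemma enc_B [simp]: "x \<in> aglues S p \<Longrightarrow> enc x \<noteq> B" "x \<in> aglues S p \<Longrightarrow> B \<noteq> enc x"
  "x \<in> aglues S p \<Longrightarrow> enc x \<noteq> 0" "x \<in> aglues S p \<Longrightarrow> 0 \<noteq> enc x" "x \<in> aglues S p \<Longrightarrow> 0 < enc x"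
  "x \<in> aglues S p \<Longrightarrow> enc x \<noteq> B + k" "x \<in> aglues S p \<Longrightarrow> B + k \<noteq> enc x"
  using enc_less[of x] enc_pos[of x] by auto

lemma HR_enc [simp]: "x \<in> aglues S p \<Longrightarrow> enc x \<in> HR \<longleftrightarrow> x \<in> {HK, HB, HJ}"
  and HC_enc [simp]: "x \<in> aglues S p \<Longrightarrow> enc x \<in> HC \<longleftrightarrow> x \<in> {VC, VJ}"
  using enc_less[of x] by (auto simp: HR_def HC_def)

lemma HR_mult [simp]: "v * B \<in> HR \<longleftrightarrow> 1 \<le> v \<and> v \<le> length w + 1"
proof
  assume "v * B \<in> HR"
  then show "1 \<le> v \<and> v \<le> length w + 1"
  proof (cases v)
    case 0
    then show ?thesis using \<open>v * B \<in> HR\<close> B_pos by (auto simp: HR_def)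
  next
    case (Suc k)
    have "v * B \<notin> {enc HK, enc HB, enc HJ}" unfolding Suc by (auto dest: sym)
    then show ?thesis using \<open>v * B \<in> HR\<close> B_pos by (auto simp: HR_def)
  qed
qed (auto simp: HR_def)

lemma zero_HR [simp]: "0 \<notin> HR" "0 \<notin> HC" using B_pos by (auto simp: HR_def HC_def)

lemma B_HR [simp]: "B \<in> HR" using HR_mult[of 1] by simp

lemma gs_small: "g < B \<Longrightarrow> gs g = strength g"
  by (simp add: gs_def strs_list_def nth_append)

lemma gs_enc [simp]: "x \<in> aglues S p \<Longrightarrow> gs (enc x) = (case x of GSym _ \<Rightarrow> 1 | GSt _ \<Rightarrow> 1 | _ \<Rightarrow> 2)"
proof -
  assume x: "x \<in> aglues S p"
  have "enc x \<in> weak \<longleftrightarrow> x \<in> GSym ` syms S p \<union> GSt ` states S"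
    unfolding weak_def by (rule inj_on_image_mem_iff[OF inj x]) (auto simp: aglues_def)
  then show ?thesis using x enc_pos[OF x] gs_small[OF enc_less[OF x]] by (cases x) (auto simp: strength_def)
qed

lemma gs_mult: "1 \<le> v \<Longrightarrow> v \<le> length w + 1 \<Longrightarrow> gs (v * B) = 2"
proof -
  assume v: "1 \<le> v" "v \<le> length w + 1"
  have "v * B \<le> (length w + 1) * B" using v(2) by (rule mult_le_mono1)
  moreover have "B \<le> v * B" using v(1) by (cases v) simp_all
  ultimately have "v * B < length strs_list" "\<not> v * B < B" by (auto simp: strs_list_def)
  moreover have "v * B - B < length w * B + 1" using mult_le_mono1[OF v(2), of B] by simp
  ultimately show ?thesis using v(1) by (simp add: gs_def strs_list_def nth_append nth_replicate del: replicate_Suc replicate.simps)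
qed

lemma zero_small: "gs 0 = 0" using gs_small[OF B_pos] by (simp add: strength_def)

sublocale lines: line_tiles gs LT HR HC
proof
  show "gs 0 = 0" by (rule zero_small)
  show "gs g = 2" if "g \<in> HR \<union> HC" for g
    using that by (auto simp: HR_def HC_def gs_mult)
  show "0 \<notin> HR" "0 \<notin> HC" by simp_all
  show "(tW t \<in> HR \<and> tS t = 0 \<and> tE t \<in> insert 0 HR \<and> tN t \<notin> HC) \<or>
      (tS t \<in> HC \<and> tW t = 0 \<and> tE t \<notin> HR) \<or>
      (tS t = 0 \<and> tW t = 0 \<and> tN t \<in> HC \<and> tE t \<in> HR)" if "t \<in> LT" for t
    using that by (cases rule: LT_cases) (simp_all add: tile_defs del: mult_Suc)
  show "(\<exists>t \<in> LT. tW t = g) \<and> (\<exists>t \<in> LT. tE t = g)" if "g \<in> HR" for g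
  proof -
    have c: "t \<in> const_line \<Longrightarrow> t \<in> LT" for t by (simp add: LT_def)
    consider "g = enc HK" | "g = enc HB" | "g = enc HJ" | v where "1 \<le> v" "v \<le> length w + 1" "g = v * B"
      using \<open>g \<in> HR\<close> by (auto simp: HR_def)
    then show ?thesis
    proof cases
      case 1
      have "control \<in> LT" "corner \<in> LT" by (auto simp: LT_def const_line_def)
      then show ?thesis using 1 by (intro conjI bexI[of _ control] bexI[of _ corner]) (auto simp: corner_def control_def)
    next
      case 2
      have "blank \<in> LT" by (auto simp: LT_def const_line_def)
      then show ?thesis using 2 by (intro conjI bexI[of _ blank]) (auto simp: blank_def)
    next
      case 3
      have "jrow (SEnd True) \<in> LT" "jcorner \<in> LT" by (auto simp: LT_def const_line_def)
      then show ?thesis using 3 by (intro conjI bexI[of _ "jrow (SEnd True)"] bexI[of _ jcorner]) (auto simp: jrow_def jcorner_def)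
    next
      case (4 v)
      have "\<exists>t \<in> LT. tW t = g"
      proof (cases "v = length w + 1")
        case True
        then show ?thesis using 4 by (intro bexI[of _ link]) (auto simp: tile_defs LT_def)
      next
        case False
        then have "chain (v - 1) \<in> LT" using 4 by (auto simp: LT_def)
        moreover have "tW (chain (v - 1)) = g" using 4 by (simp add: chain_def)
        ultimately show ?thesis by blast
      qed
      moreover have "\<exists>t \<in> LT. tE t = g"
      proof (cases "v = 1")
        case True
        then show ?thesis using 4 by (intro bexI[of _ control]) (auto simp: tile_defs LT_def const_line_def)
      next
        case False
        then have "v - 2 + 2 = v" "v - 2 < length w" using 4 by auto
        then have "chain (v - 2) \<in> LT" by (auto simp: LT_def)
        moreover have "tE (chain (v - 2)) = g" unfolding chain_def tile_sel \<open>v - 2 + 2 = v\<close> by (simp add: 4)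
        ultimately show ?thesis by blast
      qed
      ultimately show ?thesis by blast
    qed
  qed
  show "(\<exists>t \<in> LT. tN t = g) \<and> (\<exists>t \<in> LT. tS t = g)" if g: "g \<in> HC" for g
  proof -
    consider "g = enc VC" | "g = enc VJ" using g by (auto simp: HC_def)
    then show ?thesis
    proof cases
      case 1
      have "col \<in> LT" by (auto simp: LT_def const_line_def)
      then show ?thesis using 1 by (intro conjI bexI[of _ col]) (auto simp: col_def)
    next
      case 2
      have "jcorner \<in> LT" "jcol Go \<in> LT" by (auto simp: LT_def const_line_def)
      then show ?thesis using 2 by (intro conjI bexI[of _ jcorner] bexI[of _ "jcol Go"]) (auto simp: jcol_def jcorner_def)
    qed
  qed
qed

lemma TI_cases:
  assumes "t \<in> TI"
  obtains s q n e where "t = interior s q n e" "tr S s q n e" "s \<in> syms S p" "q \<in> states S"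
    "e \<in> states S" "\<forall>s'. n = Some s' \<longrightarrow> s' \<in> syms S p" "n = None \<longrightarrow> is_top q"
  using assms tr_closed[OF _ ok] unfolding TI_def by blast

lemma jline_complete:
  assumes "s \<in> syms S p" "q \<in> states S"
  shows "lines.complete 1 1 (\<lambda>k. if k = 0 then jcorner else if k > 0 then jrow s else jcol q)" (is "lines.complete 1 1 ?\<tau>")
proof -
  have L: "jcorner \<in> LT" "jrow s \<in> LT" "jcol q \<in> LT" using assms by (auto simp: LT_def const_line_def)
  have "lines.valid_line (- 1) 1 ?\<tau>"
  proof (rule lines.valid_lineI)
    fix k :: int assume k: "- 1 \<le> k" "k < 1"
    show "0 \<le> k \<Longrightarrow> tE (?\<tau> k) = tW (?\<tau> (k + 1))" using k by (auto simp: tile_defs)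
    show "k < 0 \<Longrightarrow> tS (?\<tau> k) = tN (?\<tau> (k + 1))" using k by (cases "k = -1") (auto simp: tile_defs)
  qed (use L assms in \<open>auto simp: tile_defs\<close>)
  then show ?thesis using assms by (simp add: lines.complete_def tile_defs)
qed

sublocale rects: rect_tiles gs LT HR HC TI "sg ` syms S p" "qg ` states S" "qg ` {Top True, Top False}" "enc Gb" "enc Gb2"
proof
  show "gs g = 1" if "g \<in> sg ` syms S p \<union> qg ` states S" for g using that by auto
  show "gs (enc Gb) = 2" "gs (enc Gb2) = 2" "enc Gb \<noteq> enc Gb2" "enc Gb \<notin> HC" "enc Gb2 \<notin> HC" by simp_all
  show "tN t \<in> sg ` syms S p" if "t \<in> LT" "tW t \<in> HR" for t
    using that by (elim LT_cases) (auto simp: tile_defs)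
  show "tE t \<in> qg ` states S \<and> (tN t \<in> HC \<or> tN t = 0 \<or> tN t = enc Gb)" if "t \<in> LT" "tS t \<in> HC" for t
    using that by (elim LT_cases) (auto simp: tile_defs)
  show "tE (\<tau> (- k)) \<notin> qg ` {Top True, Top False}" if c: "lines.complete m n \<tau>" and k: "1 \<le> k" "k < n" for m n \<tau> k
  proof -
    have V: "lines.valid_line (- n) m \<tau>" "0 < m" using c by (auto simp: lines.complete_def)
    have j: "- n \<le> - k - 1" "- k - 1 < m" "- k - 1 < 0" "- k - 1 \<le> m" using k V by auto
    have "tS (\<tau> (- k - 1)) = tN (\<tau> (- k))" using lines.valid_link(2)[OF V(1) j(1,2,3)] by simp
    then have N: "tN (\<tau> (- k)) \<in> HC" using lines.valid_row(3)[OF V(1) j(1,4)] j by simp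
    have "tS (\<tau> (- k)) \<in> HC" "\<tau> (- k) \<in> LT"
      using lines.valid_row(3)[OF V(1), of "- k"] lines.valid_tile[OF V(1), of "- k"] k V by auto
    \<comment> \<open>Among the column tiles only \<open>col\<close> continues upwards, and its
      state is \<open>Go\<close>.\<close>
    then show ?thesis using N by (elim LT_cases[of "\<tau> (- k)"]) (auto simp: tile_defs)
  qed
  show "tS t \<in> sg ` syms S p \<and> tW t \<in> qg ` states S \<and> tE t \<in> qg ` states S \<and>
      (tN t \<in> sg ` syms S p \<or> tN t = enc Gb \<and> tW t \<in> qg ` {Top True, Top False}) \<and>
      (tE t \<in> qg ` {Top True, Top False} \<longleftrightarrow> tW t \<in> qg ` {Top True, Top False})" if tTI: "t \<in> TI" for t
  proof -
    obtain s q n e where t: "t = interior s q n e" "tr S s q n e" "s \<in> syms S p" "q \<in> states S"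
      "e \<in> states S" "\<forall>s'. n = Some s' \<longrightarrow> s' \<in> syms S p" "n = None \<longrightarrow> is_top q"
      using tTI by (rule TI_cases)
    have top: "qg x \<in> qg ` {Top True, Top False} \<longleftrightarrow> is_top x" if "x \<in> states S" for x
      using that by (cases x) auto
    show ?thesis using t tr_top[OF t(2)] top[of e] top[of q]
      by (cases n) (simp_all add: interior_def)
  qed
  show "\<exists>t \<in> TI. tS t = a \<and> tW t = q" if aq: "a \<in> sg ` syms S p" "q \<in> qg ` states S" for a q
  proof -
    obtain s r where sr: "a = sg s" "s \<in> syms S p" "q = qg r" "r \<in> states S" using aq by auto
    obtain n e where "tr S s r n e" using tr_total by blast
    then have "interior s r n e \<in> TI" using sr by (auto simp: TI_def)
    then show ?thesis using sr by (intro bexI[of _ "interior s r n e"]) (simp_all add: interior_def)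
  qed
  show "\<exists>\<tau>. lines.complete 1 1 \<tau> \<and> tN (\<tau> 1) = a \<and> tE (\<tau> (- 1)) = q" if aq: "a \<in> sg ` syms S p" "q \<in> qg ` states S" for a q
  proof -
    obtain s r where sr: "a = sg s" "s \<in> syms S p" "q = qg r" "r \<in> states S" using aq by auto
    then show ?thesis using jline_complete[OF sr(2,4)]
      by (intro exI[of _ "\<lambda>k. if k = 0 then jcorner else if k > 0 then jrow s else jcol r"]) (simp add: tile_defs)
  qed
qed

definition row_tile :: "int \<Rightarrow> int \<Rightarrow> tile" where
  "row_tile m k = (if k = 1 then control else if k \<le> int (length w) + 1 then chain (nat (k - 2))
     else if k = int (length w) + 2 then link else if k < m then blank else endt)"

definition main_line :: "int \<Rightarrow> int \<Rightarrow> int \<Rightarrow> tile" where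
  "main_line m n k = (if k > 0 then row_tile m k else if k = 0 then corner else if k = - n then topt else col)"

text \<open>The corner decides: a junk corner is followed upwards by a \<open>jcol\<close> tile,
  which exposes \<open>enc Gb\<close>. Above a proper corner come \<open>col\<close> tiles and one
  \<open>topt\<close>. In the row each west glue leaves no choice until the blanks begin, and from
  there on only the length \<open>m\<close> matters.\<close>

lemma main_line_unique:
  assumes c: "lines.complete m n \<tau>" and g: "\<And>k. - n \<le> k \<Longrightarrow> k \<le> m \<Longrightarrow> tN (\<tau> k) \<noteq> enc Gb"
  shows "int (length w) + 3 \<le> m \<and> (\<forall>k. - n \<le> k \<and> k \<le> m \<longrightarrow> \<tau> k = main_line m n k)"
proof -
  have V: "lines.valid_line (- n) m \<tau>" "0 < m" "0 < n" "tE (\<tau> m) = 0" "tN (\<tau> (- n)) \<notin> HC"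
    using c by (auto simp: lines.complete_def)
  have L: "\<tau> k \<in> LT" if "- n \<le> k" "k \<le> m" for k using lines.valid_tile[OF V(1) that] .
  have z: "\<tau> 0 = corner \<or> \<tau> 0 = jcorner"
  proof -
    have "tN (\<tau> 0) \<in> HC" "tE (\<tau> 0) \<in> HR" using rects.valid_corner[OF V(1)] V by auto
    moreover have "\<tau> 0 \<in> LT" using L[of 0] V by simp
    ultimately show ?thesis by (elim LT_cases[of "\<tau> 0"]) (auto simp: tile_defs)
  qed
  have S1: "tS (\<tau> (- 1)) = tN (\<tau> 0)" using lines.valid_link(2)[OF V(1), of "-1"] V by simp
  have z0: "\<tau> 0 = corner"
  proof (rule ccontr)
    assume "\<tau> 0 \<noteq> corner"
    then have "tS (\<tau> (- 1)) = enc VJ" using z S1 by (auto simp: tile_defs)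
    moreover have "\<tau> (- 1) \<in> LT" using L[of "- 1"] V by simp
    ultimately have "tN (\<tau> (- 1)) = enc Gb" by (elim LT_cases[of "\<tau> (- 1)"]) (auto simp: tile_defs)
    then show False using g[of "- 1"] V by simp
  qed
  have colS: "tS (\<tau> (- int (Suc k))) = enc VC" if "int (Suc k) \<le> n" for k
    using that
  proof (induction k)
    case 0
    then show ?case using S1 z0 by (simp add: tile_defs)
  next
    case (Suc k)
    let ?i = "- int (Suc k)"
    have i: "- n \<le> ?i - 1" "?i - 1 < m" "?i - 1 < 0" "- n \<le> ?i" "?i \<le> m" "?i - 1 \<le> m" using Suc.prems V by auto
    have l: "tS (\<tau> (?i - 1)) = tN (\<tau> ?i)" using lines.valid_link(2)[OF V(1) i(1-3)] by simp
    have "tN (\<tau> ?i) \<in> HC" using lines.valid_row(3)[OF V(1) i(1) i(6)] i(3) unfolding l by simp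
    moreover have "tS (\<tau> ?i) = enc VC" using Suc by simp
    ultimately have "tN (\<tau> ?i) = enc VC" using L[OF i(4,5)] by (elim LT_cases[of "\<tau> ?i"]) (auto simp: tile_defs)
    moreover have "- int (Suc (Suc k)) = ?i - 1" by simp
    ultimately show ?case using l by (simp only:)
  qed
  have cols: "\<tau> k = main_line m n k" if k: "- n \<le> k" "k < 0" for k
  proof -
    have "tS (\<tau> k) = enc VC" using colS[of "nat (- k) - 1"] k by simp
    moreover have "\<tau> k \<in> LT" using L[of k] k V by simp
    ultimately have t: "\<tau> k = col \<or> \<tau> k = topt" by (elim LT_cases[of "\<tau> k"]) (auto simp: tile_defs)
    show ?thesis
    proof (cases "k = - n")
      case True
      then have "\<tau> k \<noteq> col" using V(5) by (auto simp: tile_defs)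
      then show ?thesis using t True V by (simp add: main_line_def)
    next
      case False
      then have i: "- n \<le> k - 1" "k - 1 < m" "k - 1 < 0" "k - 1 \<le> m" using k V by auto
      have l: "tS (\<tau> (k - 1)) = tN (\<tau> k)" using lines.valid_link(2)[OF V(1) i(1-3)] by simp
      have "tN (\<tau> k) \<in> HC" using lines.valid_row(3)[OF V(1) i(1) i(4)] i(3) unfolding l by simp
      then have "\<tau> k \<noteq> topt" by (auto simp: tile_defs)
      then show ?thesis using t False k by (simp add: main_line_def)
    qed
  qed
  \<comment> \<open>The west glue that the row must have at index \<open>k\<close>; the indices 2 to
    \<open>length w + 2\<close> belong to the input tiles and \<open>link\<close>.\<close>
  define ins where "ins k = (if k = 1 then enc HK else if k \<le> int (length w) + 2 then nat (k - 1) * B else enc HB)" for k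
  have det: "tE (\<tau> k) = ins (k + 1) \<or> int (length w) + 3 \<le> k \<and> tE (\<tau> k) = 0" and tile: "\<tau> k = row_tile m k"
    if k: "1 \<le> k" "k \<le> m" and W: "tW (\<tau> k) = ins k" for k
  proof -
    have Lk: "\<tau> k \<in> LT" using L[of k] k V by simp
    consider "k = 1" | "2 \<le> k" "k \<le> int (length w) + 1" | "k = int (length w) + 2" | "int (length w) + 3 \<le> k" using k by linarith
    then have "(tE (\<tau> k) = ins (k + 1) \<or> int (length w) + 3 \<le> k \<and> tE (\<tau> k) = 0) \<and> \<tau> k = row_tile m k"
    proof cases
      case 1
      then have "tW (\<tau> k) = enc HK" using W by (simp add: ins_def)
      then have "\<tau> k = control" using Lk by (elim LT_cases[of "\<tau> k"]) (auto simp: tile_defs)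
      then show ?thesis using 1 by (simp add: tile_defs ins_def row_tile_def)
    next
      case 2
      then have "ins k = nat (k - 1) * B" "nat (k - 1) = nat (k - 2) + 1" by (simp_all add: ins_def)
      then have WW: "tW (\<tau> k) = (nat (k - 2) + 1) * B" using W by (simp only:)
      have "\<tau> k = chain (nat (k - 2))" using Lk
      proof (cases rule: LT_cases)
        case (10 i)
        then have "(i + 1) * B = (nat (k - 2) + 1) * B" using WW by (simp add: chain_def)
        then have "i = nat (k - 2)" using B_pos by simp
        then show ?thesis using 10 by simp
      next
        case 11
        then have "(length w + 1) * B = (nat (k - 2) + 1) * B" using WW by (simp add: link_def)
        then have "length w = nat (k - 2)" using B_pos by simp
        then show ?thesis using 2 by linarith
      qed (use WW B_pos in \<open>auto simp: tile_defs\<close>)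
      moreover have "tE (chain (nat (k - 2))) = ins (k + 1)"
      proof -
        have "nat (k - 2) + 2 = nat k" using 2 by simp
        then show ?thesis using 2 by (simp add: chain_def ins_def)
      qed
      ultimately show ?thesis using 2 by (simp add: row_tile_def)
    next
      case 3
      then have "ins k = nat (k - 1) * B" "nat (k - 1) = length w + 1" by (simp_all add: ins_def)
      then have WW: "tW (\<tau> k) = (length w + 1) * B" using W by (simp only:)
      have "\<tau> k = link" using Lk
      proof (cases rule: LT_cases)
        case (10 i)
        then have "(i + 1) * B = (length w + 1) * B" using WW by (simp add: chain_def)
        then have "i = length w" using B_pos by simp
        then show ?thesis using 10 by simp
      qed (use WW B_pos in \<open>auto simp: tile_defs\<close>)
      then show ?thesis using 3 by (simp add: link_def ins_def row_tile_def)
    next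
      case 4
      then have "tW (\<tau> k) = enc HB" using W by (simp add: ins_def)
      then have t: "\<tau> k = blank \<or> \<tau> k = endt" using Lk by (elim LT_cases[of "\<tau> k"]) (auto simp: tile_defs)
      show ?thesis
      proof (cases "k = m")
        case True
        then have "\<tau> k = endt" using t V(4) by (auto simp: blank_def)
        then show ?thesis using 4 True by (simp add: row_tile_def tile_defs)
      next
        case False
        then have "k < m" "- n \<le> k" "- n \<le> k + 1" "k + 1 \<le> m" using k V by auto
        then have "tE (\<tau> k) = tW (\<tau> (k + 1))" "tW (\<tau> (k + 1)) \<in> HR"
          using lines.valid_link(1)[OF V(1), of k] lines.valid_row(1)[OF V(1), of "k + 1"] k by auto
        then have "\<tau> k = blank" using t by (auto simp: endt_def)
        then show ?thesis using 4 \<open>k < m\<close> by (simp add: row_tile_def blank_def ins_def)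
      qed
    qed
    then show "tE (\<tau> k) = ins (k + 1) \<or> int (length w) + 3 \<le> k \<and> tE (\<tau> k) = 0" "\<tau> k = row_tile m k" by blast+
  qed
  have ins0: "ins k \<noteq> 0" if "1 \<le> k" for k using that B_pos by (auto simp: ins_def)
  have rowW: "tW (\<tau> (int (Suc k))) = ins (int (Suc k))" if "int (Suc k) \<le> m" for k
    using that
  proof (induction k)
    case 0
    have "tE (\<tau> 0) = tW (\<tau> (0 + 1))" by (rule lines.valid_link(1)[OF V(1)]) (use V in auto)
    then show ?case using z0 by (simp add: tile_defs ins_def)
  next
    case (Suc k)
    let ?i = "int (Suc k)"
    have i: "1 \<le> ?i" "?i < m" "- n \<le> ?i" "?i \<le> m" "- n \<le> ?i + 1" "?i + 1 \<le> m" using Suc.prems V by auto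
    have l: "tE (\<tau> ?i) = tW (\<tau> (?i + 1))" using lines.valid_link(1)[OF V(1) i(3,2)] i by simp
    have "tW (\<tau> (?i + 1)) \<in> HR" using lines.valid_row(1)[OF V(1) i(5,6)] i by simp
    then have "tE (\<tau> ?i) \<noteq> 0" unfolding l using zero_HR by metis
    then have "tE (\<tau> ?i) = ins (?i + 1)" using det[OF i(1,4)] Suc by auto
    moreover have "int (Suc (Suc k)) = ?i + 1" by simp
    ultimately show ?case using l by (simp only:)
  qed
  have rowW': "tW (\<tau> k) = ins k" if "1 \<le> k" "k \<le> m" for k
    using rowW[of "nat k - 1"] that by simp
  have "int (length w) + 3 \<le> m"
    using det[of m] rowW'[of m] V(2,4) ins0[of "m + 1"] by auto
  moreover have "\<tau> k = main_line m n k" if "- n \<le> k" "k \<le> m" for k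
  proof -
    consider "k < 0" | "k = 0" | "k > 0" by linarith
    then show ?thesis
    proof cases
      case 3
      then have "1 \<le> k" by simp
      then show ?thesis using tile[OF _ that(2) rowW'[OF _ that(2)]] 3 by (simp add: main_line_def)
    qed (use cols that z0 in \<open>auto simp: main_line_def\<close>)
  qed
  ultimately show ?thesis by blast
qed

lemma main_line_complete:
  assumes m: "int (length w) + 3 \<le> m" and n: "1 \<le> n"
  shows "lines.complete m n (main_line m n)"
proof -
  have L: "main_line m n k \<in> LT" if "- n \<le> k" "k \<le> m" for k
    using that m by (auto simp: main_line_def row_tile_def LT_def const_line_def)
  have R: "tW (row_tile m k) \<in> HR" if "1 \<le> k" "k \<le> m" for k
    using that m by (auto simp: row_tile_def tile_defs simp del: mult_Suc add_mult_distrib add_mult_distrib2 distrib_right)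
  have RE: "tE (row_tile m k) = tW (row_tile m (k + 1))" if k: "1 \<le> k" "k < m" for k
  proof -
    consider "k = 1" "k \<le> int (length w)" | "k = 1" "length w = 0" | "2 \<le> k" "k \<le> int (length w)" | "2 \<le> k" "k = int (length w) + 1"
      | "k = int (length w) + 2" | "int (length w) + 3 \<le> k" using k by linarith
    then show ?thesis
    proof cases
      case 2
      then have h: "(k = 1) = True" "(k + 1 = 1) = False" "(k + 1 \<le> int (length w) + 1) = False" "(k + 1 = int (length w) + 2) = True" by simp_all
      have "row_tile m k = control" "row_tile m (k + 1) = link" by (simp_all only: row_tile_def h if_True if_False)
      then show ?thesis by (simp only: control_def link_def tile_sel 2(2)) simp
    next
      case 3
      then have "nat (k - 2) + 2 = nat (k - 1) + 1" by simp
      then show ?thesis using 3 by (simp add: row_tile_def chain_def)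
    next
      case 4
      then have "nat (k - 2) + 2 = length w + 1" "w \<noteq> []" by auto
      then show ?thesis using 4 by (simp add: row_tile_def chain_def link_def)
    qed (use k m in \<open>simp_all add: row_tile_def tile_defs\<close>)
  qed
  have "lines.valid_line (- n) m (main_line m n)"
  proof (rule lines.valid_lineI)
    fix k :: int assume k: "- n \<le> k" "k \<le> m"
    show "main_line m n k \<in> LT" by (rule L[OF k])
    show "0 < k \<Longrightarrow> tW (main_line m n k) \<in> HR" using R k by (simp add: main_line_def)
    show "k < 0 \<Longrightarrow> tS (main_line m n k) \<in> HC" by (simp add: main_line_def tile_defs)
    show "k = 0 \<Longrightarrow> tN (main_line m n k) \<in> HC" "k = 0 \<Longrightarrow> tE (main_line m n k) \<in> HR" by (simp_all add: main_line_def tile_defs)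
  next
    fix k :: int assume k: "- n \<le> k" "k < m"
    show "0 \<le> k \<Longrightarrow> tE (main_line m n k) = tW (main_line m n (k + 1))"
      using RE[of k] k m by (cases "k = 0") (simp_all add: main_line_def, simp add: row_tile_def tile_defs)
    show "k < 0 \<Longrightarrow> tS (main_line m n k) = tN (main_line m n (k + 1))"
      using k n by (cases "k = -1") (auto simp: main_line_def tile_defs)
  qed (use m n in simp)
  moreover have "tE (main_line m n m) = 0" using m by (simp add: main_line_def row_tile_def endt_def)
  moreover have "tN (main_line m n (- n)) \<notin> HC" using n by (simp add: main_line_def topt_def)
  ultimately show ?thesis using m n by (simp add: lines.complete_def)
qed

lemma main_line_row:
  assumes m: "m = int (W + 2)" "length w + 1 \<le> W" and x: "1 \<le> x" "x \<le> W + 2"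
  shows "tN (main_line m n (int x)) = sg (row W [p] (init_regs w) True x)"
proof -
  consider "x = 1" | i where "x = i + 2" "i < length w" | "x = length w + 2" | i where "x = i + 2" "length w < i" "i < W" | "x = W + 2"
  proof -
    have "x = 1 \<or> (x = x - 2 + 2 \<and> x - 2 < length w) \<or> x = length w + 2 \<or> (x = x - 2 + 2 \<and> length w < x - 2 \<and> x - 2 < W) \<or> x = W + 2"
      using x by linarith
    then show ?thesis using that by metis
  qed
  then show ?thesis
  proof cases
    case (2 i)
    then have "main_line m n (int x) = chain i" by (simp add: main_line_def row_tile_def)
    then show ?thesis using 2 m by (simp add: chain_def row_def cell_init)
  qed (use m in \<open>auto simp: main_line_def row_tile_def tile_defs row_def cell_init\<close>)
qed

lemma main_line_no_Gb:
  "tN (main_line m n k) \<noteq> enc Gb"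
  by (auto simp: main_line_def row_tile_def tile_defs)

text \<open>An accepting rectangle sits on a proper line, and decoding its glues yields a picture;
  conversely a picture prescribes the tiles for \<open>fill_exists\<close>. The absence of
  \<open>enc Gb\<close> corresponds to the demand that every \<open>tr\<close> step of a picture
  yields \<open>Some\<close>.\<close>

theorem accepting_iff: "rects.accepting \<noteq> {} \<longleftrightarrow> (\<exists>\<sigma>'. (init_regs w, \<sigma>') \<in> sem p)"
proof
  assume "rects.accepting \<noteq> {}"
  then obtain C where "C \<in> rects.accepting" by blast
  then obtain v m n \<tau> D where D: "C = shift v D" "lines.complete m n \<tau>" "D \<in> rects.fill m n \<tau>" "rects.full m n D"
    and gbC: "\<And>p t. C p = Some t \<Longrightarrow> tN t \<noteq> enc Gb"
    by (auto simp: rects.accepting_def rects.rects_def)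
  have gbD: "tN t \<noteq> enc Gb" if "D q = Some t" for q t
    using gbC[of "shiftp v q" t] that by (simp add: D(1) shift_app)
  have mn: "0 < m" "0 < n" using D(2) by (auto simp: lines.complete_def)
  have Dl: "D (lpos k) = Some (\<tau> k)" if "- n \<le> k" "k \<le> m" for k
    by (rule rects.fill_line[OF D(2,3)]) (simp add: line_lpos that)
  have "int (length w) + 3 \<le> m \<and> (\<forall>k. - n \<le> k \<and> k \<le> m \<longrightarrow> \<tau> k = main_line m n k)"
    by (rule main_line_unique[OF D(2)]) (use Dl gbD in blast)
  then have m3: "int (length w) + 3 \<le> m" and \<tau>: "\<And>k. - n \<le> k \<Longrightarrow> k \<le> m \<Longrightarrow> \<tau> k = main_line m n k" by auto
  define W where "W = nat m - 2"
  define T where "T = nat n"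
  have W: "m = int (W + 2)" "length w + 1 \<le> W" "n = int T" "1 \<le> T" using m3 mn by (auto simp: W_def T_def)
  define tl where "tl x y = the (D (int x, int y))" for x y :: nat
  define a where "a x y = (THE s. s \<in> syms S p \<and> sg s = tN (tl x y))" for x y
  define e where "e x y = (THE q. q \<in> states S \<and> qg q = tE (tl x y))" for x y
  have aI: "a x y = s" if "s \<in> syms S p" "tN (tl x y) = sg s" for x y s
    unfolding a_def using that by (intro the_equality) auto
  have eI: "e x y = q" if "q \<in> states S" "tE (tl x y) = qg q" for x y q
    unfolding e_def using that by (intro the_equality) auto
  have row0: "tl x 0 = main_line m n (int x)" if "1 \<le> x" "x \<le> W + 2" for x
    using Dl[of "int x"] \<tau>[of "int x"] that W by (simp add: tl_def lpos_def)
  have col0: "tl 0 y = main_line m n (- int y)" if "1 \<le> y" "y \<le> T" for y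
    using Dl[of "- int y"] \<tau>[of "- int y"] that W by (simp add: tl_def lpos_def)
  have rsym: "row W [p] (init_regs w) True x \<in> syms S p" if "1 \<le> x" "x \<le> W + 2" for x
    by (auto simp: row_def cell_init)
  have "picture S p (init_regs w) W T a e"
    unfolding picture_def
  proof (intro conjI allI impI; (elim conjE)?)
    fix x assume "1 \<le> x" "x \<le> W + 2"
    then show "a x 0 = row W [p] (init_regs w) True x"
      by (intro aI rsym) (simp_all add: row0 main_line_row[OF W(1,2)])
  next
    fix y assume "1 \<le> y" "y < T"
    then show "e 0 y = Go" using W by (intro eI) (simp_all add: col0 main_line_def tile_defs)
  next
    show "e 0 T = Top True" using W by (intro eI) (simp_all add: col0 main_line_def tile_defs)
  next
    fix x y assume xy: "1 \<le> x" "x \<le> W + 2" "1 \<le> y" "y \<le> T"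
    let ?p = "(int x, int y)"
    have r: "?p \<in> rects.rect m n" using xy W by (simp add: rects.rect_def)
    then obtain t where t: "D ?p = Some t" using D(4) by (auto simp: rects.full_def)
    have tt: "tl x y = t" using t by (simp add: tl_def)
    have "t \<in> TI" using rects.fill_cases[OF D(2,3) t] rects.rect_not_line[OF r] by simp
    then obtain s q nn ee where I: "t = interior s q nn ee" "tr S s q nn ee" "s \<in> syms S p" "q \<in> states S"
      "ee \<in> states S" "\<forall>s'. nn = Some s' \<longrightarrow> s' \<in> syms S p" "nn = None \<longrightarrow> is_top q" by (rule TI_cases)
    obtain s' where s': "nn = Some s'" using gbD[OF t] I(1) by (cases nn) (auto simp: interior_def)
    obtain u v where uv: "D (nb_S ?p) = Some u" "tN u = tS t" "D (nb_W ?p) = Some v" "tE v = tW t"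
      using rects.fill_match[OF D(2,3) r t] by blast
    have "nb_S ?p = (int x, int (y - 1))" "nb_W ?p = (int (x - 1), int y)" using xy by (auto simp: nb_defs)
    then have "tl x (y - 1) = u" "tl (x - 1) y = v" using uv by (auto simp: tl_def)
    then have "a x (y - 1) = s" "e (x - 1) y = q" using uv I by (auto simp: interior_def intro!: aI eI)
    moreover have "a x y = s'" "e x y = ee" using tt I s' by (auto simp: interior_def intro!: aI eI)
    ultimately show "tr S (a x (y - 1)) (e (x - 1) y) (Some (a x y)) (e x y)" using I s' by simp
  qed
  then show "\<exists>\<sigma>'. (init_regs w, \<sigma>') \<in> sem p"
    by (rule picture_run) (use W in \<open>auto simp: fits_def init_regs_app\<close>)
next
  assume "\<exists>\<sigma>'. (init_regs w, \<sigma>') \<in> sem p"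
  then obtain \<sigma>' where run: "(init_regs w, \<sigma>') \<in> sem p" by blast
  have "\<exists>W T a e. length w + 1 \<le> W \<and> 1 \<le> W \<and> 1 \<le> T \<and> fits W (init_regs w) \<and> picture S p (init_regs w) W T a e \<and>
    (\<forall>x y. 1 \<le> x \<and> x \<le> W + 2 \<and> y \<le> T \<longrightarrow> (\<exists>X \<tau>. a x y = row W X \<tau> True x \<and> X \<in> locs p [] \<and>
        (\<forall>r. set (\<tau> r) \<subseteq> {..<S}) \<and> (\<forall>r \<ge> 9. \<tau> r = [])))"
    by (rule run_picture[OF run _ _ ok]) (use S3 in \<open>auto simp: init_regs_app bcode_def\<close>)
  then obtain W T a e where W: "length w + 1 \<le> W" "1 \<le> W" "1 \<le> T" and P: "picture S p (init_regs w) W T a e"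
    and sym: "\<And>x y. 1 \<le> x \<Longrightarrow> x \<le> W + 2 \<Longrightarrow> y \<le> T \<Longrightarrow> \<exists>X \<tau>. a x y = row W X \<tau> True x \<and> X \<in> locs p [] \<and>
        (\<forall>r. set (\<tau> r) \<subseteq> {..<S}) \<and> (\<forall>r \<ge> 9. \<tau> r = [])" by metis
  have aS: "a x y \<in> syms S p" if xy: "1 \<le> x" "x \<le> W + 2" "y \<le> T" for x y
  proof -
    obtain X \<tau> where X: "a x y = row W X \<tau> True x" "X \<in> locs p []" "\<And>r. set (\<tau> r) \<subseteq> {..<S}" "\<And>r. r \<ge> 9 \<Longrightarrow> \<tau> r = []"
      using sym[OF xy] by metis
    have "cell \<tau> i r \<le> S" for i r
      using X(3)[of r] by (auto simp: cell_def) (meson lessThan_iff nth_mem subsetD Suc_leI)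
    then have "cell \<tau> i \<in> cells S" for i using X(4) by (auto simp: cells_def cell_def)
    then show ?thesis using X by (auto simp: row_def)
  qed
  have tr: "tr S (a x (y - 1)) (e (x - 1) y) (Some (a x y)) (e x y)" if "1 \<le> x" "x \<le> W + 2" "1 \<le> y" "y \<le> T" for x y
    using P that by (auto simp: picture_def)
  have eS: "e x y \<in> states S" if "x \<le> W + 2" "1 \<le> y" "y \<le> T" for x y
    using that
  proof (induction x)
    case 0
    then have "y < T \<or> y = T" by auto
    then show ?case using P 0 by (auto simp: picture_def)
  next
    case (Suc x)
    then show ?case using tr_closed[OF tr[of "Suc x" y] ok] aS[of "Suc x" "y - 1"] by simp
  qed
  define m n where "m = int (W + 2)" and "n = int T"
  let ?\<tau> = "main_line m n"
  have c: "lines.complete m n ?\<tau>" by (rule main_line_complete) (use W in \<open>auto simp: m_def n_def\<close>)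
  define F where "F q = (let x = nat (fst q); y = nat (snd q) in interior (a x (y - 1)) (e (x - 1) y) (Some (a x y)) (e x y))" for q
  have a0: "a x 0 = row W [p] (init_regs w) True x" if "1 \<le> x" "x \<le> W + 2" for x using P that by (simp add: picture_def)
  have e0: "e 0 y = (if y = T then Top True else Go)" if "1 \<le> y" "y \<le> T" for y using P that by (auto simp: picture_def)
  obtain D where D: "D \<in> rects.fill m n ?\<tau>" "rects.full m n D" "\<And>q. q \<in> rects.rect m n \<Longrightarrow> D q = Some (F q)"
  proof (rule rects.fill_exists[OF c, of F])
    fix D assume "D \<in> rects.fill m n ?\<tau>" "rects.full m n D" "\<And>q. q \<in> rects.rect m n \<Longrightarrow> D q = Some (F q)"
    then show thesis by (rule that)
  next
    fix q assume q: "q \<in> rects.rect m n"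
    define x y where "x = nat (fst q)" and "y = nat (snd q)"
    have xy: "1 \<le> x" "x \<le> W + 2" "1 \<le> y" "y \<le> T" "q = (int x, int y)"
      using q by (auto simp: rects.rect_def x_def y_def m_def n_def)
    have Fq: "F q = interior (a x (y - 1)) (e (x - 1) y) (Some (a x y)) (e x y)" by (simp add: F_def x_def y_def Let_def)
    have "a x (y - 1) \<in> syms S p" "e (x - 1) y \<in> states S" using aS[of x "y - 1"] eS[of "x - 1" y] xy by auto
    then show "F q \<in> TI" unfolding Fq TI_def using tr[OF xy(1-4)] by blast
    show "tS (F q) = (if nb_S q \<in> rects.rect m n then tN (F (nb_S q)) else tN (?\<tau> (fst q)))"
    proof (cases "y = 1")
      case True
      then have "nb_S q \<notin> rects.rect m n" by (simp add: rects.rect_def xy nb_defs)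
      moreover have "tN (?\<tau> (fst q)) = sg (a x 0)" using main_line_row[OF m_def W(1) xy(1,2)] a0[OF xy(1,2)] by (simp add: xy)
      ultimately show ?thesis using True by (simp add: Fq interior_def)
    next
      case False
      then have "nb_S q = (int x, int (y - 1))" "nb_S q \<in> rects.rect m n"
        using xy by (auto simp: rects.rect_def nb_defs m_def n_def)
      then show ?thesis by (simp add: Fq interior_def) (simp add: F_def interior_def Let_def)
    qed
    show "tW (F q) = (if nb_W q \<in> rects.rect m n then tE (F (nb_W q)) else tE (?\<tau> (- snd q)))"
    proof (cases "x = 1")
      case True
      then have "nb_W q \<notin> rects.rect m n" by (simp add: rects.rect_def xy nb_defs)
      moreover have "tE (?\<tau> (- snd q)) = qg (e 0 y)" using e0[OF xy(3,4)] xy by (auto simp: main_line_def tile_defs n_def)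
      ultimately show ?thesis using True by (simp add: Fq interior_def)
    next
      case False
      then have "nb_W q = (int (x - 1), int y)" "nb_W q \<in> rects.rect m n"
        using xy by (auto simp: rects.rect_def nb_defs m_def n_def)
      then show ?thesis by (simp add: Fq interior_def) (simp add: F_def interior_def Let_def)
    qed
  qed
  have "tN t \<noteq> enc Gb" if t: "D q = Some t" for q t
  proof (cases "q \<in> rects.rect m n")
    case True
    define x y where "x = nat (fst q)" and "y = nat (snd q)"
    have xy: "1 \<le> x" "x \<le> W + 2" "y \<le> T"
      using True by (auto simp: rects.rect_def x_def y_def m_def n_def)
    have "tN t = sg (a x y)" using D(3)[OF True] t by (simp add: F_def interior_def Let_def x_def y_def)
    then show ?thesis using aS[OF xy] by simp
  next
    case False
    then have "line (- n) m ?\<tau> q = Some t" using rects.fill_cases[OF c D(1) t] by blast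
    then obtain k where "t = ?\<tau> k" by (rule line_SomeE)
    then show ?thesis using main_line_no_Gb by simp
  qed
  moreover have "shift (0, 0) D \<in> rects.rects" unfolding rects.rects_def using c D(1,2) by blast
  ultimately have "D \<in> rects.accepting" by (simp add: rects.accepting_def)
  then show "rects.accepting \<noteq> {}" by blast
qed

end

section \<open>A Turing machine that writes the reduction\<close>

declare nat_bits.simps [simp del]

fun incb :: "bool list \<Rightarrow> bool list" where
  "incb [] = [True]"
| "incb (False # bs) = True # bs"
| "incb (True # bs) = False # incb bs"

lemma nat_bits_0 [simp]: "nat_bits 0 = []" by (simp add: nat_bits.simps)

lemma nat_bits_double: "0 < v \<Longrightarrow> nat_bits (2 * v) = False # nat_bits v" "nat_bits (Suc (2 * v)) = True # nat_bits v"
  by (subst nat_bits.simps; simp)+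

lemma nat_bits_Suc: "nat_bits (Suc v) = incb (nat_bits v)"
proof (induction v rule: less_induct)
  case (less v)
  show ?case
  proof (cases "even v")
    case True
    then obtain k where v: "v = 2 * k" by (auto elim: evenE)
    show ?thesis
    proof (cases "k = 0")
      case True
      then show ?thesis using nat_bits_double(2)[of 0] by (simp add: v)
    next
      case False
      then show ?thesis using nat_bits_double[of k] by (simp add: v)
    qed
  next
    case False
    then obtain k where v: "v = Suc (2 * k)" by (auto elim: oddE)
    have "Suc v = 2 * Suc k" using v by simp
    then have "nat_bits (Suc v) = False # nat_bits (Suc k)" using nat_bits_double(1)[of "Suc k"] by simp
    also have "nat_bits (Suc k) = incb (nat_bits k)" using less[of k] v by simp
    finally show ?thesis using nat_bits_double(2)[of k] by (simp add: v)
  qed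
qed

lemma nat_bits_neq: "nat_bits (Suc v) \<noteq> []"
  by (subst nat_bits.simps) simp

lemma length_nat_bits: "length (nat_bits v) \<le> v"
proof (induction v)
  case (Suc v)
  have "length (incb bs) \<le> Suc (length bs)" for bs by (induction bs rule: incb.induct) auto
  from this[of "nat_bits v"] Suc show ?case by (simp add: nat_bits_Suc)
qed simp

lemma length_dbl: "length (dbl xs) = 2 * length xs"
  by (induction xs) (auto simp: dbl_def)

lemma length_enc_nat: "length (enc_nat v) \<le> 2 * v + 2"
  using length_nat_bits[of v] by (simp add: enc_nat_def length_dbl)

text \<open>\<open>Walk d A\<close> moves in direction \<open>d\<close> until a symbol of
  \<open>A\<close> is scanned, \<open>Put\<close> and \<open>Mov\<close> take one step, and
  \<open>Br\<close> replaces the rest of the current operations according to the scanned symbol. A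
  macro instruction starts a fixed list of such operations.\<close>

datatype mop = Walk int "nat list" | Put nat int | Mov int | Br nat
datatype mac = Emit "bool list" | Cnt | Inc | Loop1 | Loop2 | Fin | Init

definition emit :: "bool list \<Rightarrow> mop list" where
  "emit bs = Walk (-1) [0] # map (\<lambda>b. Put (bcode b) (-1)) (rev bs) @ [Walk 1 [3]]"

fun body :: "mac \<Rightarrow> mop list" where
  "body (Emit bs) = emit bs"
| "body Cnt = emit [False, False] @ [Walk 1 [0], Mov (-1), Br 0]"
| "body Inc = [Walk 1 [6], Mov 1, Br 2]"
| "body Loop1 = [Walk 1 [1, 2, 6], Br 3]"
| "body Loop2 = [Walk 1 [4, 6], Br 4]"
| "body Fin = [Walk (-1) [0], Mov 1]"
| "body Init = [Mov (-1), Put 3 1, Walk 1 [0], Put 6 1, Put 2 1, Put 0 (-1), Walk (-1) [3]]"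

text \<open>Branch 0 copies the counter from its most significant bit downwards, because the output
  grows to the left: the current bit is marked by 7 or 8, its code and then the marker 2 are put in
  front of the output, and branch 1 restores the bit. Branch 2 is the carry of the increment;
  branches 3 and 4 mark the next input cell as processed.\<close>

definition branch :: "nat \<Rightarrow> nat \<Rightarrow> mop list" where
  "branch i s =
    (if i = 0 then (if s = 6 then [Walk (-1) [3]]
       else [Put (if s = 2 then 8 else 7) (-1), Walk (-1) [0], Put (if s = 2 then 2 else 1) (-1), Put 2 (-1), Walk 1 [7, 8], Br 1])
     else if i = 1 then [Put (if s = 8 then 2 else 1) (-1), Br 0]
     else if i = 2 then (if s = 2 then [Put 1 1, Br 2] else if s = 1 then [Put 2 (-1), Walk (-1) [3]]
       else [Put 2 1, Put 0 (-1), Walk (-1) [3]])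
     else if i = 3 then (if s = 6 then [Walk (-1) [3]] else [Put 4 (-1), Walk (-1) [3]])
     else (if s = 6 then [Walk (-1) [3]] else [Put 5 (-1), Walk (-1) [3]]))"

text \<open>The tape reads: output, a separator 3, the input (processed cells become 4 and later 5),
  a separator 6, the binary counter (least significant bit first) and a blank.  The output is written
  from right to left, so the head returns to the separator 3 after each macro instruction.\<close>
locale writer =
  fixes P0 P1 S1 P2 P3 P5 Rr pad :: "bool list" and Qb :: "bool \<Rightarrow> bool list"
begin

text \<open>All macro lists produce their part of \<open>out\<close> from back to front.\<close>

definition after1 :: "mac list" where "after1 = [Cnt, Emit P3, Cnt, Emit P2, Loop2]"
definition after2 :: "mac list" where "after2 = [Emit P1, Cnt, Emit P0, Fin]"
text \<open>The west glue of an input tile is written before its east glue, which is one multiple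
  higher; hence the increment between the two counters.\<close>

definition lbody :: "bool \<Rightarrow> mac list" where
  "lbody b = [Emit pad, Cnt, Emit Rr, Inc, Cnt, Emit (Qb b), Loop1]"
definition main :: "mac list" where "main = [Init, Emit P5, Loop1]"

definition next_macs :: "nat \<Rightarrow> nat \<Rightarrow> mac list \<Rightarrow> mac list" where
  "next_macs i s y = (if i = 3 then (if s = 6 then after1 else lbody (s = 2))
     else if i = 4 then (if s = 6 then after2 else [Emit S1, Loop2]) else y)"

type_synonym ctl = "mop list \<times> mac list"

fun adelta :: "ctl \<Rightarrow> nat \<Rightarrow> ctl \<times> nat \<times> int" where
  "adelta ([], []) s = (([], []), s, 0)"
| "adelta ([], m # y) s = ((body m, y), s, 0)"
| "adelta (Walk d A # x, y) s = (if s \<in> set A then ((x, y), s, 0) else ((Walk d A # x, y), s, d))"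
| "adelta (Put b d # x, y) s = ((x, y), b, d)"
| "adelta (Mov d # x, y) s = ((x, y), s, d)"
| "adelta (Br i # x, y) s = ((branch i s, next_macs i s y), s, 0)"

definition amove :: "int \<Rightarrow> nat \<Rightarrow> nat list \<Rightarrow> nat list \<Rightarrow> nat list \<times> nat list" where
  "amove d s l r = (if d = 1 then (s # l, r) else if d = 0 then (l, s # r) else (tl l, hd0 l # s # r))"

definition astep :: "ctl \<times> nat list \<times> nat list \<Rightarrow> ctl \<times> nat list \<times> nat list" where
  "astep = (\<lambda>(c, l, r). if c = ([], []) then (c, l, r) else
     (case adelta c (hd0 r) of (c', s', d) \<Rightarrow> (c', amove d s' l (tl r))))"

definition reach :: "nat \<Rightarrow> ctl \<times> nat list \<times> nat list \<Rightarrow> ctl \<times> nat list \<times> nat list \<Rightarrow> bool" where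
  "reach n a b \<longleftrightarrow> (\<exists>t \<le> n. (astep ^^ t) a = b)"

lemma reach_refl: "reach n a a"
  unfolding reach_def by (rule exI[of _ 0]) simp

lemma reach_mono: "reach m a b \<Longrightarrow> m \<le> n \<Longrightarrow> reach n a b"
  unfolding reach_def using le_trans by blast

lemma reach_trans: "reach m a b \<Longrightarrow> reach n b c \<Longrightarrow> m + n \<le> k \<Longrightarrow> reach k a c"
proof -
  assume "reach m a b" "reach n b c" and k: "m + n \<le> k"
  then obtain s t where "s \<le> m" "(astep ^^ s) a = b" "t \<le> n" "(astep ^^ t) b = c" by (auto simp: reach_def)
  then show ?thesis unfolding reach_def using k
    by (intro exI[of _ "t + s"]) (simp add: funpow_add)
qed

lemma reach_step: "astep a = b \<Longrightarrow> reach n b c \<Longrightarrow> n < k \<Longrightarrow> reach k a c"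
proof -
  assume a: "astep a = b" "reach n b c" "n < k"
  have "reach 1 a b" unfolding reach_def by (rule exI[of _ 1]) (simp add: a)
  then show ?thesis by (rule reach_trans[OF _ a(2)]) (use a in simp)
qed

lemma astep_simps:
  "astep (([], m # y), l, r) = ((body m, y), l, hd0 r # tl r)"
  "hd0 r \<in> set A \<Longrightarrow> astep ((Walk d A # x, y), l, r) = ((x, y), l, hd0 r # tl r)"
  "hd0 r \<notin> set A \<Longrightarrow> astep ((Walk d A # x, y), l, r) = ((Walk d A # x, y), amove d (hd0 r) l (tl r))"
  "astep ((Put b d # x, y), l, r) = ((x, y), amove d b l (tl r))"
  "astep ((Mov d # x, y), l, r) = ((x, y), amove d (hd0 r) l (tl r))"
  "astep ((Br i # x, y), l, r) = ((branch i (hd0 r), next_macs i (hd0 r) y), l, hd0 r # tl r)"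
  by (simp_all add: astep_def amove_def)

lemma amove_simps [simp]: "amove 1 s l r = (s # l, r)" "amove 0 s l r = (l, s # r)" "amove (-1) s l r = (tl l, hd0 l # s # r)"
  by (simp_all add: amove_def)

section \<open>Correctness and cost of the macro instructions\<close>

lemma walk_right:
  assumes "\<forall>s \<in> set u. s \<notin> set A" "e \<in> set A"
  shows "reach (length u + 1) ((Walk 1 A # x, y), l, u @ e # v) ((x, y), rev u @ l, e # v)"
  using assms
proof (induction u arbitrary: l)
  case Nil
  then show ?case by (intro reach_step[OF _ reach_refl[of 0]]) (simp_all add: astep_simps)
next
  case (Cons s u)
  have a: "astep ((Walk 1 A # x, y), l, (s # u) @ e # v) = ((Walk 1 A # x, y), s # l, u @ e # v)"
    using Cons.prems by (simp add: astep_simps)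
  have b: "reach (length u + 1) ((Walk 1 A # x, y), s # l, u @ e # v) ((x, y), rev u @ s # l, e # v)"
    using Cons by simp
  show ?case using reach_step[OF a b, of "length (s # u) + 1"] by simp
qed

text \<open>The blank behind the last symbol may be present in the list or only implicit, hence the
  two forms of \<open>v\<close>.\<close>

lemma walk_right_end:
  assumes "\<forall>s \<in> set u. s \<notin> set A" "0 \<in> set A" "v = [] \<or> v = [0]"
  shows "reach (length u + 1) ((Walk 1 A # x, y), l, u @ v) ((x, y), rev u @ l, [0])"
  using assms
proof (induction u arbitrary: l)
  case Nil
  then show ?case by (intro reach_step[OF _ reach_refl[of 0]]) (auto simp: astep_simps)
next
  case (Cons s u)
  have a: "astep ((Walk 1 A # x, y), l, (s # u) @ v) = ((Walk 1 A # x, y), s # l, u @ v)"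
    using Cons.prems by (simp add: astep_simps)
  have b: "reach (length u + 1) ((Walk 1 A # x, y), s # l, u @ v) ((x, y), rev u @ s # l, [0])"
    using Cons by simp
  show ?case using reach_step[OF a b, of "length (s # u) + 1"] by simp
qed

text \<open>The head stands on the cell to the left of \<open>v\<close>.\<close>
lemma walk_left:
  assumes "\<forall>s \<in> set u. s \<notin> set A" "e \<in> set A"
  shows "reach (length u + 1) ((Walk (-1) A # x, y), tl (u @ e # l), hd0 (u @ e # l) # v) ((x, y), l, e # rev u @ v)"
  using assms
proof (induction u arbitrary: v)
  case Nil
  then show ?case by (intro reach_step[OF _ reach_refl[of 0]]) (simp_all add: astep_simps)
next
  case (Cons s u)
  have a: "astep ((Walk (-1) A # x, y), tl ((s # u) @ e # l), hd0 ((s # u) @ e # l) # v) =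
    ((Walk (-1) A # x, y), tl (u @ e # l), hd0 (u @ e # l) # s # v)"
    using Cons.prems by (simp add: astep_simps)
  have b: "reach (length u + 1) ((Walk (-1) A # x, y), tl (u @ e # l), hd0 (u @ e # l) # s # v) ((x, y), l, e # rev u @ s # v)"
    using Cons.prems by (intro Cons.IH) auto
  show ?case using reach_step[OF a b, of "length (s # u) + 1"] by simp
qed

lemma walk_left_end:
  assumes "\<forall>s \<in> set u. s \<noteq> 0" "z = [] \<or> z = [0]"
  shows "reach (length u + 1) ((Walk (-1) [0] # x, y), tl (u @ z), hd0 (u @ z) # v) ((x, y), [], 0 # rev u @ v)"
  using assms
proof (induction u arbitrary: v)
  case Nil
  then show ?case by (intro reach_step[OF _ reach_refl[of 0]]) (auto simp: astep_simps)
next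
  case (Cons s u)
  have a: "astep ((Walk (-1) [0] # x, y), tl ((s # u) @ z), hd0 ((s # u) @ z) # v) =
    ((Walk (-1) [0] # x, y), tl (u @ z), hd0 (u @ z) # s # v)"
    using Cons.prems by (simp add: astep_simps)
  have b: "reach (length u + 1) ((Walk (-1) [0] # x, y), tl (u @ z), hd0 (u @ z) # s # v) ((x, y), [], 0 # rev u @ s # v)"
    using Cons.prems by (intro Cons.IH) auto
  show ?case using reach_step[OF a b, of "length (s # u) + 1"] by simp
qed

lemma put_bits:
  "reach (length bs) ((map (\<lambda>b. Put (bcode b) (-1)) (rev bs) @ x, y), [], 0 # v) ((x, y), [], 0 # map bcode bs @ v)"
proof (induction bs arbitrary: v rule: rev_induct)
  case Nil
  then show ?case by (simp add: reach_refl)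
next
  case (snoc b bs)
  have a: "astep ((map (\<lambda>b. Put (bcode b) (-1)) (rev (bs @ [b])) @ x, y), [], 0 # v) =
    ((map (\<lambda>b. Put (bcode b) (-1)) (rev bs) @ x, y), [], 0 # bcode b # v)"
    by (simp add: astep_simps)
  show ?case using reach_step[OF a snoc.IH, of "length (bs @ [b])"] by simp
qed

lemma bcode_neq [simp]: "bcode b \<noteq> 0" "bcode b \<noteq> 3" "bcode b \<noteq> 6" "bcode b \<noteq> 7" "bcode b \<noteq> 8" "bcode b \<noteq> 4" "bcode b \<noteq> 5"
  by (cases b; simp)+

lemma bcode_pos [simp]: "0 < bcode b" "Suc 0 \<le> bcode b" by (cases b; simp)+

lemma emit_run:
  assumes z: "z = [] \<or> z = [0]"
  shows "reach (2 * length o' + 2 * length bs + 6) ((emit bs @ x, y), rev (map bcode o') @ z, 3 # r)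
    ((x, y), rev (map bcode (bs @ o')) @ [0], 3 # r)"
proof -
  let ?P = "map (\<lambda>b. Put (bcode b) (-1)) (rev bs) @ Walk 1 [3] # x"
  have nz: "\<forall>s \<in> set (3 # rev (map bcode o')). s \<noteq> 0" by auto
  have a1: "reach (length (3 # rev (map bcode o')) + 1) ((emit bs @ x, y), rev (map bcode o') @ z, 3 # r)
     ((?P, y), [], 0 # map bcode o' @ 3 # r)"
    using walk_left_end[OF nz z, of ?P y r] by (simp add: emit_def)
  have a2: "reach (length bs) ((?P, y), [], 0 # map bcode o' @ 3 # r)
     ((Walk 1 [3] # x, y), [], (0 # map bcode bs @ map bcode o') @ 3 # r)"
    using put_bits[of bs "Walk 1 [3] # x" y "map bcode o' @ 3 # r"] by simp
  have a3: "reach (length (0 # map bcode bs @ map bcode o') + 1) ((Walk 1 [3] # x, y), [], (0 # map bcode bs @ map bcode o') @ 3 # r)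
     ((x, y), rev (0 # map bcode bs @ map bcode o') @ [], 3 # r)"
    by (rule walk_right) auto
  have "reach (2 * length o' + 2 * length bs + 6) ((emit bs @ x, y), rev (map bcode o') @ z, 3 # r)
     ((x, y), rev (0 # map bcode bs @ map bcode o') @ [], 3 # r)"
    by (rule reach_trans[OF reach_trans[OF a1 a2 order_refl] a3]) simp
  then show ?thesis by simp
qed

definition home :: "mac list \<Rightarrow> bool list \<Rightarrow> nat list \<Rightarrow> bool list \<Rightarrow> ctl \<times> nat list \<times> nat list" where
  "home y o' wz bits = (([], y), rev (map bcode o') @ [0], 3 # wz @ 6 # map bcode bits @ [0])"

definition zone :: "nat list \<Rightarrow> bool" where "zone wz \<longleftrightarrow> set wz \<subseteq> {1, 2, 4, 5}"

lemma emit_home: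
  "reach (2 * length o' + 2 * length bs + 7) (home (Emit bs # y) o' wz bits) (home y (bs @ o') wz bits)"
proof -
  have "astep (home (Emit bs # y) o' wz bits) = ((emit bs @ [], y), rev (map bcode o') @ [0], 3 # wz @ 6 # map bcode bits @ [0])"
    by (simp add: home_def astep_simps)
  from reach_step[OF this emit_run, of "2 * length o' + 2 * length bs + 7"]
  show ?thesis unfolding home_def[of y] by simp
qed

text \<open>The bits \<open>c1\<close> are still to be copied and \<open>c2\<close> are done; the
  head is on the last bit of \<open>c1\<close>, or on the separator 6 when none is left. A round
  trip across the tape takes at most \<open>2 * G\<close> steps. The hypothesis on \<open>G\<close>
  survives each round because \<open>o'\<close> grows by 2 while \<open>c1\<close> shrinks by
  1.\<close>

lemma cnt_loop:
  assumes wz: "zone wz" and z: "z = [] \<or> z = [0]" and G: "length o' + 2 * length c1 + length wz + length c1 + 10 \<le> G"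
  shows "reach ((length c1 + 1) * (2 * G)) (([Br 0], y), tl (rev (3 # wz @ 6 # map bcode c1) @ rev (map bcode o') @ z),
      hd0 (rev (3 # wz @ 6 # map bcode c1) @ rev (map bcode o') @ z) # map bcode c2 @ [0])
    (([], y), rev (map bcode (dbl c1 @ o')) @ (if c1 = [] then z else [0]), 3 # wz @ 6 # map bcode (c1 @ c2) @ [0])"
  using z G
proof (induction c1 arbitrary: o' z c2 rule: rev_induct)
  case Nil
  let ?L = "rev wz @ 3 # rev (map bcode o') @ z"
  have s: "astep (([Br 0], y), ?L, 6 # map bcode c2 @ [0]) =
      (([Walk (-1) [3]], y), tl ((6 # rev wz) @ 3 # rev (map bcode o') @ z), hd0 ((6 # rev wz) @ 3 # rev (map bcode o') @ z) # map bcode c2 @ [0])"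
    by (simp add: astep_simps branch_def next_macs_def)
  have w: "reach (length (6 # rev wz) + 1) (([Walk (-1) [3]], y), tl ((6 # rev wz) @ 3 # rev (map bcode o') @ z), hd0 ((6 # rev wz) @ 3 # rev (map bcode o') @ z) # map bcode c2 @ [0])
      (([], y), rev (map bcode o') @ z, 3 # rev (6 # rev wz) @ map bcode c2 @ [0])"
    by (rule walk_left) (use wz in \<open>auto simp: zone_def\<close>)
  have "reach (length wz + 5) (([Br 0], y), ?L, 6 # map bcode c2 @ [0])
      (([], y), rev (map bcode o') @ z, 3 # rev (6 # rev wz) @ map bcode c2 @ [0])"
    by (rule reach_step[OF s w]) simp
  then show ?case using Nil by (simp add: dbl_def) (erule reach_mono, simp)
next
  case (snoc b d)
  let ?B = "rev (3 # wz @ 6 # map bcode d)"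
  let ?O = "rev (map bcode o')"
  let ?m = "if b then 8 else (7::nat)"
  let ?t = "map bcode c2 @ [0]"
  have nz: "\<forall>s \<in> set (?B @ ?O). s \<noteq> 0" using wz by (auto simp: zone_def)
  have a1: "reach 2 (([Br 0], y), ?B @ ?O @ z, bcode b # ?t)
     (([Walk (-1) [0], Put (bcode b) (-1), Put 2 (-1), Walk 1 [7, 8], Br 1], y), tl ((?B @ ?O) @ z), hd0 ((?B @ ?O) @ z) # ?m # ?t)"
    by (rule reach_step[OF _ reach_step[OF _ reach_refl[of 0]]]) (auto simp: astep_simps branch_def next_macs_def)
  have a2: "reach (length (?B @ ?O) + 1) (([Walk (-1) [0], Put (bcode b) (-1), Put 2 (-1), Walk 1 [7, 8], Br 1], y), tl ((?B @ ?O) @ z), hd0 ((?B @ ?O) @ z) # ?m # ?t)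
     (([Put (bcode b) (-1), Put 2 (-1), Walk 1 [7, 8], Br 1], y), [], 0 # rev (?B @ ?O) @ ?m # ?t)"
    by (rule walk_left_end[OF nz snoc.prems(1)])
  have a3: "reach 2 (([Put (bcode b) (-1), Put 2 (-1), Walk 1 [7, 8], Br 1], y), [], 0 # rev (?B @ ?O) @ ?m # ?t)
     (([Walk 1 [7, 8], Br 1], y), [], (0 # 2 # bcode b # rev (?B @ ?O)) @ ?m # ?t)"
    by (rule reach_step[OF _ reach_step[OF _ reach_refl[of 0]]]) (auto simp: astep_simps)
  have a4: "reach (length (0 # 2 # bcode b # rev (?B @ ?O)) + 1)
     (([Walk 1 [7, 8], Br 1], y), [], (0 # 2 # bcode b # rev (?B @ ?O)) @ ?m # ?t)
     (([Br 1], y), rev (0 # 2 # bcode b # rev (?B @ ?O)) @ [], ?m # ?t)"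
    by (rule walk_right) (use wz in \<open>auto simp: zone_def\<close>)
  have a5: "reach 2 (([Br 1], y), rev (0 # 2 # bcode b # rev (?B @ ?O)) @ [], ?m # ?t)
     (([Br 0], y), tl (?B @ rev (map bcode (True # b # o')) @ [0]), hd0 (?B @ rev (map bcode (True # b # o')) @ [0]) # map bcode (b # c2) @ [0])"
    by (rule reach_step[OF _ reach_step[OF _ reach_refl[of 0]]]) (auto simp: astep_simps branch_def next_macs_def)
  have a6: "reach ((length d + 1) * (2 * G)) (([Br 0], y), tl (?B @ rev (map bcode (True # b # o')) @ [0]), hd0 (?B @ rev (map bcode (True # b # o')) @ [0]) # map bcode (b # c2) @ [0])
     (([], y), rev (map bcode (dbl d @ True # b # o')) @ (if d = [] then [0] else [0]), 3 # wz @ 6 # map bcode (d @ b # c2) @ [0])"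
    by (rule snoc.IH) (use snoc.prems in auto)
  note t = reach_trans[OF reach_trans[OF reach_trans[OF reach_trans[OF a1 a2 order_refl] a3 order_refl] a4 order_refl] a5 order_refl]
  have "reach ((length d + 2) * (2 * G)) (([Br 0], y), ?B @ ?O @ z, bcode b # ?t)
     (([], y), rev (map bcode (dbl d @ True # b # o')) @ (if d = [] then [0] else [0]), 3 # wz @ 6 # map bcode (d @ b # c2) @ [0])"
    by (rule reach_trans[OF t a6]) (use snoc.prems(2) in simp)
  then show ?case by (simp add: dbl_def)
qed

lemma cnt_home:
  assumes wz: "zone wz" and G: "length o' + 2 * length bits + 2 + length wz + length bits + 10 \<le> G" and b: "bits \<noteq> []"
  shows "reach ((length bits + 4) * (2 * G)) (home (Cnt # y) o' wz bits) (home y (dbl bits @ [False, False] @ o') wz bits)"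
proof -
  let ?u = "3 # wz @ 6 # map bcode bits"
  let ?O = "rev (map bcode ([False, False] @ o')) @ [0]"
  have s: "astep (home (Cnt # y) o' wz bits) =
     ((emit [False, False] @ [Walk 1 [0], Mov (-1), Br 0], y), rev (map bcode o') @ [0], 3 # wz @ 6 # map bcode bits @ [0])"
    by (simp add: home_def astep_simps)
  have a1: "reach (2 * length o' + 11) (home (Cnt # y) o' wz bits)
     (([Walk 1 [0], Mov (-1), Br 0], y), ?O, ?u @ 0 # [])"
    using reach_step[OF s emit_run, of "2 * length o' + 11"] by simp
  have a2: "reach (length ?u + 1) (([Walk 1 [0], Mov (-1), Br 0], y), ?O, ?u @ 0 # []) (([Mov (-1), Br 0], y), rev ?u @ ?O, 0 # [])"
    by (rule walk_right) (use wz in \<open>auto simp: zone_def\<close>)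
  have a3: "reach 1 (([Mov (-1), Br 0], y), rev ?u @ ?O, 0 # []) (([Br 0], y), tl (rev ?u @ ?O), hd0 (rev ?u @ ?O) # map bcode [] @ [0])"
    by (rule reach_step[OF _ reach_refl[of 0]]) (simp_all add: astep_simps)
  have a4: "reach ((length bits + 1) * (2 * G)) (([Br 0], y), tl (rev ?u @ ?O), hd0 (rev ?u @ ?O) # map bcode [] @ [0])
     (([], y), rev (map bcode (dbl bits @ [False, False] @ o')) @ (if bits = [] then [0] else [0]), 3 # wz @ 6 # map bcode (bits @ []) @ [0])"
    by (rule cnt_loop[OF wz]) (use G in auto)
  note t = reach_trans[OF reach_trans[OF a1 a2 order_refl] a3 order_refl]
  have "reach ((length bits + 4) * (2 * G)) (home (Cnt # y) o' wz bits)
     (([], y), rev (map bcode (dbl bits @ [False, False] @ o')) @ (if bits = [] then [0] else [0]), 3 # wz @ 6 # map bcode (bits @ []) @ [0])"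
    by (rule reach_trans[OF t a4]) (use G in \<open>simp add: algebra_simps\<close>)
  then show ?thesis unfolding home_def[of y] by simp
qed

text \<open>\<open>D\<close> holds the bits to the left of the head that the carry has already
  turned into \<open>False\<close>.\<close>

lemma inc_loop:
  assumes wz: "zone wz" and D: "set D \<subseteq> {1}"
  shows "reach (length D + length wz + 3 * length bits + 8) (([Br 2], y), D @ 6 # rev wz @ 3 # l, map bcode bits @ [0])
     (([], y), l, 3 # wz @ 6 # rev D @ map bcode (incb bits) @ [0])"
  using D
proof (induction bits arbitrary: D rule: incb.induct)
  case 1
  let ?U = "2 # D @ 6 # rev wz"
  have a1: "reach 3 (([Br 2], y), D @ 6 # rev wz @ 3 # l, map bcode [] @ [0]) (([Walk (-1) [3]], y), tl (?U @ 3 # l), hd0 (?U @ 3 # l) # [0])"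
    by (rule reach_step[OF _ reach_step[OF _ reach_step[OF _ reach_refl[of 0]]]]) (auto simp: astep_simps branch_def next_macs_def)
  have a2: "reach (length ?U + 1) (([Walk (-1) [3]], y), tl (?U @ 3 # l), hd0 (?U @ 3 # l) # [0]) (([], y), l, 3 # rev ?U @ [0])"
    by (rule walk_left) (use wz 1 in \<open>auto simp: zone_def\<close>)
  show ?case using reach_trans[OF a1 a2, of "length D + length wz + 3 * length ([]::bool list) + 8"] by simp
next
  case (2 bs)
  let ?U = "D @ 6 # rev wz"
  have a1: "reach 2 (([Br 2], y), D @ 6 # rev wz @ 3 # l, map bcode (False # bs) @ [0]) (([Walk (-1) [3]], y), tl (?U @ 3 # l), hd0 (?U @ 3 # l) # 2 # map bcode bs @ [0])"
    by (rule reach_step[OF _ reach_step[OF _ reach_refl[of 0]]]) (auto simp: astep_simps branch_def next_macs_def)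
  have a2: "reach (length ?U + 1) (([Walk (-1) [3]], y), tl (?U @ 3 # l), hd0 (?U @ 3 # l) # 2 # map bcode bs @ [0]) (([], y), l, 3 # rev ?U @ 2 # map bcode bs @ [0])"
    by (rule walk_left) (use wz 2 in \<open>auto simp: zone_def\<close>)
  show ?case using reach_trans[OF a1 a2, of "length D + length wz + 3 * length (False # bs) + 8"] by simp
next
  case (3 bs)
  have a1: "reach 2 (([Br 2], y), D @ 6 # rev wz @ 3 # l, map bcode (True # bs) @ [0]) (([Br 2], y), (1 # D) @ 6 # rev wz @ 3 # l, map bcode bs @ [0])"
    by (rule reach_step[OF _ reach_step[OF _ reach_refl[of 0]]]) (auto simp: astep_simps branch_def next_macs_def)
  have a2: "reach (length (1 # D) + length wz + 3 * length bs + 8) (([Br 2], y), (1 # D) @ 6 # rev wz @ 3 # l, map bcode bs @ [0])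
     (([], y), l, 3 # wz @ 6 # rev (1 # D) @ map bcode (incb bs) @ [0])"
    by (rule 3(1)) (use 3(2) in simp)
  show ?case using reach_trans[OF a1 a2, of "length D + length wz + 3 * length (True # bs) + 8"] by simp
qed

lemma inc_home:
  assumes wz: "zone wz"
  shows "reach (2 * length wz + 3 * length bits + 15) (home (Inc # y) o' wz bits) (home y o' wz (incb bits))"
proof -
  have s: "astep (home (Inc # y) o' wz bits) = (([Walk 1 [6], Mov 1, Br 2], y), rev (map bcode o') @ [0], (3 # wz) @ 6 # map bcode bits @ [0])"
    by (simp add: home_def astep_simps)
  have w: "reach (length (3 # wz) + 1) (([Walk 1 [6], Mov 1, Br 2], y), rev (map bcode o') @ [0], (3 # wz) @ 6 # map bcode bits @ [0])
     (([Mov 1, Br 2], y), rev (3 # wz) @ rev (map bcode o') @ [0], 6 # map bcode bits @ [0])"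
    by (rule walk_right) (use wz in \<open>auto simp: zone_def\<close>)
  have m: "reach 1 (([Mov 1, Br 2], y), rev (3 # wz) @ rev (map bcode o') @ [0], 6 # map bcode bits @ [0])
     (([Br 2], y), [] @ 6 # rev wz @ 3 # rev (map bcode o') @ [0], map bcode bits @ [0])"
    by (rule reach_step[OF _ reach_refl[of 0]]) (simp_all add: astep_simps)
  have i: "reach (length wz + 3 * length bits + 8) (([Br 2], y), [] @ 6 # rev wz @ 3 # rev (map bcode o') @ [0], map bcode bits @ [0])
     (([], y), rev (map bcode o') @ [0], 3 # wz @ 6 # map bcode (incb bits) @ [0])"
    using inc_loop[OF wz, of "[]" bits y "rev (map bcode o') @ [0]"] by simp
  have "reach (2 * length wz + 3 * length bits + 13) (([Walk 1 [6], Mov 1, Br 2], y), rev (map bcode o') @ [0], (3 # wz) @ 6 # map bcode bits @ [0])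
     (([], y), rev (map bcode o') @ [0], 3 # wz @ 6 # map bcode (incb bits) @ [0])"
    by (rule reach_trans[OF reach_trans[OF w m order_refl] i]) simp
  from reach_step[OF s this, of "2 * length wz + 3 * length bits + 15"] show ?thesis unfolding home_def[of y] by simp
qed

lemma mark_left:
  assumes "\<forall>s \<in> set v. s \<noteq> 3"
  shows "reach (length v + 4) (([Put a (-1), Walk (-1) [3]], y), rev v @ 3 # l, c # r) (([], y), l, 3 # v @ a # r)"
proof -
  have s: "astep (([Put a (-1), Walk (-1) [3]], y), rev v @ 3 # l, c # r) = (([Walk (-1) [3]], y), tl (rev v @ 3 # l), hd0 (rev v @ 3 # l) # a # r)"
    by (simp add: astep_simps)
  have "reach (length (rev v) + 1) (([Walk (-1) [3]], y), tl (rev v @ 3 # l), hd0 (rev v @ 3 # l) # a # r) (([], y), l, 3 # rev (rev v) @ a # r)"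
    by (rule walk_left) (use assms in auto)
  from reach_step[OF s this, of "length v + 4"] show ?thesis by simp
qed

text \<open>\<open>v\<close> is the processed prefix and \<open>c\<close> the first symbol at which
  the walk stops: an input cell to be marked, or the separator 6, at which the loop is left.\<close>

lemma loop_home:
  assumes m: "m = Loop1 \<and> i = 3 \<and> A = [1, 2, 6] \<and> a = 4 \<or> m = Loop2 \<and> i = 4 \<and> A = [4, 6] \<and> a = 5"
    and v: "set v \<subseteq> {4, 5}" "set v \<inter> set A = {}" and c: "c \<in> set A"
    and r: "3 # wz @ 6 # map bcode bits @ [0] = (3 # v) @ c # r"
  shows "c \<noteq> 6 \<Longrightarrow> reach (2 * length v + 12) (home (m # y) o' wz bits) (([], next_macs i c y), rev (map bcode o') @ [0], 3 # v @ a # r)"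
    "c = 6 \<Longrightarrow> reach (2 * length v + 12) (home (m # y) o' wz bits) (([], next_macs i c y), rev (map bcode o') @ [0], 3 # v @ c # r)"
proof -
  let ?l = "rev (map bcode o') @ [0]"
  have s: "astep (home (m # y) o' wz bits) = (([Walk 1 A, Br i], y), ?l, (3 # v) @ c # r)"
    using m r by (auto simp: home_def astep_simps)
  have w: "reach (length (3 # v) + 1) (([Walk 1 A, Br i], y), ?l, (3 # v) @ c # r) (([Br i], y), rev (3 # v) @ ?l, c # r)"
    by (rule walk_right) (use v c m in auto)
  have sw: "reach (length v + 3) (home (m # y) o' wz bits) (([Br i], y), rev (3 # v) @ ?l, c # r)"
    by (rule reach_step[OF s w]) simp
  have b: "astep (([Br i], y), rev (3 # v) @ ?l, c # r) = ((branch i c, next_macs i c y), rev (3 # v) @ ?l, c # r)"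
    by (simp add: astep_simps)
  have n3: "\<forall>s \<in> set v. s \<noteq> 3" using v by auto
  show "reach (2 * length v + 12) (home (m # y) o' wz bits) (([], next_macs i c y), ?l, 3 # v @ a # r)" if "c \<noteq> 6"
  proof -
    have "branch i c = [Put a (-1), Walk (-1) [3]]" using m that by (auto simp: branch_def)
    then have "reach (length v + 5) (([Br i], y), rev (3 # v) @ ?l, c # r) (([], next_macs i c y), ?l, 3 # v @ a # r)"
      using reach_step[OF b, of "length v + 4" _ "length v + 5"] mark_left[OF n3, of a "next_macs i c y" ?l c r] by simp
    then show ?thesis by (rule reach_trans[OF sw]) simp
  qed
  show "reach (2 * length v + 12) (home (m # y) o' wz bits) (([], next_macs i c y), ?l, 3 # v @ c # r)" if "c = 6"
  proof -
    have br: "branch i c = [Walk (-1) [3]]" using m that by (auto simp: branch_def)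
    have "reach (length (c # rev v) + 1) (([Walk (-1) [3]], next_macs i c y), tl ((c # rev v) @ 3 # ?l), hd0 ((c # rev v) @ 3 # ?l) # r) (([], next_macs i c y), ?l, 3 # rev (c # rev v) @ r)"
      by (rule walk_left) (use n3 that in auto)
    then have "reach (length v + 3) (([Br i], y), rev (3 # v) @ ?l, c # r) (([], next_macs i c y), ?l, 3 # v @ c # r)"
      using reach_step[OF b, of "length v + 2" _ "length v + 3"] by (simp add: br)
    then show ?thesis by (rule reach_trans[OF sw]) simp
  qed
qed

lemma zone_rep [simp]: "zone (replicate i 4 @ map bcode u)" "zone (replicate i 5 @ replicate j 4)" "zone (replicate i 4)"
  by (auto simp: zone_def bcode_def)

definition block :: "nat \<Rightarrow> bool \<Rightarrow> bool list" where
  "block i b = Qb b @ enc_nat (i + 2) @ Rr @ enc_nat (i + 1) @ pad"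

text \<open>Bits are processed from first to last while the output grows to the left, so their
  blocks appear in reverse order.\<close>

fun blocks :: "nat \<Rightarrow> bool list \<Rightarrow> bool list" where
  "blocks i [] = []"
| "blocks i (b # bs) = blocks (Suc i) bs @ block i b"

fun copies :: "nat \<Rightarrow> bool list" where
  "copies 0 = []"
| "copies (Suc k) = S1 @ copies k"

lemma copies_comm: "copies k @ S1 = S1 @ copies k"
  by (induction k) auto

context
  fixes G :: nat
  assumes G20: "20 \<le> G"
begin

text \<open>A common cost bound for all macro instructions, where \<open>G\<close> bounds the length
  of the tape. Only \<open>Cnt\<close> takes quadratic time, one round trip per bit of the
  counter.\<close>

abbreviation mc :: nat where "mc \<equiv> 4 * G * G"

lemma mc_ge: "k \<le> 4 * G \<Longrightarrow> k \<le> mc"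
proof -
  assume "k \<le> 4 * G"
  moreover have "4 * G * 1 \<le> 4 * G * G" using G20 by (intro mult_le_mono2) simp
  ultimately show ?thesis by linarith
qed

lemma emit_mc: "length (bs @ o') + 4 \<le> G \<Longrightarrow> reach mc (home (Emit bs # y) o' wz bits) (home y (bs @ o') wz bits)"
  by (rule reach_mono[OF emit_home], rule mc_ge) simp

lemma cnt_mc:
  assumes "zone wz" "length (enc_nat (Suc v) @ o') + length wz + length (nat_bits (Suc v)) + 12 \<le> G"
  shows "reach mc (home (Cnt # y) o' wz (nat_bits (Suc v))) (home y (enc_nat (Suc v) @ o') wz (nat_bits (Suc v)))"
proof -
  have e: "dbl (nat_bits (Suc v)) @ [False, False] @ o' = enc_nat (Suc v) @ o'" by (simp add: enc_nat_def)
  have l: "length o' + 2 * length (nat_bits (Suc v)) + 2 + length wz + length (nat_bits (Suc v)) + 10 \<le> G"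
    using assms(2) by (simp add: enc_nat_def length_dbl)
  have "(length (nat_bits (Suc v)) + 4) * (2 * G) \<le> G * (2 * G)"
    using l by (intro mult_le_mono1) simp
  also have "\<dots> \<le> mc" by simp
  finally have "(length (nat_bits (Suc v)) + 4) * (2 * G) \<le> mc" .
  then show ?thesis using reach_mono[OF cnt_home[OF assms(1) l nat_bits_neq]] unfolding e by blast
qed

lemma inc_mc:
  "zone wz \<Longrightarrow> length wz + length (nat_bits v) + 4 \<le> G \<Longrightarrow> reach mc (home (Inc # y) o' wz (nat_bits v)) (home y o' wz (nat_bits (Suc v)))"
  unfolding nat_bits_Suc by (rule reach_mono[OF inc_home], assumption, rule mc_ge) simp

lemma loop1_run:
  assumes "length (blocks i u @ o') + i + length u + length (nat_bits (Suc (i + length u))) + (i + length u + 2) + 14 \<le> G"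
  shows "reach ((7 * length u + 1) * mc) (home [Loop1] o' (replicate i 4 @ map bcode u) (nat_bits (Suc i)))
     (home after1 (blocks i u @ o') (replicate (i + length u) 4) (nat_bits (Suc (i + length u))))"
  using assms
proof (induction u arbitrary: i o')
  case Nil
  have a: "reach (2 * length (replicate i (4::nat)) + 12) (home [Loop1] o' (replicate i 4) (nat_bits (Suc i)))
     (([], next_macs 3 6 []), rev (map bcode o') @ [0], 3 # replicate i 4 @ 6 # map bcode (nat_bits (Suc i)) @ [0])"
    by (rule loop_home(2)[where A = "[1, 2, 6]" and a = 4]) auto
  have n: "next_macs 3 6 [] = after1" by (simp add: next_macs_def)
  have m: "2 * length (replicate i (4::nat)) + 12 \<le> mc" by (rule mc_ge) (use Nil in simp)
  have "reach mc (home [Loop1] o' (replicate i 4) (nat_bits (Suc i))) (home after1 o' (replicate i 4) (nat_bits (Suc i)))"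
    using reach_mono[OF a[unfolded n] m] unfolding home_def[of after1] .
  then show ?case by simp
next
  case (Cons b u)
  let ?wz = "replicate i 4 @ map bcode (b # u)"
  let ?wz' = "replicate (Suc i) (4::nat) @ map bcode u"
  have lb: "length (nat_bits (Suc i)) \<le> Suc i" "length (nat_bits (Suc (Suc i))) \<le> Suc (Suc i)" by (rule length_nat_bits)+
  have lo: "length (block i b @ o') + Suc (i + length u) + (i + length u + 3) + 14 \<le> G" using Cons.prems by simp
  have lz: "length ?wz' = Suc (i + length u)" by simp
  have a: "reach (2 * length (replicate i (4::nat)) + 12) (home [Loop1] o' ?wz (nat_bits (Suc i)))
     (([], next_macs 3 (bcode b) []), rev (map bcode o') @ [0], 3 # replicate i 4 @ 4 # map bcode u @ 6 # map bcode (nat_bits (Suc i)) @ [0])"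
    by (rule loop_home(1)[where A = "[1, 2, 6]" and a = 4]) (auto simp: bcode_def)
  have n: "next_macs 3 (bcode b) [] = lbody b" by (auto simp: next_macs_def bcode_def)
  have e: "3 # replicate i 4 @ 4 # map bcode u @ 6 # map bcode (nat_bits (Suc i)) @ [0] = 3 # ?wz' @ 6 # map bcode (nat_bits (Suc i)) @ [0]"
    by (simp add: replicate_app_Cons_same)
  have m: "2 * length (replicate i (4::nat)) + 12 \<le> mc" by (rule mc_ge) (use lo in simp)
  have 1: "reach mc (home [Loop1] o' ?wz (nat_bits (Suc i))) (home (lbody b) o' ?wz' (nat_bits (Suc i)))"
    using reach_mono[OF a[unfolded n e] m] unfolding home_def[of "lbody b"] .
  have 2: "reach mc (home (lbody b) o' ?wz' (nat_bits (Suc i))) (home [Cnt, Emit Rr, Inc, Cnt, Emit (Qb b), Loop1] (pad @ o') ?wz' (nat_bits (Suc i)))"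
    unfolding lbody_def by (rule emit_mc) (use lo in \<open>simp add: block_def\<close>)
  let ?o1 = "enc_nat (Suc i) @ pad @ o'"
  have 3: "reach mc (home [Cnt, Emit Rr, Inc, Cnt, Emit (Qb b), Loop1] (pad @ o') ?wz' (nat_bits (Suc i)))
     (home [Emit Rr, Inc, Cnt, Emit (Qb b), Loop1] ?o1 ?wz' (nat_bits (Suc i)))"
    by (rule cnt_mc, rule zone_rep) (use lo lb lz in \<open>simp add: block_def\<close>)
  have 4: "reach mc (home [Emit Rr, Inc, Cnt, Emit (Qb b), Loop1] ?o1 ?wz' (nat_bits (Suc i)))
     (home [Inc, Cnt, Emit (Qb b), Loop1] (Rr @ ?o1) ?wz' (nat_bits (Suc i)))"
    by (rule emit_mc) (use lo in \<open>simp add: block_def\<close>)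
  have 5: "reach mc (home [Inc, Cnt, Emit (Qb b), Loop1] (Rr @ ?o1) ?wz' (nat_bits (Suc i)))
     (home [Cnt, Emit (Qb b), Loop1] (Rr @ ?o1) ?wz' (nat_bits (Suc (Suc i))))"
    by (rule inc_mc, rule zone_rep) (use lo lb lz in simp)
  let ?o2 = "enc_nat (Suc (Suc i)) @ Rr @ ?o1"
  have 6: "reach mc (home [Cnt, Emit (Qb b), Loop1] (Rr @ ?o1) ?wz' (nat_bits (Suc (Suc i))))
     (home [Emit (Qb b), Loop1] ?o2 ?wz' (nat_bits (Suc (Suc i))))"
    by (rule cnt_mc, rule zone_rep) (use lo lb lz in \<open>simp add: block_def\<close>)
  have 7: "reach mc (home [Emit (Qb b), Loop1] ?o2 ?wz' (nat_bits (Suc (Suc i))))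
     (home [Loop1] (Qb b @ ?o2) ?wz' (nat_bits (Suc (Suc i))))"
    by (rule emit_mc) (use lo in \<open>simp add: block_def\<close>)
  have o3: "Qb b @ ?o2 = block i b @ o'" by (simp add: block_def)
  have 8: "reach ((7 * length u + 1) * mc) (home [Loop1] (block i b @ o') ?wz' (nat_bits (Suc (Suc i))))
     (home after1 (blocks (Suc i) u @ block i b @ o') (replicate (Suc i + length u) 4) (nat_bits (Suc (Suc i + length u))))"
    by (rule Cons.IH) (use Cons.prems in simp)
  note t = reach_trans[OF reach_trans[OF reach_trans[OF reach_trans[OF reach_trans[OF reach_trans[OF 1 2 order_refl] 3 order_refl] 4 order_refl] 5 order_refl] 6 order_refl] 7[unfolded o3] order_refl]
  have "reach ((7 * length (b # u) + 1) * mc) (home [Loop1] o' ?wz (nat_bits (Suc i)))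
     (home after1 (blocks (Suc i) u @ block i b @ o') (replicate (Suc i + length u) 4) (nat_bits (Suc (Suc i + length u))))"
    by (rule reach_trans[OF t 8]) (simp add: algebra_simps)
  then show ?case by simp
qed

lemma loop2_run:
  assumes "length (copies j @ o') + 2 * (i + j) + 14 \<le> G"
  shows "reach ((2 * j + 1) * mc) (home [Loop2] o' (replicate i 5 @ replicate j 4) bits)
     (home after2 (copies j @ o') (replicate (i + j) 5) bits)"
  using assms
proof (induction j arbitrary: i o')
  case 0
  have a: "reach (2 * length (replicate i (5::nat)) + 12) (home [Loop2] o' (replicate i 5) bits)
     (([], next_macs 4 6 []), rev (map bcode o') @ [0], 3 # replicate i 5 @ 6 # map bcode bits @ [0])"
    by (rule loop_home(2)[where A = "[4, 6]" and a = 5]) auto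
  have n: "next_macs 4 6 [] = after2" by (simp add: next_macs_def)
  have m: "2 * length (replicate i (5::nat)) + 12 \<le> mc" by (rule mc_ge) (use 0 in simp)
  have "reach mc (home [Loop2] o' (replicate i 5) bits) (home after2 o' (replicate i 5) bits)"
    using reach_mono[OF a[unfolded n] m] unfolding home_def[of after2] .
  then show ?case by simp
next
  case (Suc j)
  let ?wz = "replicate i (5::nat) @ replicate (Suc j) 4"
  let ?wz' = "replicate (Suc i) (5::nat) @ replicate j 4"
  have a: "reach (2 * length (replicate i (5::nat)) + 12) (home [Loop2] o' ?wz bits)
     (([], next_macs 4 4 []), rev (map bcode o') @ [0], 3 # replicate i 5 @ 5 # replicate j 4 @ 6 # map bcode bits @ [0])"
    by (rule loop_home(1)[where A = "[4, 6]" and a = 5]) auto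
  have n: "next_macs 4 4 [] = [Emit S1, Loop2]" by (simp add: next_macs_def)
  have e: "3 # replicate i 5 @ 5 # replicate j 4 @ 6 # map bcode bits @ [0] = 3 # ?wz' @ 6 # map bcode bits @ [0]"
    by (simp add: replicate_app_Cons_same)
  have m: "2 * length (replicate i (5::nat)) + 12 \<le> mc" by (rule mc_ge) (use Suc.prems in simp)
  have 1: "reach mc (home [Loop2] o' ?wz bits) (home [Emit S1, Loop2] o' ?wz' bits)"
    using reach_mono[OF a[unfolded n e] m] unfolding home_def[of "[Emit S1, Loop2]"] .
  have 2: "reach mc (home [Emit S1, Loop2] o' ?wz' bits) (home [Loop2] (S1 @ o') ?wz' bits)"
    by (rule emit_mc) (use Suc.prems in simp)
  have e: "copies j @ S1 @ o' = copies (Suc j) @ o'" using copies_comm[of j] by (metis append.assoc copies.simps(2))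
  have 3: "reach ((2 * j + 1) * mc) (home [Loop2] (S1 @ o') ?wz' bits) (home after2 (copies j @ S1 @ o') (replicate (Suc i + j) 5) bits)"
    by (rule Suc.IH) (use Suc.prems in simp)
  have "reach ((2 * Suc j + 1) * mc) (home [Loop2] o' ?wz bits) (home after2 (copies (Suc j) @ o') (replicate (Suc i + j) 5) bits)"
    unfolding e[symmetric] by (rule reach_trans[OF reach_trans[OF 1 2 order_refl] 3]) (simp add: algebra_simps)
  then show ?case by simp
qed

end

definition out :: "bool list \<Rightarrow> bool list" where
  "out w = (let X = enc_nat (Suc (length w)) in
     P0 @ X @ P1 @ copies (length w) @ P2 @ X @ P3 @ X @ blocks 0 w @ P5)"

text \<open>There are seven macro instructions per bit in the first loop and two in the second, plus
  a constant number, each within \<open>4 * G * G\<close> steps.\<close>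

lemma out_run:
  assumes G: "length (out w) + 3 * length w + 40 \<le> G"
  shows "\<exists>l r. reach ((9 * length w + 12) * (4 * G * G)) (([], main), [], map bcode w) (([], []), l, map bcode (out w) @ 3 # r)"
proof -
  let ?n = "length w"
  let ?X = "enc_nat (Suc ?n)"
  let ?bits = "nat_bits (Suc ?n)"
  let ?m = "4 * G * G"
  have G20: "20 \<le> G" using G by simp
  have lb: "length ?bits \<le> Suc ?n" by (rule length_nat_bits)
  have X1: "nat_bits (Suc 0) = [True]" using nat_bits_double(2)[of 0] by simp
  let ?c0 = "(([], main), [], map bcode w)"
  let ?y = "[Emit P5, Loop1]"
  \<comment> \<open>For the empty input, reading the first cell turns the implicit blank into an
    explicit entry.\<close>
  define q where "q = (if w = [] then [0::nat] else [])"
  have i1: "reach 3 ?c0 (([Walk 1 [0], Put 6 1, Put 2 1, Put 0 (-1), Walk (-1) [3]], ?y), [3], map bcode w @ q)"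
    by (rule reach_step[OF _ reach_step[OF _ reach_step[OF _ reach_refl[of 0]]]])
      (auto simp: astep_simps main_def q_def, cases w, auto)
  have i2: "reach (length (map bcode w) + 1) (([Walk 1 [0], Put 6 1, Put 2 1, Put 0 (-1), Walk (-1) [3]], ?y), [3], map bcode w @ q)
     (([Put 6 1, Put 2 1, Put 0 (-1), Walk (-1) [3]], ?y), rev (map bcode w) @ [3], [0])"
    by (rule walk_right_end) (auto simp: q_def)
  let ?U = "2 # 6 # rev (map bcode w)"
  have i3: "reach 3 (([Put 6 1, Put 2 1, Put 0 (-1), Walk (-1) [3]], ?y), rev (map bcode w) @ [3], [0])
     (([Walk (-1) [3]], ?y), tl (?U @ 3 # []), hd0 (?U @ 3 # []) # [0])"
    by (rule reach_step[OF _ reach_step[OF _ reach_step[OF _ reach_refl[of 0]]]]) (auto simp: astep_simps)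
  have i4: "reach (length ?U + 1) (([Walk (-1) [3]], ?y), tl (?U @ 3 # []), hd0 (?U @ 3 # []) # [0]) (([], ?y), [], 3 # rev ?U @ [0])"
    by (rule walk_left) auto
  let ?r = "map bcode w @ 6 # map bcode [True] @ [0]"
  have i5: "reach 1 (([], ?y), [], 3 # ?r) ((emit P5 @ [], [Loop1]), rev (map bcode []) @ [], 3 # ?r)"
    by (rule reach_step[OF _ reach_refl[of 0]]) (simp_all add: astep_simps)
  have i6: "reach (2 * length ([]::bool list) + 2 * length P5 + 6) ((emit P5 @ [], [Loop1]), rev (map bcode []) @ [], 3 # ?r)
     (([], [Loop1]), rev (map bcode (P5 @ [])) @ [0], 3 # ?r)"
    by (rule emit_run) simp
  have e4: "3 # rev ?U @ [0] = 3 # ?r" by simp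
  have h: "(([], [Loop1]), rev (map bcode (P5 @ [])) @ [0], 3 # ?r) = home [Loop1] P5 (replicate 0 4 @ map bcode w) (nat_bits (Suc 0))"
    by (simp add: home_def X1)
  have lout: "length (out w) = length P0 + length P1 + length (copies ?n) + length P2 + length P3 + length (blocks 0 w) + length P5 + 3 * length ?X"
    by (simp add: out_def Let_def)
  note t = reach_trans[OF reach_trans[OF reach_trans[OF reach_trans[OF reach_trans[OF i1 i2 order_refl] i3 order_refl] i4[unfolded e4] order_refl] i5 order_refl] i6[unfolded h] order_refl]
  have 1: "reach ?m ?c0 (home [Loop1] P5 (replicate 0 4 @ map bcode w) (nat_bits (Suc 0)))"
    by (rule reach_mono[OF t], rule mc_ge[OF G20]) (use G lout in simp)
  let ?o1 = "blocks 0 w @ P5"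
  have 2: "reach ((7 * ?n + 1) * ?m) (home [Loop1] P5 (replicate 0 4 @ map bcode w) (nat_bits (Suc 0)))
     (home after1 ?o1 (replicate (0 + ?n) 4) (nat_bits (Suc (0 + ?n))))"
    by (rule loop1_run[OF G20]) (use G lout lb in simp)
  let ?wz = "replicate ?n (4::nat)"
  have 3: "reach ?m (home [Cnt, Emit P3, Cnt, Emit P2, Loop2] ?o1 ?wz ?bits) (home [Emit P3, Cnt, Emit P2, Loop2] (?X @ ?o1) ?wz ?bits)"
    by (rule cnt_mc[OF G20 zone_rep(3)]) (use G lout lb in simp)
  have 4: "reach ?m (home [Emit P3, Cnt, Emit P2, Loop2] (?X @ ?o1) ?wz ?bits) (home [Cnt, Emit P2, Loop2] (P3 @ ?X @ ?o1) ?wz ?bits)"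
    by (rule emit_mc[OF G20]) (use G lout lb in simp)
  let ?o2 = "?X @ P3 @ ?X @ ?o1"
  have 5: "reach ?m (home [Cnt, Emit P2, Loop2] (P3 @ ?X @ ?o1) ?wz ?bits) (home [Emit P2, Loop2] ?o2 ?wz ?bits)"
    by (rule cnt_mc[OF G20 zone_rep(3)]) (use G lout lb in simp)
  have 6: "reach ?m (home [Emit P2, Loop2] ?o2 ?wz ?bits) (home [Loop2] (P2 @ ?o2) (replicate 0 5 @ ?wz) ?bits)"
    unfolding replicate.simps append.simps by (rule emit_mc[OF G20]) (use G lout lb in simp)
  let ?o3 = "copies ?n @ P2 @ ?o2"
  have 7: "reach ((2 * ?n + 1) * ?m) (home [Loop2] (P2 @ ?o2) (replicate 0 5 @ ?wz) ?bits) (home after2 ?o3 (replicate (0 + ?n) 5) ?bits)"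
    by (rule loop2_run[OF G20]) (use G lout lb in simp)
  let ?wz5 = "replicate ?n (5::nat)"
  have z5: "zone ?wz5" by (auto simp: zone_def)
  have 8: "reach ?m (home [Emit P1, Cnt, Emit P0, Fin] ?o3 ?wz5 ?bits) (home [Cnt, Emit P0, Fin] (P1 @ ?o3) ?wz5 ?bits)"
    by (rule emit_mc[OF G20]) (use G lout lb in simp)
  have 9: "reach ?m (home [Cnt, Emit P0, Fin] (P1 @ ?o3) ?wz5 ?bits) (home [Emit P0, Fin] (?X @ P1 @ ?o3) ?wz5 ?bits)"
    by (rule cnt_mc[OF G20 z5]) (use G lout lb in simp)
  have 10: "reach ?m (home [Emit P0, Fin] (?X @ P1 @ ?o3) ?wz5 ?bits) (home [Fin] (P0 @ ?X @ P1 @ ?o3) ?wz5 ?bits)"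
    by (rule emit_mc[OF G20]) (use G lout lb in simp)
  have o4: "P0 @ ?X @ P1 @ ?o3 = out w" by (simp add: out_def Let_def)
  let ?R = "?wz5 @ 6 # map bcode ?bits @ [0]"
  have f1: "reach 1 (home [Fin] (out w) ?wz5 ?bits)
     (([Walk (-1) [0], Mov 1], []), tl ((3 # rev (map bcode (out w))) @ [0]), hd0 ((3 # rev (map bcode (out w))) @ [0]) # ?R)"
    by (rule reach_step[OF _ reach_refl[of 0]]) (simp_all add: astep_simps home_def)
  have f2: "reach (length (3 # rev (map bcode (out w))) + 1)
     (([Walk (-1) [0], Mov 1], []), tl ((3 # rev (map bcode (out w))) @ [0]), hd0 ((3 # rev (map bcode (out w))) @ [0]) # ?R)
     (([Mov 1], []), [], 0 # rev (3 # rev (map bcode (out w))) @ ?R)"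
    by (rule walk_left_end) auto
  have f3: "reach 1 (([Mov 1], []), [], 0 # rev (3 # rev (map bcode (out w))) @ ?R) (([], []), [0], map bcode (out w) @ 3 # ?R)"
    by (rule reach_step[OF _ reach_refl[of 0]]) (simp_all add: astep_simps)
  have 11: "reach ?m (home [Fin] (out w) ?wz5 ?bits) (([], []), [0], map bcode (out w) @ 3 # ?R)"
    by (rule reach_mono[OF reach_trans[OF reach_trans[OF f1 f2 order_refl] f3 order_refl]], rule mc_ge[OF G20]) (use G in simp)
  note u = reach_trans[OF reach_trans[OF reach_trans[OF reach_trans[OF reach_trans[OF reach_trans[OF
      1 2[unfolded after1_def add_0] order_refl] 3 order_refl] 4 order_refl] 5 order_refl] 6 order_refl] 7[unfolded after2_def add_0] order_refl]
  note v = reach_trans[OF reach_trans[OF reach_trans[OF reach_trans[OF u 8 order_refl] 9 order_refl] 10[unfolded o4] order_refl] 11 order_refl]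
  have "reach ((9 * ?n + 12) * ?m) ?c0 (([], []), [0], map bcode (out w) @ 3 # ?R)"
    by (rule reach_mono[OF v]) (simp add: algebra_simps)
  then show ?thesis by blast
qed

text \<open>The machine must have finitely many states. Its control always consists of suffixes of
  finitely many fixed lists, which play the role of a program counter.\<close>

definition suffixes_of :: "'b list \<Rightarrow> 'b list set" where
  "suffixes_of b = (\<lambda>k. drop k b) ` {..length b}"

lemma suffixes_self: "b \<in> suffixes_of b"
  unfolding suffixes_of_def by (rule image_eqI[of _ _ 0]) auto

lemma suffixes_Cons: "a # x \<in> suffixes_of b \<Longrightarrow> x \<in> suffixes_of b \<and> a \<in> set b"
proof -
  assume "a # x \<in> suffixes_of b"
  then obtain k where k: "a # x = drop k b" by (auto simp: suffixes_of_def)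
  then have "k < length b" by (metis drop_all list.discI not_less)
  moreover have "x = drop (Suc k) b" using k by (metis drop_Suc list.sel(3) tl_drop)
  moreover have "a \<in> set b" using k by (metis in_set_dropD list.set_intros(1))
  ultimately show ?thesis by (auto simp: suffixes_of_def)
qed

definition mac_lists :: "mac list set" where
  "mac_lists = {main, after1, after2, lbody True, lbody False, [Emit S1, Loop2]}"

definition macs :: "mac set" where "macs = (\<Union>y \<in> mac_lists. set y)"

definition mop_lists :: "mop list set" where
  "mop_lists = body ` macs \<union> (\<lambda>(i, s). branch i s) ` ({..<5} \<times> {..<9})"

definition ctls :: "ctl set" where
  "ctls = (\<Union>x \<in> mop_lists. suffixes_of x) \<times> (\<Union>y \<in> mac_lists. suffixes_of y)"

lemma finite_ctls: "finite ctls"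
  by (auto simp: ctls_def mop_lists_def macs_def mac_lists_def suffixes_of_def)

fun mop_ok :: "mop \<Rightarrow> bool" where
  "mop_ok (Walk d A) \<longleftrightarrow> d \<in> {-1, 0, 1}"
| "mop_ok (Put b d) \<longleftrightarrow> b < 9 \<and> d \<in> {-1, 0, 1}"
| "mop_ok (Mov d) \<longleftrightarrow> d \<in> {-1, 0, 1}"
| "mop_ok (Br i) \<longleftrightarrow> i < 5"

lemma emit_ok: "mop \<in> set (emit bs) \<Longrightarrow> mop_ok mop"
  by (auto simp: emit_def bcode_def)

lemma body_ok: "mop \<in> set (body m) \<Longrightarrow> mop_ok mop"
  by (cases m) (auto dest: emit_ok)

lemma branch_ok: "mop \<in> set (branch i s) \<Longrightarrow> mop_ok mop"
  by (auto simp: branch_def split: if_splits)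

lemma mop_lists_ok: "x \<in> mop_lists \<Longrightarrow> mop \<in> set x \<Longrightarrow> mop_ok mop"
  by (auto simp: mop_lists_def dest: body_ok branch_ok)

lemma next_macs_mem: "y \<in> (\<Union>y \<in> mac_lists. suffixes_of y) \<Longrightarrow> next_macs i s y \<in> (\<Union>y \<in> mac_lists. suffixes_of y)"
proof -
  assume y: "y \<in> (\<Union>y \<in> mac_lists. suffixes_of y)"
  have "next_macs i s y = y \<or> next_macs i s y \<in> mac_lists"
    by (cases "s = 2") (auto simp: next_macs_def mac_lists_def)
  then show ?thesis using y suffixes_self by blast
qed

lemma nil_mem: "[] \<in> suffixes_of b"
  unfolding suffixes_of_def by (rule image_eqI[of _ _ "length b"]) auto

lemma adelta_closed:
  assumes c: "c \<in> ctls" and s: "s < 9" and d: "adelta c s = (c', s', d)"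
  shows "c' \<in> ctls \<and> s' < 9 \<and> d \<in> {-1, 0, 1}"
proof -
  obtain x y where xy: "c = (x, y)" by (cases c)
  have x: "x \<in> (\<Union>x \<in> mop_lists. suffixes_of x)" and y: "y \<in> (\<Union>y \<in> mac_lists. suffixes_of y)"
    using c by (auto simp: ctls_def xy)
  show ?thesis
  proof (cases x)
    case Nil
    show ?thesis
    proof (cases y)
      case Nil
      then show ?thesis using \<open>x = []\<close> c s d xy by auto
    next
      case (Cons m y')
      then have "y' \<in> (\<Union>y \<in> mac_lists. suffixes_of y)" "m \<in> macs"
        using y suffixes_Cons[of m y'] by (auto simp: macs_def)
      then have "(body m, y') \<in> ctls" using suffixes_self[of "body m"] by (auto simp: ctls_def mop_lists_def)
      then show ?thesis using \<open>x = []\<close> Cons s d xy by auto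
    qed
  next
    case (Cons p x')
    then obtain b where b: "b \<in> mop_lists" "p # x' \<in> suffixes_of b" using x by blast
    have x': "x' \<in> (\<Union>x \<in> mop_lists. suffixes_of x)" and ok: "mop_ok p"
      using suffixes_Cons[OF b(2)] b(1) mop_lists_ok by auto
    have xy': "(x', y) \<in> ctls" using x' y by (simp add: ctls_def)
    show ?thesis
    proof (cases p)
      case (Br i)
      have "(i, s) \<in> {..<5} \<times> {..<9}" using ok Br s by simp
      then have "branch i s \<in> mop_lists" unfolding mop_lists_def by (intro UnI2 image_eqI[of _ _ "(i, s)"]) simp_all
      then have "(branch i s, next_macs i s y) \<in> ctls"
        using suffixes_self[of "branch i s"] next_macs_mem[OF y] unfolding ctls_def by blast
      then show ?thesis using Br Cons s d xy by auto
    qed (use Cons s d xy xy' c ok in \<open>auto split: if_splits\<close>)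
  qed
qed

lemma main_mem: "([], main) \<in> ctls" and halt_mem: "([], []) \<in> ctls"
proof -
  have "branch 0 0 \<in> mop_lists" unfolding mop_lists_def by (intro UnI2 image_eqI[of _ _ "(0, 0)"]) simp_all
  then have x: "[] \<in> (\<Union>x \<in> mop_lists. suffixes_of x)" using nil_mem by blast
  have m: "main \<in> mac_lists" by (simp add: mac_lists_def)
  show "([], main) \<in> ctls" "([], []) \<in> ctls" unfolding ctls_def using x m suffixes_self[of main] nil_mem by blast+
qed

lemma exists_numbering: "\<exists>f. inj_on f ctls \<and> f ([], main) = (0::nat) \<and> f ([], []) = 1 \<and> (\<forall>c \<in> ctls. f c < card ctls + 2)"
proof -
  obtain h where h: "bij_betw h ctls {0..<card ctls}" using ex_bij_betw_finite_nat[OF finite_ctls] by blast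
  define f where "f c = (if c = ([], main) then 0 else if c = ([], []) then 1 else h c + 2)" for c
  have "inj_on f ctls" using bij_betw_imp_inj_on[OF h] by (auto simp: inj_on_def f_def)
  moreover have "f c < card ctls + 2" if "c \<in> ctls" for c
    using bij_betw_apply[OF h that] by (auto simp: f_def)
  moreover have "f ([], main) = 0" "f ([], []) = 1" by (auto simp: f_def main_def)
  ultimately show ?thesis by blast
qed

definition num :: "ctl \<Rightarrow> nat" where
  "num = (SOME f. inj_on f ctls \<and> f ([], main) = (0::nat) \<and> f ([], []) = 1 \<and> (\<forall>c \<in> ctls. f c < card ctls + 2))"

lemma num: "inj_on num ctls" "num ([], main) = 0" "num ([], []) = 1" "\<And>c. c \<in> ctls \<Longrightarrow> num c < card ctls + 2"
  using someI_ex[OF exists_numbering] unfolding num_def[symmetric] by auto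

text \<open>The numbering sends the initial control to 0 and the final one to 1, as the machine
  model prescribes. Numbers that denote no control get an arbitrary admissible transition.\<close>

definition machine :: tm where
  "machine = \<lparr>nq = card ctls + 2, ns = 9, delta = (\<lambda>q s. if q \<in> num ` ctls then
     (case adelta (the_inv_into ctls num q) s of (c', s', d) \<Rightarrow> (num c', s', d)) else (0, 0, 0))\<rparr>"

lemma machine_delta:
  "c \<in> ctls \<Longrightarrow> delta machine (num c) s = (case adelta c s of (c', s', d) \<Rightarrow> (num c', s', d))"
  by (simp add: machine_def the_inv_into_f_f[OF num(1)])

lemma machine_valid: "valid_tm machine"
  unfolding valid_tm_def
proof (intro conjI allI impI)
  fix q s assume q: "q < nq machine" and s: "s < ns machine"
  show "case delta machine q s of (q', s', d) \<Rightarrow> q' < nq machine \<and> s' < ns machine \<and> d \<in> {-1, 0, 1}"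
  proof (cases "q \<in> num ` ctls")
    case True
    then obtain c where c: "c \<in> ctls" "q = num c" by blast
    obtain c' s' d where d: "adelta c s = (c', s', d)" by (cases "adelta c s")
    have "c' \<in> ctls \<and> s' < 9 \<and> d \<in> {-1, 0, 1}"
      using adelta_closed[OF c(1) _ d] s by (simp add: machine_def)
    then show ?thesis using num(4)[of c'] by (simp add: c(2) machine_delta[OF c(1)] d) (simp add: machine_def)
  next
    case False
    then show ?thesis by (simp add: machine_def)
  qed
qed (simp_all add: machine_def)

definition tape_ok :: "nat list \<Rightarrow> bool" where "tape_ok l \<longleftrightarrow> set l \<subseteq> {..<9}"

lemma machine_step:
  assumes c: "c \<in> ctls" and t: "tape_ok l" "tape_ok r" and a: "astep (c, l, r) = (c', l', r')"
  shows "zstep machine (num c, l, r) = (num c', l', r') \<and> c' \<in> ctls \<and> tape_ok l' \<and> tape_ok r'"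
proof (cases "c = ([], [])")
  case True
  then have "(c', l', r') = (([], []), l, r)" using a by (simp add: astep_def)
  then show ?thesis using c t True num(3) by (auto simp: zstep.simps)
next
  case False
  then have n1: "num c \<noteq> 1" using num(1,3) c halt_mem by (metis inj_onD)
  obtain e s d where d: "adelta c (hd0 r) = (e, s, d)" by (cases "adelta c (hd0 r)")
  have h: "hd0 r < 9" "hd0 l < 9" using t by (auto simp: tape_ok_def intro: hd0_less)
  have cl: "e \<in> ctls" "s < 9" "d \<in> {-1, 0, 1}" using adelta_closed[OF c h(1) d] by auto
  have e: "(e, amove d s l (tl r)) = (c', l', r')" using a False by (simp add: astep_def d)
  have tl: "tape_ok (tl l)" "tape_ok (tl r)" using t unfolding tape_ok_def by (simp_all add: set_tl_subset)
  have "zstep machine (num c, l, r) = zmove d (num e) s l (tl r)"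
    using n1 by (simp add: zstep.simps machine_delta[OF c] d)
  also have "\<dots> = (num c', l', r')" using e by (auto simp: amove_def split: if_splits)
  finally show ?thesis using e cl t tl h by (auto simp: amove_def tape_ok_def split: if_splits)
qed

lemma machine_steps:
  "(astep ^^ k) (([], main), [], map bcode w) = (c, l, r) \<Longrightarrow>
    (zstep machine ^^ k) (zinit w) = (num c, l, r) \<and> c \<in> ctls \<and> tape_ok l \<and> tape_ok r"
proof (induction k arbitrary: c l r)
  case 0
  then show ?case using main_mem num(2) by (auto simp: zinit_def tape_ok_def bcode_def)
next
  case (Suc k)
  obtain c0 l0 r0 where s: "(astep ^^ k) (([], main), [], map bcode w) = (c0, l0, r0)"
    by (cases "(astep ^^ k) (([], main), [], map bcode w)")
  have a: "astep (c0, l0, r0) = (c, l, r)" using Suc.prems s by simp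
  show ?case using machine_step[OF _ _ _ a] Suc.IH[OF s] by simp
qed

section \<open>Length of the output and running time\<close>

lemma length_block: "length (block i b) \<le> length (Qb True) + length (Qb False) + length Rr + length pad + 4 * i + 10"
  using length_enc_nat[of "i + 2"] length_enc_nat[of "i + 1"] by (cases b) (simp_all add: block_def)

lemma length_blocks:
  "length (blocks i u) \<le> length u * (length (Qb True) + length (Qb False) + length Rr + length pad + 4 * (i + length u) + 10)"
proof (induction u arbitrary: i)
  case (Cons b u)
  let ?Q = "length (Qb True) + length (Qb False) + length Rr + length pad"
  have "length (blocks (Suc i) u) \<le> length u * (?Q + 4 * (Suc i + length u) + 10)" by (rule Cons.IH)
  moreover have "length (block i b) \<le> ?Q + 4 * (Suc i + length u) + 10" using length_block[of i b] by simp
  ultimately have "length (blocks i (b # u)) \<le> length u * (?Q + 4 * (Suc i + length u) + 10) + (?Q + 4 * (Suc i + length u) + 10)" by simp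
  also have "\<dots> = length (b # u) * (?Q + 4 * (i + length (b # u)) + 10)" by (simp add: algebra_simps)
  finally show ?case .
qed simp

lemma length_copies: "length (copies k) = k * length S1"
  by (induction k) auto

definition K :: nat where
  "K = length P0 + length P1 + length P2 + length P3 + length P5 + length S1 +
     length (Qb True) + length (Qb False) + length Rr + length pad + 100"

lemma length_out: "length (out w) + 3 * length w + 40 \<le> K * (length w + 1) ^ 2"
proof -
  let ?n = "length w"
  define A where "A = length P0 + length P1 + length P2 + length P3 + length P5"
  define Q where "Q = length (Qb True) + length (Qb False) + length Rr + length pad"
  have "length (out w) = A + 3 * length (enc_nat (Suc ?n)) + ?n * length S1 + length (blocks 0 w)"
    by (simp add: out_def Let_def length_copies A_def)
  also have "\<dots> \<le> A + 3 * (2 * Suc ?n + 2) + ?n * length S1 + ?n * (Q + 4 * (0 + ?n) + 10)"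
    by (intro add_mono mult_le_mono order_refl length_enc_nat length_blocks[of 0 w, folded Q_def])
  finally have l: "length (out w) + 3 * ?n + 40 \<le> A + ?n * length S1 + ?n * Q + (4 * (?n * ?n) + 19 * ?n + 52)"
    by (simp add: algebra_simps)
  define N where "N = (?n + 1) ^ 2"
  have N: "N = ?n * ?n + 2 * ?n + 1" by (simp add: N_def power2_eq_square algebra_simps)
  have "A \<le> A * N" "?n * length S1 \<le> length S1 * N" "?n * Q \<le> Q * N" "4 * (?n * ?n) + 19 * ?n + 52 \<le> 100 * N"
    unfolding N by (simp_all add: algebra_simps)
  then have "length (out w) + 3 * ?n + 40 \<le> A * N + length S1 * N + Q * N + 100 * N" using l by linarith
  also have "\<dots> = K * N" by (simp add: K_def A_def Q_def algebra_simps)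
  finally show ?thesis by (simp add: N_def)
qed

theorem out_computable: "poly_time_computable out"
  unfolding poly_time_computable_def
\<comment> \<open>The bound comes from \<open>12 * N\<close> macro instructions of cost
  \<open>4 * G * G\<close>, where \<open>G = K * N ^ 2\<close> and
  \<open>N = length w + 1\<close>.\<close>
proof (rule exI[of _ machine], rule exI[of _ "48 * K * K"], rule exI[of _ 5], intro conjI allI machine_valid)
  fix w :: "bool list"
  let ?n = "length w"
  define N where "N = ?n + 1"
  define G where "G = K * N ^ 2"
  obtain l r where "reach ((9 * ?n + 12) * (4 * G * G)) (([], main), [], map bcode w) (([], []), l, map bcode (out w) @ 3 # r)"
    using out_run[of w G] length_out[of w] unfolding G_def N_def by blast
  then obtain t where t: "t \<le> (9 * ?n + 12) * (4 * G * G)"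
    "(astep ^^ t) (([], main), [], map bcode w) = (([], []), l, map bcode (out w) @ 3 # r)"
    unfolding reach_def by blast
  have z: "(zstep machine ^^ t) (zinit w) = (1, l, map bcode (out w) @ 3 # r)"
    using machine_steps[OF t(2)] num(3) by simp
  have rep: "zrep ((tm_step machine ^^ t) (tm_init w)) (1, l, map bcode (out w) @ 3 # r)"
    using zsteps[OF machine_valid, of t w] unfolding z by blast
  have "(9 * ?n + 12) * (4 * G * G) \<le> (12 * N) * (4 * G * G)" by (intro mult_le_mono1) (simp add: N_def)
  also have "\<dots> = 48 * K * K * N ^ 5" by (simp add: G_def power2_eq_square eval_nat_numeral algebra_simps)
  finally have "t \<le> 48 * K * K * (?n + 1) ^ 5" using t(1) unfolding N_def by linarith
  moreover have "fst ((tm_step machine ^^ t) (tm_init w)) = 1" using zrep_fst[OF rep] by simp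
  moreover have "tm_output ((tm_step machine ^^ t) (tm_init w)) = out w" by (rule zrep_output[OF rep]) simp
  ultimately show "\<exists>t \<le> 48 * K * K * (?n + 1) ^ 5. fst ((tm_step machine ^^ t) (tm_init w)) = 1 \<and>
      tm_output ((tm_step machine ^^ t) (tm_init w)) = out w" by blast
qed

end

section \<open>Encodings are injective\<close>

lemma dbl_simps [simp]: "dbl [] = []" "dbl (x # xs) = True # x # dbl xs"
  by (simp_all add: dbl_def)

lemma dbl_append: "dbl (xs @ ys) = dbl xs @ dbl ys"
  by (simp add: dbl_def)

lemma dbl_prefix: "dbl u @ False # False # xs = dbl v @ False # False # ys \<Longrightarrow> u = v \<and> xs = ys"
proof (induction u arbitrary: v)
  case Nil
  then show ?case by (cases v) auto
next
  case (Cons a u)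
  then show ?case by (cases v) auto
qed

lemma nat_bits_inj: "nat_bits a = nat_bits b \<Longrightarrow> a = b"
proof (induction a arbitrary: b rule: less_induct)
  case (less a)
  show ?case
  proof (cases "a = 0 \<or> b = 0")
    case True
    then show ?thesis using less.prems nat_bits_neq[of "a - 1"] nat_bits_neq[of "b - 1"] by (cases a; cases b) auto
  next
    case False
    then have "odd a # nat_bits (a div 2) = odd b # nat_bits (b div 2)"
      using less.prems nat_bits.simps[of a] nat_bits.simps[of b] by simp
    then have "odd a = odd b" "a div 2 = b div 2" using less.IH[of "a div 2" "b div 2"] False by auto
    then show ?thesis by presburger
  qed
qed

lemma enc_nat_prefix: "enc_nat a @ xs = enc_nat b @ ys \<Longrightarrow> a = b \<and> xs = ys"
  using dbl_prefix[of "nat_bits a" xs "nat_bits b" ys] nat_bits_inj by (auto simp: enc_nat_def)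

lemma enc_nats_simps [simp]: "enc_nats [] = []" "enc_nats (x # xs) = enc_nat x @ enc_nats xs"
  "enc_nats (xs @ ys) = enc_nats xs @ enc_nats ys"
  by (simp_all add: enc_nats_def)

lemma enc_nats_inj: "enc_nats xs = enc_nats ys \<Longrightarrow> xs = ys"
proof (induction xs arbitrary: ys)
  case Nil
  then show ?case by (cases ys) (auto simp: enc_nat_def)
next
  case (Cons x xs)
  then show ?case
  proof (cases ys)
    case Nil
    then show ?thesis using Cons.prems by (simp add: enc_nat_def)
  next
    case (Cons y ys')
    then show ?thesis using enc_nat_prefix[of x "enc_nats xs" y "enc_nats ys'"] Cons.prems Cons.IH by auto
  qed
qed

definition prefix_free :: "('a \<Rightarrow> nat list) \<Rightarrow> bool" where
  "prefix_free f \<longleftrightarrow> (\<forall>x y r s. f x @ r = f y @ s \<longrightarrow> x = y \<and> r = s)"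

lemma prefix_freeD: "prefix_free f \<Longrightarrow> f x @ r = f y @ s \<Longrightarrow> x = y \<and> r = s"
  unfolding prefix_free_def by blast

lemma prefix_free_list:
  assumes f: "prefix_free f" and l: "length xs = length ys"
    and e: "concat (map f xs) @ r = concat (map f ys) @ s"
  shows "xs = ys \<and> r = s"
  using l e
proof (induction xs ys rule: list_induct2)
  case (Cons x xs y ys)
  then show ?case using prefix_freeD[OF f, of x "concat (map f xs) @ r" y "concat (map f ys) @ s"] by simp
qed simp

lemma prefix_free_tile: "prefix_free tile_nats"
  unfolding prefix_free_def
proof (intro allI impI)
  fix x y :: tile and r s assume "tile_nats x @ r = tile_nats y @ s"
  then show "x = y \<and> r = s" by (cases x; cases y) (simp add: tile_nats_def)
qed

lemma prefix_free_quad: "prefix_free (\<lambda>(a, b, c, d). [a, b, c, d])"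
  unfolding prefix_free_def
proof (intro allI impI)
  fix x y :: "nat \<times> nat \<times> nat \<times> nat" and r s
  assume "(case x of (a, b, c, d) \<Rightarrow> [a, b, c, d]) @ r = (case y of (a, b, c, d) \<Rightarrow> [a, b, c, d]) @ s"
  then show "x = y \<and> r = s" by (cases x; cases y) simp
qed

lemma prefix_free_tiles: "prefix_free (\<lambda>ts. length ts # concat (map tile_nats ts))"
  unfolding prefix_free_def
proof (intro allI impI)
  fix x y r s assume "(length x # concat (map tile_nats x)) @ r = (length y # concat (map tile_nats y)) @ s"
  then show "x = y \<and> r = s" using prefix_free_list[OF prefix_free_tile, of x y r s] by simp
qed

lemma int_code_inj: "int_code x = int_code y \<Longrightarrow> x = y"
proof -
  assume e: "int_code x = int_code y"
  have "even (int_code z) \<longleftrightarrow> z \<ge> 0" for z by (auto simp: int_code_def even_diff_nat)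
  then have "x \<ge> 0 \<longleftrightarrow> y \<ge> 0" using e by metis
  then show ?thesis using e by (auto simp: int_code_def split: if_splits)
qed

lemma prefix_free_placed: "prefix_free (\<lambda>((x, y), t). int_code x # int_code y # tile_nats t)"
  unfolding prefix_free_def
proof (intro allI impI)
  fix p q :: "(int \<times> int) \<times> tile" and r s :: "nat list"
  assume "(\<lambda>((x, y), t). int_code x # int_code y # tile_nats t) p @ r =
    (\<lambda>((x, y), t). int_code x # int_code y # tile_nats t) q @ s"
  moreover obtain x y t x' y' t' where "p = ((x, y), t)" "q = ((x', y'), t')" by (metis surj_pair)
  ultimately show "p = q \<and> r = s"
    using prefix_freeD[OF prefix_free_tile, of t r t' s] int_code_inj by simp
qed

text \<open>The language is a set of codes, so deciding membership of a code requires that it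
  denotes only one instance. Every list is preceded by its length and every item has a prefix-free
  code, so the instance can be read off from left to right.\<close>

lemma encode_inj:
  assumes "encode I = encode J" shows "I = (J :: uav_instance)"
proof -
  have e: "inst_nats I = inst_nats J" using assms enc_nats_inj by (simp add: encode_def)
  let ?q = "\<lambda>(a, b, c, d). [a, b, c, d::nat]"
  let ?t = "\<lambda>ts. length ts # concat (map tile_nats ts)"
  let ?p = "\<lambda>((x, y), t). int_code x # int_code y # tile_nats t"
  define r1 where "r1 K = length (asm K) # concat (map ?p (asm K)) @ []" for K :: uav_instance
  define r2 where "r2 K = length (tilesets K) # concat (map ?t (tilesets K)) @ r1 K" for K :: uav_instance
  define r3 where "r3 K = length (strs K) # concat (map (\<lambda>n. [n]) (strs K)) @ r2 K" for K :: uav_instance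
  have sing: "concat (map (\<lambda>n. [n]) xs) = xs" for xs :: "nat list" by (induction xs) auto
  have i: "inst_nats K = stages K # bins K # temp K # length (mix K) # concat (map ?q (mix K)) @ r3 K" for K
    by (simp add: inst_nats_def r1_def r2_def r3_def sing)
  have 1: "stages I = stages J" "bins I = bins J" "temp I = temp J" "length (mix I) = length (mix J)"
    "concat (map ?q (mix I)) @ r3 I = concat (map ?q (mix J)) @ r3 J"
    using e unfolding i by simp_all
  have 2: "mix I = mix J" "r3 I = r3 J" using prefix_free_list[OF prefix_free_quad 1(4,5)] by auto
  have pf1: "prefix_free (\<lambda>n::nat. [n])" by (simp add: prefix_free_def)
  have 3: "length (strs I) = length (strs J)" "concat (map (\<lambda>n. [n]) (strs I)) @ r2 I = concat (map (\<lambda>n. [n]) (strs J)) @ r2 J"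
    using 2(2) unfolding r3_def by simp_all
  have 4: "strs I = strs J" "r2 I = r2 J" using prefix_free_list[OF pf1 3] by auto
  have 5: "length (tilesets I) = length (tilesets J)" "concat (map ?t (tilesets I)) @ r1 I = concat (map ?t (tilesets J)) @ r1 J"
    using 4(2) unfolding r2_def by simp_all
  have 6: "tilesets I = tilesets J" "r1 I = r1 J" using prefix_free_list[OF prefix_free_tiles 5] by auto
  have 7: "length (asm I) = length (asm J)" "concat (map ?p (asm I)) @ [] = concat (map ?p (asm J)) @ []"
    using 6(2) unfolding r1_def by simp_all
  have 8: "asm I = asm J" using prefix_free_list[OF prefix_free_placed 7] by auto
  show ?thesis using 1 2 4 6 8 by (intro uav_instance.equality) simp_all
qed

section \<open>The staged system\<close>

text \<open>Bits are listed from the least significant one, so multiplication by a power of two puts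
  a constant prefix in front of the code.\<close>

lemma nat_bits_shift: "0 < v \<Longrightarrow> nat_bits (v * 2 ^ k) = replicate k False @ nat_bits v"
proof (induction k)
  case (Suc k)
  have "v * 2 ^ Suc k = 2 * (v * 2 ^ k)" by simp
  then show ?case using Suc nat_bits_double(1)[of "v * 2 ^ k"] by (simp only: replicate_Suc) simp
qed simp

lemma enc_nat_shift: "0 < v \<Longrightarrow> enc_nat (v * 2 ^ k) = dbl (replicate k False) @ enc_nat v"
  by (simp add: enc_nat_def nat_bits_shift dbl_append)

text \<open>Serves the lengths of the padded lists, which exceed a multiple of \<open>2 ^ l\<close>
  by 1.\<close>

lemma enc_nat_shift1: "0 < v \<Longrightarrow> 0 < k \<Longrightarrow> enc_nat (v * 2 ^ k + 1) = dbl (True # replicate (k - 1) False) @ enc_nat v"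
proof -
  assume v: "0 < v" "0 < k"
  then obtain j where k: "k = Suc j" by (cases k) auto
  have "v * 2 ^ k + 1 = Suc (2 * (v * 2 ^ j))" by (simp add: k)
  then have "nat_bits (v * 2 ^ k + 1) = True # replicate j False @ nat_bits v"
    by (simp only: nat_bits_double(2) nat_bits_shift[OF v(1)])
  then show ?thesis by (simp add: enc_nat_def dbl_append k)
qed

text \<open>From stage 2 on, bin 1 does the work. The two tower tiles bind to each other with
  strength 2, so bins 3 and 4 keep them apart until stage 3. Bin 5 carries the target through all
  stages. A bin of a later stage that receives nothing has no output.\<close>

definition mix_edges :: "(nat \<times> nat \<times> nat \<times> nat) list" where
  "mix_edges = [(1, 1, 2, 1), (1, 2, 2, 1), (1, 3, 2, 3), (1, 4, 2, 4), (2, 1, 3, 1), (2, 3, 3, 1), (2, 4, 3, 1),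
     (3, 1, 4, 1), (4, 1, 5, 1), (5, 1, 6, 1), (6, 1, 7, 1),
     (1, 5, 2, 5), (2, 5, 3, 5), (3, 5, 4, 5), (4, 5, 5, 5), (5, 5, 6, 5), (6, 5, 7, 5)]"

locale uav_sys = tile_sys S p enc "2 ^ l" w for S p enc l w +
  fixes CL IL :: "tile list"
  assumes CL: "set CL = const_line" "length CL = 2 ^ l" and IL: "set IL = TI" and l0: "0 < l"
begin

abbreviation "tX \<equiv> (enc Gb2, 0, enc Gb, 0) :: tile"
abbreviation "tY \<equiv> (enc Gb, 0, enc Gb2, 0) :: tile"
abbreviation "tZ \<equiv> (0, 0, 0, 0) :: tile"

text \<open>Each \<open>chain\<close> tile is followed by \<open>2 ^ l - 1\<close> copies of
  \<open>corner\<close>, which do not change the tile set. The length thus equals that of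
  \<open>strs_list\<close>, and both lengths are coded by constant bits followed by the code of
  \<open>length w + 1\<close>. The reversed order of the chain fits \<open>blocks\<close>.\<close>

definition line_list :: "tile list" where
  "line_list = CL @ [link] @ concat (map (\<lambda>i. chain i # replicate (2 ^ l - 1) corner) (rev [0..<length w]))"

definition inst :: uav_instance where
  "inst = \<lparr>stages = 7, bins = 5, temp = 2, mix = mix_edges, strs = strs_list,
     tilesets = [line_list, IL, [tX], [tY], [tZ]], asm = [((0, 0), tZ)]\<rparr>"

lemma line_list_set: "set line_list = LT"
  using CL by (auto simp: line_list_def LT_def const_line_def)

lemma line_list_length: "length line_list = (length w + 1) * 2 ^ l + 1"
proof -
  have "length (concat (map (\<lambda>i. chain i # replicate (2 ^ l - 1) corner) xs)) = length xs * 2 ^ l" for xs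
    by (induction xs) auto
  then show ?thesis using CL(2) by (simp add: line_list_def)
qed

lemma strs_length: "length strs_list = (length w + 1) * 2 ^ l + 1"
  by (simp add: strs_list_def)

lemma inst_gs_eq: "inst_gs inst = gs"
  by (rule ext) (simp add: inst_gs_def inst_def gs_def)

lemma enc_small: "x \<in> aglues S p \<Longrightarrow> enc x < length strs_list"
  using enc_less[of x] by (simp add: strs_length)

lemma LT_glues: "t \<in> LT \<Longrightarrow> g \<in> tile_glues t \<Longrightarrow> g < length strs_list"
proof -
  assume t: "t \<in> LT" "g \<in> tile_glues t"
  have v: "v * 2 ^ l < length strs_list" if "v \<le> length w + 1" for v
    using mult_le_mono1[OF that, of "2 ^ l"] by (simp add: strs_length)
  have z: "0 < length strs_list" by (simp add: strs_length)
  have v1: "2 ^ l < length strs_list" using v[of 1] by simp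
  have v2: "(length w + 1) * 2 ^ l < length strs_list" using v by blast
  have v3: "(i + 2) * 2 ^ l < length strs_list" "(i + 1) * 2 ^ l < length strs_list" if "i < length w" for i
    using v[of "i + 2"] v[of "i + 1"] that by auto
  from t(1) show ?thesis
    by (rule LT_cases) (use t(2) z v1 v2 v3 in \<open>auto simp: tile_glues_def tile_defs enc_small simp del: add_mult_distrib mult_Suc\<close>)
qed

lemma TI_glues: "t \<in> TI \<Longrightarrow> g \<in> tile_glues t \<Longrightarrow> g < length strs_list"
proof -
  assume t: "t \<in> TI" "g \<in> tile_glues t"
  from t(1) obtain s q n e where I: "t = interior s q n e" "s \<in> syms S p" "q \<in> states S" "e \<in> states S"
    "\<forall>s'. n = Some s' \<longrightarrow> s' \<in> syms S p" by (rule TI_cases) blast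
  then show ?thesis using t(2) by (cases n) (auto simp: tile_glues_def interior_def enc_small)
qed

lemma wf: "wf_instance inst"
proof -
  have z: "strs_list \<noteq> []" "strs_list ! 0 = 0" "0 < length strs_list"
    using zero_small by (auto simp: gs_def strs_list_def)
  have m: "\<forall>(i, j, i', j') \<in> set mix_edges. 1 \<le> i \<and> i' = i + 1 \<and> i' \<le> 7 \<and> 1 \<le> j \<and> j \<le> 5 \<and> 1 \<le> j' \<and> j' \<le> 5"
    by (simp add: mix_edges_def)
  have t: "g < length strs_list" if "ts \<in> set [line_list, IL, [tX], [tY], [tZ]]" "t \<in> set ts" "g \<in> tile_glues t" for ts t g
    using that LT_glues[of t g] TI_glues[of t g] z enc_small[of Gb] enc_small[of Gb2]
    by (auto simp: line_list_set IL tile_glues_def)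
  show ?thesis unfolding wf_instance_def using z m t
    by (auto simp: inst_def tile_glues_def)
qed

section \<open>Outputs of the bins, stage by stage\<close>

abbreviation T :: "config set \<Rightarrow> config set" where "T \<equiv> terminal 2 gs"

lemma terminal_empty: "T {} = {}"
proof -
  have "C \<notin> produced 2 gs {}" for C
  proof
    assume "C \<in> produced 2 gs {}"
    then show False by induction auto
  qed
  then show ?thesis by (auto simp: terminal_def)
qed

lemma bin_first: "bin_terminal inst (Suc 0) j = T (single_tiles (set (tilesets inst ! (j - 1))))"
  by (simp add: inst_gs_eq bin_tiles_def) (simp add: inst_def)

lemma bin_next:
  assumes "{k. 1 \<le> k \<and> k \<le> 5 \<and> (Suc i, k, Suc (Suc i), j) \<in> set mix_edges} = Ks"
  shows "bin_terminal inst (Suc (Suc i)) j = T (\<Union>k \<in> Ks. bin_terminal inst (Suc i) k)"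
proof -
  have "{bin_terminal inst (Suc i) k | k. 1 \<le> k \<and> k \<le> bins inst \<and> (Suc i, k, Suc (Suc i), j) \<in> set (mix inst)} =
    (\<lambda>k. bin_terminal inst (Suc i) k) ` Ks"
    unfolding assms[symmetric] by (auto simp: inst_def)
  then show ?thesis by (simp add: inst_gs_eq) (simp add: inst_def)
qed

lemma edges_from: "{k. 1 \<le> k \<and> k \<le> 5 \<and> (Suc 0, k, Suc (Suc 0), 1) \<in> set mix_edges} = {1, 2}"
  "{k. 1 \<le> k \<and> k \<le> 5 \<and> (Suc 0, k, Suc (Suc 0), 3) \<in> set mix_edges} = {3}"
  "{k. 1 \<le> k \<and> k \<le> 5 \<and> (Suc 0, k, Suc (Suc 0), 4) \<in> set mix_edges} = {4}"
  "{k. 1 \<le> k \<and> k \<le> 5 \<and> (Suc (Suc 0), k, Suc (Suc (Suc 0)), 1) \<in> set mix_edges} = {1, 3, 4}"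
  "i \<in> {2, 3, 4, 5} \<Longrightarrow> {k. 1 \<le> k \<and> k \<le> 5 \<and> (Suc i, k, Suc (Suc i), 1) \<in> set mix_edges} = {1}"
  "i \<in> {0, 1, 2, 3, 4, 5} \<Longrightarrow> {k. 1 \<le> k \<and> k \<le> 5 \<and> (Suc i, k, Suc (Suc i), 5) \<in> set mix_edges} = {5}"
  "j \<in> {2, 3, 4} \<Longrightarrow> {k. 1 \<le> k \<and> k \<le> 5 \<and> (Suc 5, k, Suc (Suc 5), j) \<in> set mix_edges} = {}"
  by (auto simp: mix_edges_def)

lemma single_bins: "T (single_tiles TI) = singles TI" "T (single_tiles {tX}) = singles {tX}"
  "T (single_tiles {tY}) = singles {tY}" "T (single_tiles {tZ}) = singles {tZ}"
proof -
  have "glue_str gs (tE s) (tW t) < 2 \<and> glue_str gs (tN s) (tS t) < 2" if "s \<in> TI" "t \<in> TI" for s t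
    using rects.TI[OF that(1)] rects.TI[OF that(2)] rects.gs1 by (auto simp: glue_str_def)
  then show "T (single_tiles TI) = singles TI" by (rule terminal_singles)
  show "T (single_tiles {tX}) = singles {tX}" "T (single_tiles {tY}) = singles {tY}" "T (single_tiles {tZ}) = singles {tZ}"
    by (rule terminal_singles; simp add: glue_str_def zero_small)+
qed

lemma singles_Un: "singles A \<union> singles B = singles (A \<union> B)"
  unfolding singles_def by blast

lemma stage_two: "bin_terminal inst (Suc (Suc 0)) 1 = rects.rects"
proof -
  have "bin_terminal inst (Suc (Suc 0)) 1 = T (bin_terminal inst (Suc 0) 1 \<union> bin_terminal inst (Suc 0) 2)"
    unfolding bin_next[OF edges_from(1)] by simp
  also have "\<dots> = T (T (single_tiles LT) \<union> T (single_tiles TI))"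
    unfolding bin_first by (simp add: inst_def line_list_set IL)
  finally show ?thesis unfolding single_bins rects.terminal_S2 .
qed

lemma stage_three: "bin_terminal inst (Suc (Suc (Suc 0))) 1 = rects.accepting"
proof -
  have 3: "bin_terminal inst (Suc (Suc 0)) 3 = singles {tX}"
  proof -
    have "bin_terminal inst (Suc (Suc 0)) 3 = T (T (single_tiles {tX}))"
      unfolding bin_next[OF edges_from(2)] bin_first by (simp add: inst_def del: bin_terminal.simps)
    then show ?thesis using terminal_terminal[of 2 gs "single_tiles {tX}"] by (simp only: single_bins)
  qed
  have 4: "bin_terminal inst (Suc (Suc 0)) 4 = singles {tY}"
  proof -
    have "bin_terminal inst (Suc (Suc 0)) 4 = T (T (single_tiles {tY}))"
      unfolding bin_next[OF edges_from(3)] bin_first by (simp add: inst_def)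
    then show ?thesis using terminal_terminal[of 2 gs "single_tiles {tY}"] by (simp only: single_bins)
  qed
  have "bin_terminal inst (Suc (Suc (Suc 0))) 1 = T (rects.rects \<union> (singles {tX} \<union> singles {tY}))"
    unfolding bin_next[OF edges_from(4)] using 3 4 stage_two by (simp only: UN_insert UN_empty Un_empty_right)
  then show ?thesis unfolding singles_Un using rects.terminal_S3 by (simp add: insert_commute)
qed

lemma accepting_terminal: "T rects.accepting = rects.accepting"
  unfolding rects.terminal_S3[symmetric] by (rule terminal_terminal)

lemma stage_later: "i \<in> {2, 3, 4, 5, 6} \<Longrightarrow> bin_terminal inst (Suc i) 1 = rects.accepting"
proof -
  have s: "bin_terminal inst (Suc (Suc i)) 1 = rects.accepting" if "i \<in> {2, 3, 4, 5}" "bin_terminal inst (Suc i) 1 = rects.accepting" for i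
    unfolding bin_next[OF edges_from(5)[OF that(1)]] using that(2) accepting_terminal by (simp only: UN_insert UN_empty Un_empty_right)
  have 2: "bin_terminal inst (Suc 2) 1 = rects.accepting" using stage_three by (simp only: numeral_2_eq_2)
  have 3: "bin_terminal inst (Suc 3) 1 = rects.accepting" using s[of 2] 2 by (simp add: numeral_3_eq_3 numeral_2_eq_2 del: bin_terminal.simps)
  have 4: "bin_terminal inst (Suc 4) 1 = rects.accepting" using s[of 3] 3 by (simp add: eval_nat_numeral del: bin_terminal.simps)
  have 5: "bin_terminal inst (Suc 5) 1 = rects.accepting" using s[of 4] 4 by (simp add: eval_nat_numeral del: bin_terminal.simps)
  have 6: "bin_terminal inst (Suc 6) 1 = rects.accepting" using s[of 5] 5 by (simp add: eval_nat_numeral del: bin_terminal.simps)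
  assume "i \<in> {2, 3, 4, 5, 6}"
  then show ?thesis using 2 3 4 5 6 by (auto simp del: bin_terminal.simps)
qed

lemma stage_inert: "i \<le> 6 \<Longrightarrow> bin_terminal inst (Suc i) 5 = singles {tZ}"
proof (induction i)
  case 0
  show ?case unfolding bin_first by (simp add: inst_def single_bins)
next
  case (Suc i)
  then have i: "i \<in> {0, 1, 2, 3, 4, 5}" by auto
  have "T (singles {tZ}) = singles {tZ}"
    unfolding single_bins(4)[symmetric] by (rule terminal_terminal)
  then show ?case unfolding bin_next[OF edges_from(6)[OF i]] using Suc by (simp del: bin_terminal.simps)
qed

lemma system_output_inst: "system_output inst = rects.accepting \<union> singles {tZ}"
proof -
  have s7: "stages inst = Suc 6" "bins inst = 5" by (simp_all add: inst_def)
  have "{j. 1 \<le> j \<and> j \<le> (5::nat)} = {1, 2, 3, 4, 5}" by auto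
  moreover have "{bin_terminal inst (Suc 6) j | j. 1 \<le> j \<and> j \<le> 5} = bin_terminal inst (Suc 6) ` {j. 1 \<le> j \<and> j \<le> 5}"
    by blast
  moreover have "bin_terminal inst (Suc 6) j = {}" if "j \<in> {2, 3, 4}" for j
  proof -
    have "bin_terminal inst (Suc (Suc 5)) j = {}" unfolding bin_next[OF edges_from(7)[OF that]] by (simp add: terminal_empty)
    moreover have "Suc (Suc 5) = Suc 6" by simp
    ultimately show ?thesis by (simp only:)
  qed
  moreover have "bin_terminal inst (Suc 6) 1 = rects.accepting" "bin_terminal inst (Suc 6) 5 = singles {tZ}"
    using stage_later[of 6] stage_inert[of 6] by (simp_all del: bin_terminal.simps)
  ultimately show ?thesis unfolding system_output_def s7 by (simp del: bin_terminal.simps One_nat_def)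
qed

lemma target_shifts: "{C. \<exists>v. C = shift v (target inst)} = singles {tZ}"
proof -
  have t: "target inst = [(0, 0) \<mapsto> tZ]" by (simp add: target_def inst_def)
  have "C \<in> singles {tZ} \<longleftrightarrow> (\<exists>v. C = shift v [(0, 0) \<mapsto> tZ])" for C
    unfolding shift_single singles_def by (auto simp: shiftp_def)
  then show ?thesis unfolding t by blast
qed

text \<open>An accepting rectangle contains a corner, whose north glue is not null. So it differs
  from the target, and its presence in the output destroys uniqueness.\<close>

lemma accepting_not_inert: "C \<in> rects.accepting \<Longrightarrow> C \<notin> singles {tZ}"
proof
  assume C: "C \<in> rects.accepting" "C \<in> singles {tZ}"
  then obtain v m n \<tau> D where D: "C = shift v D" "lines.complete m n \<tau>" "D \<in> rects.fill m n \<tau>"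
    by (auto simp: rects.accepting_def rects.rects_def)
  have mn: "lines.valid_line (- n) m \<tau>" "- n \<le> 0" "0 \<le> m" using D(2) by (auto simp: lines.complete_def)
  have "D (lpos 0) = Some (\<tau> 0)" by (rule rects.fill_line[OF D(2,3)]) (use mn in \<open>simp add: line_lpos\<close>)
  then have "C (shiftp v (lpos 0)) = Some (\<tau> 0)" by (simp add: D(1) shift_app)
  moreover have "tN (\<tau> 0) \<noteq> 0" using rects.valid_corner[OF mn] zero_HR(2) by metis
  moreover obtain q where "C = [q \<mapsto> tZ]" using C(2) by (auto simp: singles_def)
  ultimately have "\<tau> 0 = tZ" "tN (\<tau> 0) \<noteq> 0" by (auto split: if_splits)
  then show False by simp
qed

theorem uniquely_assembles_iff: "uniquely_assembles inst \<longleftrightarrow> \<not> (\<exists>\<sigma>'. (init_regs w, \<sigma>') \<in> sem p)"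
  unfolding uniquely_assembles_def system_output_inst target_shifts accepting_iff[symmetric]
  using accepting_not_inert by blast

end

section \<open>The code of the instance as an output of the writer\<close>

context uav_sys
begin

definition zeros :: "bool list" where "zeros = dbl (replicate l False)"
definition one_zeros :: "bool list" where "one_zeros = dbl (True # replicate (l - 1) False)"

text \<open>Each part is a stretch of the code that does not depend on \<open>w\<close>. Where the
  counter follows as the upper bits of a larger number, the part ends with the constant low-order
  bits \<open>zeros\<close> or \<open>one_zeros\<close> of that number.\<close>

definition head_part :: "bool list" where
  "head_part = enc_nats ([7, 5, 2, length mix_edges] @ concat (map (\<lambda>(a, b, c, d). [a, b, c, d]) mix_edges)) @ one_zeros"
definition strength_part :: "bool list" where "strength_part = enc_nats (map strength [0..<2 ^ l])"
definition strong_part :: "bool list" where "strong_part = enc_nats (replicate (2 ^ l) 2)"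
text \<open>The leading 2 is the last entry of \<open>strs_list\<close>, and 5 is the number of tile
  sets.\<close>

definition count_part :: "bool list" where "count_part = enc_nats [2, 5] @ one_zeros"
definition line_part :: "bool list" where
  "line_part = enc_nats (concat (map tile_nats CL)) @ enc_nats [sg (SCell (\<lambda>_. 0)), enc HB, 0] @ zeros"
definition bit_part :: "bool \<Rightarrow> bool list" where "bit_part b = enc_nat (sg (SCell (bit_cell b))) @ zeros"
definition mid_part :: "bool list" where "mid_part = enc_nat 0 @ zeros"
definition pad_part :: "bool list" where
  "pad_part = enc_nats (concat (map tile_nats (replicate (2 ^ l - 1) corner)))"
definition tail_part :: "bool list" where
  "tail_part = enc_nats (concat (map (\<lambda>ts. length ts # concat (map tile_nats ts)) [IL, [tX], [tY], [tZ]]) @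
     [1, 0, 0, 0, 0, 0, 0])"

definition reduction :: "bool list \<Rightarrow> bool list" where
  "reduction = writer.out head_part strength_part strong_part count_part line_part tail_part mid_part pad_part bit_part"

interpretation wr: writer head_part strength_part strong_part count_part line_part tail_part mid_part pad_part bit_part .

lemma copies_eq: "wr.copies k = enc_nats (replicate (k * 2 ^ l) 2)"
proof (induction k)
  case (Suc k)
  have "wr.copies (Suc k) = strong_part @ enc_nats (replicate (k * 2 ^ l) 2)" by (simp add: Suc)
  then show ?case by (simp add: strong_part_def replicate_add)
qed simp

lemma block_eq: "i < length w \<Longrightarrow>
  wr.block i (w ! i) = enc_nats (concat (map tile_nats (chain i # replicate (2 ^ l - 1) corner)))"
  using enc_nat_shift[of "i + 2" l] enc_nat_shift[of "i + 1" l]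
  unfolding wr.block_def
  by (simp add: bit_part_def mid_part_def pad_part_def zeros_def chain_def tile_nats_def del: mult_Suc)

lemma blocks_eq: "wr.blocks k u = concat (map (\<lambda>i. wr.block (k + i) (u ! i)) (rev [0..<length u]))"
proof (induction u arbitrary: k)
  case (Cons b u)
  have "[0..<length (b # u)] = 0 # map Suc [0..<length u]" by (simp add: map_Suc_upt upt_conv_Cons del: upt_Suc)
  then show ?case by (simp add: Cons.IH rev_map comp_def del: upt_Suc)
qed simp

lemma blocks_tiles: "wr.blocks 0 w = enc_nats (concat (map tile_nats
    (concat (map (\<lambda>i. chain i # replicate (2 ^ l - 1) corner) (rev [0..<length w])))))"
proof -
  have "wr.blocks 0 w = concat (map (\<lambda>i. enc_nats (concat (map tile_nats (chain i # replicate (2 ^ l - 1) corner)))) (rev [0..<length w]))"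
    unfolding blocks_eq by (intro arg_cong[of _ _ concat] map_cong refl) (simp add: block_eq)
  moreover have "concat (map (\<lambda>i. enc_nats (concat (map tile_nats (f i)))) xs) =
    enc_nats (concat (map tile_nats (concat (map f xs))))" for f :: "nat \<Rightarrow> tile list" and xs
    by (induction xs) simp_all
  ultimately show ?thesis by (simp only:)
qed

theorem encode_inst: "encode inst = reduction w"
proof -
  let ?n = "length w"
  have len: "enc_nat ((?n + 1) * 2 ^ l + 1) = one_zeros @ enc_nat (Suc ?n)"
    using enc_nat_shift1[of "?n + 1" l] l0 by (simp add: one_zeros_def)
  have lk: "enc_nats (tile_nats link) = enc_nats [sg (SCell (\<lambda>_. 0)), enc HB, 0] @ zeros @ enc_nat (Suc ?n)"
    using enc_nat_shift[of "?n + 1" l] by (simp add: link_def tile_nats_def zeros_def del: mult_Suc)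
  have st: "enc_nats strs_list = strength_part @ wr.copies ?n @ enc_nat 2"
    by (simp add: strs_list_def strength_part_def copies_eq replicate_append_same[symmetric] del: replicate_append_same)
  have li: "enc_nats (concat (map tile_nats line_list)) =
    enc_nats (concat (map tile_nats CL)) @ enc_nats (tile_nats link) @ wr.blocks 0 w"
    by (simp add: line_list_def blocks_tiles)
  have "encode inst = enc_nats ([7, 5, 2, length mix_edges] @ concat (map (\<lambda>(a, b, c, d). [a, b, c, d]) mix_edges)) @
     enc_nat (length strs_list) @ enc_nats strs_list @ enc_nat 5 @
     enc_nat (length line_list) @ enc_nats (concat (map tile_nats line_list)) @ tail_part"
    by (simp add: encode_def inst_nats_def inst_def tail_part_def int_code_def tile_nats_def eval_nat_numeral)
  then show ?thesis
    unfolding reduction_def wr.out_def Let_def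
    by (simp only: strs_length line_list_length len st li lk head_part_def count_part_def line_part_def append_assoc enc_nats_simps append_Nil append_Nil2)
qed

lemma reduction_computable: "poly_time_computable reduction"
  unfolding reduction_def by (rule wr.out_computable)

theorem reduction_iff: "reduction w \<in> staged_UAV_7_2 \<longleftrightarrow> \<not> (\<exists>\<sigma>'. (init_regs w, \<sigma>') \<in> sem p)"
proof -
  have "stages inst = 7" "temp inst = 2" by (simp_all add: inst_def)
  then show ?thesis
    unfolding staged_UAV_7_2_def encode_inst[symmetric] uniquely_assembles_iff[symmetric]
    using wf encode_inj by blast
qed

end

theorem mainTheorem4:
  shows "Pi2P_hard staged_UAV_7_2"
  unfolding Pi2P_hard_def
proof (intro allI impI)
  fix L' assume "Pi2P L'"
  then obtain V c k where V: "poly_time_computable (\<lambda>x. [V x])"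
    and L': "\<And>w. w \<in> L' \<longleftrightarrow> (\<forall>y. length y \<le> c * (length w + 1) ^ k \<longrightarrow>
      (\<exists>z. length z \<le> c * (length w + 1) ^ k \<and> V (tuple3 w y z)))"
    unfolding Pi2P_def by blast
  obtain M where M: "valid_tm M"
    and run: "\<And>x. \<exists>t. fst ((tm_step M ^^ t) (tm_init x)) = 1 \<and> tm_output ((tm_step M ^^ t) (tm_init x)) = [V x]"
    using V unfolding poly_time_computable_def by blast
  define S where "S = max (ns M) (nq M)"
  have S: "ns M \<le> S" "nq M \<le> S" by (auto simp: S_def)
  have S3: "3 \<le> S" using M S by (auto simp: valid_tm_def)
  define p where "p = main_prog M S c k"
  have ok: "prog_ok 9 S p" unfolding p_def by (rule main_ok[OF M S])
  obtain h where h: "bij_betw h (aglues S p) {0..<card (aglues S p)}"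
    using ex_bij_betw_finite_nat[OF finite_aglues] by blast
  define enc where "enc = Suc \<circ> h"
  \<comment> \<open>Large enough that \<open>2 ^ l\<close> exceeds every glue number and that
    \<open>const_line\<close>, which has seven tiles besides the junk rows and columns, fits into a
    list of length \<open>2 ^ l\<close>.\<close>
  define l where "l = card (aglues S p) + card (syms S p) + card (states S) + 8"
  have l: "card (aglues S p) + card (syms S p) + card (states S) + 8 < 2 ^ l"
    unfolding l_def by (rule less_exp)
  have sys: "tile_sys S p enc (2 ^ l)"
  proof
    show "inj_on enc (aglues S p)" using bij_betw_imp_inj_on[OF h] by (auto simp: enc_def inj_on_def)
    show "enc ` aglues S p \<subseteq> {1..<2 ^ l}"
    proof
      fix x assume "x \<in> enc ` aglues S p"
      then obtain g where "g \<in> aglues S p" "x = Suc (h g)" by (auto simp: enc_def)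
      then show "x \<in> {1..<2 ^ l}" using bij_betw_apply[OF h, of g] l by auto
    qed
  qed (fact ok S3)+
  interpret tile_sys S p enc "2 ^ l" "[]" by (rule sys)
  have "card const_line \<le> card {corner, control, blank, endt, col, topt, jcorner} + card (jrow ` syms S p) + card (jcol ` states S)"
    unfolding const_line_def using card_Un_le order_trans add_le_mono1 by meson
  moreover have "card {corner, control, blank, endt, col, topt, jcorner} \<le> 7"
    using card_length[of "[corner, control, blank, endt, col, topt, jcorner]"] by simp
  moreover have "card (jrow ` syms S p) \<le> card (syms S p)" "card (jcol ` states S) \<le> card (states S)"
    using card_image_le finite_syms finite_states by blast+
  ultimately have card: "card const_line \<le> 2 ^ l" using l by linarith
  have "finite const_line" unfolding const_line_def using finite_syms finite_states by blast
  then obtain cs where cs: "set cs = const_line" "length cs = card const_line"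
    using finite_distinct_list distinct_card by metis
  define CL where "CL = cs @ replicate (2 ^ l - length cs) corner"
  have CL: "set CL = const_line" "length CL = 2 ^ l"
    using cs card by (auto simp: CL_def const_line_def)
  have "TI \<subseteq> (\<lambda>(s, q, n, e). interior s q n e) ` (syms S p \<times> states S \<times> (insert None (Some ` syms S p)) \<times> states S)"
  proof
    fix t assume "t \<in> TI"
    then obtain s q n e where "t = interior s q n e" "s \<in> syms S p" "q \<in> states S" "e \<in> states S"
      "\<forall>s'. n = Some s' \<longrightarrow> s' \<in> syms S p" by (rule TI_cases) blast
    then show "t \<in> (\<lambda>(s, q, n, e). interior s q n e) ` (syms S p \<times> states S \<times> (insert None (Some ` syms S p)) \<times> states S)"
      by (intro image_eqI[of _ _ "(s, q, n, e)"]) (cases n; simp)+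
  qed
  then have "finite TI"
    by (rule finite_subset) (simp add: finite_syms finite_states)
  then obtain IL where IL: "set IL = TI" using finite_list by blast
  \<comment> \<open>\<open>reduction\<close> is independent of the word fixed in the locale, so one
    function serves all inputs; only its correctness is established for each \<open>w\<close>
    separately.\<close>
  define f where "f = uav_sys.reduction S p enc l CL IL"
  have uav: "uav_sys S p enc l CL IL"
    using sys CL IL by (intro uav_sys.intro uav_sys_axioms.intro) (simp_all add: l_def)
  have "w \<in> L' \<longleftrightarrow> f w \<in> staged_UAV_7_2" for w
  proof -
    have "f w \<in> staged_UAV_7_2 \<longleftrightarrow> \<not> (\<exists>\<sigma>'. (init_regs w, \<sigma>') \<in> sem p)"
      unfolding f_def by (rule uav_sys.reduction_iff[OF uav])
    also have "\<dots> \<longleftrightarrow> w \<in> L'" unfolding init_regs_def p_def main_sem[OF M S run] L' by blast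
    finally show ?thesis by blast
  qed
  moreover have "poly_time_computable f" unfolding f_def by (rule uav_sys.reduction_computable[OF uav])
  ultimately show "poly_reducible L' staged_UAV_7_2" unfolding poly_reducible_def by blast
qed

end
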